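(* Under the standing assumptions and with the varifolds $V^t$ ($t\ge0$) defined in the context, $\|\delta V^t\|(\mathbb{R}^n)=\|\delta V^t\|(\overline\Omega)$ is finite for a.e. $t\ge0$, and $\int_0^T\|\delta V^t\|(\overline\Omega)\,dt$ is finite for all $T>0$.
   Context: Setting. $n$ is a positive integer, $\Omega\subset\mathbb{R}^n$ is a bounded domain with smooth boundary (not assumed convex), $\nu$ is the outer unit normal to $\partial\Omega$. $W\in C^3(\mathbb{R})$ satisfies: (W1) $W(\pm1)=0$ and $W(s)>0$ for all $s\ne\pm1$; (W2) for some $-1<\gamma<1$, $W'<0$ on $(\gamma,1)$ and $W'>0$ on $(-1,\gamma)$; (W3) for some $0<\alpha<1$ and $\beta>0$, $W''(s)\ge\beta$ for all $\alpha\le|s|\le1$. Initial data. $\{\varepsilon_i\}_{i\ge1}$ are positive numbers with $\varepsilon_i\to0$, and $u_{\varepsilon_i,0}\in C^1(\overline\Omega)$ satisfy, with constants $D_0,c_1,c_2$ and $\lambda\in[3/5,1)$ independent of $i$: (i) $\|u_{\varepsilon_i,0}\|_{L^\infty(\Omega)}\le1$; (ii) $\sup_i\sup_{x\in\Omega,\,r>0}\omega_{n-1}^{-1}r^{1-n}\int_{B_r(x)\cap\Omega}\frac{\varepsilon_i|\nabla u_{\varepsilon_i,0}|^2}{2}+\frac{W(u_{\varepsilon_i,0})}{\varepsilon_i}\,dy\le D_0$; (iii) $\sup_i\max_{\overline\Omega}\varepsilon_i|\nabla u_{\varepsilon_i,0}|\le c_1$; (iv) $\max_{\overline\Omega}\left(\frac{\varepsilon_i|\nabla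 u_{\varepsilon_i,0}|^2}{2}-\frac{W(u_{\varepsilon_i,0})}{\varepsilon_i}\right)\le c_2\varepsilon_i^{-\lambda}$ for all $i$; (v) $\langle\nabla u_{\varepsilon_i,0},\nu\rangle=0$ on $\partial\Omega$ for all $i$. Here $\omega_{n-1}$ is the volume of the unit ball of $\mathbb{R}^{n-1}$ and $B_r(x)$ is the open ball. Equation. $u_{\varepsilon_i}$ is the unique solution, with regularity $C([0,\infty);C^1(\overline\Omega))\cap C^\infty(\overline\Omega\times(0,\infty))$ as recorded in the paper, of $\partial_tu_{\varepsilon_i}=\Delta u_{\varepsilon_i}-W'(u_{\varepsilon_i})/\varepsilon_i^2$ in $\Omega\times(0,\infty)$, $\langle\nabla u_{\varepsilon_i},\nu\rangle=0$ on $\partial\Omega\times(0,\infty)$, $u_{\varepsilon_i}(\cdot,0)=u_{\varepsilon_i,0}$ in $\Omega$. Measures. $\mu^t_{\varepsilon_i}:=\left(\frac{\varepsilon_i|\nabla u_{\varepsilon_i}(\cdot,t)|^2}{2}+\frac{W(u_{\varepsilon_i}(\cdot,t))}{\varepsilon_i}\right)\mathcal{L}^n\lfloor_\Omega$, regarded as a Radon measure on $\mathbb{R}^n$. It is known that there exist a subsequence (denoted by the same index, and fixed from now on) and Radon measures $\{\mu^t\}_{t\ge0}$ on $\mathbb{R}^n$ such that $\mu^t_{\varepsilon_i}\to\mu^t$ (as Radon measures) for all $t\ge0$; $\mathrm{spt}\,\mu^t\subset\overline\Omega$. Varifolds. $\mathbf{G}(n,n-1)$ is the space of $(n-1)$-dimensional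 subspaces $S$ of $\mathbb{R}^n$, each identified with the orthogonal projection onto $S$; $G_{n-1}(\mathbb{R}^n):=\mathbb{R}^n\times\mathbf{G}(n,n-1)$. A general $(n-1)$-varifold in $\mathbb{R}^n$ is a Radon measure $V$ on $G_{n-1}(\mathbb{R}^n)$; its weight measure is $\|V\|(\phi)=\int\phi(x)\,dV(x,S)$; its first variation is $\delta V(g)=\int\nabla g(x)\cdot S\,dV(x,S)$ for $g\in C^1_c(\mathbb{R}^n;\mathbb{R}^n)$, where $A\cdot B=\sum_{i,j}A_{ij}B_{ij}$; $\|\delta V\|$ is its total variation measure. $V$ is rectifiable if $V(\phi)=\int_M\phi(x,\mathrm{Tan}_xM)\theta(x)\,d\mathcal{H}^{n-1}(x)$ for some $\mathcal{H}^{n-1}$-measurable countably $(n-1)$-rectifiable $M$ and locally $\mathcal{H}^{n-1}$-integrable $\theta$ on $M$ ($\mathrm{Tan}_xM$ the approximate tangent space); such $V$ is uniquely determined by $\|V\|$. A Radon measure is called rectifiable if it is the weight of a rectifiable $(n-1)$-varifold. The measure $\mu^t$ is rectifiable for a.e. $t\ge0$. Definition of $V^t$. If $\mu^t$ is rectifiable, $V^t$ is the rectifiable $(n-1)$-varifold in $\mathbb{R}^n$ with $\|V^t\|=\mu^t$. If $\mu^t$ is not rectifiable, $V^t$ is an arbitrary $(n-1)$-varifold in $\mathbb{R}^n$ with $\|V^t\|=\mu^t$ (for example $V^t(\phi)=\int\phi(\cdot,\mathbb{R}^{n-1}\times\{0\})\,d\mu^t$). *)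

theory Defs
  imports "HOL-Analysis.Analysis"
begin

section \<open>Function spaces and smooth domains\<close>

definition grad :: "('a::euclidean_space \<Rightarrow> real) \<Rightarrow> 'a \<Rightarrow> 'a" where
  "grad f x = (\<Sum>b\<in>Basis. frechet_derivative f (at x) b *\<^sub>R b)"

definition laplacian :: "('a::euclidean_space \<Rightarrow> real) \<Rightarrow> 'a \<Rightarrow> real" where
  "laplacian f x =
     (\<Sum>b\<in>Basis. frechet_derivative (\<lambda>y. frechet_derivative f (at y) b) (at x) b)"

text \<open>
  The continuous extension to \<open>closure \<Omega>\<close> of the gradient taken in the open set \<open>\<Omega>\<close>.
  Only used for functions that are \<open>C\<^sup>1\<close> up to the boundary, where the limit exists and
  agrees with \<open>grad f\<close> in \<open>\<Omega>\<close>; it never looks at values of \<open>f\<close> outside \<open>\<Omega>\<close>.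
\<close>
definition grad_closure :: "'a::euclidean_space set \<Rightarrow> ('a \<Rightarrow> real) \<Rightarrow> 'a \<Rightarrow> 'a" where
  "grad_closure \<Omega> f x = Lim (at x within \<Omega>) (grad f)"

text \<open>
  \<open>U\<close> is open and \<open>U \<subseteq> S \<subseteq> closure U\<close>: all partial derivatives of order \<open>\<le> k\<close> exist in
  \<open>U\<close> and extend continuously to \<open>S\<close>. With \<open>S = U\<close> this is \<open>C\<^sup>k\<close> on the open set \<open>U\<close>, with
  \<open>S = closure U\<close> it is \<open>C\<^sup>k\<close> up to the boundary.
\<close>
fun derivs_extend :: "nat \<Rightarrow> 'a::euclidean_space set \<Rightarrow> 'a set \<Rightarrow> ('a \<Rightarrow> real) \<Rightarrow> bool" where
  "derivs_extend 0 U S f \<longleftrightarrow> (\<exists>g. continuous_on S g \<and> (\<forall>x\<in>U. g x = f x))"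
| "derivs_extend (Suc k) U S f \<longleftrightarrow>
     (\<exists>g. continuous_on S g \<and> (\<forall>x\<in>U. g x = f x)) \<and>
     (\<forall>x\<in>U. f differentiable (at x)) \<and>
     (\<forall>b\<in>Basis. derivs_extend k U S (\<lambda>x. frechet_derivative f (at x) b))"

definition Ck_upto :: "nat \<Rightarrow> 'a::euclidean_space set \<Rightarrow> 'a set \<Rightarrow> ('a \<Rightarrow> real) \<Rightarrow> bool" where
  "Ck_upto k U S f \<longleftrightarrow> continuous_on S f \<and> derivs_extend k U S f"

definition smooth_upto :: "'a::euclidean_space set \<Rightarrow> 'a set \<Rightarrow> ('a \<Rightarrow> real) \<Rightarrow> bool" where
  "smooth_upto U S f \<longleftrightarrow> (\<forall>k. Ck_upto k U S f)"

definition local_defining_function ::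
  "'a::euclidean_space set \<Rightarrow> 'a \<Rightarrow> ('a \<Rightarrow> real) \<Rightarrow> bool" where
  "local_defining_function \<Omega> p \<rho> \<longleftrightarrow>
     (\<exists>U. open U \<and> p \<in> U \<and> smooth_upto U U \<rho> \<and> (\<forall>x\<in>U. grad \<rho> x \<noteq> 0) \<and>
          \<Omega> \<inter> U = {x \<in> U. \<rho> x < 0})"

definition bounded_smooth_domain :: "'a::euclidean_space set \<Rightarrow> bool" where
  "bounded_smooth_domain \<Omega> \<longleftrightarrow>
     open \<Omega> \<and> connected \<Omega> \<and> \<Omega> \<noteq> {} \<and> bounded \<Omega> \<and>
     (\<forall>p\<in>frontier \<Omega>. \<exists>\<rho>. local_defining_function \<Omega> p \<rho>)"

definition outer_unit_normal :: "'a::euclidean_space set \<Rightarrow> 'a \<Rightarrow> 'a \<Rightarrow> bool" where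
  "outer_unit_normal \<Omega> p v \<longleftrightarrow>
     (\<exists>\<rho>. local_defining_function \<Omega> p \<rho> \<and> v = sgn (grad \<rho> p))"

definition continuous_into_C1_closure ::
  "'a::euclidean_space set \<Rightarrow> (real \<Rightarrow> 'a \<Rightarrow> real) \<Rightarrow> bool" where
  "continuous_into_C1_closure \<Omega> u \<longleftrightarrow>
     (\<forall>t\<ge>0. Ck_upto 1 \<Omega> (closure \<Omega>) (u t)) \<and>
     (\<forall>t\<ge>0. uniform_limit (closure \<Omega>) u (u t) (at t within {0..}) \<and>
             uniform_limit (closure \<Omega>) (\<lambda>s. grad_closure \<Omega> (u s)) (grad_closure \<Omega> (u t))
               (at t within {0..}))"

definition Cc :: "'a::topological_space set \<Rightarrow> ('a \<Rightarrow> real) \<Rightarrow> bool" where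
  "Cc X \<phi> \<longleftrightarrow> continuous_on X \<phi> \<and> (\<exists>K. compact K \<and> K \<subseteq> X \<and> (\<forall>x\<in>X - K. \<phi> x = 0))"

definition C1c_fields :: "(real^'n) set \<Rightarrow> (real^'n \<Rightarrow> real^'n) set" where
  "C1c_fields U = {g. (\<forall>x. g differentiable (at x)) \<and>
     continuous_on UNIV (\<lambda>x. jacobian g (at x)) \<and>
     (\<exists>K. compact K \<and> K \<subseteq> U \<and> (\<forall>x. x \<notin> K \<longrightarrow> g x = 0))}"


section \<open>Allen--Cahn equation and its energy measures\<close>

definition ac_solution ::
  "(real \<Rightarrow> real) \<Rightarrow> 'a::euclidean_space set \<Rightarrow> ('a \<Rightarrow> 'a) \<Rightarrow> real \<Rightarrow> ('a \<Rightarrow> real) \<Rightarrow>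
   (real \<Rightarrow> 'a \<Rightarrow> real) \<Rightarrow> bool" where
  "ac_solution W \<Omega> \<nu> \<epsilon> u\<^sub>0 u \<longleftrightarrow>
     continuous_into_C1_closure \<Omega> u \<and>
     smooth_upto (\<Omega> \<times> {0<..}) (closure \<Omega> \<times> {0<..}) (\<lambda>(x, t). u t x) \<and>
     (\<forall>x\<in>\<Omega>. \<forall>t>0. deriv (\<lambda>s. u s x) t = laplacian (u t) x - deriv W (u t x) / \<epsilon>\<^sup>2) \<and>
     (\<forall>x\<in>frontier \<Omega>. \<forall>t>0. grad_closure \<Omega> (u t) x \<bullet> \<nu> x = 0) \<and>
     (\<forall>x\<in>\<Omega>. u 0 x = u\<^sub>0 x)"

definition ac_energy_density ::
  "(real \<Rightarrow> real) \<Rightarrow> real \<Rightarrow> ('a::euclidean_space \<Rightarrow> real) \<Rightarrow> 'a \<Rightarrow> real" where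
  "ac_energy_density W \<epsilon> f x = \<epsilon> * (norm (grad f x))\<^sup>2 / 2 + W (f x) / \<epsilon>"

definition ac_measure ::
  "(real \<Rightarrow> real) \<Rightarrow> 'a::euclidean_space set \<Rightarrow> real \<Rightarrow> ('a \<Rightarrow> real) \<Rightarrow> 'a measure" where
  "ac_measure W \<Omega> \<epsilon> f =
     density lborel (\<lambda>x. ennreal (indicator \<Omega> x * ac_energy_density W \<epsilon> f x))"


section \<open>Radon measures and Hausdorff measure\<close>

text \<open>Borel measures on the closed set \<open>X\<close> that are finite on compact sets;
  regularity is automatic on closed subsets of Euclidean space.\<close>
definition radon_measure_on :: "'a::euclidean_space set \<Rightarrow> 'a measure \<Rightarrow> bool" where
  "radon_measure_on X M \<longleftrightarrow>
     sets M = sets (restrict_space borel X) \<and>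
     (\<forall>K. compact K \<and> K \<subseteq> X \<longrightarrow> emeasure M K < \<infinity>)"

definition measure_support :: "'a::metric_space measure \<Rightarrow> 'a set" where
  "measure_support M = {x. \<forall>r>0. emeasure M (ball x r) > 0}"

definition radon_converges :: "(nat \<Rightarrow> 'a::euclidean_space measure) \<Rightarrow> 'a measure \<Rightarrow> bool" where
  "radon_converges M N \<longleftrightarrow>
     (\<forall>\<phi>. Cc UNIV \<phi> \<longrightarrow> (\<lambda>i. integral\<^sup>L (M i) \<phi>) \<longlonglongrightarrow> integral\<^sup>L N \<phi>)"

text \<open>Boundedness is required because \<open>diameter\<close> is meaningless on unbounded sets, and empty
  covering sets count zero also for \<open>m = 0\<close>, so that the result is counting measure there.\<close>
definition hausdorff_premeasure ::
  "nat \<Rightarrow> real \<Rightarrow> 'a::euclidean_space set \<Rightarrow> ennreal" where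
  "hausdorff_premeasure m \<delta> A =
     (INF C \<in> {C :: nat \<Rightarrow> 'a set. A \<subseteq> (\<Union>j. C j) \<and>
                                     (\<forall>j. bounded (C j) \<and> diameter (C j) \<le> \<delta>)}.
        \<Sum>j. if C j = {} then 0
            else ennreal (unit_ball_vol (real m) * (diameter (C j) / 2) ^ m))"

definition hausdorff_outer :: "nat \<Rightarrow> 'a::euclidean_space set \<Rightarrow> ennreal" where
  "hausdorff_outer m A = (SUP \<delta> \<in> {0<..}. hausdorff_premeasure m \<delta> A)"

text \<open>On the sigma-algebra of all Caratheodory measurable sets.\<close>
definition hausdorff_measure :: "nat \<Rightarrow> 'a::euclidean_space measure" where
  "hausdorff_measure m =
     measure_of UNIV (lambda_system UNIV UNIV (hausdorff_outer m)) (hausdorff_outer m)"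


section \<open>Rectifiable sets\<close>

text \<open>Some linear subspace \<open>T\<close> of dimension \<open>m\<close> of the ambient space serves as the parameter
  space \<open>\<real>\<^sup>m\<close>.\<close>
definition countably_rectifiable :: "nat \<Rightarrow> 'a::euclidean_space set \<Rightarrow> bool" where
  "countably_rectifiable m M \<longleftrightarrow>
     (\<exists>N T (f :: nat \<Rightarrow> 'a \<Rightarrow> 'a). hausdorff_outer m N = 0 \<and> subspace T \<and> dim T = m \<and>
        (\<forall>j. \<exists>L. L-lipschitz_on T (f j)) \<and> M \<subseteq> N \<union> (\<Union>j. f j ` T))"

definition locally_hausdorff_integrable ::
  "nat \<Rightarrow> 'a::euclidean_space set \<Rightarrow> ('a \<Rightarrow> real) \<Rightarrow> bool" where
  "locally_hausdorff_integrable m M \<theta> \<longleftrightarrow>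
     (\<forall>K. compact K \<longrightarrow> set_integrable (hausdorff_measure m) (M \<inter> K) \<theta>)"

text \<open>\<open>P\<close> is the approximate tangent space of \<open>M\<close> at \<open>x\<close> with respect to the multiplicity
  \<open>\<theta>\<close>: the blow-ups at \<open>x\<close> of \<open>\<theta>\<close> times Hausdorff measure on \<open>M\<close> converge to \<open>\<theta> x\<close> times
  Hausdorff measure on \<open>P\<close>. The weight is needed since Hausdorff measure on \<open>M\<close> need not be
  locally finite; up to null sets the tangent space does not depend on the positive weight.\<close>
definition approx_tangent_space ::
  "nat \<Rightarrow> 'a::euclidean_space set \<Rightarrow> ('a \<Rightarrow> real) \<Rightarrow> 'a \<Rightarrow> 'a set \<Rightarrow> bool" where
  "approx_tangent_space m M \<theta> x P \<longleftrightarrow>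
     subspace P \<and> dim P = m \<and>
     (\<forall>\<phi>. Cc UNIV \<phi> \<longrightarrow>
        ((\<lambda>r. (LINT y:M|hausdorff_measure m. \<phi> ((y - x) /\<^sub>R r) * \<theta> y) / r ^ m)
           \<longlongrightarrow> \<theta> x * (LINT y:P|hausdorff_measure m. \<phi> y)) (at_right 0))"


section \<open>Varifolds of codimension one\<close>

text \<open>For a subspace \<open>S\<close>, the nearest point map is the orthogonal projection.\<close>
definition orth_projection :: "(real^'n) set \<Rightarrow> real^'n^'n" where
  "orth_projection S = matrix (closest_point S)"

definition grassmannian_hyper :: "(real^'n^'n) set" where
  "grassmannian_hyper = orth_projection ` {S. subspace S \<and> dim S = CARD('n) - 1}"

definition varifold :: "((real^'n) \<times> (real^'n^'n)) measure \<Rightarrow> bool" where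
  "varifold V \<longleftrightarrow> radon_measure_on (UNIV \<times> grassmannian_hyper) V"

definition weight :: "((real^'n) \<times> (real^'n^'n)) measure \<Rightarrow> (real^'n) measure" where
  "weight V = distr V borel fst"

text \<open>The inner product of matrices is the sum of the products of the entries.\<close>
definition first_variation ::
  "((real^'n) \<times> (real^'n^'n)) measure \<Rightarrow> (real^'n \<Rightarrow> real^'n) \<Rightarrow> real" where
  "first_variation V g = (\<integral>(x, S). jacobian g (at x) \<bullet> S \<partial>V)"

text \<open>The value \<open>\<infinity>\<close> is allowed. Negative values of the first variation are truncated by
  \<open>ennreal\<close>, which does not affect the supremum since \<open>g = 0\<close> competes.\<close>
definition first_variation_norm ::
  "((real^'n) \<times> (real^'n^'n)) measure \<Rightarrow> (real^'n) set \<Rightarrow> ennreal" where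
  "first_variation_norm V A =
     (INF U \<in> {U. open U \<and> A \<subseteq> U}.
        SUP g \<in> {g \<in> C1c_fields U. \<forall>x. norm (g x) \<le> 1}. ennreal (first_variation V g))"

definition rectifiable_varifold :: "((real^'n) \<times> (real^'n^'n)) measure \<Rightarrow> bool" where
  "rectifiable_varifold V \<longleftrightarrow>
     varifold V \<and>
     (let m = CARD('n) - 1; H = (hausdorff_measure m :: (real^'n) measure) in
      \<exists>M \<theta> Tan. M \<in> sets H \<and> countably_rectifiable m M \<and>
        (\<forall>x\<in>M. 0 \<le> \<theta> x) \<and> locally_hausdorff_integrable m M \<theta> \<and>
        (AE x in H. x \<in> M \<longrightarrow> approx_tangent_space m M \<theta> x (Tan x)) \<and>
        (\<forall>\<phi>. Cc (UNIV \<times> grassmannian_hyper) \<phi> \<longrightarrow>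
           integral\<^sup>L V \<phi> = (LINT x:M|H. \<phi> (x, orth_projection (Tan x)) * \<theta> x)))"

definition rectifiable_measure :: "(real^'n) measure \<Rightarrow> bool" where
  "rectifiable_measure \<mu> \<longleftrightarrow> (\<exists>V. rectifiable_varifold V \<and> weight V = \<mu>)"

end

theory Submission
 imports Defs
begin

text \<open>Let \<open>e\<close> be the energy density and \<open>S = e I - eps Du \<otimes> Du\<close> the stress of a solution.

 The first variation at a fixed time. Testing the equation with \<open>eps Du \<bullet> h\<close> expresses the integral
 of \<open>S \<bullet> Dh\<close> by that of \<open>eps u\<^sub>t Du \<bullet> h\<close> and a boundary integral of \<open>e\<close> times the normal part of
 \<open>h\<close>. The boundary integral is not small, but subtracting from \<open>h\<close> a multiple of an extended normal
 field gives it a sign, so that \<open>\<bar>\<integral> S \<bullet> Dh\<bar> \<le> K sup \<bar>h\<bar> (energy + dissipation)\<close>, where the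
 dissipation is \<open>\<integral> eps u\<^sub>t\<^sup>2\<close> (\<open>first_variation_bound\<close>). The energy decreases, and the dissipation is
 bounded in \<open>L\<^sup>1\<close> in time, uniformly in \<open>eps\<close> (\<open>dissipation_bound\<close>). By Fatou, almost every time
 admits a subsequence of bounded dissipation; it depends on the time.

 The discrepancy. A maximum principle gives \<open>eps\<^sup>2 \<bar>Du\<bar>\<^sup>2 / 2 \<le> W(u) + kp\<close> for every fixed \<open>kp > 0\<close> and
 small \<open>eps\<close> (\<open>gradient_bound\<close>). Away from the wells \<open>W\<close> is bounded below, and near the wells the
 equation itself leaves little gradient energy; so the positive part of
 \<open>eps \<bar>Du\<bar>\<^sup>2 / 2 - W(u) / eps\<close> tends to zero in \<open>L\<^sup>1\<close> along sequences of bounded dissipation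
 (\<open>discrepancy_bound\<close>). Only this one-sided statement is needed.

 The limit of the stress. Where \<open>V\<close> has the tangent plane with unit normal \<open>n\<close>, the field
 \<open>((y - x) \<bullet> n) \<chi> n\<close>, with a cut-off \<open>\<chi>\<close> at scale \<open>r\<close>, has size \<open>r\<close> but derivative close to
 \<open>\<chi> n \<otimes> n\<close> near the plane. As the limit of the stress has bounded first variation, its \<open>n \<otimes> n\<close>
 part vanishes. The limit of \<open>eps Du \<otimes> Du\<close> is nonnegative with trace at most that of \<open>n \<otimes> n\<close>,
 hence it is \<open>n \<otimes> n\<close>, and the stress converges to the projection onto the tangent plane. The proof
 of \<open>rectifiable_identification\<close> does not form the limit of \<open>eps Du \<otimes> Du\<close>: it works with a sublinear
 functional of matrix fields (later an upper limit) and with one test field that averages the above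
 fields over all points and planes at a single scale.

 So the norm of the first variation of \<open>V\<^sup>t\<close> is at most \<open>K\<close> times the sum of the
 energy bound and the lower limit of the dissipation, which is integrable in time. Countably many test fields suffice for this norm, and measurability in
 time comes from truncated upper limits (\<open>limits_along_bounded_dissipation\<close>).\<close>

text \<open>Short forms for symbols that occur in most lines.\<close>
notation scaleR (infixr "*R" 75) and divideR (infixl "'/R" 70) and LIMSEQ (infix "---->" 60) and tendsto (infixr "--->" 55)

section \<open>Hausdorff outer measure and densities\<close>

definition hausdorff_term :: "nat => 'a::euclidean_space set => ennreal" where
 "hausdorff_term m C = (if C = {} then 0 else ennreal (unit_ball_vol (real m) * (diameter C / 2) ^ m))"

lemma hausdorff_premeasure_le:
 assumes "A <= (\<Union>j. C j)" "!!j::nat. bounded (C j) & diameter (C j) <= dl"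
 shows "hausdorff_premeasure m dl A <= (\<Sum>j. hausdorff_term m (C j))" unfolding hausdorff_premeasure_def hausdorff_term_def
 by (rule INF_lower) (use assms in auto)

lemma hausdorff_premeasure_lessD:
 assumes "hausdorff_premeasure m dl A < a"
 shows "EX C. A <= (\<Union>j. C j) & (ALL j::nat. bounded (C j)) & (ALL j. diameter (C j) <= dl) &
  (\<Sum>j. hausdorff_term m (C j)) < a" using assms unfolding hausdorff_premeasure_def hausdorff_term_def INF_less_iff by auto

lemma hausdorff_premeasure_mono:
 "A <= B ==> hausdorff_premeasure m dl A <= hausdorff_premeasure m dl B" unfolding hausdorff_premeasure_def by (rule INF_superset_mono) auto

lemma hausdorff_premeasure_le_outer:
 "dl > 0 ==> hausdorff_premeasure m dl A <= hausdorff_outer m A" unfolding hausdorff_outer_def by (rule SUP_upper) auto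

lemma hausdorff_outer_mono: "A <= B ==> hausdorff_outer m A <= hausdorff_outer m B"
 unfolding hausdorff_outer_def by (rule SUP_mono) (auto intro: hausdorff_premeasure_mono)

lemma hausdorff_outer_empty [simp]: "hausdorff_outer m {} = 0"
proof -
 have "hausdorff_premeasure m dl {} <= 0" if "dl > 0" for dl
  using hausdorff_premeasure_le[of "{}" "%_. {}" dl m] that by (simp add: hausdorff_term_def)
 then have "hausdorff_outer m {} <= 0" unfolding hausdorff_outer_def by (intro SUP_least) auto
 then show ?thesis by simp
qed

lemma hausdorff_premeasure_UN:
 assumes "dl > 0"
 shows "hausdorff_premeasure m dl (\<Union>n. A n) <= (\<Sum>n::nat. hausdorff_premeasure m dl (A n))"
proof (rule ennreal_le_epsilon)
 fix e :: real assume "0 < e" and fin: "(\<Sum>n. hausdorff_premeasure m dl (A n)) < top"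
 have *: "hausdorff_premeasure m dl (A n) < hausdorff_premeasure m dl (A n) + e * (1/2)^Suc n" for n
  using fin \<open>0 < e\<close> by (auto simp add: less_top dest!: ennreal_suminf_lessD)
 have "EX C. A n <= (\<Union>j. C j) & (ALL j::nat. bounded (C j)) & (ALL j. diameter (C j) <= dl) &
   (\<Sum>j. hausdorff_term m (C j)) <= hausdorff_premeasure m dl (A n) + e * (1/2)^Suc n" for n
  using hausdorff_premeasure_lessD[OF *[of n]] by (blast intro: less_imp_le)
 then obtain B where B: "!!n. A n <= (\<Union>j. B n j)" "!!n j::nat. bounded (B n j)"
   "!!n j. diameter (B n j) <= dl"
   "!!n. (\<Sum>j. hausdorff_term m (B n j)) <= hausdorff_premeasure m dl (A n) + e * (1/2)^Suc n" by metis
 define C where "C = case_prod B o prod_decode"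
 have "hausdorff_premeasure m dl (\<Union>n. A n) <= (\<Sum>i. hausdorff_term m (C i))"
 proof (rule hausdorff_premeasure_le)
  show "(\<Union>n. A n) <= (\<Union>j. C j)" using B(1) by (auto simp add: C_def subset_eq) (metis prod.case prod_encode_inverse)
 qed (use B in "auto simp: C_def split_def")
 also have "... = (\<Sum>n. \<Sum>i. hausdorff_term m (B n i))" unfolding C_def comp_def by (intro suminf_ennreal_2dimen) auto
 also have "... <= (\<Sum>n. hausdorff_premeasure m dl (A n) + e * (1/2) ^ Suc n)" by (intro suminf_le B summableI)
 also have "... = (\<Sum>n. hausdorff_premeasure m dl (A n)) + (\<Sum>n. ennreal e * ennreal ((1/2) ^ Suc n))"
  using \<open>0 < e\<close> by (subst suminf_add[symmetric])
           (auto simp del: ennreal_suminf_cmult simp add: ennreal_mult[symmetric])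
 also have "... = (\<Sum>n. hausdorff_premeasure m dl (A n)) + e" unfolding ennreal_suminf_cmult
  by (subst suminf_ennreal_eq[OF zero_le_power power_half_series]) auto
 finally show "hausdorff_premeasure m dl (\<Union>n. A n) <= (\<Sum>n. hausdorff_premeasure m dl (A n)) + e" .
qed

lemma hausdorff_outer_measure_space:
 "outer_measure_space (Pow UNIV) (hausdorff_outer m :: 'a::euclidean_space set => ennreal)"
 unfolding outer_measure_space_def positive_def increasing_def countably_subadditive_def
proof (intro conjI ballI allI impI)
 fix A :: "nat => 'a set"
 show "hausdorff_outer m (\<Union>i. A i) <= (\<Sum>i. hausdorff_outer m (A i))" unfolding hausdorff_outer_def[of m "\<Union>i. A i"]
 proof (rule SUP_least)
  fix dl :: real assume "dl : {0<..}"
  then have d: "dl > 0" by simp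
  show "hausdorff_premeasure m dl (\<Union>i. A i) <= (\<Sum>i. hausdorff_outer m (A i))" by (rule order_trans[OF hausdorff_premeasure_UN[OF d]])
     (intro suminf_le summableI hausdorff_premeasure_le_outer d)
 qed
qed (auto intro: hausdorff_outer_mono)

lemma
 shows sets_hausdorff_measure:
   "sets (hausdorff_measure m :: 'a::euclidean_space measure) = lambda_system UNIV UNIV (hausdorff_outer m)"
  and space_hausdorff_measure [simp]: "space (hausdorff_measure m :: 'a measure) = UNIV"
  and emeasure_hausdorff_measure:
   "!!A. A : sets (hausdorff_measure m :: 'a measure) ==>
     emeasure (hausdorff_measure m) A = hausdorff_outer m A"
proof -
 have ms: "measure_space UNIV (lambda_system UNIV UNIV (hausdorff_outer m))
     (hausdorff_outer m :: 'a set => ennreal)"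
  using sigma_algebra.caratheodory_lemma[of UNIV "Pow (UNIV :: 'a set)", OF sigma_algebra_Pow hausdorff_outer_measure_space] by simp
 then interpret sa: sigma_algebra UNIV "lambda_system UNIV UNIV (hausdorff_outer m :: 'a set => ennreal)" by (simp add: measure_space_def)
 show s: "sets (hausdorff_measure m :: 'a measure) = lambda_system UNIV UNIV (hausdorff_outer m)" unfolding hausdorff_measure_def by simp
 show "space (hausdorff_measure m :: 'a measure) = UNIV" unfolding hausdorff_measure_def by simp
 show "emeasure (hausdorff_measure m) A = hausdorff_outer m A"
  if "A : sets (hausdorff_measure m :: 'a measure)" for A using that ms unfolding s unfolding hausdorff_measure_def measure_space_def
  by (intro emeasure_measure_of_sigma) auto
qed

lemma power_right_approx:
 fixes d dl tau :: real
 assumes "dl > 0" "tau > 0"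
 obtains r where "d < r" "r < d + dl" "r ^ m < d ^ m + tau"
proof -
 have "((%r. r ^ m) ---> d ^ m) (at_right d)" by (intro tendsto_intros)
 then have "\<forall>\<^sub>F r in at_right d. r ^ m < d ^ m + tau" using assms by (intro order_tendstoD) auto
 moreover have "\<forall>\<^sub>F r in at_right d. r : {d<..<d+dl}" using assms by (intro eventually_at_right_real) auto
 ultimately have "EX r. r ^ m < d ^ m + tau & r : {d<..<d+dl}" by (intro eventually_happens'[OF trivial_limit_at_right_real] eventually_conj)
 then show ?thesis using that by auto
qed

text \<open>A set of diameter \<open>d\<close> that meets \<open>E\<close> lies in a ball of radius slightly above \<open>d\<close> centred in
 \<open>E\<close>; passing from the half diameter in the Hausdorff sums to the radius costs the factor \<open>2 ^ m\<close>.\<close>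
lemma hausdorff_density_uniform:
 fixes nu :: "'a::euclidean_space measure" and s a tau dl :: real
 assumes sets: "sets nu = sets borel" and pos: "s > 0" "tau > 0" "dl > 0"
  and H: "hausdorff_outer m E < ennreal a"
  and dens: "!!x r. x : E ==> 0 < r ==> r < dl ==> emeasure nu (ball x r) <= ennreal (s * r ^ m)"
 obtains U where "open U" "E <= U" "emeasure nu U <= ennreal (s * (2 ^ m / unit_ball_vol (real m) * a + tau))"
proof -
 define om where "om = unit_ball_vol (real m)"
 have w: "om > 0" by (simp add: om_def)
 have "hausdorff_premeasure m (dl/2) E < ennreal a" using hausdorff_premeasure_le_outer[of "dl/2" m E] H pos by (auto intro: le_less_trans)
 from hausdorff_premeasure_lessD[OF this] obtain C where C: "E <= (\<Union>j. C j)" "!!j::nat. bounded (C j)"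
  "!!j. diameter (C j) <= dl/2" "(\<Sum>j. hausdorff_term m (C j)) < ennreal a" by blast
 have "EX r. diameter (C j) < r & r < dl & r ^ m < diameter (C j) ^ m + tau * (1/2)^Suc j" for j
 proof -
  obtain r where "diameter (C j) < r" "r < diameter (C j) + dl/2" "r ^ m < diameter (C j) ^ m + tau * (1/2)^Suc j"
   by (rule power_right_approx[of "dl/2" "tau * (1/2)^Suc j" "diameter (C j)" m]) (use pos in auto)
  then show ?thesis using C(3)[of j] by (intro exI[of _ r]) auto
 qed
 then obtain r where r: "!!j. diameter (C j) < r j" "!!j. r j < dl"
   "!!j. r j ^ m < diameter (C j) ^ m + tau * (1/2)^Suc j" by metis
 define x where "x j = (SOME y. y : C j \<inter> E)" for j
 define B where "B j = (if C j \<inter> E = {} then {} else ball (x j) (r j))" for j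
 have x: "x j : C j" "x j : E" if "C j \<inter> E ~= {}" for j using that some_in_eq[of "C j \<inter> E"] unfolding x_def by auto
 have r0: "r j > 0" for j using r(1)[of j] diameter_ge_0[OF C(2)[of j]] by linarith
 have sub: "C j \<inter> E <= B j" for j
 proof
  fix y assume y: "y : C j \<inter> E"
  then have "dist (x j) y <= diameter (C j)" using x[of j] by (intro diameter_bounded_bound C) auto
  then show "y : B j" using y r(1)[of j] by (auto simp: B_def)
 qed
 show ?thesis
 proof
  show "open (\<Union>j. B j)" by (auto simp: B_def)
  show "E <= (\<Union>j. B j)" using C(1) sub by blast
  have Bsets: "B j : sets nu" for j unfolding sets by (auto simp: B_def)
  have nB: "emeasure nu (B j) <= ennreal (s * 2^m / om) * hausdorff_term m (C j) + ennreal s * ennreal (tau * (1/2)^Suc j)" for j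
  proof (cases "C j \<inter> E = {}")
   case False
   have "emeasure nu (B j) <= ennreal (s * r j ^ m)" using False dens[OF x(2)[OF False] r0 r(2)] by (simp add: B_def)
   also have "... <= ennreal (s * (diameter (C j) ^ m + tau * (1/2)^Suc j))" using r(3)[of j] pos by (intro ennreal_leI mult_left_mono) auto
   also have "... = ennreal (s * 2^m / om) * ennreal (om * (diameter (C j) / 2) ^ m) + ennreal s * ennreal (tau * (1/2)^Suc j)"
    using w pos diameter_ge_0[OF C(2)[of j]] by (subst ennreal_mult[symmetric] ennreal_plus[symmetric]; simp add: field_simps)+
   finally show ?thesis using False by (auto simp: hausdorff_term_def om_def)
  qed (simp add: B_def)
  have "emeasure nu (\<Union>j. B j) <= (\<Sum>j. emeasure nu (B j))" by (intro emeasure_subadditive_countably) (use Bsets in auto)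
  also have "... <= (\<Sum>j. ennreal (s * 2^m / om) * hausdorff_term m (C j) + ennreal s * ennreal (tau * (1/2)^Suc j))"
   by (intro suminf_le nB summableI)
  also have "... = ennreal (s * 2^m / om) * (\<Sum>j. hausdorff_term m (C j)) + ennreal s * (\<Sum>j. ennreal tau * ennreal ((1/2)^Suc j))"
  proof -
   have "ennreal (tau * (1/2)^Suc j) = ennreal tau * ennreal ((1/2)^Suc j)" for j using pos by (intro ennreal_mult) auto
   then show ?thesis by (simp only: suminf_add[symmetric] summableI ennreal_suminf_cmult)
  qed
  also have "(\<Sum>j. ennreal tau * ennreal ((1/2)^Suc j)) = ennreal tau" unfolding ennreal_suminf_cmult
   by (subst suminf_ennreal_eq[OF zero_le_power power_half_series]) auto
  also have "ennreal (s * 2^m / om) * (\<Sum>j. hausdorff_term m (C j)) + ennreal s * ennreal tau <=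
    ennreal (s * 2^m / om) * ennreal a + ennreal s * ennreal tau" using C(4) by (intro add_right_mono mult_left_mono) auto
  also have "... = ennreal (s * (2 ^ m / om * a + tau))"
  proof -
   have "a > 0" using H by (metis ennreal_neg not_le not_less_zero)
   then show ?thesis using pos w by (simp add: ennreal_mult[symmetric] ennreal_plus[symmetric] field_simps del: ennreal_plus)
  qed
  finally show "emeasure nu (\<Union>j. B j) <= ennreal (s * (2 ^ m / unit_ball_vol (real m) * a + tau))" unfolding om_def .
 qed
qed

text \<open>The points where the density bound holds below scale \<open>1 / k\<close> increase to \<open>E\<close>; the open sets for
 these pieces are intersected over all larger \<open>k\<close>, so that their measures pass to the limit.\<close>
lemma hausdorff_density:
 fixes nu :: "'a::euclidean_space measure" and s a tau :: real
 assumes sets: "sets nu = sets borel" and fin: "emeasure nu UNIV < \<infinity>" and pos: "s > 0" "tau > 0"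
  and H: "hausdorff_outer m E < ennreal a"
  and dens: "!!x. x : E ==> EX dl>0. ALL r. 0 < r --> r < dl --> emeasure nu (ball x r) <= ennreal (s * r ^ m)"
 obtains U where "open U" "E <= U" "emeasure nu U <= ennreal (s * (2 ^ m / unit_ball_vol (real m) * a + tau))"
proof -
 let ?c = "%tau. ennreal (s * (2 ^ m / unit_ball_vol (real m) * a + tau))"
 have apos: "a > 0" using H by (metis ennreal_neg not_le not_less_zero)
 define F where "F k = {x:E. ALL r. 0 < r --> r < inverse (Suc k) --> emeasure nu (ball x r) <= ennreal (s * r ^ m)}" for k
 have "EX U. open U & F k <= U & emeasure nu U <= ?c (tau/2)" for k
 proof -
  have "hausdorff_outer m (F k) < ennreal a" by (rule le_less_trans[OF hausdorff_outer_mono H]) (auto simp: F_def)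
  then obtain V where "open V" "F k <= V" "emeasure nu V <= ?c (tau/2)"
   by (rule hausdorff_density_uniform[OF sets, of s "tau/2" "inverse (Suc k)" m "F k" a, rotated 3])
    (use pos in "auto simp: F_def")
  then show ?thesis by blast
 qed
 then obtain U where U: "!!k. open (U k)" "!!k. F k <= U k" "!!k. emeasure nu (U k) <= ?c (tau/2)" by metis
 define G where "G k = (\<Inter>j\<in>{k..}. U j)" for k
 have Gs: "G k : sets nu" for k unfolding G_def sets using U(1) by (intro sets.countable_INT'') auto
 have Gm: "G k <= G (Suc k)" for k unfolding G_def by auto
 have "F k <= F j" if "k <= j" for k j
 proof -
  have "inverse (real (Suc j)) <= inverse (real (Suc k))" using that by (simp add: field_simps)
  then show ?thesis unfolding F_def by (blast intro: order_less_le_trans)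
 qed
 then have FG: "F k <= G k" for k using U(2) unfolding G_def by blast
 have "E <= (\<Union>k. F k)"
 proof
  fix x assume x: "x : E"
  obtain dl where d: "dl > 0" "ALL r. 0 < r --> r < dl --> emeasure nu (ball x r) <= ennreal (s * r ^ m)" using dens[OF x] by auto
  obtain k where "inverse (Suc k) < dl" using reals_Archimedean[OF d(1)] by auto
  then have "x : F k" using d x unfolding F_def by (blast intro: order_less_trans)
  then show "x : (\<Union>k. F k)" by auto
 qed
 then have EG: "E <= (\<Union>k. G k)" using FG by blast
 have "emeasure nu (\<Union>k. G k) = (SUP k. emeasure nu (G k))" using Gs Gm by (intro SUP_emeasure_incseq[symmetric] incseq_SucI) auto
 also have "... <= ?c (tau/2)"
 proof (rule SUP_least)
  fix k
  have "emeasure nu (G k) <= emeasure nu (U k)" using U(1) by (intro emeasure_mono) (auto simp: G_def sets)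
  then show "emeasure nu (G k) <= ?c (tau/2)" using U(3)[of k] by simp
 qed
 also have "... < ?c tau" using pos apos by (intro ennreal_lessI) (auto intro!: mult_pos_pos add_pos_pos simp: field_simps)
 finally have less: "emeasure nu (\<Union>k. G k) < ?c tau" .
 have sp: "space nu = UNIV" using sets_eq_imp_space_eq[OF sets] by simp
 have "(\<Union>k. G k) : sets borel" using Gs unfolding sets by blast
 from outer_regular[OF sets _ this] less obtain O' where "open O'" "(\<Union>k. G k) <= O'" "emeasure nu O' < ?c tau"
  using fin sp by (auto simp: INF_less_iff)
 then show ?thesis using EG that[of O'] by auto
qed

section \<open>Compactly supported functions\<close>

definition compactly_supported :: "('a::euclidean_space => 'b::euclidean_space) set" where
 "compactly_supported = {F. continuous_on UNIV F & (EX K. compact K & (ALL x. x ~: K --> F x = 0))}"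

lemma compactly_supportedI:
 "continuous_on UNIV F ==> compact K ==> (!!x. x ~: K ==> F x = 0) ==> F : compactly_supported" unfolding compactly_supported_def by auto

lemma compactly_supported_comp:
 assumes "F : compactly_supported" "continuous_on UNIV g" "g 0 = 0"
 shows "(%x. g (F x)) : compactly_supported"
proof -
 have "continuous_on UNIV (%x. g (F x))" using assms by (intro continuous_on_compose2[OF assms(2)]) (auto simp: compactly_supported_def)
 then show ?thesis using assms unfolding compactly_supported_def by force
qed

lemma compactly_supported_comp2:
 assumes "F : compactly_supported" "G : compactly_supported"
  and "continuous_on UNIV (%(x,y). g x y)" "g 0 0 = 0"
 shows "(%x. g (F x) (G x)) : compactly_supported"
proof -
 obtain K L where KL: "compact K" "!!x. x ~: K ==> F x = 0" "compact L" "!!x. x ~: L ==> G x = 0"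
  using assms unfolding compactly_supported_def by auto
 have "continuous_on UNIV (%x. (F x, G x))" using assms by (intro continuous_intros) (auto simp: compactly_supported_def)
 from continuous_on_compose2[OF assms(3) this]
 have "continuous_on UNIV (%x. g (F x) (G x))" by simp
 then show ?thesis by (rule compactly_supportedI[OF _ compact_Un[OF KL(1,3)]]) (use KL assms(4) in auto)
qed

lemma compactly_supported_bounded:
 assumes "F : compactly_supported"
 obtains C where "C > 0" "!!x. norm (F x) <= C"
proof -
 obtain K where K: "compact K" "!!x. x ~: K ==> F x = 0" "continuous_on UNIV F" using assms unfolding compactly_supported_def by auto
 then have "compact (F ` K)" by (intro compact_continuous_image) (auto intro: continuous_on_subset)
 then obtain C where C: "C > 0" "ALL y:F ` K. norm y <= C" using compact_imp_bounded bounded_pos by blast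
 have "norm (F x) <= C" for x using C K(2)[of x] by (cases "x : K") auto
 then show ?thesis using C that by blast
qed

lemma compactly_supported_measurable:
 "F : compactly_supported ==> F : borel_measurable borel" unfolding compactly_supported_def by (auto intro: borel_measurable_continuous_onI)

lemma compactly_supported_integrable:
 assumes "F : compactly_supported" "finite_measure mu" "sets mu = sets borel"
 shows "integrable mu F"
proof -
 interpret finite_measure mu by fact
 obtain C where "C > 0" "!!x. norm (F x) <= C" using compactly_supported_bounded[OF assms(1)] by auto
 then show ?thesis using compactly_supported_measurable[OF assms(1)] assms(3)
  by (intro integrable_const_bound[where B=C]) (auto cong: measurable_cong_sets)
qed

section \<open>Smooth steps, cut-offs and test fields\<close>

lemma DERIV_max_power:
 fixes s :: real
 shows "((%s. max 0 s ^ Suc (Suc n)) has_real_derivative real (Suc (Suc n)) * max 0 s ^ Suc n) (at s)"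
proof -
 consider "s > 0" | "s < 0" | "s = 0" by linarith
 then show ?thesis
 proof cases
  case 1
  have "((%s. s ^ Suc (Suc n)) has_real_derivative real (Suc (Suc n)) * s ^ Suc n) (at s)" by (rule derivative_eq_intros refl | simp)+
  then have "((%s. max 0 s ^ Suc (Suc n)) has_real_derivative real (Suc (Suc n)) * s ^ Suc n) (at s)"
   by (rule has_field_derivative_transform_within_open[where S="{0<..}"]) (use 1 in auto)
  then show ?thesis using 1 by (simp add: max_def)
 next
  case 2
  have "((%s. 0) has_real_derivative 0) (at s)" by simp
  then have "((%s. max 0 s ^ Suc (Suc n)) has_real_derivative 0) (at s)"
   by (rule has_field_derivative_transform_within_open[where S="{..<0}"]) (use 2 in auto)
  then show ?thesis using 2 by (simp add: max_def)
 next
  case 3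
  have "((%h. (max 0 (0 + h) ^ Suc (Suc n) - max 0 0 ^ Suc (Suc n)) / h) ---> 0) (at (0::real))"
  proof (rule Lim_null_comparison)
   show "\<forall>\<^sub>F h in at (0::real). norm ((max 0 (0 + h) ^ Suc (Suc n) - max 0 0 ^ Suc (Suc n)) / h) <= \<bar>h\<bar> ^ Suc n"
    by (rule always_eventually) (auto simp: max_def abs_mult power_abs mult_nonpos_nonneg)
   have "((%h::real. \<bar>h\<bar> ^ Suc n) ---> \<bar>0\<bar> ^ Suc n) (at 0)" by (intro tendsto_intros)
   then show "((%h::real. \<bar>h\<bar> ^ Suc n) ---> 0) (at 0)" by simp
  qed
  then show ?thesis using 3 by (simp add: DERIV_def)
 qed
qed

definition smoothstep :: "real => real" where
 "smoothstep s = 3 * max 0 s ^ 2 - 2 * max 0 s ^ 3 + 3 * max 0 (s - 1) ^ 2 + 2 * max 0 (s - 1) ^ 3"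

definition smoothstep' :: "real => real" where
 "smoothstep' s = 6 * max 0 s - 6 * max 0 s ^ 2 + 6 * max 0 (s - 1) + 6 * max 0 (s - 1) ^ 2"

lemma DERIV_smoothstep: "(smoothstep has_real_derivative smoothstep' s) (at s)"
proof -
 have a: "((%s. max 0 s ^ 2) has_real_derivative 2 * max 0 s) (at s)" for s :: real using DERIV_max_power[of 0 s] by (simp add: numeral_2_eq_2)
 have b: "((%s. max 0 s ^ 3) has_real_derivative 3 * max 0 s ^ 2) (at s)" for s :: real
  using DERIV_max_power[of 1 s] by (simp add: numeral_3_eq_3 numeral_2_eq_2)
 have c: "((%s. s - 1) has_real_derivative 1) (at s)" by (rule derivative_eq_intros refl | simp)+
 have a': "((%s. max 0 (s-1) ^ 2) has_real_derivative 2 * max 0 (s-1)) (at s)" using DERIV_chain2[OF a c] by simp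
 have b': "((%s. max 0 (s-1) ^ 3) has_real_derivative 3 * max 0 (s-1) ^ 2) (at s)" using DERIV_chain2[OF b c] by simp
 show ?thesis unfolding smoothstep_def[abs_def] smoothstep'_def by (rule derivative_eq_intros a b a' b' refl | simp)+
qed

lemma smoothstep_eq:
 "s <= 0 ==> smoothstep s = 0" "s >= 1 ==> smoothstep s = 1"
 "0 <= s ==> s <= 1 ==> smoothstep s = s^2 * (3 - 2 * s)" by (auto simp: smoothstep_def max_def algebra_simps power2_eq_square power3_eq_cube)

lemma smoothstep'_eq:
 "s <= 0 ==> smoothstep' s = 0" "s >= 1 ==> smoothstep' s = 0"
 "0 <= s ==> s <= 1 ==> smoothstep' s = 6 * s * (1 - s)" by (auto simp: smoothstep'_def max_def algebra_simps power2_eq_square)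

lemma smoothstep'_bounds: "0 <= smoothstep' s" "smoothstep' s <= 2"
proof -
 consider "s <= 0" | "s >= 1" | "0 <= s" "s <= 1" by linarith
 then have "0 <= smoothstep' s & smoothstep' s <= 2"
 proof cases
  case 3
  have "0 <= (1 - 2 * s)^2" by simp
  then have "6 * s * (1 - s) <= 2" by (simp add: power2_eq_square algebra_simps)
  then show ?thesis using 3 by (simp add: smoothstep'_eq)
 qed (auto simp: smoothstep'_eq)
 then show "0 <= smoothstep' s" "smoothstep' s <= 2" by auto
qed

lemma smoothstep_bounds: "0 <= smoothstep s" "smoothstep s <= 1"
proof -
 have mono: "smoothstep a <= smoothstep b" if "a <= b" for a b
  by (rule DERIV_nonneg_imp_nondecreasing[OF that]) (use DERIV_smoothstep smoothstep'_bounds in blast)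
 show "0 <= smoothstep s" using mono[of "min s 0" s] by (simp add: smoothstep_eq)
 show "smoothstep s <= 1" using mono[of s "max s 1"] by (simp add: smoothstep_eq)
qed

lemma continuous_smoothstep' [continuous_intros]:
 "continuous_on A f ==> continuous_on A (%x. smoothstep' (f x))" unfolding smoothstep'_def by (intro continuous_intros)

lemma continuous_smoothstep [continuous_intros]:
 "continuous_on A f ==> continuous_on A (%x. smoothstep (f x))" unfolding smoothstep_def by (intro continuous_intros)

definition tensor :: "real^'n => real^'n => real^'n^'n" where
 "tensor v w = (\<chi> i j. v $ i * w $ j)"

lemma tensor_mult: "tensor v w *v h = (w \<bullet> h) *R v"
 by (simp add: tensor_def matrix_vector_mult_def vec_eq_iff inner_vec_def sum_distrib_left sum_distrib_right mult_ac)

lemma inner_tensor: "A \<bullet> tensor v w = v \<bullet> (A *v w)"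
 by (simp add: tensor_def inner_vec_def matrix_vector_mult_def sum_distrib_left sum_distrib_right mult_ac)

lemma tensor_inner_tensor: "tensor a b \<bullet> tensor v w = (a \<bullet> v) * (b \<bullet> w)"
 by (simp add: inner_tensor tensor_mult inner_commute mult.commute)

lemma mat_inner_tensor: "mat 1 \<bullet> tensor v w = v \<bullet> w"
 by (simp add: inner_tensor)

lemma norm_tensor: "norm (tensor v w) = norm v * norm w"
 by (simp add: norm_eq_sqrt_inner tensor_inner_tensor real_sqrt_mult)

lemma tensor_scale: "tensor (c *R v) w = c *R tensor v w" "tensor v (c *R w) = c *R tensor v w"
 by (simp_all add: tensor_def vec_eq_iff)

lemma continuous_on_tensor [continuous_intros]:
 "continuous_on A f ==> continuous_on A g ==> continuous_on A (%x. tensor (f x) (g x))" unfolding tensor_def by (intro continuous_intros)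

lemma jacobian_eq:
 fixes g :: "real^'n => real^'m" and A :: "real^'n^'m"
 assumes "(g has_derivative (%h. A *v h)) (at x)"
 shows "jacobian g (at x) = A" unfolding jacobian_def frechet_derivative_at[OF assms, symmetric] by simp

lemma C1c_fieldsI:
 fixes g :: "real^'n => real^'n"
 assumes d: "!!x. (g has_derivative (%h. A x *v h)) (at x)" and c: "continuous_on UNIV A"
  and K: "compact K" "K <= U" "!!x. x ~: K ==> g x = 0"
 shows "g : C1c_fields U"
proof -
 have "(%x. jacobian g (at x)) = A" using jacobian_eq[OF d] by auto
 then show ?thesis using assms unfolding C1c_fields_def differentiable_def by auto
qed

lemma C1c_fieldsD:
 fixes g :: "real^'n => real^'n"
 assumes "g : C1c_fields U"
 shows "(g has_derivative (%h. jacobian g (at x) *v h)) (at x)"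
  "continuous_on UNIV (%x. jacobian g (at x))" "continuous_on UNIV g"
  "EX K. compact K & K <= U & (ALL x. x ~: K --> g x = 0 & jacobian g (at x) = 0)"
proof -
 show d: "(g has_derivative (%h. jacobian g (at x) *v h)) (at x)" for x using assms by (auto simp: C1c_fields_def jacobian_works)
 show "continuous_on UNIV (%x. jacobian g (at x))" using assms by (auto simp: C1c_fields_def)
 show "continuous_on UNIV g"
  using assms by (auto simp: C1c_fields_def intro: differentiable_imp_continuous_on differentiable_at_imp_differentiable_on)
 obtain K where K: "compact K" "K <= U" "!!x. x ~: K ==> g x = 0" using assms by (auto simp: C1c_fields_def)
 have "jacobian g (at x) = 0" if x: "x ~: K" for x
 proof (rule jacobian_eq)
  have "((%x. 0) has_derivative (%h. 0)) (at x)" by simp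
  then have "(g has_derivative (%h. 0)) (at x)" by (rule has_derivative_transform_within_open[of _ _ _ _ "-K"])
     (use x K compact_imp_closed in auto)
  then show "(g has_derivative (%h. 0 *v h)) (at x)" by simp
 qed
 then show "EX K. compact K & K <= U & (ALL x. x ~: K --> g x = 0 & jacobian g (at x) = 0)" using K by blast
qed

lemma C1c_fields_mono: "U <= V ==> C1c_fields U <= C1c_fields V"
 unfolding C1c_fields_def by blast

lemma C1c_fields_scale:
 fixes g :: "real^'n => real^'n"
 assumes "g : C1c_fields U"
 shows "(%x. c *R g x) : C1c_fields U"
  "jacobian (%x. c *R g x) (at x) = c *R jacobian g (at x)"
proof -
 have d: "((%x. c *R g x) has_derivative (%h. (c *R jacobian g (at x)) *v h)) (at x)" for x
  using has_derivative_scaleR_right[OF C1c_fieldsD(1)[OF assms], of c] by (simp add: scaleR_matrix_vector_assoc)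
 obtain K where "compact K" "K <= U" "!!x. x ~: K ==> g x = 0" using C1c_fieldsD(4)[OF assms] by blast
 then show "(%x. c *R g x) : C1c_fields U" using C1c_fieldsD(2)[OF assms] by (intro C1c_fieldsI[OF d]) (auto intro!: continuous_intros)
 show "jacobian (%x. c *R g x) (at x) = c *R jacobian g (at x)" by (rule jacobian_eq[OF d])
qed

lemma C1c_fields_zero:
 shows "(%x :: real^'n. 0 :: real^'n) : C1c_fields U"
  "jacobian (%x :: real^'n. 0) (at y) = (0 :: real^'n^'n)"
proof -
 have d: "((%x :: real^'n. 0 :: real^'n) has_derivative (%h. (0 :: real^'n^'n) *v h)) (at x)" for x by simp
 show "(%x :: real^'n. 0 :: real^'n) : C1c_fields U" by (rule C1c_fieldsI[OF d, of "{}"]) auto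
 show "jacobian (%x :: real^'n. 0) (at y) = (0 :: real^'n^'n)" by (rule jacobian_eq[OF d])
qed

lemma C1c_fields_sum:
 fixes g :: "'i => real^'n => real^'n"
 assumes "finite F" "!!i. i : F ==> g i : C1c_fields U"
 shows "(%x. \<Sum>i\<in>F. g i x) : C1c_fields U"
  "jacobian (%x. \<Sum>i\<in>F. g i x) (at x) = (\<Sum>i\<in>F. jacobian (g i) (at x))"
proof -
 have d: "((%x. \<Sum>i\<in>F. g i x) has_derivative (%h. (\<Sum>i\<in>F. jacobian (g i) (at x)) *v h)) (at x)" for x
 proof -
  have "((%x. \<Sum>i\<in>F. g i x) has_derivative (%h. \<Sum>i\<in>F. jacobian (g i) (at x) *v h)) (at x)"
   by (intro has_derivative_sum C1c_fieldsD(1)[where U=U] assms)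
  also have "(%h. \<Sum>i\<in>F. jacobian (g i) (at x) *v h) = (%h. (\<Sum>i\<in>F. jacobian (g i) (at x)) *v h)"
   using assms(1) by (induction F rule: finite_induct) (auto simp: matrix_vector_mult_add_rdistrib fun_eq_iff)
  finally show ?thesis .
 qed
 have "ALL i:F. EX K. compact K & K <= U & (ALL x. x ~: K --> g i x = 0)" using C1c_fieldsD(4)[OF assms(2)] by meson
 then obtain K where K: "!!i. i : F ==> compact (K i) & K i <= U & (ALL x. x ~: K i --> g i x = 0)" by metis
 show "(%x. \<Sum>i\<in>F. g i x) : C1c_fields U"
 proof (rule C1c_fieldsI[OF d])
  show "continuous_on UNIV (%x. \<Sum>i\<in>F. jacobian (g i) (at x))" by (intro continuous_intros C1c_fieldsD(2)[where U=U] assms)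
  show "compact (\<Union>i\<in>F. K i)" using K assms(1) by (intro compact_UN) auto
 qed (use K in auto)
 show "jacobian (%x. \<Sum>i\<in>F. g i x) (at x) = (\<Sum>i\<in>F. jacobian (g i) (at x))" by (rule jacobian_eq[OF d])
qed

lemma has_derivative_smoothstep_comp:
 assumes "(f has_derivative f') (at x)"
 shows "((%x. smoothstep (f x)) has_derivative (%h. smoothstep' (f x) * f' h)) (at x)"
 using has_derivative_compose[OF assms DERIV_smoothstep[unfolded has_field_derivative_def, of "f x"]] by simp

definition cutoff :: "'a::euclidean_space => real" where
 "cutoff w = smoothstep ((9/4 - w \<bullet> w) / (5/4))"

definition cutoff_grad :: "'a::euclidean_space => 'a" where
 "cutoff_grad w = (smoothstep' ((9/4 - w \<bullet> w) / (5/4)) * (- 8/5)) *R w"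

lemma has_derivative_cutoff: "(cutoff has_derivative (%h. cutoff_grad w \<bullet> h)) (at w)"
proof -
 have "((%w. (9/4 - w \<bullet> w) / (5/4)) has_derivative (%h. (- 8/5) * (w \<bullet> h))) (at w)"
  by (rule derivative_eq_intros refl | simp add: inner_commute)+
 from has_derivative_smoothstep_comp[OF this] show ?thesis unfolding cutoff_def[abs_def] cutoff_grad_def by (simp add: mult.assoc)
qed

lemma continuous_on_cutoff [continuous_intros]:
 "continuous_on A f ==> continuous_on A (%x. cutoff (f x))"
 "continuous_on A f ==> continuous_on A (%x. cutoff_grad (f x))" unfolding cutoff_def cutoff_grad_def by (intro continuous_intros; simp)+

lemma cutoff_props:
 "0 <= cutoff w" "cutoff w <= 1" "norm w <= 1 ==> cutoff w = 1" "norm w >= 3/2 ==> cutoff w = 0"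
 "norm w >= 3/2 ==> cutoff_grad w = 0" "norm (cutoff_grad w) <= 5"
proof -
 show "0 <= cutoff w" "cutoff w <= 1" by (auto simp: cutoff_def smoothstep_bounds)
 show "norm w <= 1 ==> cutoff w = 1" unfolding cutoff_def by (rule smoothstep_eq(2)) (auto simp: norm_eq_sqrt_inner)
 have *: "norm w >= 3/2 ==> (9/4 - w \<bullet> w) / (5/4) <= 0" using power_mono[of "3/2" "norm w" 2] by (simp add: dot_square_norm power_divide)
 show "norm w >= 3/2 ==> cutoff w = 0" unfolding cutoff_def using * by (rule smoothstep_eq(1))
 show z: "norm w >= 3/2 ==> cutoff_grad w = 0" unfolding cutoff_grad_def using * by (simp add: smoothstep'_eq(1))
 show "norm (cutoff_grad w) <= 5"
 proof (cases "norm w >= 3/2")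
  case False
  have "norm (cutoff_grad w) = smoothstep' ((9/4 - w \<bullet> w) / (5/4)) * (8/5) * norm w"
   by (simp add: cutoff_grad_def abs_mult smoothstep'_bounds)
  also have "... <= 2 * (8/5) * (3/2)" using False smoothstep'_bounds by (intro mult_mono) auto
  finally show ?thesis by simp
 qed (use z in simp)
qed

section \<open>Rectifiable varifolds and their blow-ups\<close>

lemma hyperplane_projection:
 fixes z :: "real^'n"
 assumes z: "norm z = 1"
 shows "subspace {y. y \<bullet> z = 0}" "dim {y. y \<bullet> z = 0} = CARD('n) - 1"
  "orth_projection {y. y \<bullet> z = 0} = mat 1 - tensor z z"
proof -
 let ?P = "{y. y \<bullet> z = 0}"
 have zz: "z \<bullet> z = 1" using z by (simp add: dot_square_norm)
 show s: "subspace ?P" by (auto simp: subspace_def inner_left_distrib)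
 have "z ~= 0" using z by auto
 then show "dim ?P = CARD('n) - 1" using dim_hyperplane[of z] by (simp add: inner_commute)
 have cp: "closest_point ?P y = y - (y \<bullet> z) *R z" for y
 proof (rule closest_point_unique[symmetric])
  show "convex ?P" "closed ?P" using s by (auto intro: subspace_imp_convex closed_subspace)
  show "y - (y \<bullet> z) *R z : ?P" by (simp add: inner_diff_left zz)
  show "ALL p:?P. dist y (y - (y \<bullet> z) *R z) <= dist y p"
  proof
   fix p assume p: "p : ?P"
   have "dist y (y - (y \<bullet> z) *R z) = \<bar>y \<bullet> z\<bar>" using z by (simp add: dist_norm)
   also have "\<bar>y \<bullet> z\<bar> = \<bar>(y - p) \<bullet> z\<bar>" using p by (simp add: inner_diff_left)
   also have "... <= dist y p" using Cauchy_Schwarz_ineq2[of "y - p" z] z by (simp add: dist_norm)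
   finally show "dist y (y - (y \<bullet> z) *R z) <= dist y p" .
  qed
 qed
 have "closest_point ?P = (%y. (mat 1 - tensor z z) *v y)" by (rule ext) (simp add: cp matrix_vector_mult_diff_rdistrib tensor_mult inner_commute)
 then show "orth_projection ?P = mat 1 - tensor z z" unfolding orth_projection_def by simp
qed

lemma hyperplane_normal:
 fixes S :: "(real^'n) set"
 assumes "subspace S" "dim S = CARD('n) - 1"
 obtains z where "norm z = 1" "S = {y. y \<bullet> z = 0}"
proof -
 have "dim S < DIM(real^'n)" using assms by simp
 then obtain a where a: "a ~= 0" "span S <= {x. a \<bullet> x = 0}" using lowdim_subset_hyperplane by blast
 define z where "z = sgn a"
 have z: "norm z = 1" using a by (simp add: z_def norm_sgn)
 have sub: "S <= {y. y \<bullet> z = 0}" using a span_superset[of S] by (auto simp: z_def sgn_div_norm inner_commute)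
 have "S = {y. y \<bullet> z = 0}" by (rule subspace_dim_equal[OF assms(1) hyperplane_projection(1)[OF z] sub])
    (simp add: hyperplane_projection(2)[OF z] assms(2))
 then show ?thesis using z that by blast
qed

lemma grassmannian_hyper_eq:
 "(grassmannian_hyper :: (real^'n^'n) set) = (%z. mat 1 - tensor z z) ` sphere 0 1"
proof safe
 fix P :: "real^'n^'n" assume "P : grassmannian_hyper"
 then obtain S where S: "subspace S" "dim S = CARD('n) - 1" "P = orth_projection S" unfolding grassmannian_hyper_def by blast
 obtain z where "norm z = 1" "S = {y. y \<bullet> z = 0}" using hyperplane_normal[OF S(1,2)] by blast
 then show "P : (%z. mat 1 - tensor z z) ` sphere 0 1" using S(3) hyperplane_projection(3)[of z] by auto
next
 fix z :: "real^'n" assume "z : sphere 0 1"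
 then have z: "norm z = 1" by simp
 have "mat 1 - tensor z z = orth_projection {y. y \<bullet> z = 0}" using hyperplane_projection(3)[OF z] by simp
 then show "mat 1 - tensor z z : grassmannian_hyper" unfolding grassmannian_hyper_def using hyperplane_projection(1,2)[OF z] by blast
qed

lemma compact_grassmannian_hyper: "compact (grassmannian_hyper :: (real^'n^'n) set)"
 unfolding grassmannian_hyper_eq by (intro compact_continuous_image continuous_intros) auto

lemma measurable_mult_locally_integrable:
 fixes h f :: "'a::euclidean_space => real"
 assumes sp: "space M = UNIV" and loc: "!!K. compact K ==> integrable M (%x. indicator K x * h x)"
 shows "h : borel_measurable M" "f : borel_measurable borel ==> (%x. f x * h x) : borel_measurable M"
proof -
 show h[measurable]: "h : borel_measurable M"
 proof (rule borel_measurable_LIMSEQ_real)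
  show "(%x. indicator (cball 0 (real i)) x * h x) : borel_measurable M" for i using loc by auto
  fix x :: 'a
  obtain N where "norm x <= real N" using real_arch_simple by blast
  then have "\<forall>\<^sub>F i in sequentially. indicator (cball 0 (real i)) x * h x = h x"
   unfolding eventually_sequentially by (intro exI[of _ N]) auto
  then show "(%i. indicator (cball 0 (real i)) x * h x) ----> h x" by (rule tendsto_eventually)
 qed
 define N where "N = {x. h x ~= 0}"
 have "{x:space M. h x ~= 0} : sets M" by measurable
 then have N: "N : sets M" unfolding N_def using sp by simp
 have c: "K \<inter> N : sets M" if "compact K" for K
 proof -
  have [measurable]: "(%x. indicator K x * h x) : borel_measurable M" using loc[OF that] by auto
  have "{x:space M. indicator K x * h x ~= 0} : sets M" by measurable
  then show ?thesis using sp by (simp add: N_def Int_def indicator_def conj_commute cong: rev_conj_cong)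
 qed
 have o: "S \<inter> N : sets M" if "open S" for S
 proof -
  obtain C where "!!n::nat. compact (C n)" "\<Union>(range C) = S" by (rule open_Union_compact_subsets[OF \<open>open S\<close>]) (rule that)
  then have "S \<inter> N = (\<Union>n. C n \<inter> N)" "!!n. C n \<inter> N : sets M" using c by auto
  then show ?thesis by (simp only:) (intro sets.countable_UN, auto)
 qed
 assume f: "f : borel_measurable borel"
 have "(%x. x) : measurable (restrict_space M N) borel"
  by (rule borel_measurableI) (use o sp N in "auto simp: sets_restrict_space_iff space_restrict_space")
 then have "f : measurable (restrict_space M N) borel" using f by (rule measurable_compose)
 then have "(%x. f x * indicator N x) : borel_measurable M" using N sp by (subst (asm) borel_measurable_restrict_space_iff) (auto simp: mult.commute)
 then have "(%x. (f x * indicator N x) * h x) : borel_measurable M" by measurable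
 moreover have "(%x. (f x * indicator N x) * h x) = (%x. f x * h x)" by (auto simp: N_def indicator_def)
 ultimately show "(%x. f x * h x) : borel_measurable M" by simp
qed

lemma Cc_UNIV: "Cc UNIV phi \<longleftrightarrow> continuous_on UNIV phi & (EX K. compact K & (ALL x. x ~: K --> phi x = 0))"
 unfolding Cc_def by auto

lemma norm_rescale: "r > 0 ==> norm ((y - x) /R r) = dist x y / r" for x y :: "'a::real_normed_vector"
 by (simp add: dist_norm norm_minus_commute divide_inverse mult.commute)

lemma Cc_fst: "Cc UNIV phi ==> Cc (UNIV \<times> (grassmannian_hyper :: (real^'n^'n) set)) (%z. phi (fst z))" for phi :: "real^'n => real"
proof -
 assume c: "Cc UNIV phi"
 then obtain K where K: "compact K" "ALL x. x ~: K --> phi x = 0" unfolding Cc_def by auto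
 show ?thesis unfolding Cc_def
 proof (intro conjI exI[of _ "K \<times> grassmannian_hyper"])
  show "continuous_on (UNIV \<times> grassmannian_hyper) (%z. phi (fst z))"
   by (rule continuous_on_compose2[of UNIV phi _ fst]) (use c in "simp_all add: Cc_def continuous_on_fst")
 qed (use K in "auto intro!: compact_Times compact_grassmannian_hyper")
qed

lemma Cc_bounded:
 assumes "Cc X phi"
 obtains C where "C > 0" "!!x. x : X ==> \<bar>phi x\<bar> <= C"
proof -
 obtain K where K: "compact K" "K <= X" "ALL x:X-K. phi x = 0" "continuous_on X phi" using assms unfolding Cc_def by auto
 then have "compact (phi ` K)" by (intro compact_continuous_image) (auto intro: continuous_on_subset)
 then obtain C where C: "C > 0" "ALL y:phi ` K. norm y <= C" using compact_imp_bounded bounded_pos by blast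
 have "\<bar>phi x\<bar> <= C" if "x : X" for x using C K(3) that by (cases "x : K") auto
 then show ?thesis using C that by blast
qed

lemma Cc_cutoff: "R > 0 ==> Cc UNIV (%y :: real^'n. cutoff ((y - x) /R R))"
proof -
 assume R: "R > 0"
 have "cutoff ((y - x) /R R) = 0" if "y ~: cball x (2 * R)" for y
 proof -
  have "2 * R < dist x y" using that by auto
  then show ?thesis using R by (intro cutoff_props) (simp_all only: norm_rescale, simp add: field_simps)
 qed
 then show ?thesis unfolding Cc_def by (intro conjI exI[of _ "cball x (2 * R)"] continuous_intros) auto
qed

text \<open>\<open>h\<close> is the multiplicity, extended by zero off the rectifiable set, and \<open>T\<close> the approximate
 tangent space.\<close>
locale tangent_representation =
 fixes V :: "((real^'n) \<times> (real^'n^'n)) measure" and h :: "real^'n => real" and T :: "real^'n => (real^'n) set"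
  and H :: "(real^'n) measure" and m :: nat
 defines "m \<equiv> CARD('n) - 1" and "H \<equiv> hausdorff_measure m"
 assumes varif: "varifold V" and finV: "emeasure V (space V) < \<infinity>"
  and h_nonneg: "!!x. h x >= 0"
  and h_loc: "!!K. compact K ==> integrable H (%x. indicator K x * h x)"
  and tangent: "AE x in H. h x > 0 --> subspace (T x) & dim (T x) = m &
   (ALL phi. Cc UNIV phi --> ((%r. (LINT y|H. phi ((y - x) /R r) * h y) / r ^ m)
     ---> h x * (LINT y:T x|H. phi y)) (at_right 0))"
  and repr: "!!phi. Cc (UNIV \<times> grassmannian_hyper) phi ==>
    integral\<^sup>L V phi = (LINT x|H. phi (x, orth_projection (T x)) * h x)"

lemma rectifiable_varifold_tangent_representation:
 fixes V :: "((real^'n) \<times> (real^'n^'n)) measure"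
 assumes "rectifiable_varifold V" "emeasure V (space V) < \<infinity>"
 obtains h T where "tangent_representation V h T"
proof -
 let ?m = "CARD('n) - 1"
 let ?H = "hausdorff_measure (CARD('n) - 1) :: (real^'n) measure"
 obtain M th Tan where M: "varifold V" "M : sets ?H" "ALL x:M. 0 <= th x" "locally_hausdorff_integrable ?m M th"
  "AE x in ?H. x : M --> approx_tangent_space ?m M th x (Tan x)"
  "!!phi. Cc (UNIV \<times> grassmannian_hyper) phi ==>
      integral\<^sup>L V phi = (LINT x:M|?H. phi (x, orth_projection (Tan x)) * th x)"
  using assms(1) unfolding rectifiable_varifold_def Let_def by blast
 define h where "h x = indicator M x * th x" for x
 have eq: "(LINT x:M|?H. f x * th x) = (LINT x|?H. f x * h x)" for f
  unfolding set_lebesgue_integral_def h_def by (rule Bochner_Integration.integral_cong) auto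
 have "tangent_representation V h Tan"
 proof
  show "varifold V" "emeasure V (space V) < \<infinity>" by fact+
  show "h x >= 0" for x using M(3) by (auto simp: h_def indicator_def)
  show "integrable ?H (%x. indicator K x * h x)" if "compact K" for K
  proof -
   have "set_integrable ?H (M \<inter> K) th" using M(4) that unfolding locally_hausdorff_integrable_def by blast
   moreover have "(%x. indicator (M \<inter> K) x *R th x) = (%x. indicator K x * h x)" by (auto simp: h_def indicator_def)
   ultimately show ?thesis unfolding set_integrable_def by simp
  qed
  show "AE x in ?H. h x > 0 --> subspace (Tan x) & dim (Tan x) = ?m &
   (ALL phi. Cc UNIV phi --> ((%r. (LINT y|?H. phi ((y - x) /R r) * h y) / r ^ ?m)
     ---> h x * (LINT y:Tan x|?H. phi y)) (at_right 0))" using M(5)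
  proof eventually_elim
   case (elim x)
   then show ?case unfolding approx_tangent_space_def eq by (auto simp: h_def indicator_def split: if_splits)
  qed
  show "integral\<^sup>L V phi = (LINT x|?H. phi (x, orth_projection (Tan x)) * h x)"
   if "Cc (UNIV \<times> grassmannian_hyper) phi" for phi using M(6)[OF that] unfolding eq .
 qed
 then show ?thesis by (rule that)
qed

lemma emeasure_weight: "varifold V ==> A : sets borel ==> emeasure (weight V) A = emeasure V (fst -` A \<inter> space V)"
 and varifold_space: "varifold V ==> space V = UNIV \<times> grassmannian_hyper"
 and varifold_sets: "varifold V ==> sets V = sets (restrict_space borel (UNIV \<times> grassmannian_hyper))"
 and varifold_measurable: "!!f. varifold V ==> f : measurable borel N ==> f : measurable V N"
 for V :: "((real^'n) \<times> (real^'n^'n)) measure"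
proof -
 assume v: "varifold V"
 show s: "sets V = sets (restrict_space borel (UNIV \<times> grassmannian_hyper))" using v unfolding varifold_def radon_measure_on_def by blast
 show sp: "space V = UNIV \<times> grassmannian_hyper" using sets_eq_imp_space_eq[OF s] by (simp add: space_restrict_space)
 show m: "f : measurable V N" if "f : measurable borel N" for f :: "_ => 'c" and N
  using measurable_restrict_space1[OF that] measurable_cong_sets[OF s refl] by auto
 assume "A : sets borel"
 then show "emeasure (weight V) A = emeasure V (fst -` A \<inter> space V)" unfolding weight_def
  by (intro emeasure_distr m borel_measurable_continuous_onI continuous_on_fst continuous_on_id)
qed

context tangent_representation begin

abbreviation lift where "lift x \<equiv> (x, orth_projection (T x))"

lemma space_H [simp]: "space H = UNIV" unfolding H_def by simp

lemma finite_V: "finite_measure V" using finV by (intro finite_measureI) auto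

lemma fst_measurable: "fst : measurable V borel"
 by (intro varifold_measurable[OF varif] borel_measurable_continuous_onI continuous_on_fst continuous_on_id)

lemma finite_weight: "finite_measure (weight V)" and sets_weight: "sets (weight V) = sets borel"
 unfolding weight_def by (rule finite_measure.finite_measure_distr[OF finite_V fst_measurable]) simp

lemma mult_h_measurable: "!!f. f : borel_measurable borel ==> (%x. f x * h x) : borel_measurable H"
 using measurable_mult_locally_integrable[OF space_H h_loc] by auto

lemma integrable_mult_h:
 assumes f: "f : borel_measurable borel" "!!x. \<bar>f x\<bar> <= C" "compact K" "!!x. x ~: K ==> f x = 0"
 shows "integrable H (%x. f x * h x)"
proof (rule Bochner_Integration.integrable_bound)
 show "integrable H (%x. C * (indicator K x * h x))" using h_loc[OF f(3)] by simp
 show "(%x. f x * h x) : borel_measurable H" by (rule mult_h_measurable[OF f(1)])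
 show "AE x in H. norm (f x * h x) <= norm (C * (indicator K x * h x))"
 proof (rule AE_I2)
  fix x
  have "\<bar>f x\<bar> <= C * indicator K x" using f(2)[of x] f(4)[of x] by (cases "x : K") auto
  from mult_right_mono[OF this h_nonneg[of x]]
  have "\<bar>f x\<bar> * h x <= C * (indicator K x * h x)" by (simp add: mult.assoc)
  then have "\<bar>f x\<bar> * h x <= \<bar>C * (indicator K x * h x)\<bar>" by linarith
  then show "norm (f x * h x) <= norm (C * (indicator K x * h x))" using h_nonneg[of x] by (simp only: real_norm_def abs_mult abs_of_nonneg)
 qed
qed

lemma Cc_integrable_V:
 assumes "Cc (UNIV \<times> grassmannian_hyper) phi"
 shows "integrable V phi"
proof -
 interpret finite_measure V by (rule finite_V)
 obtain C where C: "!!x. x : UNIV \<times> grassmannian_hyper ==> \<bar>phi x\<bar> <= C" using Cc_bounded[OF assms] by blast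
 have "continuous_on (UNIV \<times> grassmannian_hyper) phi" using assms unfolding Cc_def by blast
 then have "phi : borel_measurable (restrict_space borel (UNIV \<times> grassmannian_hyper))" by (rule borel_measurable_continuous_on_restrict)
 then have "phi : borel_measurable V" using measurable_cong_sets[OF varifold_sets[OF varif] refl] by blast
 then show ?thesis by (intro integrable_const_bound[where B=C]) (use C in "auto simp: varifold_space[OF varif]")
qed

lemma weight_eq:
 assumes "Cc UNIV phi"
 shows "(LINT x|weight V. phi x) = (LINT x|H. phi x * h x)"
proof -
 have "(LINT x|weight V. phi x) = (LINT z|V. phi (fst z))" unfolding weight_def
 proof (rule integral_distr[OF fst_measurable])
  show "phi : borel_measurable borel" using assms unfolding Cc_def by (auto intro: borel_measurable_continuous_onI)
 qed
 also have "... = (LINT x|H. phi x * h x)" using repr[OF Cc_fst[OF assms]] by simp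
 finally show ?thesis .
qed

lemma integrable_Cc_H:
 assumes pos: "emeasure V (space V) > 0" and phi: "Cc (UNIV \<times> grassmannian_hyper) phi" "!!z. phi z >= 0"
 shows "integrable H (%x. phi (lift x) * h x)"
proof -
 interpret finite_measure V by (rule finite_V)
 let ?c = "%k (x :: real^'n). cutoff ((x - 0) /R real (Suc k))"
 have cc: "Cc UNIV (?c k)" for k by (rule Cc_cutoff) simp
 have "(%k. LINT z|V. ?c k (fst z)) ----> (LINT z|V. (1::real))"
 proof (rule integral_dominated_convergence[where w="%_. 1"])
  show "AE z in V. (%k. ?c k (fst z)) ----> 1"
  proof (rule AE_I2, rule tendsto_eventually)
   fix z :: "(real^'n) \<times> (real^'n^'n)"
   obtain N where N: "norm (fst z) <= real N" using real_arch_simple by blast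
   show "\<forall>\<^sub>F k in sequentially. ?c k (fst z) = 1" unfolding eventually_sequentially
   proof (intro exI[of _ N] allI impI)
    fix n assume "N <= n"
    then have "norm (fst z) <= real (Suc n)" using N by simp
    then show "?c n (fst z) = 1" by (intro cutoff_props) (auto simp: field_simps)
   qed
  qed
  show "(%z. ?c k (fst z)) : borel_measurable V" for k using Cc_integrable_V[OF Cc_fst[OF cc]] by auto
 qed (auto simp: cutoff_props)
 moreover have "(LINT z|V. (1::real)) > 0" using pos by (simp add: emeasure_eq_measure)
 ultimately have "\<forall>\<^sub>F k in sequentially. (LINT z|V. ?c k (fst z)) > 0" by (rule order_tendstoD)
 then obtain k where k: "(LINT z|V. ?c k (fst z)) > 0" by (auto simp: eventually_sequentially)
 have Csum: "Cc (UNIV \<times> grassmannian_hyper) (%z. phi z + ?c k (fst z))"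
 proof -
  have 1: "Cc (UNIV \<times> (grassmannian_hyper :: (real^'n^'n) set)) (%z. ?c k (fst z))" by (rule Cc_fst[OF cc])
  have "EX K. compact K & K <= X & (ALL x:X-K. f x + g x = 0)" if "Cc X f" "Cc X g" for X and f g :: "'a::topological_space => real"
  proof -
   obtain K where K: "compact K" "K <= X" "ALL x:X-K. f x = 0" using \<open>Cc X f\<close> unfolding Cc_def by blast
   obtain L where L: "compact L" "L <= X" "ALL x:X-L. g x = 0" using \<open>Cc X g\<close> unfolding Cc_def by blast
   from K L show ?thesis by (intro exI[of _ "K \<union> L"]) (auto intro: compact_Un)
  qed
  from this[OF phi(1) 1] show ?thesis using 1 phi(1) unfolding Cc_def by (intro conjI continuous_on_add) (simp_all only:)
 qed
 have "(LINT z|V. phi z + ?c k (fst z)) = (LINT z|V. phi z) + (LINT z|V. ?c k (fst z))"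
  by (intro Bochner_Integration.integral_add Cc_integrable_V phi Cc_fst cc)
 moreover have "(LINT z|V. phi z) >= 0" using phi(2) by simp
 ultimately have "(LINT z|V. phi z + ?c k (fst z)) ~= 0" using k by linarith
 then have "(LINT x|H. (phi (lift x) + ?c k x) * h x) ~= 0" using repr[OF Csum] by simp
 then have "integrable H (%x. (phi (lift x) + ?c k x) * h x)" using not_integrable_integral_eq by blast
 moreover have "integrable H (%x. ?c k x * h x)"
 proof -
  obtain K where "compact K" "ALL x. x ~: K --> ?c k x = 0" "continuous_on UNIV (?c k)" using cc[of k] unfolding Cc_def by auto
  then show ?thesis by (intro integrable_mult_h[where C=1 and K=K]) (auto simp: cutoff_props intro: borel_measurable_continuous_onI)
 qed
 ultimately have "integrable H (%x. (phi (lift x) + ?c k x) * h x - ?c k x * h x)" by (rule Bochner_Integration.integrable_diff)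
 then show ?thesis by (simp add: algebra_simps)
qed

text \<open>For test functions the formula is the definition of a rectifiable varifold; it passes to
 compact sets by decreasing approximation.\<close>
lemma compact_formula:
 assumes pos: "emeasure V (space V) > 0" and K: "compact K" "K <= UNIV \<times> grassmannian_hyper"
 shows "integrable H (%x. indicator K (lift x) * h x)"
  "measure V K = (LINT x|H. indicator K (lift x) * h x)"
proof -
 interpret finite_measure V by (rule finite_V)
 have "integrable H (%x. indicator K (lift x) * h x) &
  measure V K = (LINT x|H. indicator K (lift x) * h x)"
 proof (cases "K = {}")
  case False
  define phi where "phi j z = max 0 (1 - real (Suc j) * infdist z K)" for j z
  have Cc: "Cc (UNIV \<times> grassmannian_hyper) (phi j)" for j
  proof -
   have "bounded {z. infdist z K <= 1}"
   proof -
    obtain R where R: "!!z. z : K ==> norm z <= R" using compact_imp_bounded[OF K(1)] bounded_iff by blast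
    have "norm z <= R + 1" if "infdist z K <= 1" for z
    proof -
     obtain y where "y : K" "infdist z K = dist z y" using infdist_attains_inf[OF compact_imp_closed[OF K(1)] False] by metis
     then show ?thesis using that R[of y] norm_triangle_sub[of z y] by (auto simp: dist_norm)
    qed
    then show ?thesis unfolding bounded_iff by blast
   qed
   then have "compact ({z. infdist z K <= 1} \<inter> (UNIV \<times> grassmannian_hyper))" unfolding compact_eq_bounded_closed
    by (intro conjI closed_Int closed_Times closed_Collect_le continuous_intros compact_imp_closed[OF compact_grassmannian_hyper])
     (auto intro: bounded_subset)
   moreover have "phi j z = 0" if "infdist z K > 1" for z
   proof -
    have "1 * 1 <= real (Suc j) * infdist z K" using that by (intro mult_mono) auto
    then show ?thesis by (simp add: phi_def)
   qed
   moreover have "continuous_on (UNIV \<times> grassmannian_hyper) (phi j)" unfolding phi_def[abs_def] by (intro continuous_intros)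
   ultimately show ?thesis unfolding Cc_def
    by (intro conjI exI[of _ "{z. infdist z K <= 1} \<inter> (UNIV \<times> grassmannian_hyper)"]) (auto, meson not_le)
  qed
  have nn: "0 <= phi j z" "phi j z <= phi 0 z" "phi j z <= 1" for j z
  proof -
   define a b where "a = infdist z K" and "b = real j * infdist z K"
   have "0 <= a" "0 <= b" by (auto simp: a_def b_def infdist_nonneg)
   moreover have "phi j z = max 0 (1 - (a + b))" "phi 0 z = max 0 (1 - a)" by (simp_all add: phi_def a_def b_def distrib_right)
   ultimately show "0 <= phi j z" "phi j z <= phi 0 z" "phi j z <= 1" by auto
  qed
  have lim: "(%j. phi j z) ----> indicator K z" for z
  proof (cases "z : K")
   case True then show ?thesis by (simp add: phi_def)
  next
   case z: False
   then have d: "infdist z K > 0" using K(1) False by (metis compact_imp_closed in_closed_iff_infdist_zero infdist_nonneg less_eq_real_def)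
   obtain N where "1 / infdist z K < real N" using reals_Archimedean2 by blast
   then have N: "1 < real N * infdist z K" using d by (simp add: field_simps)
   have "phi j z = 0" if "j >= N" for j
   proof -
    have "real N * infdist z K <= real (Suc j) * infdist z K" using that d by (intro mult_right_mono) auto
    then show ?thesis using N by (simp add: phi_def)
   qed
   then have "\<forall>\<^sub>F j in sequentially. phi j z = indicator K z" using z unfolding eventually_sequentially by auto
   then show ?thesis by (rule tendsto_eventually)
  qed
  have Ks: "K : sets V"
   using K by (auto simp: varifold_sets[OF varif] sets_restrict_space_iff closed_Times compact_imp_closed[OF compact_grassmannian_hyper] compact_imp_closed borel_closed)
  have iH: "integrable H (%x. phi j (lift x) * h x)" for j by (rule integrable_Cc_H[OF pos Cc nn(1)])
  have l1: "(%j. LINT z|V. phi j z) ----> (LINT z|V. indicator K z)" by (rule integral_dominated_convergence[where w="%_. 1"])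
     (use Ks lim nn Cc_integrable_V[OF Cc] in "auto")
  have m: "(%x. indicator K (lift x) * h x) : borel_measurable H"
  proof (rule borel_measurable_LIMSEQ_real)
   show "(%i. phi i (lift x) * h x) ----> indicator K (lift x) * h x" for x by (intro tendsto_intros lim)
  qed (use iH in auto)
  have l2: "(%j. LINT x|H. phi j (lift x) * h x) ----> (LINT x|H. indicator K (lift x) * h x)"
  proof (rule integral_dominated_convergence[OF m _ iH[of 0]])
   show "AE x in H. (%i. phi i (lift x) * h x) ----> indicator K (lift x) * h x" by (intro AE_I2 tendsto_intros lim)
   show "AE x in H. norm (phi i (lift x) * h x) <= phi 0 (lift x) * h x" for i using nn h_nonneg by (auto simp: abs_mult intro!: mult_right_mono)
  qed (use iH in auto)
  have "integrable H (%x. indicator K (lift x) * h x)"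
  proof (rule Bochner_Integration.integrable_bound[OF iH[of 0] m])
   show "AE x in H. norm (indicator K (lift x) * h x) <= norm (phi 0 (lift x) * h x)" using h_nonneg by (auto simp: indicator_def phi_def)
  qed
  moreover have "(LINT z|V. indicator K z) = (LINT x|H. indicator K (lift x) * h x)" by (rule LIMSEQ_unique[OF l1]) (use l2 repr[OF Cc] in simp)
  ultimately show ?thesis using Ks by simp
 qed simp
 then show "integrable H (%x. indicator K (lift x) * h x)"
  "measure V K = (LINT x|H. indicator K (lift x) * h x)" by auto
qed

definition rescaled :: "(real^'n => real) => real => real^'n => real" where
 "rescaled psi r x = (LINT y|weight V. psi ((y - x) /R r)) / r ^ m"

text \<open>Two consequences of the convergence to the tangent plane: test functions that vanish on the
 plane have vanishing averages, and the density does not oscillate between scales.\<close>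
lemma blow_up:
 "AE x in H. h x > 0 --> (EX z L. norm z = 1 & orth_projection (T x) = mat 1 - tensor z z &
   (ALL psi. Cc UNIV psi --> (ALL y. y \<bullet> z = 0 --> psi y = 0) --> ((%r. rescaled psi r x) ---> 0) (at_right 0)) &
   ((%r. rescaled cutoff r x) ---> L) (at_right 0))" using tangent
proof eventually_elim
 case (elim x)
 show ?case
 proof
  assume hx: "h x > 0"
  have T: "subspace (T x)" "dim (T x) = CARD('n) - 1"
   and conv: "!!phi. Cc UNIV phi ==> ((%r. (LINT y|H. phi ((y - x) /R r) * h y) / r ^ m)
     ---> h x * (LINT y:T x|H. phi y)) (at_right 0)" using elim hx by (auto simp: m_def)
  have Ccr: "Cc UNIV (%y. phi ((y - x) /R r))" if "Cc UNIV phi" "r > 0" for phi :: "real^'n => real" and r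
  proof -
   obtain K where K: "compact K" "ALL y. y ~: K --> phi y = 0" "continuous_on UNIV phi" using \<open>Cc UNIV phi\<close> unfolding Cc_UNIV by (elim conjE exE) (rule that)
   have "compact ((%w. x + r *R w) ` K)" by (intro compact_continuous_image K continuous_intros)
   moreover have "phi ((y - x) /R r) = 0" if "y ~: (%w. x + r *R w) ` K" for y
   proof -
    have "y = x + r *R ((y - x) /R r)" using \<open>r > 0\<close> by simp
    then have "(y - x) /R r ~: K" using that by blast
    then show ?thesis using K by blast
   qed
   moreover have "continuous_on UNIV (%y. phi ((y - x) /R r))" by (rule continuous_on_compose2[OF K(3)]) (auto intro!: continuous_intros)
   ultimately show ?thesis unfolding Cc_def by auto
  qed
  have convW: "((%r. rescaled phi r x) ---> h x * (LINT y:T x|H. phi y)) (at_right 0)"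
   if "Cc UNIV phi" for phi
  proof (rule Lim_transform_eventually[OF conv[OF that]])
   have "\<forall>\<^sub>F r::real in at_right 0. r > 0" by (simp add: eventually_at_right_less)
   then show "\<forall>\<^sub>F r in at_right 0. (LINT y|H. phi ((y - x) /R r) * h y) / r ^ m = rescaled phi r x"
    by eventually_elim (simp add: rescaled_def weight_eq[OF Ccr[OF that]])
  qed
  obtain z where z: "norm z = 1" "T x = {y. y \<bullet> z = 0}" using hyperplane_normal[OF T] by blast
  have p: "orth_projection (T x) = mat 1 - tensor z z" using hyperplane_projection(3)[OF z(1)] z(2) by simp
  have null: "((%r. rescaled psi r x) ---> 0) (at_right 0)"
   if "Cc UNIV psi" "ALL y. y \<bullet> z = 0 --> psi y = 0" for psi
  proof -
   have "(%y. indicat_real (T x) y *R psi y) = (%y. 0)" using that z(2) by (auto simp: indicator_def)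
   then have "(LINT y:T x|H. psi y) = 0" unfolding set_lebesgue_integral_def by simp
   then show ?thesis using convW[OF that(1)] by simp
  qed
  have "Cc UNIV (cutoff :: real^'n => real)" using Cc_cutoff[of 1 0] by simp
  from convW[OF this] show "EX z L. norm z = 1 & orth_projection (T x) = mat 1 - tensor z z &
   (ALL psi. Cc UNIV psi --> (ALL y. y \<bullet> z = 0 --> psi y = 0) --> ((%r. rescaled psi r x) ---> 0) (at_right 0)) &
   ((%r. rescaled cutoff r x) ---> L) (at_right 0)" using z(1) p null by blast
 qed
qed

end

section \<open>Identification of the limit of the stress\<close>

text \<open>Near the plane through \<open>x\<close> orthogonal to \<open>z\<close> the field is small, but its derivative is close
 to the projection onto the normal direction \<open>z\<close>.\<close>
lemma tangential_field:
 fixes z x :: "real^'n" and r :: real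
 assumes z: "norm z = 1" and r: "r > 0"
 defines "w \<equiv> %y. (y - x) /R r"
 defines "g \<equiv> %y. (r * (w y \<bullet> z) * cutoff (w y)) *R z"
 shows "g : C1c_fields (ball x (2 * r))" "norm (g y) <= 2 * r"
  "jacobian g (at y) = tensor z (cutoff (w y) *R z + (w y \<bullet> z) *R cutoff_grad (w y))"
proof -
 let ?s = "%y h. r * ((w y \<bullet> z) * (cutoff_grad (w y) \<bullet> (h /R r)) + (h /R r) \<bullet> z * cutoff (w y))"
 let ?A = "%y. tensor z (cutoff (w y) *R z + (w y \<bullet> z) *R cutoff_grad (w y))"
 have nw: "norm (w y) = dist x y / r" for y unfolding w_def by (rule norm_rescale[OF r])
 have dw: "(w has_derivative (%h. h /R r)) (at y)" for y unfolding w_def by (rule derivative_eq_intros refl | simp)+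
 have d: "(g has_derivative (%h. ?A y *v h)) (at y)" for y
 proof -
  have dc: "((%y. cutoff (w y)) has_derivative (%h. cutoff_grad (w y) \<bullet> (h /R r))) (at y)"
   using has_derivative_compose[OF dw has_derivative_cutoff] .
  have di: "((%y. w y \<bullet> z) has_derivative (%h. (h /R r) \<bullet> z)) (at y)" using has_derivative_inner_left[OF dw] .
  have "((%y. (r * ((w y \<bullet> z) * cutoff (w y))) *R z) has_derivative
    (%h. (?s y h) *R z)) (at y)" by (intro has_derivative_scaleR_left has_derivative_mult_right has_derivative_mult dc di)
  also have "(%h. (?s y h) *R z) = (%h. ?A y *v h)"
  proof
   fix h
   have "?s y h =
     (cutoff (w y) *R z + (w y \<bullet> z) *R cutoff_grad (w y)) \<bullet> h" using r by (simp add: inner_add_left inner_commute[of h z] field_simps)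
   then show "(?s y h) *R z = ?A y *v h" by (simp only: tensor_mult)
  qed
  finally show ?thesis unfolding g_def by (simp only: mult.assoc)
 qed
 have cw: "continuous_on UNIV w" unfolding w_def by (intro continuous_intros)
 have far: "norm (w y) >= 3/2" if "y ~: cball x (3/2 * r)" for y using that r by (simp add: nw field_simps)
 show "g : C1c_fields (ball x (2 * r))"
 proof (rule C1c_fieldsI[OF d])
  show "continuous_on UNIV ?A" by (intro continuous_intros cw)
  show "compact (cball x (3/2 * r))" by simp
  show "cball x (3/2 * r) <= ball x (2 * r)" using r by auto
  show "g y = 0" if "y ~: cball x (3/2 * r)" for y using cutoff_props(4)[OF far[OF that]] by (simp add: g_def)
 qed
 show "norm (g y) <= 2 * r"
 proof (cases "norm (w y) >= 3/2")
  case False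
  have "\<bar>w y \<bullet> z\<bar> <= 2" using Cauchy_Schwarz_ineq2[of "w y" z] z False by simp
  then have "r * \<bar>w y \<bullet> z\<bar> * cutoff (w y) <= r * 2 * 1" using r by (intro mult_mono) (auto simp: cutoff_props)
  then show ?thesis using z r by (simp add: g_def abs_mult cutoff_props(1))
 next
  case True
  then show ?thesis using cutoff_props(4)[OF True] r by (simp add: g_def)
 qed
 show "jacobian g (at y) = ?A y" by (rule jacobian_eq[OF d])
qed

lemma tilt_eq: "P : grassmannian_hyper ==> norm (mat 1 - P) = 1" for P :: "real^'n^'n"
 unfolding grassmannian_hyper_eq by (auto simp: norm_tensor)

lemma tensor_add: "tensor v (w + w') = tensor v w + tensor v w'"
 by (simp add: tensor_def vec_eq_iff distrib_left)

lemma finite_borel_partition: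
 fixes B :: "'a::euclidean_space set"
 assumes "bounded B" "B : sets borel" "dl > 0"
 obtains I S where "finite I" "I <= B" "disjoint_family_on S I" "(\<Union>a\<in>I. S a) = B"
  "!!a. a : I ==> S a : sets borel" "!!a z. a : I ==> z : S a ==> dist a z < dl"
proof -
 have "compact (closure B)" using assms(1) by simp
 moreover have "closure B <= (\<Union>c\<in>closure B. ball c (dl / 2))" using assms(3) by auto
 ultimately obtain C where C: "finite C" "closure B <= (\<Union>c\<in>C. ball c (dl / 2))"
  using compactE_image[of "closure B" "closure B" "%c. ball c (dl / 2)"] that by (metis open_ball)
 have "EX I S. finite I & I <= B & disjoint_family_on S I & (\<Union>a\<in>I. S a) = B &
   (ALL a:I. S a : sets borel & (ALL z:S a. dist a z < dl))"
  if "B <= (\<Union>c\<in>C. ball c (dl / 2))" "B : sets borel" for B using C(1) that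
 proof (induction C arbitrary: B)
  case empty
  then show ?case by (intro exI[of _ "{}"]) (auto simp: disjoint_family_on_def)
 next
  case (insert c C)
  let ?D = "B \<inter> ball c (dl / 2)"
  have "B - ball c (dl / 2) <= (\<Union>c\<in>C. ball c (dl / 2))" "B - ball c (dl / 2) : sets borel" using insert.prems by auto
  from insert.IH[OF this] obtain I S where IS: "finite I" "I <= B - ball c (dl / 2)" "disjoint_family_on S I"
   "(\<Union>a\<in>I. S a) = B - ball c (dl / 2)" "ALL a:I. S a : sets borel & (ALL z:S a. dist a z < dl)" by blast
  show ?case
  proof (cases "?D = {}")
   case True
   then have "B - ball c (dl / 2) = B" by blast
   with IS show ?thesis by metis
  next
   case False
   then obtain a where a: "a : ?D" by blast
   have D: "?D : sets borel" using insert.prems by auto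
   have Da: "dist a z < dl" if "z : ?D" for z using a that dist_triangle_half_r[of c a dl z] by auto
   have "S b \<inter> ?D = {}" if "b : I" for b using IS(4) that by blast
   then have "disjoint_family_on (S(a := ?D)) (insert a I)" using IS(2,3) a by (auto simp: disjoint_family_on_def)
   moreover have "(\<Union>b\<in>insert a I. (S(a := ?D)) b) = ?D \<union> (\<Union>b\<in>I. S b)" using IS(2) a by auto
   then have "(\<Union>b\<in>insert a I. (S(a := ?D)) b) = B" unfolding IS(4) by blast
   ultimately show ?thesis using IS(1,2,5) a D Da by (intro exI[of _ "insert a I"] exI[of _ "S(a := ?D)"]) (simp only: , auto)
  qed
 qed
 from this[OF order_trans[OF closure_subset C(2)] assms(2)] show ?thesis using that by blast
qed

context tangent_representation begin

abbreviation plane_bundle :: "((real^'n) \<times> (real^'n^'n)) set" where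
 "plane_bundle \<equiv> UNIV \<times> grassmannian_hyper"

lemma closed_bundle: "closed plane_bundle"
 using compact_grassmannian_hyper by (intro closed_Times closed_UNIV compact_imp_closed)

lemma sets_V: "A : sets borel ==> A <= plane_bundle ==> A : sets V"
 using closed_bundle by (auto simp: varifold_sets[OF varif] sets_restrict_space_iff)

text \<open>By inner regularity, a Borel set of positive measure contains a compact one, to which
 \<open>compact_formula\<close> applies. Almost everywhere statements for the Hausdorff measure are
 transferred to \<open>V\<close> in this way.\<close>
lemma AE_not_in_by_compacts:
 assumes Q: "Q : sets borel"
  and null: "!!K. emeasure V (space V) > 0 ==> compact K ==> K <= Q \<inter> plane_bundle ==>
   AE x in H. h x > 0 --> (lift x) ~: K"
 shows "AE z in V. z ~: Q"
proof (rule ccontr)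
 assume neg: "~ ?thesis"
 interpret VM: finite_measure V by (rule finite_V)
 have Sb: "Q \<inter> plane_bundle : sets borel" using Q closed_bundle by auto
 define V' where "V' = distr V borel (%z. z)"
 have V': "emeasure V' A = emeasure V (A \<inter> space V)" if "A : sets borel" for A
  unfolding V'_def using that varifold_measurable[OF varif measurable_ident] by (subst emeasure_distr) (auto simp: id_def)
 have sV: "Q \<inter> plane_bundle : sets V" by (rule sets_V[OF Sb]) auto
 have "emeasure V (Q \<inter> plane_bundle) ~= 0"
 proof
  assume "emeasure V (Q \<inter> plane_bundle) = 0"
  then have "AE z in V. z ~: Q \<inter> plane_bundle" using sV by (intro AE_not_in) (auto simp: null_sets_def)
  then have "AE z in V. z ~: Q" using AE_space by eventually_elim (simp add: varifold_space[OF varif])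
  then show False using neg by simp
 qed
 then have "emeasure V' (Q \<inter> plane_bundle) > 0" using V'[OF Sb] by (auto simp: zero_less_iff_neq_zero varifold_space[OF varif] Int_absorb2)
 also have "emeasure V' (Q \<inter> plane_bundle) = (SUP K \<in> {K. K <= Q \<inter> plane_bundle & compact K}. emeasure V' K)"
  by (rule inner_regular) (use V'[of UNIV] finV Sb in "auto simp: V'_def")
 finally obtain K where K: "K <= Q \<inter> plane_bundle" "compact K" "emeasure V' K > 0" by (auto simp: less_SUP_iff)
 have KX: "K <= plane_bundle" using K(1) by auto
 have VK: "measure V K > 0" using K(3) V'[of K] K(2) KX
  by (simp add: compact_imp_closed borel_closed varifold_space[OF varif] Int_absorb2 VM.emeasure_eq_measure)
 have pos: "emeasure V (space V) > 0" using VK VM.bounded_measure[of K] by (auto simp: VM.emeasure_eq_measure)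
 have "AE x in H. indicator K (lift x) * h x = 0" using null[OF pos K(2,1)]
 proof eventually_elim
  case (elim x)
  then show ?case using h_nonneg[of x] by (auto simp: indicator_def)
 qed
 then have "(LINT x|H. indicator K (lift x) * h x) = 0" by (rule integral_eq_zero_AE)
 then show False using VK compact_formula(2)[OF pos K(2) KX] by simp
qed

text \<open>Bounds the difference between the derivative of \<open>tangential_field\<close> and a multiple of the
 normal projection; it vanishes on the plane \<open>P\<close>.\<close>
definition tilt :: "real^'n^'n => real^'n => real" where
 "tilt P w = norm ((mat 1 - P) *v w) * norm (cutoff_grad w)"

lemma continuous_tilt [continuous_intros]:
 "continuous_on A f ==> continuous_on A g ==> continuous_on A (%x. tilt (f x) (g x))"
 unfolding tilt_def matrix_vector_mult_def by (intro continuous_intros)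

lemma rescaled_measurable:
 fixes psi :: "(real^'n) \<times> (real^'n^'n) => real^'n => real"
 assumes "continuous_on UNIV (%z. psi (fst z) (snd z))"
 shows "(%z. rescaled (psi z) r (fst z)) : borel_measurable borel"
proof -
 interpret W: finite_measure "weight V" by (rule finite_weight)
 have "continuous_on UNIV (%u :: ((real^'n) \<times> (real^'n^'n)) \<times> (real^'n). (fst u, (snd u - fst (fst u)) /R r))"
  by (intro continuous_intros)
 from continuous_on_compose2[OF assms this]
 have "continuous_on UNIV (%u :: ((real^'n) \<times> (real^'n^'n)) \<times> (real^'n). psi (fst u) ((snd u - fst (fst u)) /R r))" by simp
 then have "(%u. psi (fst u) ((snd u - fst (fst u)) /R r)) : borel_measurable (borel \<Otimes>\<^sub>M weight V)"
  unfolding measurable_cong_sets[OF sets_pair_measure_cong[OF refl sets_weight] refl] borel_prod by (rule borel_measurable_continuous_onI)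
 then have "(%z. LINT y|weight V. psi z ((y - fst z) /R r)) : borel_measurable borel"
  by (intro W.borel_measurable_lebesgue_integral) (simp add: case_prod_beta')
 then show ?thesis unfolding rescaled_def by simp
qed

lemma Cc_tilt: "Cc UNIV (tilt P)"
 unfolding Cc_UNIV by (intro conjI exI[of _ "cball 0 (3/2)"] continuous_intros) (auto simp: tilt_def cutoff_props)

lemma rescaled_cutoff_bounds:
 assumes "r > 0"
 shows "measure (weight V) (ball x r) <= r ^ m * rescaled cutoff r x"
  "r ^ m * rescaled cutoff r x <= measure (weight V) (ball x (3/2 * r))"
proof -
 interpret W: finite_measure "weight V" by (rule finite_weight)
 have i: "integrable (weight V) (%y. cutoff ((y - x) /R r))"
 proof (rule W.integrable_const_bound[where B=1])
  show "(%y. cutoff ((y - x) /R r)) : borel_measurable (weight V)" unfolding measurable_cong_sets[OF sets_weight refl]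
   by (intro borel_measurable_continuous_onI continuous_intros)
 qed (auto simp: cutoff_props)
 have ib: "integrable (weight V) (indicat_real (ball x s))" "(LINT y|weight V. indicator (ball x s) y) = measure (weight V) (ball x s)" for s
  by (simp_all add: sets_weight W.emeasure_eq_measure)
 have *: "indicat_real (ball x r) y <= cutoff ((y - x) /R r)" "cutoff ((y - x) /R r) <= indicat_real (ball x (3/2 * r)) y" for y
 proof -
  have n: "norm ((y - x) /R r) * r = dist x y" unfolding norm_rescale[OF assms] using assms by simp
  define a where "a = norm ((y - x) /R r)"
  have 1: "a <= 1" if "dist x y < r" using n that assms unfolding a_def[symmetric]
   by (metis less_eq_real_def linorder_not_less mult_1 mult_right_less_imp_less)
  have 2: "a >= 3/2" if "~ dist x y < 3/2 * r" using n that assms unfolding a_def[symmetric] by (metis linorder_not_less mult_strict_right_mono)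
  show "indicat_real (ball x r) y <= cutoff ((y - x) /R r)"
   using 1 cutoff_props(3)[of "(y - x) /R r"] unfolding a_def by (simp add: indicator_def cutoff_props(1) del: scaleR_right_diff_distrib)
  show "cutoff ((y - x) /R r) <= indicat_real (ball x (3/2 * r)) y"
   using 2 cutoff_props(4)[of "(y - x) /R r"] unfolding a_def by (auto simp: indicator_def cutoff_props(2) simp del: scaleR_right_diff_distrib)
 qed
 have "r ^ m * rescaled cutoff r x = (LINT y|weight V. cutoff ((y - x) /R r))" using assms by (simp add: rescaled_def)
 then show "measure (weight V) (ball x r) <= r ^ m * rescaled cutoff r x"
  "r ^ m * rescaled cutoff r x <= measure (weight V) (ball x (3/2 * r))"
  unfolding ib(2)[symmetric] using * by (simp_all only:) (intro integral_mono i ib(1); assumption)+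
qed

lemma dyadic: "filterlim (%j. (1/2 :: real) ^ j) (at_right 0) sequentially"
 "filterlim (%j. 8 * (1/2 :: real) ^ j) (at_right 0) sequentially" using tendsto_mult_right_zero[OF LIMSEQ_power_zero[of "1/2 :: real"], of 8]
 by (auto intro!: filterlim_at_withinI LIMSEQ_power_zero)

text \<open>If the density of the weight were zero on a set on which the multiplicity is at least \<open>s\<close>,
 the density theorem would make its measure smaller than \<open>s\<close> times its Hausdorff measure.\<close>
lemma AE_density_positive: "AE z in V. ~ (%j. rescaled cutoff (8 * (1/2) ^ j) (fst z)) ----> 0"
proof -
 let ?pT = "%x. orth_projection (T x)"
 have meas: "(%z :: (real^'n) \<times> (real^'n^'n). rescaled cutoff r (fst z)) : borel_measurable borel" for r
  by (intro rescaled_measurable[where psi="%z. cutoff"] continuous_intros)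
 define Q :: "((real^'n) \<times> (real^'n^'n)) set" where "Q = {z. (%j. rescaled cutoff (8 * (1/2) ^ j) (fst z)) ----> 0}"
 have "AE z in V. z ~: Q"
 proof (rule AE_not_in_by_compacts)
  have "{z :: (real^'n) \<times> (real^'n^'n) : space borel. (%j. rescaled cutoff (8 * (1/2) ^ j) (fst z)) ----> 0} : sets borel"
   using meas by measurable
  then show "Q : sets borel" by (simp add: Q_def)
  fix K :: "((real^'n) \<times> (real^'n^'n)) set"
  assume pos: "emeasure V (space V) > 0" and K: "compact K" "K <= Q \<inter> plane_bundle"
  interpret VM: finite_measure V by (rule finite_V)
  define E where "E s = {x. (x, ?pT x) : K & h x > s}" for s
  have iP: "integrable H (%x. indicator K (x, ?pT x) * h x)" and VP: "measure V K = (LINT x|H. indicator K (x, ?pT x) * h x)"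
   using compact_formula[OF pos K(1)] K(2) by auto
  have null: "E s : null_sets H" if s: "s > 0" for s
  proof (rule ccontr)
   assume nn: "E s ~: null_sets H"
   have Es: "E s : sets H"
   proof -
    have [measurable]: "(%x. indicator K (x, ?pT x) * h x) : borel_measurable H" using iP by auto
    have "{x:space H. indicator K (x, ?pT x) * h x > s} : sets H" by measurable
    also have "{x:space H. indicator K (x, ?pT x) * h x > s} = E s" using s by (auto simp: E_def indicator_def)
    finally show ?thesis .
   qed
   have Ele: "indicat_real (E s) x * s <= indicator K (x, ?pT x) * h x" for x using h_nonneg[of x] s by (auto simp: E_def indicator_def)
   have "integrable H (%x. indicat_real (E s) x * s)"
   proof (rule Bochner_Integration.integrable_bound[OF iP])
    show "AE x in H. norm (indicat_real (E s) x * s) <= norm (indicator K (x, ?pT x) * h x)"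
     using Ele s by (intro AE_I2) (smt (verit) indicator_pos_le mult_nonneg_nonneg real_norm_def)
   qed (use Es in measurable)
   then have iE: "integrable H (indicat_real (E s))" using s by simp
   define a where "a = measure H (E s)"
   have e: "emeasure H (E s) = ennreal a" using iE Es by (simp add: a_def emeasure_eq_ennreal_measure integrable_indicator_iff less_top[symmetric])
   have a: "a > 0"
   proof (rule ccontr)
    assume "~ a > 0"
    then have "emeasure H (E s) = 0" using e by (simp add: ennreal_neg)
    then show False using nn Es by (simp add: null_sets_def)
   qed
   obtain N where N: "N : null_sets H" "{x. ~ (h x > 0 --> (EX z L. norm z = 1 & ?pT x = mat 1 - tensor z z &
     (ALL psi. Cc UNIV psi --> (ALL y. y \<bullet> z = 0 --> psi y = 0) --> ((%r. rescaled psi r x) ---> 0) (at_right 0)) &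
     ((%r. rescaled cutoff r x) ---> L) (at_right 0)))} <= N" using blow_up unfolding eventually_ae_filter by auto
   define kp where "kp = 2 ^ m / unit_ball_vol (real m)"
   have kp: "kp > 0" by (auto simp: kp_def)
   define c where "c = s / (2 * (kp * 2 + 1))"
   have k1: "kp * 2 + 1 > 0" using kp by simp
   then have c: "c > 0" using s by (simp add: c_def)
   have "c * (kp * (2 * a) + a) = c * (kp * 2 + 1) * a" by (simp add: algebra_simps)
   also have "c * (kp * 2 + 1) = s / 2" unfolding c_def using k1 by (simp del: distrib_left_numeral)
   finally have ca: "c * (kp * (2 * a) + a) = s * a / 2" by simp
   have dens: "EX dl>0. ALL r. 0 < r --> r < dl --> emeasure (weight V) (ball x r) <= ennreal (c * r ^ m)"
    if x: "x : E s - N" for x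
   proof -
    have "h x > 0" using x s by (auto simp: E_def)
    then obtain L where L: "((%r. rescaled cutoff r x) ---> L) (at_right 0)" using x N(2) by blast
    have "(x, ?pT x) : Q" using x K(2) by (auto simp: E_def)
    then have "L = 0" using LIMSEQ_unique[OF filterlim_compose[OF L dyadic(2)]] by (simp add: Q_def)
    then have "\<forall>\<^sub>F r in at_right 0. rescaled cutoff r x < c" using L c by (intro order_tendstoD) auto
    then obtain dl where dl: "dl > 0" "!!r. 0 < r ==> r < dl ==> rescaled cutoff r x < c" unfolding eventually_at_right_field by auto
    show ?thesis
    proof (intro exI[of _ dl] conjI allI impI dl(1))
     fix r :: real assume r: "0 < r" "r < dl"
     have "measure (weight V) (ball x r) <= r ^ m * c" using rescaled_cutoff_bounds(1)[OF r(1), of x] less_imp_le[OF dl(2)[OF r]] r(1)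
      by (meson mult_left_mono order_trans less_imp_le zero_less_power)
     then show "emeasure (weight V) (ball x r) <= ennreal (c * r ^ m)"
      by (simp add: finite_measure.emeasure_eq_measure[OF finite_weight] mult.commute ennreal_leI)
    qed
   qed
   have "hausdorff_outer m (E s - N) <= hausdorff_outer m (E s)" by (rule hausdorff_outer_mono) auto
   also have "... = ennreal a" using emeasure_hausdorff_measure[of "E s" m] Es e unfolding H_def by simp
   also have "... < ennreal (2 * a)" using a by (simp add: ennreal_less_iff)
   finally have Hl: "hausdorff_outer m (E s - N) < ennreal (2 * a)" .
   have "emeasure (weight V) UNIV < \<infinity>" using finite_measure.emeasure_finite[OF finite_weight] by (simp add: less_top[symmetric])
   from hausdorff_density[OF sets_weight this c a Hl dens]
   obtain U where U: "open U" "E s - N <= U" "emeasure (weight V) U <= ennreal (s * a / 2)" unfolding kp_def[symmetric] ca by blast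
   let ?Q = "K - U \<times> UNIV"
   have "?Q = K \<inter> ((- U) \<times> UNIV)" by auto
   then have Q: "compact ?Q" "?Q <= plane_bundle" using K U(1) by (auto intro!: compact_Int_closed closed_Times simp: closed_Compl)
   have iQ: "integrable H (%x. indicator ?Q (x, ?pT x) * h x)" and VQ: "measure V ?Q = (LINT x|H. indicator ?Q (x, ?pT x) * h x)"
    using compact_formula[OF pos Q] by auto
   have "s * a = (LINT x|H. indicator (E s) x * s)" using Es iE by (simp add: a_def)
   also have "... <= (LINT x|H. indicator K (x, ?pT x) * h x - indicator ?Q (x, ?pT x) * h x)"
   proof (rule integral_mono_AE)
    show "AE x in H. indicat_real (E s) x * s <= indicator K (x, ?pT x) * h x - indicator ?Q (x, ?pT x) * h x" using AE_not_in[OF N(1)]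
    proof eventually_elim
     case (elim x)
     show ?case
     proof (cases "x : E s")
      case True
      then have "x : U" "(x, ?pT x) : K" "h x > s" using U(2) elim by (auto simp: E_def)
      then show ?thesis using True by simp
     qed (use h_nonneg[of x] in "auto simp: indicator_def")
    qed
   qed (use iP iQ iE in auto)
   also have "... = measure V K - measure V ?Q" using iP iQ VP VQ by simp
   also have "... = measure V (K - ?Q)" by (rule VM.finite_measure_Diff[symmetric])
      (use K(1,2) Q in "auto intro!: sets_V borel_closed compact_imp_closed")
   also have "... <= measure V (fst -` U \<inter> space V)" by (rule VM.finite_measure_mono)
      (use K(2) measurable_sets[OF fst_measurable borel_open[OF U(1)]] in "auto simp: varifold_space[OF varif]")
   also have "... = measure (weight V) U" unfolding weight_def using U(1) by (simp add: measure_distr[OF fst_measurable])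
   also have "... <= s * a / 2" using U(3) s a by (simp add: finite_measure.emeasure_eq_measure[OF finite_weight])
   finally show False using s a by (simp add: mult_le_0_iff)
  qed
  have "AE x in H. ALL j. x ~: E (inverse (real (Suc j)))" unfolding AE_all_countable by (intro allI AE_not_in null) simp
  then show "AE x in H. h x > 0 --> (x, ?pT x) ~: K"
  proof eventually_elim
   case (elim x)
   show ?case using reals_Archimedean[of "h x"] elim by (auto simp: E_def)
  qed
 qed
 then show ?thesis by (simp add: Q_def)
qed

text \<open>The mean of \<open>tilt\<close> relative to the local mass at a scale eight times larger; overlapping
 balls of radius \<open>2 r\<close> are absorbed by this larger scale.\<close>
definition excess :: "nat => (real^'n) \<times> (real^'n^'n) => real" where
 "excess j z = rescaled (tilt (snd z)) ((1/2) ^ j) (fst z) / rescaled cutoff (8 * (1/2) ^ j) (fst z)"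

lemma rescaled_cutoff_tilt_measurable:
 "(%z :: (real^'n) \<times> (real^'n^'n). rescaled cutoff r (fst z)) : borel_measurable borel"
  "(%z. rescaled (tilt (snd z)) r (fst z)) : borel_measurable borel"
 by (intro rescaled_measurable[where psi="%z. cutoff"] rescaled_measurable[where psi="%z. tilt (snd z)"] continuous_intros)+

lemma excess_measurable [measurable]: "excess j : borel_measurable borel"
 unfolding excess_def[abs_def] by (intro borel_measurable_divide rescaled_cutoff_tilt_measurable)

lemma AE_excess: "AE z in V. (%j. excess j z) ----> 0"
proof -
 let ?W = "%j (z :: (real^'n) \<times> (real^'n^'n)). rescaled cutoff (8 * (1/2) ^ j) (fst z)"
 let ?E = "%j (z :: (real^'n) \<times> (real^'n^'n)). rescaled (tilt (snd z)) ((1/2) ^ j) (fst z)"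
 note [measurable] = rescaled_cutoff_tilt_measurable
 have "AE z in V. z ~: {z:space borel. ~ ((%j. ?E j z) ----> 0 & Cauchy (%j. ?W j z))}"
 proof (rule AE_not_in_by_compacts)
  show "{z:space borel. ~ ((%j. ?E j z) ----> 0 & Cauchy (%j. ?W j z))} : sets borel" by measurable
  fix K :: "((real^'n) \<times> (real^'n^'n)) set"
  assume K: "K <= {z:space borel. ~ ((%j. ?E j z) ----> 0 & Cauchy (%j. ?W j z))} \<inter> plane_bundle"
  show "AE x in H. h x > 0 --> (lift x) ~: K" using blow_up
  proof eventually_elim
   case (elim x)
   show ?case
   proof
    assume "h x > 0"
    then obtain z L where z: "norm z = 1" "orth_projection (T x) = mat 1 - tensor z z"
     and null: "!!psi. Cc UNIV psi ==> (ALL y. y \<bullet> z = 0 --> psi y = 0) ==> ((%r. rescaled psi r x) ---> 0) (at_right 0)"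
     and L: "((%r. rescaled cutoff r x) ---> L) (at_right 0)" using elim by blast
    have "(%j. ?W j (lift x)) ----> L" using filterlim_compose[OF L dyadic(2)] by simp
    then have 1: "Cauchy (%j. ?W j (lift x))" by (intro LIMSEQ_imp_Cauchy)
    have "((%r. rescaled (tilt (orth_projection (T x))) r x) ---> 0) (at_right 0)"
     by (rule null[OF Cc_tilt]) (simp add: tilt_def z(2) tensor_mult inner_commute)
    from filterlim_compose[OF this dyadic(1)] 1 K show "(lift x) ~: K" by auto
   qed
  qed
 qed
 then show ?thesis using AE_density_positive
 proof eventually_elim
  case (elim z)
  then have E: "(%j. ?E j z) ----> 0" and "convergent (%j. ?W j z)" by (auto simp: Cauchy_convergent_iff)
  then obtain L where L: "(%j. ?W j z) ----> L" by (auto simp: convergent_def)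
  then have "L ~= 0" using elim(2) by auto
  from tendsto_divide[OF E L this] show ?case by (simp add: excess_def)
 qed
qed

text \<open>Fubini replaces covering arguments by averaging over the centres of all balls.\<close>
lemma integral_preimage_balls:
 fixes phi :: "'b => 'a::euclidean_space"
 assumes M: "finite_measure M" and phi: "phi : borel_measurable M" and Z: "Z : sets M" and s: "s >= 0"
 shows "(\<integral>\<^sup>+y. emeasure M (Z \<inter> phi -` ball y s) \<partial>lborel) = emeasure M Z * ennreal (unit_ball_vol DIM('a) * s ^ DIM('a))"
  "(%y. emeasure M (Z \<inter> phi -` ball y s)) : borel_measurable borel"
proof -
 interpret M: finite_measure M by fact
 interpret pair_sigma_finite M "lborel :: 'a measure" ..
 define D where "D = {u:space (M \<Otimes>\<^sub>M lborel). fst u : Z & dist (phi (fst u)) (snd u) < s}"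
 have D: "D : sets (M \<Otimes>\<^sub>M lborel)" unfolding D_def using phi Z by measurable
 have Zx: "x : space M" if "x : Z" for x using sets.sets_into_space[OF Z] that by blast
 have sl: "(%x. (x, y)) -` D = Z \<inter> phi -` ball y s" for y using Zx by (auto simp: D_def space_pair_measure dist_commute)
 show "(%y. emeasure M (Z \<inter> phi -` ball y s)) : borel_measurable borel" using measurable_emeasure_Pair2[OF D] unfolding sl by simp
 have "(\<integral>\<^sup>+y. emeasure M (Z \<inter> phi -` ball y s) \<partial>lborel) = (\<integral>\<^sup>+x. emeasure lborel (Pair x -` D) \<partial>M)"
  using emeasure_pair_measure_alt2[OF D] lborel.emeasure_pair_measure_alt[OF D] unfolding sl by simp
 also have "... = (\<integral>\<^sup>+x. ennreal (unit_ball_vol DIM('a) * s ^ DIM('a)) * indicator Z x \<partial>M)"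
 proof (intro nn_integral_cong)
  fix x
  have "Pair x -` D = (if x : Z then ball (phi x) s else {})" using Zx by (auto simp: D_def space_pair_measure)
  then show "emeasure lborel (Pair x -` D) = ennreal (unit_ball_vol DIM('a) * s ^ DIM('a)) * indicator Z x" using s by (simp add: emeasure_ball)
 qed
 finally show "(\<integral>\<^sup>+y. emeasure M (Z \<inter> phi -` ball y s) \<partial>lborel) = emeasure M Z * ennreal (unit_ball_vol DIM('a) * s ^ DIM('a))"
  unfolding nn_integral_cmult_indicator[OF Z] by (simp only: mult.commute)
qed

text \<open>At a point of \<open>Z\<close> the coefficients \<open>c\<close> of the nearby cells with planes close to its own add up to
 less than \<open>om\<close>. A cell has at most \<open>c\<close> times the mass of the ball of radius \<open>12 r\<close>, so the cells
 that meet a small ball around the point carry at most \<open>om\<close> times the mass of a ball of radius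
 \<open>14 r\<close>. Averaging balls of radius \<open>3/8 r\<close> over all centres gives the bound, as \<open>14 / (3/8) < 40\<close>.\<close>
lemma low_density_small:
 assumes I: "finite I" "disjoint_family_on S I" "(\<Union>a\<in>I. S a) = B" "!!a. a : I ==> S a : sets borel"
   "!!a z. a : I ==> z : S a ==> dist a z < min eps r / 4"
  and B: "B <= plane_bundle" and r: "r > 0" and c0: "!!a. a : I ==> 0 <= c a" and c: "!!a. a : I ==> c a * measure (weight V) (ball (fst a) (12 * r)) >= measure V (S a)"
  and C: "finite C" "grassmannian_hyper <= (\<Union>P\<in>C. ball P (eps / 4) :: (real^'n^'n) set)" and om: "om > 0"
 defines "Z \<equiv> {z:B. (\<Sum>a\<in>I. indicator (cball (snd a) eps) (snd z) * (c a * cutoff ((fst z - fst a) /R r))) < om}"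
 shows "Z : sets borel" "measure V Z <= real (card C) * (40 ^ CARD('n) * measure V (space V)) * om"
proof -
 interpret VM: finite_measure V by (rule finite_V)
 interpret W: finite_measure "weight V" by (rule finite_weight)
 let ?T = "%a z. indicator (cball (snd a) eps) (snd z) * (c a * cutoff ((fst z - fst a) /R r)) :: real"
 have Bb: "B : sets borel" using I(1,4) unfolding I(3)[symmetric] by auto
 have SX: "S a : sets V" if "a : I" for a using I(3) B that by (intro sets_V I(4)) auto
 have "(%z. \<Sum>a\<in>I. ?T a z) : borel_measurable borel"
 proof (intro borel_measurable_sum borel_measurable_times)
  fix a
  have "snd : borel_measurable (borel :: ((real^'n) \<times> (real^'n^'n)) measure)" by (intro borel_measurable_continuous_onI continuous_intros)
  then show "(%z :: (real^'n) \<times> (real^'n^'n). indicat_real (cball (snd a) eps) (snd z)) : borel_measurable borel"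
   by (rule measurable_compose) (intro borel_measurable_indicator borel_closed closed_cball)
 qed (intro borel_measurable_continuous_onI continuous_intros)+
 then have "{z:space borel. (\<Sum>a\<in>I. ?T a z) < om} : sets borel" by measurable
 from sets.Int[OF Bb this] show Zb: "Z : sets borel" unfolding Z_def by (simp add: Int_def)
 have ZB: "Z <= B" by (auto simp: Z_def)
 have near: "measure V {z'\<in>B. snd z' : ball P (eps/4) & dist (fst z) (fst z') < 3/4 * r} <= om * measure (weight V) (ball y (14 * r))"
  if z: "z : Z" "snd z : ball P (eps/4)" "dist y (fst z) < r" for y z P
 proof -
  let ?U = "{z'\<in>B. snd z' : ball P (eps/4) & dist (fst z) (fst z') < 3/4 * r}"
  define mu where "mu = measure (weight V) (ball y (14 * r))"
  define I' where "I' = {a:I. S a \<inter> ?U ~= {}}"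
  have I': "finite I'" "I' <= I" "!!a. a : I' ==> S a : sets V" using I(1) SX by (auto simp: I'_def)
  have "?U <= (\<Union>a\<in>I'. S a)" using I(3) by (auto simp: I'_def)
  then have "measure V ?U <= measure V (\<Union>a\<in>I'. S a)" using I' by (intro VM.finite_measure_mono sets.finite_UN) auto
  also have "... <= (\<Sum>a\<in>I'. measure V (S a))" using I' by (intro VM.finite_measure_subadditive_finite) auto
  also have "... <= (\<Sum>a\<in>I'. ?T a z * mu)"
  proof (rule sum_mono)
   fix a assume "a : I'"
   then obtain z' where a: "a : I" "z' : S a" "dist P (snd z') < eps/4" "dist (fst z) (fst z') < 3/4 * r" by (auto simp: I'_def)
   have d: "dist a z' < eps/4" "dist a z' < r/4" using I(5)[OF a(1,2)] by auto
   have f: "dist (fst a) (fst z) < r" using d(2) a(4) dist_fst_le[of a z'] dist_triangle[of "fst a" "fst z" "fst z'"] by (simp add: dist_commute)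
   then have "norm ((fst z - fst a) /R r) <= 1" unfolding norm_rescale[OF r] using r by simp
   then have "cutoff ((fst z - fst a) /R r) = 1" by (rule cutoff_props(3))
   moreover have "dist (snd a) (snd z) <= eps"
    using d(1) a(3) z(2) dist_snd_le[of a z'] dist_triangle[of "snd a" "snd z" "snd z'"] dist_triangle[of "snd z'" "snd z" P]
     zero_le_dist[of a z'] unfolding mem_ball dist_commute[of "snd z'"] by linarith
   moreover have "measure V (S a) <= c a * mu"
   proof -
    have "ball (fst a) (12 * r) <= ball y (14 * r)"
    proof
     fix x assume "x : ball (fst a) (12 * r)"
     then show "x : ball y (14 * r)" using f z(3) dist_triangle[of y x "fst a"] dist_triangle[of y "fst a" "fst z"] by (simp add: dist_commute)
    qed
    then have "measure (weight V) (ball (fst a) (12 * r)) <= mu" unfolding mu_def by (intro W.finite_measure_mono) (auto simp: sets_weight)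
    then show ?thesis using c0[OF a(1)] c[OF a(1)] mult_left_mono order_trans by blast
   qed
   ultimately show "measure V (S a) <= ?T a z * mu" by simp
  qed
  also have "... <= (\<Sum>a\<in>I. ?T a z * mu)" by (intro sum_mono2) (use I(1) I' c0 in "auto simp: cutoff_props mu_def intro!: mult_nonneg_nonneg")
  also have "... <= om * mu" using z(1) unfolding sum_distrib_right[symmetric] by (intro mult_right_mono) (auto simp: Z_def mu_def)
  finally show ?thesis unfolding mu_def .
 qed
 have piece: "measure V (Z \<inter> (UNIV \<times> ball P (eps/4))) <= 40 ^ CARD('n) * measure V (space V) * om" for P :: "real^'n^'n"
 proof -
  let ?Z = "Z \<inter> (UNIV \<times> ball P (eps/4))"
  have Zb': "?Z : sets borel" by (intro sets.Int Zb borel_open open_Times) auto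
  have Zs: "?Z : sets V" using ZB B by (intro sets_V Zb') auto
  note ib = integral_preimage_balls[OF finite_V fst_measurable]
  have "emeasure V ?Z * ennreal (unit_ball_vol (real CARD('n)) * (3/8 * r) ^ CARD('n)) =
    (\<integral>\<^sup>+y. emeasure V (?Z \<inter> fst -` ball y (3/8 * r)) \<partial>lborel)" using ib(1)[OF Zs, of "3/8 * r"] r by simp
  also have "... <= (\<integral>\<^sup>+y. ennreal om * emeasure V (space V \<inter> fst -` ball y (14 * r)) \<partial>lborel)"
  proof (rule nn_integral_mono)
   fix y :: "real^'n"
   have "measure V (?Z \<inter> fst -` ball y (3/8 * r)) <= om * measure (weight V) (ball y (14 * r))"
   proof (cases "?Z \<inter> fst -` ball y (3/8 * r) = {}")
    case False
    then obtain z where "z : ?Z \<inter> fst -` ball y (3/8 * r)" by blast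
    then have z: "z : ?Z" "dist y (fst z) < 3/8 * r" by auto
    have "measure V (?Z \<inter> fst -` ball y (3/8 * r)) <= measure V {z'\<in>B. snd z' : ball P (eps/4) & dist (fst z) (fst z') < 3/4 * r}"
    proof (rule VM.finite_measure_mono)
     show "?Z \<inter> fst -` ball y (3/8 * r) <= {z'\<in>B. snd z' : ball P (eps/4) & dist (fst z) (fst z') < 3/4 * r}"
     proof
      fix z' assume z': "z' : ?Z \<inter> fst -` ball y (3/8 * r)"
      then have "dist (fst z) (fst z') < 3/4 * r" using z(2) dist_triangle3[of "fst z" "fst z'" y] by simp
      then show "z' : {z'\<in>B. snd z' : ball P (eps/4) & dist (fst z) (fst z') < 3/4 * r}" using z' ZB by (auto simp: mem_Times_iff)
     qed
     have "B \<inter> (ball (fst z) (3/4 * r) \<times> ball P (eps/4)) : sets V" using B by (intro sets_V sets.Int Bb borel_open open_Times) auto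
     moreover have "B \<inter> (ball (fst z) (3/4 * r) \<times> ball P (eps/4)) = {z'\<in>B. snd z' : ball P (eps/4) & dist (fst z) (fst z') < 3/4 * r}"
      by auto
     ultimately show "{z'\<in>B. snd z' : ball P (eps/4) & dist (fst z) (fst z') < 3/4 * r} : sets V" by simp
    qed
    also have "... <= om * measure (weight V) (ball y (14 * r))" using z r by (intro near) auto
    finally show ?thesis .
   qed (use om in simp)
   also have "measure (weight V) (ball y (14 * r)) = measure V (space V \<inter> fst -` ball y (14 * r))"
    unfolding weight_def by (simp add: measure_distr[OF fst_measurable] Int_commute)
   finally show "emeasure V (?Z \<inter> fst -` ball y (3/8 * r)) <= ennreal om * emeasure V (space V \<inter> fst -` ball y (14 * r))"
    using om by (simp add: VM.emeasure_eq_measure ennreal_mult'[symmetric] ennreal_leI)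
  qed
  also have "... = ennreal om * (emeasure V (space V) * ennreal (unit_ball_vol (real CARD('n)) * (14 * r) ^ CARD('n)))"
   using ib[OF sets.top, of "14 * r"] r by (simp add: nn_integral_cmult)
  finally have "measure V ?Z * (unit_ball_vol (real CARD('n)) * (3/8 * r) ^ CARD('n)) <=
    om * (measure V (space V) * (unit_ball_vol (real CARD('n)) * (14 * r) ^ CARD('n)))"
   using r om by (simp add: VM.emeasure_eq_measure ennreal_mult'[symmetric] del: power_mult_distrib power_divide)
  also have "... <= om * (measure V (space V) * (unit_ball_vol (real CARD('n)) * (40 * (3/8 * r)) ^ CARD('n)))"
   using r om by (intro mult_left_mono power_mono) auto
  also have "(40 * (3/8 * r)) ^ CARD('n) = 40 ^ CARD('n) * (3/8 * r) ^ CARD('n)" by (rule power_mult_distrib)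
  finally have "measure V ?Z * (unit_ball_vol (real CARD('n)) * (3/8 * r) ^ CARD('n)) <=
    (40 ^ CARD('n) * measure V (space V) * om) * (unit_ball_vol (real CARD('n)) * (3/8 * r) ^ CARD('n))" by (simp only: mult_ac)
  then show ?thesis using r by simp
 qed
 have "Z <= (\<Union>P\<in>C. Z \<inter> (UNIV \<times> ball P (eps/4)))" using ZB B C(2) by fastforce
 then have "measure V Z <= measure V (\<Union>P\<in>C. Z \<inter> (UNIV \<times> ball P (eps/4)))" using ZB B C(1)
  by (intro VM.finite_measure_mono sets.finite_UN sets_V sets.Int Zb borel_open open_Times) auto
 also have "... <= (\<Sum>P\<in>C. measure V (Z \<inter> (UNIV \<times> ball P (eps/4))))" using ZB B C(1)
  by (intro VM.finite_measure_subadditive_finite image_subsetI sets_V sets.Int Zb borel_open open_Times) auto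
 also have "... <= (\<Sum>P\<in>C. 40 ^ CARD('n) * measure V (space V) * om)" by (intro sum_mono piece)
 finally show "measure V Z <= real (card C) * (40 ^ CARD('n) * measure V (space V)) * om" by simp
qed

text \<open>For large \<open>t\<close> the norm of \<open>t a - F\<close> with a unit vector \<open>a\<close> is \<open>t - a \<bullet> F\<close> up to an error of order
 \<open>1 / t\<close>. The estimate survives for sums of unit vectors as long as a definite part \<open>om\<close> of the
 weights belongs to vectors close to \<open>a\<close>; the others only enter with their norm.\<close>
lemma rank_one_perturbation:
 fixes q :: "'i => 'b::real_inner" and F a0 :: 'b
 assumes I: "finite I" "!!a. a : I ==> 0 <= c a" "!!a. a : I ==> norm (q a) <= 1"
  and J: "J <= I" "!!a. a : J ==> norm (q a - a0) <= eps" "om <= sum c J" and pos: "om > 0" "t > 0"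
 shows "norm (t *R (\<Sum>a\<in>I. c a *R q a) - F) <= t * sum c I - a0 \<bullet> F + eps * norm F + (norm F)^2 / (2 * (t * om))"
proof -
 have cJ: "0 <= c a" "norm (c a *R q a) <= c a" if "a : I" for a using I(2,3)[OF that] by (auto intro: mult_left_le)
 have sub: "norm (\<Sum>a\<in>L. c a *R q a) <= sum c L" if "L <= I" for L using cJ that by (intro sum_norm_le) blast
 define D X where "D = t * sum c J" and "X = t *R (\<Sum>a\<in>J. c a *R q a)"
 have D: "D > 0" "t * om <= D" using J(3) pos by (auto simp: D_def intro!: mult_left_mono)
 have X: "norm X <= D" using sub[OF J(1)] pos by (simp add: X_def D_def)
 have "X - D *R a0 = t *R (\<Sum>a\<in>J. c a *R (q a - a0))" by (simp add: X_def D_def scaleR_diff_right sum_subtractf scaleR_sum_left[symmetric])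
 moreover have "norm (\<Sum>a\<in>J. c a *R (q a - a0)) <= (\<Sum>a\<in>J. c a * eps)"
 proof (intro sum_norm_le)
  fix a assume a: "a : J"
  then have "c a >= 0" using cJ(1) J(1) by blast
  then show "norm (c a *R (q a - a0)) <= c a * eps" using mult_left_mono[OF J(2)[OF a], of "c a"] by simp
 qed
 ultimately have "norm (X - D *R a0) <= D * eps" using pos by (simp add: D_def sum_distrib_right[symmetric])
 then have "\<bar>(X - D *R a0) \<bullet> F\<bar> <= D * eps * norm F" by (intro order_trans[OF Cauchy_Schwarz_ineq2] mult_right_mono) auto
 then have "D * (a0 \<bullet> F) - D * (eps * norm F) <= X \<bullet> F" by (simp add: inner_diff_left abs_le_iff)
 then have aF: "a0 \<bullet> F - eps * norm F <= (X \<bullet> F) / D" using D(1) by (simp only: pos_le_divide_eq) (simp add: algebra_simps)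
 define u where "u = (norm F)^2 / (2 * D) - (X \<bullet> F) / D"
 have u: "2 * D * u = (norm F)^2 - 2 * (X \<bullet> F)" using D(1) by (simp add: u_def right_diff_distrib)
 have "\<bar>X \<bullet> F\<bar> <= D * norm F" by (intro order_trans[OF Cauchy_Schwarz_ineq2] mult_right_mono X) auto
 moreover have "0 <= (D - norm F)^2" by simp
 then have "2 * (D * norm F) <= D * D + (norm F)^2" by (simp add: power2_eq_square algebra_simps)
 moreover have "2 * D * (D + u) = 2 * (D * D) + ((norm F)^2 - 2 * (X \<bullet> F))" by (simp add: distrib_left u)
 ultimately have "0 <= 2 * D * (D + u)" using zero_le_square[of D] unfolding abs_le_iff by linarith
 then have Du: "0 <= D + u" using D(1) by (simp add: zero_le_mult_iff)
 have "(norm (X - F))^2 <= D^2 + 2 * D * u"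
  using power_mono[OF X, of 2] by (simp add: u power2_norm_eq_inner inner_diff_left inner_diff_right inner_commute)
 also have "... <= (D + u)^2" by (simp add: power2_sum)
 finally have XF: "norm (X - F) <= D + u" using Du by (rule power2_le_imp_le)
 have "(norm F)^2 / (2 * D) <= (norm F)^2 / (2 * (t * om))" using D pos by (intro divide_left_mono) auto
 then have u': "u <= (norm F)^2 / (2 * (t * om)) - a0 \<bullet> F + eps * norm F" using aF by (simp add: u_def)
 have "(\<Sum>a\<in>I. c a *R q a) = (\<Sum>a\<in>J. c a *R q a) + (\<Sum>a\<in>I-J. c a *R q a)"
  using sum.subset_diff[OF J(1) I(1)] by (simp add: add.commute)
 then have "t *R (\<Sum>a\<in>I. c a *R q a) - F = t *R (\<Sum>a\<in>I-J. c a *R q a) + (X - F)" by (simp add: X_def scaleR_add_right)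
 then have "norm (t *R (\<Sum>a\<in>I. c a *R q a) - F) <= norm (t *R (\<Sum>a\<in>I-J. c a *R q a)) + norm (X - F)" using norm_triangle_ineq by metis
 moreover have "norm (t *R (\<Sum>a\<in>I-J. c a *R q a)) <= t * sum c (I - J)" using sub[of "I - J"] pos by simp
 moreover have "t * sum c I = t * sum c (I - J) + D" using sum.subset_diff[OF J(1) I(1), of c] by (simp add: D_def distrib_left)
 ultimately show ?thesis using XF u' by linarith
qed

text \<open>The field \<open>g\<close> is uniformly small, yet its derivative is, up to an error \<open>e\<close> with small
 integral, a nonnegative combination of normal projections; outside a set of small measure, planes
 close to the right one have total weight at least \<open>om\<close>. That \<open>om\<close> does not depend on \<open>eta\<close> is
 essential, since \<open>eta\<close> has to be small against \<open>om\<close>.\<close>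
definition averaged_normals :: "real => real => real => ((real^'n) \<times> (real^'n^'n)) set =>
  ((real^'n) \<times> (real^'n^'n) => real^'n => real) => (real^'n => real^'n) => (real^'n => real) =>
  ((real^'n) \<times> (real^'n^'n)) set => bool" where
 "averaged_normals eps om eta I c g e Bad \<longleftrightarrow> finite I & I <= plane_bundle &
  (ALL a:I. ALL y. 0 <= c a y) & g : C1c_fields UNIV & (ALL y. norm (g y) <= eta) &
  integrable (weight V) e & (LINT y|weight V. e y) <= eta &
  (ALL y. norm (jacobian g (at y) - (\<Sum>a\<in>I. c a y *R (mat 1 - snd a))) <= e y) &
  Bad : sets V & measure V Bad <= eps &
  (ALL z:plane_bundle - Bad. om <= (\<Sum>a\<in>I. indicator (cball (snd a) eps) (snd z) * c a (fst z)))"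

text \<open>At a common dyadic scale \<open>r\<close> the excess is small off a set of small measure. The good set is
 partitioned into small cells, and the fields of \<open>tangential_field\<close> at the cells are added with
 the measure of the cell over the local mass as weight. This normalisation keeps the sum as small
 as a single field, and the error is controlled by the excess.\<close>
lemma averaged_normal_field:
 assumes eps: "eps > 0"
 obtains om where "om > 0" "!!eta. eta > 0 ==> EX I c g e Bad. averaged_normals eps om eta I c g e Bad"
proof -
 interpret VM: finite_measure V by (rule finite_V)
 interpret W: finite_measure "weight V" by (rule finite_weight)
 have spV: "space V = plane_bundle" by (rule varifold_space[OF varif])
 define M where "M = measure V (space V)"
 have M: "M >= 0" by (simp add: M_def)
 have "grassmannian_hyper <= (\<Union>P\<in>grassmannian_hyper. ball P (eps / 4) :: (real^'n^'n) set)" using eps by auto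
 then obtain C where C: "finite C" "(grassmannian_hyper :: (real^'n^'n) set) <= (\<Union>P\<in>C. ball P (eps / 4))"
  using compactE_image[OF compact_grassmannian_hyper, of grassmannian_hyper "%P. ball P (eps / 4)"] by (metis open_ball)
 define A where "A = real (card C) * (40 ^ CARD('n) * M)"
 have A: "A >= 0" using M by (simp add: A_def)
 define om where "om = eps / (2 * (A + 1))"
 have om: "om > 0" using eps A by (simp add: om_def)
 have "A * om <= (A + 1) * om" using om by (intro mult_right_mono) auto
 also have "... = eps / 2"
 proof -
  have "A + 1 ~= 0" using A by simp
  then show ?thesis unfolding om_def by (simp del: distrib_left_numeral)
 qed
 finally have Aom: "A * om <= eps / 2" .
 have "ALL P. EX n. P : grassmannian_hyper --> norm n = 1 & mat 1 - P = tensor n n" for P :: "real^'n^'n" unfolding grassmannian_hyper_eq by auto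
 then obtain n :: "real^'n^'n => real^'n" where n: "!!P. P : grassmannian_hyper ==> norm (n P) = 1 & mat 1 - P = tensor (n P) (n P)" by metis
 show ?thesis
 proof (rule that[OF om])
  fix eta :: real assume eta: "eta > 0"
  define eta' where "eta' = eta / (M + 1)"
  have eta': "eta' > 0" "M * eta' <= eta" using eta M by (auto simp: eta'_def field_simps)
  define Far where "Far j = {z:space V. excess j z > eta' | norm (fst z) > real j}" for j
  have [measurable]: "(%z. excess j z) : borel_measurable V" "fst : borel_measurable V" for j
   using varifold_measurable[OF varif excess_measurable] fst_measurable by auto
  have Far: "Far j : sets V" for j unfolding Far_def by measurable
  have "(%j. LINT z|V. indicat_real (Far j) z) ----> (LINT z|V. 0)"
  proof (rule integral_dominated_convergence[where w="%_. 1"])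
   show "AE z in V. (%j. indicat_real (Far j) z) ----> 0" using AE_excess
   proof eventually_elim
    case (elim z)
    have "\<forall>\<^sub>F j in sequentially. excess j z < eta'" using elim eta'(1) by (rule order_tendstoD(2))
    moreover have "\<forall>\<^sub>F j in sequentially. norm (fst z) <= real j" using filterlim_real_sequentially unfolding filterlim_at_top by blast
    ultimately have "\<forall>\<^sub>F j in sequentially. indicat_real (Far j) z = 0" by eventually_elim (auto simp: Far_def indicator_def)
    then show ?case by (rule tendsto_eventually)
   qed
  qed (use Far in "auto simp: indicator_def")
  then have "(%j. measure V (Far j)) ----> 0" using Far by simp
  then have "\<forall>\<^sub>F j in sequentially. measure V (Far j) < eps / 2" using eps by (intro order_tendstoD) auto
  moreover have "(%j. 2 * (1/2) ^ j :: real) ----> 2 * 0" by (intro tendsto_intros LIMSEQ_power_zero) auto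
  then have "\<forall>\<^sub>F j in sequentially. 2 * (1/2) ^ j < eta" using eta by (intro order_tendstoD) auto
  ultimately have "\<forall>\<^sub>F j in sequentially. measure V (Far j) < eps / 2 & 2 * (1/2) ^ j < eta" by (rule eventually_conj)
  then obtain j where j: "measure V (Far j) < eps / 2" "2 * (1/2) ^ j < eta" by (auto simp: eventually_sequentially)
  define r :: real where "r = (1/2) ^ j"
  have r: "r > 0" by (simp add: r_def)
  define B where "B = plane_bundle \<inter> {z:space borel. excess j z <= eta' & norm (fst z) <= real j}"
  have [measurable]: "(fst :: (real^'n) \<times> (real^'n^'n) => _) : borel_measurable borel"
   by (intro borel_measurable_continuous_onI continuous_intros)
  have "{z:space borel. excess j z <= eta' & norm (fst z) <= real j} : sets borel" by measurable
  then have Bb: "B : sets borel" unfolding B_def by (intro sets.Int borel_closed[OF closed_bundle])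
  have BX: "B <= plane_bundle" by (auto simp: B_def)
  have "B <= cball 0 (real j) \<times> grassmannian_hyper" by (auto simp: B_def)
  then have Bbd: "bounded B" by (rule bounded_subset[rotated]) (intro bounded_Times bounded_cball compact_imp_bounded compact_grassmannian_hyper)
  have "min eps r / 4 > 0" using eps r by simp
  then obtain I S where I: "finite I" "I <= B" "disjoint_family_on S I" "(\<Union>a\<in>I. S a) = B"
   "!!a. a : I ==> S a : sets borel" "!!a z. a : I ==> z : S a ==> dist a z < min eps r / 4" using finite_borel_partition[OF Bbd Bb] by metis
  define mass where "mass a = (8 * r) ^ m * rescaled cutoff (8 * r) (fst a)" for a :: "(real^'n) \<times> (real^'n^'n)"
  have mass: "measure (weight V) (ball (fst a) (8 * r)) <= mass a" "mass a <= measure (weight V) (ball (fst a) (12 * r))" for a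
   using rescaled_cutoff_bounds[of "8 * r" "fst a"] r by (auto simp: mass_def)
  define v where "v a = measure V (S a) / mass a" for a
  have v: "v a >= 0" for a using mass(1)[of a] by (auto simp: v_def intro!: divide_nonneg_nonneg intro: order_trans[OF measure_nonneg])
  define c where "c a y = v a * cutoff ((y - fst a) /R r)" for a y
  define G where "G a y = (r * (((y - fst a) /R r) \<bullet> n (snd a)) * cutoff ((y - fst a) /R r)) *R n (snd a)" for a y
  define e where "e y = (\<Sum>a\<in>I. v a * tilt (snd a) ((y - fst a) /R r))" for y
  define g where "g y = (\<Sum>a\<in>I. v a *R G a y)" for y
  have IX: "I <= plane_bundle" using I(2) BX by blast
  have na: "norm (n (snd a)) = 1" "mat 1 - snd a = tensor (n (snd a)) (n (snd a))" if "a : I" for a using n[of "snd a"] IX that by auto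
  have gf: "G a : C1c_fields (ball (fst a) (2 * r))" "!!y. norm (G a y) <= 2 * r"
   "!!y. jacobian (G a) (at y) = tensor (n (snd a)) (cutoff ((y - fst a) /R r) *R n (snd a) +
     (((y - fst a) /R r) \<bullet> n (snd a)) *R cutoff_grad ((y - fst a) /R r))" if "a : I" for a
   unfolding G_def by (rule tangential_field[OF na(1)[OF that] r])+
  have ga: "(%y. v a *R G a y) : C1c_fields UNIV" if "a : I" for a by (rule C1c_fields_scale(1)) (use gf(1)[OF that] C1c_fields_mono in blast)
  have g1: "g : C1c_fields UNIV" unfolding g_def by (rule C1c_fields_sum(1)[OF I(1) ga])
  have SB: "S a : sets V" "S a <= plane_bundle" if "a : I" for a
  proof -
   show "S a <= plane_bundle" using I(4) BX that by blast
   then show "S a : sets V" by (intro sets_V I(5) that)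
  qed
  have sum_S: "(\<Sum>a\<in>J. measure V (S a)) <= measure (weight V) (ball x s)"
   if J: "J <= I" "!!a. a : J ==> dist x (fst a) + r / 4 <= s" for J x s
  proof -
   have "S ` J <= sets V" using J(1) SB by auto
   then have "(\<Sum>a\<in>J. measure V (S a)) = measure V (\<Union>a\<in>J. S a)"
    using finite_subset[OF J(1) I(1)] disjoint_family_on_mono[OF J(1) I(3)] by (subst VM.finite_measure_finite_Union) auto
   also have "... <= measure V (fst -` ball x s \<inter> space V)"
   proof (rule VM.finite_measure_mono)
    show "(\<Union>a\<in>J. S a) <= fst -` ball x s \<inter> space V"
    proof
     fix z assume "z : (\<Union>a\<in>J. S a)"
     then obtain a where a: "a : J" "z : S a" by blast
     then have "dist (fst a) (fst z) < r / 4" using I(6)[of a z] J(1) dist_fst_le[of a z] by fastforce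
     then have "dist x (fst z) < s" using J(2)[OF a(1)] dist_triangle[of x "fst z" "fst a"] by linarith
     then show "z : fst -` ball x s \<inter> space V" using SB(2)[of a] a J(1) by (auto simp: spV)
    qed
   qed (rule measurable_sets[OF fst_measurable], simp)
   also have "... = measure (weight V) (ball x s)" unfolding weight_def by (simp add: measure_distr[OF fst_measurable])
   finally show ?thesis .
  qed
  have g2: "norm (g y) <= eta" for y
  proof -
   define J where "J = {a:I. y : ball (fst a) (2 * r)}"
   have out: "G a y = 0" if "a : I - J" for a
   proof -
    have "a : I" "y ~: ball (fst a) (2 * r)" using that by (auto simp: J_def)
    then show ?thesis using C1c_fieldsD(4)[OF gf(1)[of a]] by (meson subsetD)
   qed
   have "g y = (\<Sum>a\<in>J. v a *R G a y)" unfolding g_def by (rule sum.mono_neutral_right[OF I(1)]) (use out in "auto simp: J_def")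
   also have "norm ... <= (\<Sum>a\<in>J. v a * (2 * r))" using gf(2) v by (intro sum_norm_le) (auto simp: J_def intro!: mult_left_mono)
   also have "... = (\<Sum>a\<in>J. v a) * (2 * r)" by (simp add: sum_distrib_right)
   also have "... <= 1 * (2 * r)"
   proof (rule mult_right_mono)
    define sg where "sg = (\<Sum>a\<in>J. measure V (S a))"
    have sg: "sg >= 0" by (auto simp: sg_def intro: sum_nonneg)
    have "v a <= measure V (S a) / sg" if "a : J" for a
    proof (cases "sg = 0")
     case True
     have "finite J" using I(1) by (simp add: J_def)
     then have "measure V (S a) = 0" using True that unfolding sg_def by (simp add: sum_nonneg_eq_0_iff)
     then show ?thesis by (simp add: v_def)
    next
     case False
     have "sg <= measure (weight V) (ball (fst a) (8 * r))" unfolding sg_def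
     proof (rule sum_S)
      show "dist (fst a) (fst b) + r / 4 <= 8 * r" if "b : J" for b
       using that \<open>a : J\<close> r dist_triangle[of "fst a" "fst b" y] by (auto simp: J_def dist_commute)
     qed (auto simp: J_def)
     then show ?thesis using False sg mass(1)[of a] unfolding v_def by (intro divide_left_mono mult_pos_pos) auto
    qed
    then have "(\<Sum>a\<in>J. v a) <= (\<Sum>a\<in>J. measure V (S a) / sg)" by (rule sum_mono)
    also have "... <= 1" by (simp add: sum_divide_distrib[symmetric] sg_def[symmetric])
    finally show "(\<Sum>a\<in>J. v a) <= 1" .
   qed (use r in simp)
   finally show ?thesis using j(2) by (simp add: r_def)
  qed
  have it: "integrable (weight V) (%y. tilt P ((y - x) /R r))" for P x
  proof -
   obtain b where "!!w. \<bar>tilt P w\<bar> <= b" using Cc_bounded[OF Cc_tilt] by (metis UNIV_I)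
   then show ?thesis by (intro W.integrable_const_bound[where B=b])
      (auto simp: measurable_cong_sets[OF sets_weight refl] intro!: borel_measurable_continuous_onI continuous_intros)
  qed
  have e1: "integrable (weight V) e" unfolding e_def by (intro Bochner_Integration.integrable_sum integrable_mult_right it)
  have e2: "(LINT y|weight V. e y) <= eta"
  proof -
   have "(LINT y|weight V. e y) = (\<Sum>a\<in>I. v a * (LINT y|weight V. tilt (snd a) ((y - fst a) /R r)))"
    unfolding e_def using it by (subst Bochner_Integration.integral_sum) auto
   also have "... <= (\<Sum>a\<in>I. measure V (S a) * eta')"
   proof (rule sum_mono)
    fix a assume a: "a : I"
    have "v a * (LINT y|weight V. tilt (snd a) ((y - fst a) /R r)) = measure V (S a) * (excess j a / 8 ^ m)"
     using r by (simp add: v_def mass_def excess_def rescaled_def[of "tilt (snd a)"] r_def power_mult_distrib)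
    also have "... <= measure V (S a) * (eta' / 1)" using a I(2) eta'(1) by (intro mult_left_mono frac_le) (auto simp: B_def)
    finally show "v a * (LINT y|weight V. tilt (snd a) ((y - fst a) /R r)) <= measure V (S a) * eta'" by simp
   qed
   also have "... <= M * eta'" unfolding sum_distrib_right[symmetric]
   proof (intro mult_right_mono)
    have "(\<Sum>a\<in>I. measure V (S a)) = measure V (\<Union>a\<in>I. S a)" using I(1,3) SB by (subst VM.finite_measure_finite_Union) auto
    then show "(\<Sum>a\<in>I. measure V (S a)) <= M" using VM.bounded_measure by (simp add: M_def)
   qed (use eta'(1) in simp)
   finally show ?thesis using eta'(2) by simp
  qed
  have e3: "norm (jacobian g (at y) - (\<Sum>a\<in>I. c a y *R (mat 1 - snd a))) <= e y" for y
  proof -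
   have "jacobian g (at y) = (\<Sum>a\<in>I. v a *R jacobian (G a) (at y))"
    unfolding g_def[abs_def] by (subst C1c_fields_sum(2)[OF I(1) ga], assumption)
     (intro sum.cong refl C1c_fields_scale(2)[OF gf(1)])
   then have "jacobian g (at y) - (\<Sum>a\<in>I. c a y *R (mat 1 - snd a)) =
     (\<Sum>a\<in>I. v a *R tensor (n (snd a)) ((((y - fst a) /R r) \<bullet> n (snd a)) *R cutoff_grad ((y - fst a) /R r)))"
    by (simp only: sum_subtractf[symmetric])
      (intro sum.cong refl, simp only: gf(3) na(2) c_def tensor_scale tensor_add scaleR_add_right scaleR_scaleR add_diff_cancel_left')
   also have "norm ... <= e y" unfolding e_def
   proof (rule sum_norm_le)
    fix a assume a: "a : I"
    show "norm (v a *R tensor (n (snd a)) ((((y - fst a) /R r) \<bullet> n (snd a)) *R cutoff_grad ((y - fst a) /R r)))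
     <= v a * tilt (snd a) ((y - fst a) /R r)"
     using v[of a] na[OF a] by (simp only: tilt_def tensor_mult norm_scaleR norm_tensor) (simp add: inner_commute)
   qed
   finally show ?thesis .
  qed
  define Z where "Z = {z:B. (\<Sum>a\<in>I. indicator (cball (snd a) eps) (snd z) * (v a * cutoff ((fst z - fst a) /R r))) < om}"
  have vm: "measure V (S a) <= v a * measure (weight V) (ball (fst a) (12 * r))" if "a : I" for a
  proof (cases "mass a = 0")
   case True
   then have "measure V (S a) <= 0" using sum_S[of "{a}" "fst a" "8 * r"] that r mass(1)[of a] by simp
   then show ?thesis using v[of a] by (auto intro: order_trans mult_nonneg_nonneg)
  next
   case False
   then have "measure V (S a) = v a * mass a" by (simp add: v_def)
   then show ?thesis using mass(2)[of a] v[of a] by (simp add: mult_left_mono)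
  qed
  have Z: "Z : sets borel" "measure V Z <= A * om"
   unfolding Z_def A_def M_def by (rule low_density_small[OF I(1,3,4,5,6) BX r v vm C om]; assumption)+
  have ZV: "Z : sets V" using BX by (intro sets_V Z(1)) (auto simp: Z_def)
  define Bad where "Bad = Far j \<union> Z"
  have "measure V Bad <= measure V (Far j) + measure V Z" unfolding Bad_def by (rule measure_Un_le[OF Far ZV])
  then have Bad: "measure V Bad <= eps" "Bad : sets V" using j(1) Z(2) Aom Far ZV by (auto simp: Bad_def)
  have "ALL z:plane_bundle - Bad. om <= (\<Sum>a\<in>I. indicator (cball (snd a) eps) (snd z) * c a (fst z))"
   by (auto simp: Bad_def Far_def Z_def B_def spV c_def not_less)
  moreover have "ALL a:I. ALL y. 0 <= c a y" unfolding c_def using v by (auto simp: cutoff_props)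
  ultimately show "EX I c g e Bad. averaged_normals eps om eta I c g e Bad" using I(1) IX g1 g2 e1 e2 e3 Bad unfolding averaged_normals_def by blast
 qed
qed

end

text \<open>Apply \<open>p\<close> to \<open>F - t DG\<close> with the averaged field \<open>G\<close>, where \<open>F = - Dg\<close>. Subadditivity separates
 \<open>p F\<close> from \<open>p (- DG)\<close>, which is controlled by \<open>bound\<close> as \<open>G\<close> is small; the lower bound of \<open>p\<close> by
 the norm and \<open>rank_one_perturbation\<close> leave the normal part of \<open>F\<close> as \<open>t\<close> tends to infinity.\<close>
theorem rectifiable_identification:
 fixes V :: "((real^'n) \<times> (real^'n^'n)) measure" and p :: "(real^'n => real^'n^'n) => real"
 assumes rect: "rectifiable_varifold V" and fin: "emeasure V (space V) < \<infinity>"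
  and sub: "!!F G. F : compactly_supported ==> G : compactly_supported ==> p (%x. F x + G x) <= p F + p G"
  and hom: "!!F c. F : compactly_supported ==> c > 0 ==> p (%x. c *R F x) <= c * p F"
  and le: "!!F. F : compactly_supported ==> p F <= (LINT x|weight V. norm (F x))"
  and bound: "!!g G. g : C1c_fields UNIV ==> (!!x. norm (g x) <= G) ==>
    (LINT x|weight V. mat 1 \<bullet> jacobian g (at x)) + p (%x. - jacobian g (at x)) <= C * G"
  and g: "g : C1c_fields UNIV"
 shows "first_variation V g <= (LINT x|weight V. mat 1 \<bullet> jacobian g (at x)) + p (%x. - jacobian g (at x))"
proof -
 obtain h T where ht: "tangent_representation V h T" using rectifiable_varifold_tangent_representation[OF rect fin] by blast
 interpret tangent_representation V h T "hausdorff_measure (CARD('n) - 1)" "CARD('n) - 1" by (rule ht) simp_all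
 interpret VM: finite_measure V by (rule finite_V)
 interpret W: finite_measure "weight V" by (rule finite_weight)
 let ?mu = "weight V" and ?io = "mat 1 :: real^'n^'n"
 have spV: "space V = UNIV \<times> grassmannian_hyper" by (rule varifold_space[OF varif])
 have cs: "(%x. jacobian f (at x)) : compactly_supported" if "f : C1c_fields UNIV" for f :: "real^'n => real^'n"
  using C1c_fieldsD(2,4)[OF that] unfolding compactly_supported_def by fast
 have cneg: "(%x. - f x) : compactly_supported" if "f : compactly_supported" for f :: "real^'n => real^'n^'n"
  by (rule compactly_supported_comp[OF that]) (auto intro: continuous_intros)
 have cscale: "(%x. t *R f x) : compactly_supported" if "f : compactly_supported" for t and f :: "real^'n => real^'n^'n"
  by (rule compactly_supported_comp[OF that]) (auto intro!: continuous_intros)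
 have int: "integrable ?mu f" if "f : compactly_supported" for f :: "real^'n => real^'n^'n"
  by (rule compactly_supported_integrable[OF that finite_weight sets_weight])
 have tr: "integrable V (%z. f (fst z))" "(LINT z|V. f (fst z)) = (LINT x|?mu. f x)" if "integrable ?mu f" for f :: "real^'n => real"
 proof -
  have f: "f : borel_measurable borel" using that by (simp add: measurable_cong_sets[OF sets_weight refl, symmetric])
  show "integrable V (%z. f (fst z))" using that unfolding weight_def integrable_distr_eq[OF fst_measurable f] .
  show "(LINT z|V. f (fst z)) = (LINT x|?mu. f x)" unfolding weight_def by (rule integral_distr[OF fst_measurable f, symmetric])
 qed
 define F where "F = (%x. - jacobian g (at x))"
 have F: "F : compactly_supported" unfolding F_def by (intro cneg cs g)
 have p0: "0 <= p (%x. 0)" using sub[of "%x. 0" "%x. 0"] cscale[OF F, of 0] by simp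
 have lower: "- (LINT x|?mu. norm (f x)) <= p f" if f: "f : compactly_supported" for f using sub[OF f cneg[OF f]] le[OF cneg[OF f]] p0 by simp
 have "0 <= C" using bound[OF C1c_fields_zero(1), of 1] p0 by (simp add: C1c_fields_zero(2))
 obtain b where b: "b > 0" "!!x. norm (F x) <= b" using compactly_supported_bounded[OF F] by blast
 have sndm: "snd : borel_measurable V" by (intro varifold_measurable[OF varif] borel_measurable_continuous_onI continuous_on_snd continuous_on_id)
 have Fm: "(%z. F (fst z)) : borel_measurable V" by (rule measurable_compose[OF fst_measurable compactly_supported_measurable[OF F]])
 have tilted: "\<bar>(?io - snd z) \<bullet> F (fst z)\<bar> <= norm (F (fst z))" if "z : space V" for z
  using Cauchy_Schwarz_ineq2[of "?io - snd z" "F (fst z)"] tilt_eq[of "snd z"] that by (auto simp: spV)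
 have iS: "integrable V (%z. (?io - snd z) \<bullet> F (fst z))"
 proof (rule VM.integrable_const_bound[where B=b])
  show "AE z in V. norm ((?io - snd z) \<bullet> F (fst z)) <= b" by (rule AE_I2) (use tilted b(2) in "auto intro: order_trans")
 qed (use sndm Fm in measurable)
 have key: "(LINT z|V. (?io - snd z) \<bullet> F (fst z)) <= p F"
 proof (rule field_le_epsilon)
  fix dl :: real assume dl: "dl > 0"
  define M where "M = measure V (space V)"
  have M: "M >= 0" by (simp add: M_def)
  define eps where "eps = dl / (3 * (b * M + 2 * b + 1))"
  have pos1: "b * M + 2 * b + 1 > 0" using b M by (intro add_nonneg_pos add_nonneg_nonneg mult_nonneg_nonneg) auto
  have third: "dl / (3 * x) * x = dl / 3" if "x > 0" for x using that by simp
  have eps: "eps > 0" "eps * (b * M + 2 * b + 1) = dl / 3" using dl pos1 unfolding eps_def third[OF pos1] by auto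
  obtain om where om: "om > 0" "!!eta. eta > 0 ==> EX I c g e Bad. averaged_normals eps om eta I c g e Bad"
   using averaged_normal_field[OF eps(1)] by blast
  \<comment> \<open>\<open>om\<close> fixes the large factor \<open>t\<close>, which in turn fixes the size \<open>eta\<close> of the field\<close>
  define t where "t = 3 * b^2 * (M + 1) / (2 * om * dl)"
  have t: "t > 0" using b(1) M om(1) dl by (simp add: t_def)
  have "b^2 / (2 * (t * om)) * M <= b^2 / (2 * (t * om)) * (M + 1)" using t om(1) by (intro mult_left_mono) auto
  also have "... = dl / 3"
  proof -
   define X where "X = b^2 * (M + 1)"
   have X: "X > 0" using b(1) M by (simp add: X_def)
   have "2 * (t * om) = 3 * X / dl" using om(1) dl by (simp add: t_def X_def field_simps)
   then have "b^2 / (2 * (t * om)) * (M + 1) = X / (3 * X / dl)" by (simp add: X_def)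
   then show ?thesis using X by simp
  qed
  finally have t2: "b^2 / (2 * (t * om)) * M <= dl / 3" .
  define kp where "kp = t * (1 + norm ?io + C)"
  have kp: "kp > 0" using t \<open>0 <= C\<close> by (auto simp: kp_def intro!: mult_pos_pos add_pos_nonneg)
  define eta where "eta = dl / (3 * kp)"
  have eta: "eta > 0" "kp * eta = dl / 3" using dl kp by (auto simp: eta_def)
  obtain I c G e Bad where field: "averaged_normals eps om eta I c G e Bad" using om(2)[OF eta(1)] by blast
  then have I: "finite I" "I <= UNIV \<times> grassmannian_hyper"
   and c: "!!a y. a : I ==> 0 <= c a y"
   and G: "G : C1c_fields UNIV" "!!y. norm (G y) <= eta"
   and e: "integrable ?mu e" "(LINT y|?mu. e y) <= eta"
    "!!y. norm (jacobian G (at y) - (\<Sum>a\<in>I. c a y *R (?io - snd a))) <= e y"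
   and Bad: "Bad : sets V" "measure V Bad <= eps"
    "!!z. z : UNIV \<times> grassmannian_hyper - Bad ==> om <= (\<Sum>a\<in>I. indicator (cball (snd a) eps) (snd z) * c a (fst z))"
   unfolding averaged_normals_def by (elim conjE; simp)+
  define D N where "D y = jacobian G (at y)" and "N y = (\<Sum>a\<in>I. c a y *R (?io - snd a))" for y
  have Dc: "D : compactly_supported" unfolding D_def[abs_def] by (rule cs[OF G(1)])
  have FD: "(%x. F x + t *R - D x) : compactly_supported"
   using compactly_supported_comp2[OF F cscale[OF cneg[OF Dc]], of "(+)"] by (simp add: case_prod_beta' continuous_on_add continuous_on_fst continuous_on_snd)
  have "p (%x. F x + t *R - D x) <= p F + t * p (%x. - D x)" using sub[OF F cscale[OF cneg[OF Dc], of t]] hom[OF cneg[OF Dc] t] by simp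
  moreover have "t * ((LINT x|?mu. ?io \<bullet> D x) + p (%x. - D x)) <= t * (C * eta)"
   using bound[OF G] t unfolding D_def by (intro mult_left_mono) auto
  ultimately have pF: "t * (LINT x|?mu. ?io \<bullet> D x) - (LINT x|?mu. norm (F x + t *R - D x)) - t * (C * eta) <= p F"
   using lower[OF FD] unfolding distrib_left by linarith
  have pw: "(?io - snd z) \<bullet> F (fst z) - (eps * b + b^2 / (2 * (t * om))) - 2 * b * indicator Bad z <=
    t * (?io \<bullet> D (fst z)) - norm (F (fst z) + t *R - D (fst z)) + t * (1 + norm ?io) * e (fst z)"
   if z: "z : space V" for z
  proof -
   let ?y = "fst z"
   let ?w = "\<Sum>a\<in>I. c a ?y"
   have q: "norm (?io - snd a) = 1" "?io \<bullet> (?io - snd a) = 1" if "a : I" for a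
   proof -
    have P: "snd a : grassmannian_hyper" using I(2) that by auto
    then show "norm (?io - snd a) = 1" by (rule tilt_eq)
    show "?io \<bullet> (?io - snd a) = 1" using P unfolding grassmannian_hyper_eq by (auto simp: mat_inner_tensor dot_square_norm)
   qed
   have "?io \<bullet> N ?y = ?w" by (simp add: N_def inner_sum_right q)
   moreover have "\<bar>?io \<bullet> (D ?y - N ?y)\<bar> <= norm ?io * e ?y"
    using e(3)[of ?y] by (intro order_trans[OF Cauchy_Schwarz_ineq2] mult_left_mono) (auto simp: D_def N_def)
   ultimately have "?w - norm ?io * e ?y <= ?io \<bullet> D ?y" unfolding inner_diff_right by linarith
   then have 1: "t * ?w - t * norm ?io * e ?y <= t * (?io \<bullet> D ?y)"
    using mult_left_mono[of _ _ t] t by (fastforce simp: right_diff_distrib mult.assoc)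
   have "F ?y + t *R - D ?y = - (t *R N ?y - F ?y) - t *R (D ?y - N ?y)" by (simp add: algebra_simps)
   then have "norm (F ?y + t *R - D ?y) <= norm (t *R N ?y - F ?y) + norm (t *R (D ?y - N ?y))" by (metis norm_minus_cancel norm_triangle_ineq4)
   also have "norm (t *R (D ?y - N ?y)) <= t * e ?y" using e(3)[of ?y] t by (simp add: D_def N_def)
   finally have 2: "norm (F ?y + t *R - D ?y) <= norm (t *R N ?y - F ?y) + t * e ?y" by simp
   have "norm (t *R N ?y - F ?y) <= t * ?w - (?io - snd z) \<bullet> F ?y + (eps * b + b^2 / (2 * (t * om))) + 2 * b * indicator Bad z"
   proof (cases "z : Bad")
    case False
    define J where "J = {a:I. snd z : cball (snd a) eps}"
    have "(\<Sum>a\<in>I. indicator (cball (snd a) eps) (snd z) * c a ?y) = (\<Sum>a\<in>J. c a ?y)"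
     unfolding J_def sum.inter_filter[OF I(1)] by (intro sum.cong) (auto simp: indicator_def)
    then have "om <= (\<Sum>a\<in>J. c a ?y)" using Bad(3)[of z] z False by (simp add: spV)
    moreover have "norm ((?io - snd a) - (?io - snd z)) <= eps" if "a : J" for a using that by (simp add: J_def dist_norm norm_minus_commute)
    ultimately have "norm (t *R N ?y - F ?y) <= t * ?w - (?io - snd z) \<bullet> F ?y + eps * norm (F ?y) + (norm (F ?y))^2 / (2 * (t * om))"
     unfolding N_def by (intro rank_one_perturbation[where J=J]) (use I(1) c q(1) om(1) t in "auto simp: J_def")
    moreover have "eps * norm (F ?y) + (norm (F ?y))^2 / (2 * (t * om)) <= eps * b + b^2 / (2 * (t * om))"
     using b eps(1) t om(1) by (intro add_mono mult_left_mono divide_right_mono power_mono) auto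
    ultimately show ?thesis using False by simp
   next
    case True
    have "norm (N ?y) <= ?w" unfolding N_def using c q(1) by (intro sum_norm_le) auto
    then have "norm (t *R N ?y) <= t * ?w" using t by simp
    moreover have "0 <= eps * b + b^2 / (2 * (t * om))" using b(1) eps(1) t om(1) by simp
    ultimately show ?thesis using True tilted[OF z] b(2)[of ?y] norm_triangle_ineq4[of "t *R N ?y" "F ?y"] by simp
   qed
   then show ?thesis using 1 2 by (simp add: algebra_simps)
  qed
  have i1: "integrable ?mu (%x. ?io \<bullet> D x)" using int[OF Dc] by simp
  have i2: "integrable ?mu (%x. norm (F x + t *R - D x))" using int[OF FD] by (rule integrable_norm)
  have iB: "integrable V (%z. 2 * b * indicator Bad z)" using Bad(1) by (simp add: VM.emeasure_eq_measure)
  have "(LINT z|V. (?io - snd z) \<bullet> F (fst z)) - ((eps * b + b^2 / (2 * (t * om))) * M + 2 * b * measure V Bad) =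
    (LINT z|V. (?io - snd z) \<bullet> F (fst z) - (eps * b + b^2 / (2 * (t * om))) - 2 * b * indicator Bad z)"
   using iS iB Bad(1) by (simp add: M_def mult.commute)
  also have "... <= (LINT z|V. t * (?io \<bullet> D (fst z)) - norm (F (fst z) + t *R - D (fst z)) + t * (1 + norm ?io) * e (fst z))"
   by (intro integral_mono pw) (use iS iB tr(1)[OF i1] tr(1)[OF i2] tr(1)[OF e(1)] in auto)
  also have "... = t * (LINT x|?mu. ?io \<bullet> D x) - (LINT x|?mu. norm (F x + t *R - D x)) + t * (1 + norm ?io) * (LINT x|?mu. e x)"
   using tr[OF i1] tr[OF i2] tr[OF e(1)] by simp
  also have "... <= p F + t * (C * eta) + t * (1 + norm ?io) * eta"
   using pF e(2) t by (intro add_mono mult_left_mono) (auto intro!: add_nonneg_nonneg mult_nonneg_nonneg)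
  also have "... = p F + kp * eta" by (simp add: kp_def algebra_simps)
  finally have "(LINT z|V. (?io - snd z) \<bullet> F (fst z)) <= p F + dl / 3 + ((eps * b + b^2 / (2 * (t * om))) * M + 2 * b * measure V Bad)"
   unfolding eta(2) by linarith
  moreover have "2 * b * measure V Bad <= 2 * b * eps" using Bad(2) b(1) by (intro mult_left_mono) auto
  moreover have "eps * b * M + 2 * b * eps <= dl / 3" using eps by (simp add: algebra_simps)
  ultimately show "(LINT z|V. (?io - snd z) \<bullet> F (fst z)) <= p F + dl" using t2 unfolding distrib_right by linarith
 qed
 have i: "integrable ?mu (%x. ?io \<bullet> jacobian g (at x))" using int[OF cs[OF g]] by simp
 have "first_variation V g = (LINT z|V. ?io \<bullet> jacobian g (at (fst z)) + (?io - snd z) \<bullet> F (fst z))"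
  unfolding first_variation_def F_def by (intro Bochner_Integration.integral_cong) (auto simp: inner_diff_left inner_commute)
 also have "... = (LINT x|?mu. ?io \<bullet> jacobian g (at x)) + (LINT z|V. (?io - snd z) \<bullet> F (fst z))" using tr[OF i] iS by simp
 finally show ?thesis using key unfolding F_def by simp
qed

section \<open>Partial derivatives and a defining function of the domain\<close>

definition smooth_in :: "'a::euclidean_space set => 'a set => ('a => real) => bool" where
 "smooth_in U S f \<longleftrightarrow> (ALL k. derivs_extend k U S f)"

definition pd :: "'a::euclidean_space => ('a => real) => 'a => real" where
 "pd b f x = frechet_derivative f (at x) b"

lemma smooth_inD:
 assumes "smooth_in U S f"
 shows "x : U ==> f differentiable (at x)"
  and "b : Basis ==> smooth_in U S (pd b f)"
  and "EX g. continuous_on S g & (ALL x:U. g x = f x)"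
proof -
 have 1: "derivs_extend (Suc k) U S f" for k using assms unfolding smooth_in_def by blast
 show "x : U ==> f differentiable (at x)" using 1[of 0] by simp
 show "b : Basis ==> smooth_in U S (pd b f)" using 1 unfolding smooth_in_def pd_def[abs_def] by simp
 show "EX g. continuous_on S g & (ALL x:U. g x = f x)" using 1[of 0] by simp
qed

lemma smooth_upto_in: "smooth_upto U S f ==> smooth_in U S f"
 unfolding smooth_upto_def smooth_in_def Ck_upto_def by blast

lemma smooth_in_continuous_on:
 assumes "smooth_in U S f" "U <= S"
 shows "continuous_on U f"
proof -
 obtain g where "continuous_on S g" "ALL x:U. g x = f x" using smooth_inD(3)[OF assms(1)] by blast
 then show ?thesis using assms(2) continuous_on_subset continuous_on_cong by (metis (mono_tags, lifting))
qed

lemma has_derivative_pd: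
 fixes f :: "'a::euclidean_space => real"
 assumes "f differentiable (at x)"
 shows "(f has_derivative (%h. \<Sum>b\<in>Basis. (h \<bullet> b) * pd b f x)) (at x)"
proof -
 have d: "(f has_derivative frechet_derivative f (at x)) (at x)" using assms frechet_derivative_works by blast
 have l: "linear (frechet_derivative f (at x))" using d by (rule has_derivative_linear)
 have "frechet_derivative f (at x) h = (\<Sum>b\<in>Basis. (h \<bullet> b) * pd b f x)" for h
 proof -
  have "frechet_derivative f (at x) (\<Sum>b\<in>Basis. (h \<bullet> b) *R b) = (\<Sum>b\<in>Basis. (h \<bullet> b) * pd b f x)"
   by (simp add: linear_sum[OF l] linear_scale[OF l] pd_def)
  then show ?thesis by (simp add: euclidean_representation)
 qed
 then have eq: "frechet_derivative f (at x) = (%h. \<Sum>b\<in>Basis. (h \<bullet> b) * pd b f x)" by (rule ext)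
 show ?thesis using d unfolding eq .
qed

lemma pd_eq: "(f has_derivative f') (at x) ==> pd b f x = f' b"
 unfolding pd_def using frechet_derivative_at by metis

lemma pd_has_real_derivative:
 fixes f :: "'a::euclidean_space => real"
 assumes "f differentiable (at (x + s *R b))"
 shows "((%s. f (x + s *R b)) has_real_derivative pd b f (x + s *R b)) (at s)"
proof -
 have "(f has_derivative frechet_derivative f (at (x + s *R b))) (at (x + s *R b))" using assms frechet_derivative_works by blast
 moreover have "((%s. x + s *R b) has_derivative (%t. t *R b)) (at s)" by (rule derivative_eq_intros refl | simp)+
 ultimately have "((%s. f (x + s *R b)) has_derivative (%t. frechet_derivative f (at (x + s *R b)) (t *R b))) (at s)"
  by (rule has_derivative_compose[rotated])
 moreover have "linear (frechet_derivative f (at (x + s *R b)))" using calculation(1) assms linear_frechet_derivative by blast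
 ultimately show ?thesis unfolding pd_def by (intro has_derivative_imp_has_field_derivative) (auto simp: linear_scale)
qed

lemma pd_local:
 assumes "open U" "x : U" "!!y. y : U ==> f y = g y"
 shows "pd b f x = pd b g x"
proof -
 have "(f has_derivative F) (at x) \<longleftrightarrow> (g has_derivative F) (at x)" for F
  using has_derivative_transform_within_open[OF _ assms(1,2)] assms(3) by metis
 then show ?thesis unfolding pd_def frechet_derivative_def by simp
qed

text \<open>The symmetric double difference of \<open>f\<close> along \<open>a\<close> and \<open>b\<close> equals, by two applications
 of the mean value theorem, either mixed partial derivative at nearby points.\<close>
lemma double_difference:
 fixes f :: "'a::euclidean_space => real"
 assumes s: "s > 0" and sub: "!!sg tau. 0 <= sg ==> sg <= s ==> 0 <= tau ==> tau <= s ==> x + sg *R a + tau *R b : U"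
  and d: "!!y. y : U ==> f differentiable (at y)" "!!y. y : U ==> pd a f differentiable (at y)"
 obtains sg tau where "0 < sg" "sg < s" "0 < tau" "tau < s"
  "f (x + s *R a + s *R b) - f (x + s *R a) - f (x + s *R b) + f x = s^2 * pd b (pd a f) (x + sg *R a + tau *R b)"
proof -
 have 1: "((%sg. f (x + sg *R a + s *R b) - f (x + sg *R a)) has_real_derivative
   pd a f (x + sg *R a + s *R b) - pd a f (x + sg *R a)) (at sg)" if "0 <= sg" "sg <= s" for sg
 proof -
  have "((%sg. f ((x + s *R b) + sg *R a)) has_real_derivative pd a f ((x + s *R b) + sg *R a)) (at sg)"
   using sub[OF that, of s] s by (intro pd_has_real_derivative d) (simp add: add_ac)
  moreover have "((%sg. f (x + sg *R a)) has_real_derivative pd a f (x + sg *R a)) (at sg)"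
   using sub[OF that, of 0] s by (intro pd_has_real_derivative d) simp
  ultimately show ?thesis by (auto simp: add_ac intro!: DERIV_diff)
 qed
 obtain sg where sg: "0 < sg" "sg < s"
  "(f (x + s *R a + s *R b) - f (x + s *R a)) - (f (x + 0 *R a + s *R b) - f (x + 0 *R a)) =
   (s - 0) * (pd a f (x + sg *R a + s *R b) - pd a f (x + sg *R a))" using MVT2[OF s 1] by auto
 have 2: "((%tau. pd a f ((x + sg *R a) + tau *R b)) has_real_derivative pd b (pd a f) ((x + sg *R a) + tau *R b)) (at tau)"
  if "0 <= tau" "tau <= s" for tau using sub[OF _ _ that] sg by (intro pd_has_real_derivative d) simp
 obtain tau where "0 < tau" "tau < s" "pd a f (x + sg *R a + s *R b) - pd a f (x + sg *R a + 0 *R b) =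
   (s - 0) * pd b (pd a f) (x + sg *R a + tau *R b)" using MVT2[OF s 2] by auto
 then show ?thesis using sg that[of sg tau] by (simp add: power2_eq_square algebra_simps)
qed

lemma pd_commute:
 fixes f :: "'a::euclidean_space => real"
 assumes "open U" "x : U" and d: "!!y. y : U ==> f differentiable (at y)"
  "!!y. y : U ==> pd a f differentiable (at y)" "!!y. y : U ==> pd b f differentiable (at y)"
  and c: "continuous_on U (pd b (pd a f))" "continuous_on U (pd a (pd b f))"
 shows "pd a (pd b f) x = pd b (pd a f) x"
proof -
 obtain e where e: "e > 0" "ball x e <= U" using assms(1,2) openE by blast
 define K where "K = norm a + norm b + 1"
 have K: "K > 0" by (simp add: K_def add_nonneg_pos)
 have close: "dist (x + sg *R a + tau *R b) x <= s * K" if "0 <= sg" "sg <= s" "0 <= tau" "tau <= s" for sg tau s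
 proof -
  have "dist (x + sg *R a + tau *R b) x = norm (sg *R a + tau *R b)" by (simp add: dist_norm)
  also have "... <= sg * norm a + tau * norm b" using norm_triangle_ineq[of "sg *R a" "tau *R b"] that by simp
  also have "... <= s * norm a + s * norm b" using that by (intro add_mono mult_right_mono) auto
  also have "... <= s * K" using that by (simp add: K_def algebra_simps)
  finally show ?thesis .
 qed
 have ex: "EX y z. dist y x <= s * K & dist z x <= s * K & pd b (pd a f) y = pd a (pd b f) z" if s: "0 < s" "s * K < e" for s
 proof -
  have sub: "x + sg *R a + tau *R b : U" "x + tau *R b + sg *R a : U" if "0 <= sg" "sg <= s" "0 <= tau" "tau <= s" for sg tau
   using close[OF that] s e by (auto simp: dist_commute add_ac subset_iff)
  obtain sg tau where 1: "0 < sg" "sg < s" "0 < tau" "tau < s"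
    "f (x + s *R a + s *R b) - f (x + s *R a) - f (x + s *R b) + f x = s^2 * pd b (pd a f) (x + sg *R a + tau *R b)"
   using double_difference[OF s(1) sub(1) d(1,2)] by blast
  obtain sg' tau' where 2: "0 < sg'" "sg' < s" "0 < tau'" "tau' < s"
    "f (x + s *R b + s *R a) - f (x + s *R b) - f (x + s *R a) + f x = s^2 * pd a (pd b f) (x + sg' *R b + tau' *R a)"
   using double_difference[where a=b and b=a and x=x and f=f and U=U, OF s(1) sub(2) d(1,3)] by blast
  have "s^2 * pd b (pd a f) (x + sg *R a + tau *R b) = s^2 * pd a (pd b f) (x + sg' *R b + tau' *R a)"
  proof -
   have "f (x + s *R b + s *R a) = f (x + s *R a + s *R b)" by (simp add: add_ac)
   then show ?thesis using 1(5) 2(5) by linarith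
  qed
  then have "pd b (pd a f) (x + sg *R a + tau *R b) = pd a (pd b f) (x + sg' *R b + tau' *R a)" using s by simp
  moreover have "dist (x + sg *R a + tau *R b) x <= s * K" "dist (x + sg' *R b + tau' *R a) x <= s * K"
   using close[of sg s tau] close[of tau' s sg'] 1 2 by (auto simp: add_ac)
  ultimately show ?thesis by blast
 qed
 show ?thesis
 proof (rule ccontr)
  assume ne: "pd a (pd b f) x ~= pd b (pd a f) x"
  define eta where "eta = \<bar>pd a (pd b f) x - pd b (pd a f) x\<bar> / 2"
  have eta: "eta > 0" using ne by (simp add: eta_def)
  have "isCont (pd b (pd a f)) x" "isCont (pd a (pd b f)) x" using c assms(1,2) continuous_on_eq_continuous_at by blast+
  then obtain d1 d2 where d12: "d1 > 0" "!!y. dist y x < d1 ==> dist (pd b (pd a f) y) (pd b (pd a f) x) < eta"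
    "d2 > 0" "!!y. dist y x < d2 ==> dist (pd a (pd b f) y) (pd a (pd b f) x) < eta" using eta unfolding continuous_at_eps_delta by (metis dist_norm)
  define s where "s = min e (min d1 d2) / (2 * K)"
  have s: "s > 0" "s * K = min e (min d1 d2) / 2" using e d12 K by (auto simp: s_def)
  have sK: "s * K < e" "s * K < d1" "s * K < d2" unfolding s(2) using e d12 by auto
  obtain y z where "dist y x <= s * K" "dist z x <= s * K" "pd b (pd a f) y = pd a (pd b f) z" using ex[OF s(1) sK(1)] by blast
  moreover have "dist (pd b (pd a f) y) (pd b (pd a f) x) < eta" "dist (pd a (pd b f) z) (pd a (pd b f) x) < eta"
   using calculation d12(2)[of y] d12(4)[of z] sK by linarith+
  ultimately show False unfolding eta_def dist_real_def by (smt (verit) field_sum_of_halves)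
 qed
qed

lemma smooth_in_pd_commute:
 assumes "open U" "U <= S" "smooth_in U S f" "a : Basis" "b : Basis" "x : U"
 shows "pd a (pd b f) x = pd b (pd a f) x"
 using assms by (intro pd_commute[OF assms(1,6)] smooth_in_continuous_on[of U S] smooth_inD(1)[of U S]) (auto intro: smooth_inD(2))

definition C2_on :: "(real^'n) set => (real^'n => real) => (real^'n => real^'n) => (real^'n => real^'n^'n) => bool" where
 "C2_on U f g A \<longleftrightarrow> (ALL x:U. (f has_derivative (%h. g x \<bullet> h)) (at x)) &
   (ALL x:U. (g has_derivative (%h. A x *v h)) (at x)) & continuous_on U A"

lemma C2_on_continuous: "C2_on U f g A ==> continuous_on U f"
 unfolding C2_on_def by (auto intro!: has_derivative_continuous_on intro: has_derivative_at_withinI)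

lemma grad_component: "grad f x \<bullet> h = (\<Sum>b\<in>Basis. (h \<bullet> b) * pd b f x)"
 unfolding grad_def pd_def inner_sum_left inner_scaleR_left by (intro sum.cong) (simp_all add: inner_commute mult.commute)

lemma has_derivative_grad:
 "f differentiable (at x) ==> (f has_derivative (%h. grad f x \<bullet> h)) (at x)" using has_derivative_pd[of f x] by (simp add: grad_component)

lemma grad_vec_nth: "grad f x $ i = pd (axis i 1) f x" for f :: "real^'n => real"
proof -
 have "grad f x $ i = grad f x \<bullet> axis i 1" by (simp add: cart_eq_inner_axis)
 also have "... = (\<Sum>b\<in>Basis. (axis i 1 \<bullet> b) * pd b f x)" by (rule grad_component)
 also have "... = (\<Sum>b\<in>Basis. if b = axis i 1 then pd b f x else 0)"
 proof (rule sum.cong)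
  have "axis i 1 : (Basis :: (real^'n) set)" by simp
  then show "(axis i 1 \<bullet> b) * pd b f x = (if b = axis i 1 then pd b f x else 0)" if "b : Basis" for b :: "real^'n"
   using that by (auto simp: inner_Basis)
 qed simp
 also have "... = pd (axis i 1) f x" by simp
 finally show ?thesis .
qed

lemma smooth_in_C2_on:
 fixes f :: "real^'n => real"
 assumes "open U" "smooth_in U U f"
 shows "C2_on U f (grad f) (%x. \<chi> i j. pd (axis j 1) (pd (axis i 1) f) x)" unfolding C2_on_def
proof (intro conjI ballI)
 fix x assume x: "x : U"
 show "(f has_derivative (%h. grad f x \<bullet> h)) (at x)" by (rule has_derivative_grad) (rule smooth_inD(1)[OF assms(2) x])
 have "(grad f has_derivative (%h. \<chi> i. grad (pd (axis i 1) f) x \<bullet> h)) (at x)"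
 proof (subst has_derivative_componentwise_within, rule ballI)
  fix b :: "real^'n" assume "b : Basis"
  then obtain i where b: "b = axis i 1" unfolding Basis_vec_def by auto
  have "pd (axis i 1) f differentiable (at x)" by (rule smooth_inD(1)[OF smooth_inD(2)[OF assms(2)] x]) simp
  from has_derivative_grad[OF this]
  show "((%x. grad f x \<bullet> b) has_derivative (%h. (\<chi> i. grad (pd (axis i 1) f) x \<bullet> h) \<bullet> b)) (at x)"
   unfolding b cart_eq_inner_axis[symmetric] grad_vec_nth by simp
 qed
 moreover have "(\<chi> i. grad (pd (axis i 1) f) x \<bullet> h) = (\<chi> i j. pd (axis j 1) (pd (axis i 1) f) x) *v h" for h
  by (simp add: matrix_vector_mult_def inner_vec_def grad_vec_nth)
 ultimately show "(grad f has_derivative (%h. (\<chi> i j. pd (axis j 1) (pd (axis i 1) f) x) *v h)) (at x)" by simp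
next
 show "continuous_on U (%x. \<chi> i j. pd (axis j 1) (pd (axis i 1) f) x)"
  by (intro continuous_intros smooth_in_continuous_on[of U U] smooth_inD(2) assms) auto
qed

lemma local_defining_zero:
 fixes rho :: "'a::euclidean_space => real"
 assumes "open Om" "open U" "p : frontier Om" "p : U" "Om \<inter> U = {x:U. rho x < 0}" "continuous_on U rho"
 shows "rho p = 0"
proof -
 have "p ~: Om" using assms(1,3) by (auto simp: frontier_def interior_open)
 then have "p ~: {x:U. rho x < 0}" using assms(5) by blast
 then have "rho p >= 0" using assms(4) by simp
 moreover have "~ rho p > 0"
 proof
  assume "rho p > 0"
  have "isCont rho p" using assms(2,4,6) continuous_on_eq_continuous_at by blast
  then have "\<forall>\<^sub>F x in at p. rho x > 0" using \<open>rho p > 0\<close> unfolding isCont_def by (rule order_tendstoD)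
  then obtain S where S: "open S" "p : S" "ALL x:S. x ~= p --> rho x > 0" unfolding eventually_at_topological by blast
  have "p : closure Om" using assms(3) by (simp add: frontier_def)
  then obtain y where "y : Om" "y : S \<inter> U" using S(1,2) assms(2,4) open_Int_closure_eq_empty[of "S \<inter> U" Om] by blast
  then have "y : {x:U. rho x < 0}" "y ~= p" using assms(5) \<open>p ~: Om\<close> by blast+
  then have "rho y < 0" "y ~= p" by simp_all
  then show False using S(3) \<open>y : S \<inter> U\<close> by force
 qed
 ultimately show ?thesis by linarith
qed

lemma derivative_sign:
 fixes f :: "'a::real_inner => real"
 assumes "(f has_derivative (%h. g \<bullet> h)) (at p)" "f p = 0" "g \<bullet> v < 0"
 shows "\<forall>\<^sub>F h in at_right 0. f (p + h *R v) < 0"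
proof -
 have "((%h. p + h *R v) has_derivative (%h. h *R v)) (at 0)" by (rule derivative_eq_intros refl | simp)+
 moreover have "(f has_derivative (%h. g \<bullet> h)) (at (p + 0 *R v))" using assms(1) by simp
 ultimately have "((%h. f (p + h *R v)) has_derivative (%h. g \<bullet> (h *R v))) (at 0)" by (rule has_derivative_compose)
 then have "((%h. f (p + h *R v)) has_real_derivative g \<bullet> v) (at 0)" by (rule has_derivative_imp_has_field_derivative) simp
 from DERIV_neg_dec_right[OF this assms(3)] obtain d where "d > 0" "ALL h>0. h < d --> f (p + h *R v) < 0" using assms(2) by auto
 then show ?thesis unfolding eventually_at_right_field by blast
qed

text \<open>Otherwise a direction, the difference of the unit gradients, makes one function negative and
 the other one positive.\<close>
lemma defining_gradients_parallel:
 fixes f1 f2 :: "'a::real_inner => real"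
 assumes "open U" "p : U" "(f1 has_derivative (%h. g1 \<bullet> h)) (at p)" "(f2 has_derivative (%h. g2 \<bullet> h)) (at p)"
  "f1 p = 0" "f2 p = 0" "!!x. x : U ==> f1 x < 0 \<longleftrightarrow> f2 x < 0" "g1 ~= 0" "g2 ~= 0"
 shows "EX c>0. g1 = c *R sgn g2"
proof -
 have key: "~ (g1 \<bullet> v < 0 & g2 \<bullet> v > 0)" for v
 proof
  assume v: "g1 \<bullet> v < 0 & g2 \<bullet> v > 0"
  have 1: "\<forall>\<^sub>F h in at_right 0. f1 (p + h *R v) < 0" by (rule derivative_sign) (use assms v in auto)
  have 2: "\<forall>\<^sub>F h in at_right 0. - f2 (p + h *R v) < 0"
  proof (rule derivative_sign[of "%x. - f2 x" "- g2"])
   show "((%x. - f2 x) has_derivative (%h. - g2 \<bullet> h)) (at p)" using has_derivative_minus[OF assms(4)] by simp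
  qed (use assms v in auto)
  have "((%h. p + h *R v) ---> p + 0 *R v) (at_right 0)" by (intro tendsto_intros)
  then have 3: "\<forall>\<^sub>F h in at_right 0. p + h *R v : U" using assms(1,2) topological_tendstoD by fastforce
  have "\<forall>\<^sub>F h::real in at_right 0. False" using 1 2 3 by eventually_elim (use assms(7) in fastforce)
  then show False by simp
 qed
 have n: "norm (sgn g1) = 1" "norm (sgn g2) = 1" "g1 = norm g1 *R sgn g1" "g2 = norm g2 *R sgn g2"
  using assms(8,9) by (auto simp: norm_sgn sgn_div_norm)
 have "sgn g1 = sgn g2"
 proof (rule ccontr)
  assume ne: "sgn g1 ~= sgn g2"
  have "0 < (norm (sgn g1 - sgn g2))^2" using ne by simp
  then have lt: "sgn g1 \<bullet> sgn g2 < 1" unfolding dist_norm[symmetric] dot_norm_neg[of "sgn g1" "sgn g2"] n(1,2) by (simp add: dist_norm)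
  have "sgn g1 \<bullet> (sgn g2 - sgn g1) < 0" "sgn g2 \<bullet> (sgn g2 - sgn g1) > 0"
   using lt n(1,2) by (simp_all add: inner_diff_right inner_commute dot_square_norm)
  then have "norm g1 * (sgn g1 \<bullet> (sgn g2 - sgn g1)) < 0" "norm g2 * (sgn g2 \<bullet> (sgn g2 - sgn g1)) > 0"
   using assms(8,9) by (simp_all add: mult_pos_neg)
  then show False using key[of "sgn g2 - sgn g1"] n(3,4) by (metis inner_scaleR_left)
 qed
 then show ?thesis using n(3) assms(8) by (intro exI[of _ "norm g1"]) auto
qed

lemma C2_on_bump:
 fixes p :: "real^'n" and r :: real
 defines "s \<equiv> %x. max 0 (r^2 - (x - p) \<bullet> (x - p))"
 shows "C2_on UNIV (%x. s x ^ 3) (%x. (- 6 * s x ^ 2) *R (x - p))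
  (%x. (24 * s x) *R tensor (x - p) (x - p) + (- 6 * s x ^ 2) *R mat 1)" unfolding C2_on_def
proof (intro conjI ballI)
 let ?t = "%x. r^2 - (x - p) \<bullet> (x - p)"
 have dt: "(?t has_derivative (%h. - 2 * ((x - p) \<bullet> h))) (at x)" for x by (rule derivative_eq_intros refl | simp add: inner_commute)+
 have a: "((%s. max 0 s ^ 2) has_real_derivative 2 * max 0 s) (at s)" for s :: real using DERIV_max_power[of 0 s] by (simp add: numeral_2_eq_2)
 have b: "((%s. max 0 s ^ 3) has_real_derivative 3 * max 0 s ^ 2) (at s)" for s :: real
  using DERIV_max_power[of 1 s] by (simp add: numeral_3_eq_3 numeral_2_eq_2)
 show "((%x. s x ^ 3) has_derivative (%h. ((- 6 * s x ^ 2) *R (x - p)) \<bullet> h)) (at x)" for x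
  using has_derivative_compose[OF dt b[unfolded has_field_derivative_def]] unfolding s_def by (simp add: mult_ac)
 have d2: "((%x. s x ^ 2) has_derivative (%h. - 4 * s x * ((x - p) \<bullet> h))) (at x)" for x
  using has_derivative_compose[OF dt a[unfolded has_field_derivative_def]] unfolding s_def by (simp add: mult_ac)
 show "((%x. (- 6 * s x ^ 2) *R (x - p)) has_derivative
   (%h. ((24 * s x) *R tensor (x - p) (x - p) + (- 6 * s x ^ 2) *R mat 1) *v h)) (at x)" for x
 proof -
  have "((%x. (- 6 * s x ^ 2) *R (x - p)) has_derivative
   (%h. (- 6 * s x ^ 2) *R h + (- 6 * (- 4 * s x * ((x - p) \<bullet> h))) *R (x - p))) (at x)" by (rule derivative_eq_intros d2 refl | simp)+
  moreover have "(%h. (- 6 * s x ^ 2) *R h + (- 6 * (- 4 * s x * ((x - p) \<bullet> h))) *R (x - p)) =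
   (%h. ((24 * s x) *R tensor (x - p) (x - p) + (- 6 * s x ^ 2) *R mat 1) *v h)"
   by (rule ext) (simp add: matrix_vector_mult_add_rdistrib tensor_mult scaleR_matrix_vector_assoc[symmetric] matrix_vector_mult_diff_rdistrib)
  ultimately show ?thesis by (simp only:)
 qed
 show "continuous_on UNIV (%x. (24 * s x) *R tensor (x - p) (x - p) + (- 6 * s x ^ 2) *R (mat 1 :: real^'n^'n))"
  unfolding s_def by (intro continuous_intros)
qed

lemma C2_on_mult:
 assumes "C2_on U f1 g1 A1" "C2_on U f2 g2 A2" "open U"
 shows "C2_on U (%x. f1 x * f2 x) (%x. f1 x *R g2 x + f2 x *R g1 x)
  (%x. f1 x *R A2 x + tensor (g2 x) (g1 x) + f2 x *R A1 x + tensor (g1 x) (g2 x))" unfolding C2_on_def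
proof (intro conjI ballI)
 fix x assume x: "x : U"
 note d = assms(1,2)[unfolded C2_on_def, THEN conjunct1, rule_format, OF x]
 note e = assms(1,2)[unfolded C2_on_def, THEN conjunct2, THEN conjunct1, rule_format, OF x]
 show "((%x. f1 x * f2 x) has_derivative (%h. (f1 x *R g2 x + f2 x *R g1 x) \<bullet> h)) (at x)"
  using has_derivative_mult[OF d] by (simp add: inner_add_left mult.commute)
 show "((%x. f1 x *R g2 x + f2 x *R g1 x) has_derivative
   (%h. (f1 x *R A2 x + tensor (g2 x) (g1 x) + f2 x *R A1 x + tensor (g1 x) (g2 x)) *v h)) (at x)"
  using has_derivative_add[OF has_derivative_scaleR[OF d(1) e(2)] has_derivative_scaleR[OF d(2) e(1)]]
  by (simp add: matrix_vector_mult_add_rdistrib tensor_mult scaleR_matrix_vector_assoc[symmetric] add.assoc)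
next
 have cf: "continuous_on U f1" "continuous_on U f2" "continuous_on U g1" "continuous_on U g2" using assms(1,2) unfolding C2_on_def
  by (auto intro!: has_derivative_continuous_on intro: has_derivative_at_withinI)
 have cA: "continuous_on U A1" "continuous_on U A2" using assms unfolding C2_on_def by auto
 show "continuous_on U (%x. f1 x *R A2 x + tensor (g2 x) (g1 x) + f2 x *R A1 x + tensor (g1 x) (g2 x))" by (intro continuous_intros cf cA)
qed

lemma C2_on_transform:
 assumes "C2_on U f g A" "open U" "!!x. x : U ==> f' x = f x & g' x = g x & A' x = A x"
 shows "C2_on U f' g' A'"
proof -
 have "(f' has_derivative (%h. g' x \<bullet> h)) (at x)" "(g' has_derivative (%h. A' x *v h)) (at x)" if x: "x : U" for x
  using assms x unfolding C2_on_def by (auto intro: has_derivative_transform_within_open[OF _ assms(2) x])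
 moreover have "continuous_on U A'" using assms(1,3) unfolding C2_on_def by (metis (no_types, lifting) continuous_on_cong)
 ultimately show ?thesis unfolding C2_on_def by blast
qed

lemma C2_on_const: "C2_on U (%x. c) (%x. 0) (%x. 0)"
proof -
 have "((%x. c) has_derivative (%h. (0 :: real^'n) \<bullet> h)) (at x)"
  "((%x. 0) has_derivative (%h. (0 :: real^'n^'n) *v h)) (at x)" for x :: "real^'n" by (rule has_derivative_eq_rhs[OF has_derivative_const], auto)+
 then show ?thesis unfolding C2_on_def by (blast intro: continuous_on_const)
qed

lemma C2_on_Un:
 assumes "C2_on U f g A" "C2_on V f g A" "open U" "open V"
 shows "C2_on (U \<union> V) f g A" using assms unfolding C2_on_def by (auto intro: continuous_on_open_Un)

lemma C2_on_sum:
 assumes "finite I" "!!i. i : I ==> C2_on U (f i) (g i) (A i)"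
 shows "C2_on U (%x. \<Sum>i\<in>I. f i x) (%x. \<Sum>i\<in>I. g i x) (%x. \<Sum>i\<in>I. A i x)" unfolding C2_on_def
proof (intro conjI ballI)
 fix x assume x: "x : U"
 show "((%x. \<Sum>i\<in>I. f i x) has_derivative (%h. (\<Sum>i\<in>I. g i x) \<bullet> h)) (at x)"
  unfolding inner_sum_left by (intro has_derivative_sum) (use assms x in "auto simp: C2_on_def")
 have "(\<Sum>i\<in>I. A i x) *v h = (\<Sum>i\<in>I. A i x *v h)" for h
  using assms(1) by (induction I rule: finite_induct) (auto simp: matrix_vector_mult_add_rdistrib)
 then show "((%x. \<Sum>i\<in>I. g i x) has_derivative (%h. (\<Sum>i\<in>I. A i x) *v h)) (at x)"
  by (simp only:) (intro has_derivative_sum, use assms x in \<open>auto simp: C2_on_def\<close>)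
next
 show "continuous_on U (%x. \<Sum>i\<in>I. A i x)" by (intro continuous_intros) (use assms in "auto simp: C2_on_def")
qed

text \<open>Local defining functions are multiplied by bump functions and added. All summands are
 nonpositive inside and nonnegative outside, and their gradients on the boundary are parallel, so
 nothing cancels; near an interior point the constant \<open>-1\<close> serves as defining function.\<close>
theorem global_defining_function:
 fixes Om :: "(real^'n) set"
 assumes dom: "bounded_smooth_domain Om"
 obtains rho g A K where "C2_on UNIV rho g A" "compact K" "!!x. x ~: K ==> rho x = 0" "Om = {x. rho x < 0}"
  "!!x. x : frontier Om ==> rho x = 0 & g x ~= 0"
  "!!x v. x : frontier Om ==> outer_unit_normal Om x v ==> EX c>0. g x = c *R v"
proof -
 have op: "open Om" and bd: "bounded Om" using dom unfolding bounded_smooth_domain_def by auto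
 define Q where "Q p U sg g A \<longleftrightarrow> open U & p : U & C2_on U sg g A & Om \<inter> U = {x:U. sg x < 0} & (ALL x:U \<inter> frontier Om. g x ~= 0)" for p U sg g A
 have loc: "EX U sg g A. Q p U sg g A"
  if p: "p : closure Om" for p
 proof (cases "p : Om")
  case True
  have "C2_on Om (%x. -1) (%x. 0) (%x. 0)" by (rule C2_on_const)
  moreover have "Om \<inter> frontier Om = {}" using op by (auto simp: frontier_def interior_open)
  ultimately have "Q p Om (%x. -1) (%x. 0) (%x. 0)" using True op unfolding Q_def by auto
  then show ?thesis by blast
 next
  case False
  then have "p : frontier Om" using p op by (simp add: frontier_def interior_open)
  then obtain sg where "local_defining_function Om p sg" using dom unfolding bounded_smooth_domain_def by blast
  then obtain U where U: "open U" "p : U" "smooth_upto U U sg" "ALL x:U. grad sg x ~= 0" "Om \<inter> U = {x:U. sg x < 0}"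
   unfolding local_defining_function_def by blast
  have "Q p U sg (grad sg) (%x. \<chi> i j. pd (axis j 1) (pd (axis i 1) sg) x)"
   unfolding Q_def using U smooth_in_C2_on[OF U(1) smooth_upto_in[OF U(3)]] by auto
  then show ?thesis by blast
 qed
 then obtain U sg gs As where QL: "!!p. p : closure Om ==> Q p (U p) (sg p) (gs p) (As p)" by metis
 have L: "open (U p)" "p : U p" "C2_on (U p) (sg p) (gs p) (As p)" "Om \<inter> U p = {x:U p. sg p x < 0}"
   "!!x. x : U p ==> x : frontier Om ==> gs p x ~= 0" "!!x. x : U p ==> sg p x < 0 \<longleftrightarrow> x : Om" if "p : closure Om" for p
  using QL[OF that] unfolding Q_def by blast+
 have "EX r>0. cball p r <= U p" if "p : closure Om" for p using L(1,2)[OF that] open_contains_cball by blast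
 then obtain r where r: "!!p. p : closure Om ==> r p > 0 & cball p (r p) <= U p" by metis
 have "compact (closure Om)" using bd by (simp add: compact_closure)
 moreover have "closure Om <= (\<Union>p\<in>closure Om. ball p (r p))" using r by force
 ultimately obtain P where P: "P <= closure Om" "finite P" "closure Om <= (\<Union>p\<in>P. ball p (r p))"
  using compactE_image[of "closure Om" "closure Om" "%p. ball p (r p)"] by auto
 define b where "b p x = max 0 ((r p)^2 - (x - p) \<bullet> (x - p)) ^ 3" for p x
 have b0: "b p x >= 0" for p x by (simp add: b_def)
 have bpos: "b p x > 0" if "x : ball p (r p)" for p x
 proof -
  have "norm (x - p) < r p" using that by (simp add: dist_norm norm_minus_commute)
  then have "(norm (x - p))^2 < (r p)^2" by (intro power_strict_mono) auto
  then show ?thesis by (simp add: b_def power2_norm_eq_inner)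
 qed
 have bzero: "b p x = 0 & max 0 ((r p)^2 - (x - p) \<bullet> (x - p)) = 0" if "x ~: cball p (r p)" "r p > 0" for p x
 proof -
  have "norm (x - p) > r p" using that by (simp add: dist_norm norm_minus_commute)
  then have "(norm (x - p))^2 > (r p)^2" using that by (intro power_strict_mono) auto
  then show ?thesis by (simp add: b_def power2_norm_eq_inner)
 qed
 define h where "h p x = (if x : U p then b p x * sg p x else 0)" for p x
 have "EX g A. C2_on UNIV (h p) g A & (ALL x:frontier Om. g x = (if x : U p then b p x *R gs p x else 0))"
  if p: "p : closure Om" for p
 proof -
  let ?b = "%x. max 0 ((r p)^2 - (x - p) \<bullet> (x - p))"
  let ?gb = "%x. (- 6 * ?b x ^ 2) *R (x - p)"
  let ?Ab = "%x. (24 * ?b x) *R tensor (x - p) (x - p) + (- 6 * ?b x ^ 2) *R mat 1"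
  define g where "g x = (if x : U p then b p x *R gs p x + sg p x *R ?gb x else 0)" for x
  define A where "A x = (if x : U p then b p x *R As p x + tensor (gs p x) (?gb x) + sg p x *R ?Ab x + tensor (?gb x) (gs p x) else 0)" for x
  have cb: "C2_on (U p) (b p) ?gb ?Ab" using C2_on_bump[of "r p" p] unfolding C2_on_def b_def by (auto intro: continuous_on_subset)
  have oU: "open (U p)" and cs: "C2_on (U p) (sg p) (gs p) (As p)" using L(1,3)[OF p] by auto
  have c1: "C2_on (U p) (h p) g A" by (rule C2_on_transform[OF C2_on_mult[OF cb cs oU] oU]) (auto simp: h_def g_def A_def)
  have o2: "open (- cball p (r p))" by (simp add: open_Compl)
  have c2: "C2_on (- cball p (r p)) (h p) g A"
  proof (rule C2_on_transform[OF C2_on_const[of _ 0] o2])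
   fix x assume "x : - cball p (r p)"
   then show "h p x = 0 & g x = 0 & A x = 0" using bzero[of x p] r[OF p] by (auto simp: h_def g_def A_def tensor_def vec_eq_iff)
  qed
  have "U p \<union> - cball p (r p) = UNIV" using r[OF p] by auto
  then have "C2_on UNIV (h p) g A" using C2_on_Un[OF c1 c2 oU o2] by simp
  moreover have "sg p x = 0" if "x : frontier Om" "x : U p" for x
  proof (rule local_defining_zero[OF op oU that])
   show "Om \<inter> U p = {x:U p. sg p x < 0}" by (rule L(4)[OF p])
   show "continuous_on (U p) (sg p)" by (rule C2_on_continuous[OF cs])
  qed
  ultimately show ?thesis by (intro exI[of _ g] exI[of _ A]) (auto simp: g_def)
 qed
 then obtain G AA where GA: "!!p. p : closure Om ==> C2_on UNIV (h p) (G p) (AA p) &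
   (ALL x:frontier Om. G p x = (if x : U p then b p x *R gs p x else 0))" by metis
 define rho where "rho x = (\<Sum>p\<in>P. h p x)" for x
 have C2: "C2_on UNIV rho (%x. \<Sum>p\<in>P. G p x) (%x. \<Sum>p\<in>P. AA p x)" unfolding rho_def by (rule C2_on_sum[OF P(2)]) (use GA P(1) in auto)
 have neg: "rho x < 0" if x: "x : Om" for x
 proof -
  obtain q where q: "q : P" "x : ball q (r q)" using P(3) x closure_subset by blast
  have qU: "x : U q" using q r[of q] P(1) ball_subset_cball[of q "r q"] by blast
  have le: "h p x <= 0" if "p : P" for p using L(6)[of p x] that P(1) x b0[of p x] by (auto simp: h_def intro!: mult_nonneg_nonpos)
  have "h q x < 0" using L(6)[of q x] q P(1) x bpos[OF q(2)] qU by (auto simp: h_def intro!: mult_pos_neg)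
  then show ?thesis unfolding rho_def using sum_nonpos[of "P - {q}"] le q P(2)
   by (subst sum.remove[OF P(2) q(1)]) (auto intro!: add_neg_nonpos sum_nonpos)
 qed
 have nonneg: "rho x >= 0" if "x ~: Om" for x unfolding rho_def
 proof (rule sum_nonneg)
  fix p assume "p : P"
  then have "x : U p ==> sg p x >= 0" using L(6)[of p x] P(1) that by force
  then show "0 <= h p x" using b0[of p x] by (simp add: h_def)
 qed
 have fr: "EX c>0. (\<Sum>p\<in>P. G p x) = c *R v" if x: "x : frontier Om" and v: "outer_unit_normal Om x v" for x v
 proof -
  obtain rho' U' where U': "open U'" "x : U'" "smooth_upto U' U' rho'" "ALL x:U'. grad rho' x ~= 0" "Om \<inter> U' = {x:U'. rho' x < 0}" "v = sgn (grad rho' x)"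
   using v unfolding outer_unit_normal_def local_defining_function_def by blast
  have C': "C2_on U' rho' (grad rho') (%x. \<chi> i j. pd (axis j 1) (pd (axis i 1) rho') x)"
   using smooth_in_C2_on[OF U'(1) smooth_upto_in[OF U'(3)]] .
  have z': "rho' x = 0" by (rule local_defining_zero[OF op U'(1) x U'(2,5)]) (use U'(3) in "auto simp: smooth_upto_def Ck_upto_def")
  have par: "EX c>0. gs p x = c *R v" if "p : P" "x : U p" for p
  proof -
   have Lp: "open (U p)" "C2_on (U p) (sg p) (gs p) (As p)" "Om \<inter> U p = {x:U p. sg p x < 0}" "gs p x ~= 0" using L[of p] that P(1) x by blast+
   show ?thesis unfolding U'(6)
   proof (rule defining_gradients_parallel[where U="U p \<inter> U'" and p=x])
    show "(sg p has_derivative (%h. gs p x \<bullet> h)) (at x)" using Lp(2) that unfolding C2_on_def by blast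
    show "(rho' has_derivative (%h. grad rho' x \<bullet> h)) (at x)" using C' U'(2) unfolding C2_on_def by blast
    show "sg p x = 0" by (rule local_defining_zero[OF op Lp(1) x that(2) Lp(3) C2_on_continuous[OF Lp(2)]])
    show "sg p y < 0 \<longleftrightarrow> rho' y < 0" if "y : U p \<inter> U'" for y using that Lp(3) U'(5) by auto
   qed (use Lp U' that z' in auto)
  qed
  have "EX c>=0. G p x = c *R v & (x : ball p (r p) --> c > 0)" if "p : P" for p
  proof (cases "x : U p")
   case True
   obtain c where c: "c > 0" "gs p x = c *R v" using par[OF \<open>p : P\<close> True] by blast
   have "G p x = (b p x * c) *R v" using GA[of p] that P(1) x True c by auto
   then show ?thesis using c b0[of p x] bpos[of x p] by (intro exI[of _ "b p x * c"]) auto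
  next
   case False
   moreover have p: "p : closure Om" using \<open>p : P\<close> P(1) by blast
   ultimately have "G p x = 0" using GA[OF p] x by auto
   moreover have "x ~: ball p (r p)" using r[OF p] ball_subset_cball[of p "r p"] False by blast
   ultimately show ?thesis by (intro exI[of _ 0]) auto
  qed
  then obtain c where c: "!!p. p : P ==> c p >= 0 & G p x = c p *R v & (x : ball p (r p) --> c p > 0)" by metis
  have "x : closure Om" using x by (simp add: frontier_def)
  then obtain q where q: "q : P" "x : ball q (r q)" using P(3) by blast
  have "(\<Sum>p\<in>P. c p) > 0" using c q P(2) by (intro sum_pos2[of _ q]) auto
  moreover have "(\<Sum>p\<in>P. G p x) = (\<Sum>p\<in>P. c p) *R v" using c by (simp add: scaleR_sum_left)
  ultimately show ?thesis by blast
 qed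
 have cont: "continuous_on UNIV rho" by (rule C2_on_continuous[OF C2])
 have eq: "Om = {x. rho x < 0}" using neg nonneg by (auto simp: not_less[symmetric])
 show ?thesis
 proof (rule that[OF C2 _ _ eq])
  show "compact (\<Union>p\<in>P. cball p (r p))" using P(2) by (intro compact_UN) auto
  show "rho x = 0" if "x ~: (\<Union>p\<in>P. cball p (r p))" for x
   unfolding rho_def using that bzero r P(1) by (intro sum.neutral) (auto simp: h_def)
  show "rho x = 0 & (\<Sum>p\<in>P. G p x) ~= 0" if x: "x : frontier Om" for x
  proof
   show "rho x = 0" by (rule local_defining_zero[OF op open_UNIV x]) (use eq cont in auto)
   obtain rho' where l: "local_defining_function Om x rho'" using dom x unfolding bounded_smooth_domain_def by blast
   then obtain c where c: "c > 0" "(\<Sum>p\<in>P. G p x) = c *R sgn (grad rho' x)" using fr[OF x] unfolding outer_unit_normal_def by blast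
   have "grad rho' x ~= 0" using l unfolding local_defining_function_def by blast
   then show "(\<Sum>p\<in>P. G p x) ~= 0" using c by (simp add: sgn_zero_iff)
  qed
 qed (rule fr)
qed

section \<open>Regularity of Allen-Cahn solutions\<close>

definition continuous_ext :: "'a::euclidean_space set => 'a set => ('a => real) => 'a => real" where
 "continuous_ext U S f = (SOME g. continuous_on S g & (ALL x:U. g x = f x))"

lemma continuous_ext:
 assumes "smooth_in U S f"
 shows "continuous_on S (continuous_ext U S f)" "x : U ==> continuous_ext U S f x = f x"
 using someI_ex[OF smooth_inD(3)[OF assms]] unfolding continuous_ext_def by auto

lemma pd_slice:
 fixes F :: "('a::euclidean_space \<times> real) => real"
 assumes "F differentiable (at (x, t))"
 shows "(%y. F (y, t)) differentiable (at x)" "pd b (%y. F (y, t)) x = pd (b, 0) F (x, t)"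
  "((%s. F (x, s)) has_real_derivative pd (0, 1) F (x, t)) (at t)"
proof -
 have d: "(F has_derivative frechet_derivative F (at (x, t))) (at (x, t))" using assms frechet_derivative_works by blast
 have l: "linear (frechet_derivative F (at (x, t)))" using d by (rule has_derivative_linear)
 have 1: "((%y. F (y, t)) has_derivative (%h. frechet_derivative F (at (x, t)) (h, 0))) (at x)"
 proof -
  have "((%y. (y, t)) has_derivative (%h. (h, 0))) (at x)" by (rule derivative_eq_intros refl | simp)+
  from has_derivative_compose[where g=F, OF this] d show ?thesis by simp
 qed
 then show "(%y. F (y, t)) differentiable (at x)" unfolding differentiable_def by blast
 show "pd b (%y. F (y, t)) x = pd (b, 0) F (x, t)" unfolding pd_eq[OF 1] by (simp add: pd_def)
 have "((%s. F (x, s)) has_derivative (%h. frechet_derivative F (at (x, t)) (0, h))) (at t)"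
 proof -
  have "((%s. (x, s)) has_derivative (%h. (0, h))) (at t)" by (rule derivative_eq_intros refl | simp)+
  from has_derivative_compose[where g=F, OF this] d show ?thesis by simp
 qed
 then show "((%s. F (x, s)) has_real_derivative pd (0, 1) F (x, t)) (at t)"
 proof (rule has_derivative_imp_has_field_derivative)
  fix h :: real
  have "frechet_derivative F (at (x, t)) (0, h) = frechet_derivative F (at (x, t)) (h *R (0, 1))" by simp
  then show "h * pd (0, 1) F (x, t) = frechet_derivative F (at (x, t)) (0, h)" unfolding pd_def by (simp only: linear_scale[OF l]) simp
 qed
qed

text \<open>The part of the regularity and of the equation that the estimates use. On the closed
 domain, \<open>p\<close> is the gradient, \<open>D\<close> the Hessian, \<open>ut\<close> the time derivative and \<open>pt\<close> its gradient,
 all extended continuously from the open domain; \<open>T i j\<close> is the \<open>j\<close>-th unmixed second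
 derivative of the \<open>i\<close>-th component of \<open>p\<close>.\<close>
locale neumann_solution =
 fixes Om :: "(real^'n) set" and rho :: "real^'n => real" and g :: "real^'n => real^'n" and A :: "real^'n => real^'n^'n"
  and W W' W'' :: "real => real" and eps :: real
  and u :: "real => real^'n => real" and p :: "real => real^'n => real^'n"
  and D :: "real => real^'n => real^'n^'n" and ut :: "real => real^'n => real"
  and pt :: "real => real^'n => real^'n" and T :: "real => real^'n => real^'n^'n"
 assumes open_dom: "open Om" and bounded_dom: "bounded Om"
  and C2_rho: "C2_on UNIV rho g A" and rho_support: "EX K. compact K & (ALL x. x ~: K --> rho x = 0)"
  and dom_eq: "Om = {x. rho x < 0}"
  and frontier_rho: "!!x. x : frontier Om ==> rho x = 0 & g x ~= 0"
  and W_deriv: "!!s. (W has_real_derivative W' s) (at s)" "!!s. (W' has_real_derivative W'' s) (at s)"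
  and W''_cont: "continuous_on UNIV W''" and eps_pos: "eps > 0"
  and u_cont: "continuous_on ({0..} \<times> closure Om) (%(t, x). u t x)"
  and p_cont: "continuous_on ({0..} \<times> closure Om) (%(t, x). p t x)"
  and u_p: "!!t x. t >= 0 ==> x : Om ==> (u t has_derivative (%h. p t x \<bullet> h)) (at x)"
  and neumann: "!!t x. t > 0 ==> x : frontier Om ==> p t x \<bullet> g x = 0"
  and D_cont: "continuous_on ({0<..} \<times> closure Om) (%(t, x). D t x)"
  and ut_cont: "continuous_on ({0<..} \<times> closure Om) (%(t, x). ut t x)"
  and pt_cont: "continuous_on ({0<..} \<times> closure Om) (%(t, x). pt t x)"
  and p_D: "!!t x. t > 0 ==> x : Om ==> (p t has_derivative (%h. D t x *v h)) (at x)"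
  and D_sym: "!!t x. t > 0 ==> x : Om ==> transpose (D t x) = D t x"
  and u_ut: "!!t x. t > 0 ==> x : Om ==> ((%s. u s x) has_real_derivative ut t x) (at t)"
  and p_pt: "!!t x. t > 0 ==> x : Om ==> ((%s. p s x) has_vector_derivative pt t x) (at t)"
  and ut_pt: "!!t x. t > 0 ==> x : Om ==> (ut t has_derivative (%h. pt t x \<bullet> h)) (at x)"
  and D_T: "!!t x i j. t > 0 ==> x : Om ==>
    ((%s. D t (x + s *R axis j 1) $ i $ j) has_real_derivative T t x $ i $ j) (at 0)"
  and equation: "!!t x. t > 0 ==> x : Om ==> ut t x = trace (D t x) - W' (u t x) / eps^2"
  and equation': "!!t x i. t > 0 ==> x : Om ==> (\<Sum>j\<in>UNIV. T t x $ i $ j) = pt t x $ i + W'' (u t x) / eps^2 * p t x $ i"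

lemma limpt_closure_open:
 fixes Om :: "'a::euclidean_space set"
 assumes "open Om" "x : closure Om"
 shows "at x within Om ~= bot"
proof (cases "x : Om")
 case True
 then show ?thesis by (simp add: at_within_open[OF _ assms(1)])
next
 case False
 then have "x islimpt Om" using assms(2) by (auto simp: closure_def)
 then show ?thesis by (simp add: trivial_limit_within)
qed

lemma grad_closure_C1:
 fixes f :: "real^'n => real"
 assumes op: "open Om" and C1: "Ck_upto 1 Om (closure Om) f"
 shows "continuous_on (closure Om) f" "continuous_on (closure Om) (grad_closure Om f)"
  "x : Om ==> grad_closure Om f x = grad f x" "x : Om ==> (f has_derivative (%h. grad f x \<bullet> h)) (at x)"
proof -
 have d: "!!x. x : Om ==> f differentiable (at x)"
  and e: "!!b. b : Basis ==> EX g. continuous_on (closure Om) g & (ALL x:Om. g x = frechet_derivative f (at x) b)"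
  using C1 unfolding Ck_upto_def by auto
 show "continuous_on (closure Om) f" using C1 unfolding Ck_upto_def by auto
 show "x : Om ==> (f has_derivative (%h. grad f x \<bullet> h)) (at x)" for x by (rule has_derivative_grad[OF d])
 obtain G where G: "!!b. b : Basis ==> continuous_on (closure Om) (G b) & (ALL x:Om. G b x = frechet_derivative f (at x) b)" using e by metis
 define P where "P x = (\<Sum>b\<in>Basis. G b x *R b)" for x
 have P: "continuous_on (closure Om) P" unfolding P_def by (intro continuous_intros) (use G in auto)
 have PO: "P x = grad f x" if "x : Om" for x unfolding P_def grad_def using G that by (intro sum.cong) auto
 have gc: "grad_closure Om f x = P x" if "x : closure Om" for x unfolding grad_closure_def
 proof (rule tendsto_Lim[OF limpt_closure_open[OF op that]])
  have "(P ---> P x) (at x within Om)" using P that closure_subset unfolding continuous_on_def by (blast intro: tendsto_within_subset)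
  then show "(grad f ---> P x) (at x within Om)" by (rule Lim_transform_eventually) (auto simp: eventually_at_filter PO)
 qed
 show "continuous_on (closure Om) (grad_closure Om f)" using P gc by (metis continuous_on_cong)
 show "x : Om ==> grad_closure Om f x = grad f x" using gc PO closure_subset by (metis subsetD)
qed

lemma uniform_limit_joint_continuous:
 fixes f :: "real => 'a::metric_space => 'b::metric_space"
 assumes "!!t. t : I ==> continuous_on S (f t)" "!!t. t : I ==> uniform_limit S f (f t) (at t within I)"
 shows "continuous_on (I \<times> S) (%(t, x). f t x)" unfolding continuous_on_iff
proof (clarsimp)
 fix t x and e :: real assume t: "t : I" "x : S" "e > 0"
 from uniform_limitD[OF assms(2)[OF t(1)], of "e/2"] t(3)
 obtain d1 where d1: "d1 > 0" "!!s y. s : I ==> s ~= t ==> dist s t < d1 ==> y : S ==> dist (f s y) (f t y) < e/2" unfolding eventually_at by auto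
 obtain d2 where d2: "d2 > 0" "!!y. y : S ==> dist y x < d2 ==> dist (f t y) (f t x) < e/2"
  using assms(1)[OF t(1)] t(2,3) unfolding continuous_on_iff by (metis half_gt_zero)
 show "EX d>0. ALL s:I. ALL y:S. dist (s, y) (t, x) < d --> dist (f s y) (f t x) < e"
 proof (intro exI[of _ "min d1 d2"] conjI ballI impI)
  fix s y assume s: "s : I" "y : S" "dist (s, y) (t, x) < min d1 d2"
  then have "dist s t < d1" "dist y x < d2" using dist_fst_le[of "(s, y)" "(t, x)"] dist_snd_le[of "(s, y)" "(t, x)"] by auto
  then have "dist (f s y) (f t y) < e/2" "dist (f t y) (f t x) < e/2" using d1(2)[of s y] d2(2)[of y] s t(3) by (cases "s = t"; auto)+
  then show "dist (f s y) (f t x) < e" using dist_triangle[of "f s y" "f t x" "f t y"] by linarith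
 qed (use d1 d2 in auto)
qed

theorem ac_solution_neumann_solution:
 fixes Om :: "(real^'n) set"
 assumes rho: "open Om" "bounded Om" "C2_on UNIV rho g A" "EX K. compact K & (ALL x. x ~: K --> rho x = 0)"
  "Om = {x. rho x < 0}" "!!x. x : frontier Om ==> rho x = 0 & g x ~= 0"
  and nu: "!!x. x : frontier Om ==> EX c>0. g x = c *R nu x"
  and W: "!!s. (W has_real_derivative W' s) (at s)" "!!s. (W' has_real_derivative W'' s) (at s)" "continuous_on UNIV W''"
  and eps: "eps > 0" and sol: "ac_solution W Om nu eps u\<^sub>0 u"
 obtains D ut pt T where "neumann_solution Om rho g A W W' W'' eps u (%t. grad_closure Om (u t)) D ut pt T"
proof -
 define U where "U = Om \<times> {0::real<..}"
 define S where "S = closure Om \<times> {0::real<..}"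
 define F where "F = (%(x, t). u t x)"
 define e where "e i = ((axis i 1 :: real^'n), 0::real)" for i
 define tau where "tau = ((0 :: real^'n), 1::real)"
 have U: "open U" "U <= S" unfolding U_def S_def using rho(1) closure_subset by (auto intro!: open_Times)
 have eB: "e i : Basis" "tau : Basis" for i unfolding e_def tau_def Basis_prod_def by auto
 have C1: "Ck_upto 1 Om (closure Om) (u t)" if "t >= 0" for t using sol that unfolding ac_solution_def continuous_into_C1_closure_def by blast
 have sF: "smooth_in U S F" using sol unfolding ac_solution_def U_def S_def F_def by (blast intro: smooth_upto_in)
 note sm = smooth_inD(2)[OF _ eB(1)] smooth_inD(2)[OF _ eB(2)]
 have dU: "f differentiable (at z)" if "smooth_in U S f" "z : U" for f z using smooth_inD(1)[OF that] .
 have comm: "pd a (pd b f) z = pd b (pd a f) z" if "smooth_in U S f" "a : Basis" "b : Basis" "z : U" for f a b z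
  using smooth_in_pd_commute[OF U that] .
 have UI: "(x, t) : U" if "x : Om" "t > 0" for x t using that by (auto simp: U_def)
 have Fu: "F (x, t) = u t x" for x t by (simp add: F_def)
 let ?E = "continuous_ext U S"
 define D where "D t x = (\<chi> i j. ?E (pd (e j) (pd (e i) F)) (x, t))" for t x
 define ut where "ut t x = ?E (pd tau F) (x, t)" for t x
 define pt where "pt t x = (\<chi> i. ?E (pd (e i) (pd tau F)) (x, t))" for t x
 define T where "T t x = (\<chi> i j. pd (e j) (pd (e j) (pd (e i) F)) (x, t))" for t x
 have swap: "continuous_on ({0<..} \<times> closure Om) (%(t, x). f (x, t))" if "continuous_on S f" for f :: "(real^'n) \<times> real => real"
  unfolding split_beta by (rule continuous_on_compose2[OF that]) (auto intro!: continuous_intros simp: S_def)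
 have Dx: "D t x $ i $ j = pd (e j) (pd (e i) F) (x, t)" if "x : Om" "t > 0" for t x i j
  unfolding D_def using continuous_ext(2)[OF sm(1)[OF sm(1)[OF sF]] UI[OF that]] by simp
 have utx: "ut t x = pd tau F (x, t)" if "x : Om" "t > 0" for t x unfolding ut_def using continuous_ext(2)[OF sm(2)[OF sF] UI[OF that]] by simp
 have ptx: "pt t x $ i = pd (e i) (pd tau F) (x, t)" if "x : Om" "t > 0" for t x i
  unfolding pt_def using continuous_ext(2)[OF sm(1)[OF sm(2)[OF sF]] UI[OF that]] by simp
 have px: "grad_closure Om (u t) x $ i = pd (e i) F (x, t)" if "x : Om" "t > 0" for t x i
 proof -
  have "grad_closure Om (u t) x = grad (u t) x" using grad_closure_C1(3)[OF rho(1) C1] that by simp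
  then show ?thesis using pd_slice(2)[OF dU[OF sF UI[OF that]], of "axis i 1"] by (simp add: grad_vec_nth e_def F_def)
 qed
 have vec_d: "(f has_derivative (%h. M *v h)) (at x)"
  if "!!i. ((%y. f y $ i) has_derivative (%h. (M *v h) $ i)) (at x)" for f :: "real^'n => real^'n" and M x
  unfolding has_derivative_componentwise_within[of f]
 proof (rule ballI)
  fix b :: "real^'n" assume "b : Basis"
  then obtain i where b: "b = axis i 1" unfolding Basis_vec_def by auto
  show "((%x. f x \<bullet> b) has_derivative (%x. (M *v x) \<bullet> b)) (at x)" using that[of i] unfolding b cart_eq_inner_axis[symmetric] .
 qed
 have slice: "((%y. f (y, t)) has_derivative (%h. \<Sum>i\<in>UNIV. pd (e i) f (x, t) * h $ i)) (at x)"
  if f: "smooth_in U S f" and x: "x : Om" "t > 0" for f x t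
 proof -
  have d: "(%y. f (y, t)) differentiable (at x)" using pd_slice(1)[OF dU[OF f UI[OF x]]] .
  have "grad (%y. f (y, t)) x \<bullet> h = (\<Sum>i\<in>UNIV. pd (e i) f (x, t) * h $ i)" for h
   by (simp add: inner_vec_def grad_vec_nth pd_slice(2)[OF dU[OF f UI[OF x]]] e_def)
  then show ?thesis using has_derivative_grad[OF d] by simp
 qed
 have loc: "(f' has_derivative G) (at x)" if "(f has_derivative G) (at x)" "x : Om" "!!y. y : Om ==> f y = f' y"
  for f f' :: "real^'n => real" and G x using has_derivative_transform_within_open[OF that(1) rho(1) that(2)] that(3) by simp
 have line: "((%s. f (x + s *R axis j 1, t)) has_real_derivative pd (e j) f (x, t)) (at 0)"
  if f: "smooth_in U S f" and x: "x : Om" "t > 0" for f x t j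
  using pd_has_real_derivative[of f "(x, t)" 0 "e j"] dU[OF f UI[OF x]] by (simp add: e_def)
 have near: "\<forall>\<^sub>F s in nhds 0. x + s *R (b :: real^'n) : Om" if "x : Om" for x b
 proof -
  have "((%s. x + s *R b) ---> x + 0 *R b) (nhds 0)" by (intro tendsto_intros filterlim_ident)
  then show ?thesis using topological_tendstoD[OF _ rho(1)] that by fastforce
 qed
 have pde: "pd tau F (x, t) = (\<Sum>j\<in>UNIV. pd (e j) (pd (e j) F) (x, t)) - W' (F (x, t)) / eps^2" if x: "x : Om" "t > 0" for x t
 proof -
  have dW: "deriv W s = W' s" for s using W(1) by (rule DERIV_imp_deriv)
  have "deriv (%s. u s x) t = pd tau F (x, t)" using pd_slice(3)[OF dU[OF sF UI[OF x]]] unfolding Fu tau_def by (rule DERIV_imp_deriv)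
  moreover have "laplacian (u t) x = (\<Sum>j\<in>UNIV. pd (e j) (pd (e j) F) (x, t))"
  proof -
   have "laplacian (u t) x = (\<Sum>b\<in>Basis. pd b (%y. pd b (u t) y) x)" by (simp add: laplacian_def pd_def)
   also have "... = (\<Sum>j\<in>UNIV. pd (axis j 1) (%y. pd (axis j 1) (u t) y) x)"
   proof -
    have B: "(Basis :: (real^'n) set) = range (%j. axis j 1)" by (auto simp: Basis_vec_def)
    have "inj (%j::'n. axis j (1::real))" by (auto simp: inj_on_def axis_eq_axis)
    then show ?thesis unfolding B by (simp add: sum.reindex)
   qed
   also have "... = (\<Sum>j\<in>UNIV. pd (e j) (pd (e j) F) (x, t))"
   proof (rule sum.cong[OF refl])
    fix j
    have "pd (axis j 1) (%y. pd (axis j 1) (u t) y) x = pd (axis j 1) (%y. pd (e j) F (y, t)) x"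
    proof (rule pd_local[OF rho(1) x(1)])
     fix y assume "y : Om"
     then show "pd (axis j 1) (u t) y = pd (e j) F (y, t)" using pd_slice(2)[OF dU[OF sF UI[OF _ x(2)]], of y "axis j 1"] by (simp add: e_def F_def)
    qed
    also have "... = pd (e j) (pd (e j) F) (x, t)" using pd_slice(2)[OF dU[OF sm(1)[OF sF] UI[OF x]]] by (simp add: e_def)
    finally show "pd (axis j 1) (%y. pd (axis j 1) (u t) y) x = pd (e j) (pd (e j) F) (x, t)" .
   qed
   finally show ?thesis .
  qed
  ultimately show ?thesis using sol x unfolding ac_solution_def Fu dW by simp
 qed
 have pde': "(\<Sum>j\<in>UNIV. pd (e j) (pd (e j) (pd (e i) F)) (x, t)) = pd (e i) (pd tau F) (x, t) + W'' (F (x, t)) / eps^2 * pd (e i) F (x, t)"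
  if x: "x : Om" "t > 0" for x t i
 proof -
  have 3: "pd (e i) (pd (e j) (pd (e j) F)) (x, t) = pd (e j) (pd (e j) (pd (e i) F)) (x, t)" for j
  proof -
   have "pd (e i) (pd (e j) (pd (e j) F)) (x, t) = pd (e j) (pd (e i) (pd (e j) F)) (x, t)" by (rule comm[OF sm(1)[OF sF] eB(1) eB(1) UI[OF x]])
   also have "... = pd (e j) (pd (e j) (pd (e i) F)) (x, t)" by (rule pd_local[OF U(1) UI[OF x]]) (rule comm[OF sF eB(1) eB(1)])
   finally show ?thesis .
  qed
  have "((%s. (\<Sum>j\<in>UNIV. pd (e j) (pd (e j) F) (x + s *R axis i 1, t)) - W' (F (x + s *R axis i 1, t)) / eps^2)
    has_real_derivative (\<Sum>j\<in>UNIV. pd (e i) (pd (e j) (pd (e j) F)) (x, t)) - W'' (F (x, t)) * pd (e i) F (x, t) / eps^2) (at 0)"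
  proof (intro DERIV_diff DERIV_sum DERIV_cdivide line sm(1) sF x)
   have "(W' has_real_derivative W'' (F (x, t))) (at (F (x + 0 *R axis i 1, t)))" using W(2) by simp
   from DERIV_chain2[OF this line[OF sF x]]
   show "((%s. W' (F (x + s *R axis i 1, t))) has_real_derivative W'' (F (x, t)) * pd (e i) F (x, t)) (at 0)" .
  qed
  then have "((%s. pd tau F (x + s *R axis i 1, t))
    has_real_derivative (\<Sum>j\<in>UNIV. pd (e i) (pd (e j) (pd (e j) F)) (x, t)) - W'' (F (x, t)) * pd (e i) F (x, t) / eps^2) (at 0)"
  proof (rule DERIV_cong_ev[THEN iffD1, OF refl _ refl, rotated])
   show "\<forall>\<^sub>F s in nhds 0. (\<Sum>j\<in>UNIV. pd (e j) (pd (e j) F) (x + s *R axis i 1, t)) - W' (F (x + s *R axis i 1, t)) / eps^2 = pd tau F (x + s *R axis i 1, t)"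
    using near[OF x(1), of "axis i 1"] by eventually_elim (simp add: pde x(2))
  qed
  then have "pd (e i) (pd tau F) (x, t) = (\<Sum>j\<in>UNIV. pd (e i) (pd (e j) (pd (e j) F)) (x, t)) - W'' (F (x, t)) * pd (e i) F (x, t) / eps^2"
   using DERIV_unique[OF line[OF sm(2)[OF sF] x]] by blast
  then show ?thesis unfolding 3 by simp
 qed
 have "neumann_solution Om rho g A W W' W'' eps u (%t. grad_closure Om (u t)) D ut pt T"
 proof
  show "continuous_on ({0..} \<times> closure Om) (%(t, x). u t x)" by (rule uniform_limit_joint_continuous)
    (use sol grad_closure_C1(1)[OF rho(1) C1] in "auto simp: ac_solution_def continuous_into_C1_closure_def")
  show "continuous_on ({0..} \<times> closure Om) (%(t, x). grad_closure Om (u t) x)" by (rule uniform_limit_joint_continuous)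
    (use sol grad_closure_C1(2)[OF rho(1) C1] in "auto simp: ac_solution_def continuous_into_C1_closure_def")
  show "continuous_on ({0<..} \<times> closure Om) (%(t, x). D t x)"
   unfolding D_def using swap[OF continuous_ext(1)[OF sm(1)[OF sm(1)[OF sF]]]] unfolding split_beta by (intro continuous_intros) simp
  show "continuous_on ({0<..} \<times> closure Om) (%(t, x). ut t x)" unfolding ut_def by (rule swap[OF continuous_ext(1)[OF sm(2)[OF sF]]])
  show "continuous_on ({0<..} \<times> closure Om) (%(t, x). pt t x)"
   unfolding pt_def using swap[OF continuous_ext(1)[OF sm(1)[OF sm(2)[OF sF]]]] unfolding split_beta by (intro continuous_intros) simp
  fix t :: real and x
  show "(u t has_derivative (%h. grad_closure Om (u t) x \<bullet> h)) (at x)" if "t >= 0" "x : Om"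
   using grad_closure_C1(3,4)[OF rho(1) C1[OF that(1)] that(2)] by simp
  show "grad_closure Om (u t) x \<bullet> g x = 0" if tx: "t > 0" "x : frontier Om"
  proof -
   obtain c where "g x = c *R nu x" using nu[OF tx(2)] by blast
   moreover have "grad_closure Om (u t) x \<bullet> nu x = 0" using sol tx unfolding ac_solution_def by blast
   ultimately show ?thesis by simp
  qed
  assume t: "t > 0" and x: "x : Om"
  show "(grad_closure Om (u t) has_derivative (%h. D t x *v h)) (at x)"
  proof (rule vec_d)
   fix i
   have "((%y. pd (e i) F (y, t)) has_derivative (%h. (D t x *v h) $ i)) (at x)"
    using slice[OF sm(1)[OF sF] x t] by (simp add: matrix_vector_mult_def Dx[OF x t])
   then show "((%y. grad_closure Om (u t) y $ i) has_derivative (%h. (D t x *v h) $ i)) (at x)" by (rule loc[OF _ x]) (simp add: px t)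
  qed
  show "transpose (D t x) = D t x" by (simp add: transpose_def vec_eq_iff Dx[OF x t]) (intro allI comm[OF sF eB(1) eB(1) UI[OF x t]])
  show "((%s. u s x) has_real_derivative ut t x) (at t)" using pd_slice(3)[OF dU[OF sF UI[OF x t]]] unfolding Fu utx[OF x t] tau_def .
  show "((%s. grad_closure Om (u s) x) has_vector_derivative pt t x) (at t)"
   unfolding has_vector_derivative_def has_derivative_componentwise_within[of "%s. grad_closure Om (u s) x"]
  proof (rule ballI)
   fix b :: "real^'n" assume "b : Basis"
   then obtain i where b: "b = axis i 1" unfolding Basis_vec_def by auto
   have "((%s. pd (e i) F (x, s)) has_real_derivative pd tau (pd (e i) F) (x, t)) (at t)"
    using pd_slice(3)[OF dU[OF sm(1)[OF sF] UI[OF x t]]] unfolding tau_def .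
   then have "((%s. pd (e i) F (x, s)) has_real_derivative pt t x $ i) (at t)" using comm[OF sF eB(2) eB(1) UI[OF x t]] by (simp add: ptx[OF x t])
   then have "((%s. grad_closure Om (u s) x $ i) has_real_derivative pt t x $ i) (at t)"
    by (rule has_field_derivative_transform_within_open[where S="{0<..}"]) (use t px[OF x] in auto)
   then show "((%s. grad_closure Om (u s) x \<bullet> b) has_derivative (%s. (s *R pt t x) \<bullet> b)) (at t)"
    unfolding b cart_eq_inner_axis[symmetric] has_field_derivative_def by (rule has_derivative_eq_rhs) (simp add: fun_eq_iff)
  qed
  show "(ut t has_derivative (%h. pt t x \<bullet> h)) (at x)"
  proof (rule loc[OF _ x])
   show "((%y. pd tau F (y, t)) has_derivative (%h. pt t x \<bullet> h)) (at x)"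
    using slice[OF sm(2)[OF sF] x t] by (simp add: inner_vec_def ptx[OF x t])
  qed (simp add: utx t)
  show "((%s. D t (x + s *R axis j 1) $ i $ j) has_real_derivative T t x $ i $ j) (at 0)" for i j
  proof (rule DERIV_cong_ev[THEN iffD1, OF refl _ refl])
   show "\<forall>\<^sub>F s in nhds 0. pd (e j) (pd (e i) F) (x + s *R axis j 1, t) = D t (x + s *R axis j 1) $ i $ j"
    using near[OF x, of "axis j 1"] by eventually_elim (simp add: Dx t)
   show "((%s. pd (e j) (pd (e i) F) (x + s *R axis j 1, t)) has_real_derivative T t x $ i $ j) (at 0)"
    using line[OF sm(1)[OF sm(1)[OF sF]] x t] by (simp add: T_def)
  qed
  show "ut t x = trace (D t x) - W' (u t x) / eps^2" using pde[OF x t] by (simp add: utx[OF x t] trace_def Dx[OF x t] Fu)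
  show "(\<Sum>j\<in>UNIV. T t x $ i $ j) = pt t x $ i + W'' (u t x) / eps^2 * grad_closure Om (u t) x $ i" for i
   using pde'[OF x t, of i] by (simp add: T_def ptx[OF x t] px[OF x t] Fu)
 qed (use rho W eps in auto)
 then show ?thesis by (rule that)
qed

section \<open>Maximum principles and the gradient bound\<close>

lemma second_derivative_at_max:
 fixes phi :: "real => real"
 assumes d: "\<forall>\<^sub>F s in nhds 0. (phi has_real_derivative phi' s) (at s)" and d2: "(phi' has_real_derivative c) (at 0)"
  and mx: "\<forall>\<^sub>F s in nhds 0. phi s <= phi 0"
 shows "phi' 0 = 0" "c <= 0"
proof -
 obtain e where e: "e > 0" "!!s. \<bar>s\<bar> < e ==> (phi has_real_derivative phi' s) (at s) & phi s <= phi 0"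
  using eventually_conj[OF d mx] unfolding eventually_nhds_metric dist_real_def by auto
 show z: "phi' 0 = 0" by (rule DERIV_local_max[of phi "phi' 0" 0 e]) (use e in auto)
 show "c <= 0"
 proof (rule ccontr)
  assume "~ c <= 0"
  then obtain d where d: "d > 0" "!!h. h > 0 ==> h < d ==> phi' h > 0" using DERIV_pos_inc_right[OF d2] z by auto
  define s where "s = min d e / 2"
  have s: "s > 0" "s < d" "s < e" using d e by (auto simp: s_def)
  obtain z where "0 < z" "z < s" "phi s - phi 0 = (s - 0) * phi' z" using MVT2[of 0 s phi phi'] s e(2) by auto
  then have "phi s > phi 0" using d(2)[of z] s by (metis diff_gt_0_iff_gt diff_zero less_trans mult_pos_pos)
  then show False using e(2)[of s] s by simp
 qed
qed

lemma time_derivative_at_max: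
 fixes phi :: "real => real"
 assumes "(phi has_real_derivative c) (at t)" "t > 0" "!!s. 0 <= s ==> s <= t ==> phi s <= phi t"
 shows "c >= 0"
proof (rule ccontr)
 assume "~ c >= 0"
 then obtain d where d: "d > 0" "!!h. h > 0 ==> h < d ==> phi t < phi (t - h)" using DERIV_neg_dec_left[OF assms(1)] by auto
 define h where "h = min d t / 2"
 have "0 < h" "h < d" "h <= t" unfolding h_def using assms(2) d(1) by linarith+
 then show False using d(2)[of h] assms(3)[of "t - h"] by simp
qed

text \<open>A positive maximum over the closed space-time cylinder up to time \<open>t\<close> is not at time zero.\<close>
lemma parabolic_max_principle:
 fixes Q :: "real => 'a::euclidean_space => real"
 assumes cont: "continuous_on ({0..} \<times> S) (%(t, x). Q t x)" and S: "compact S"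
  and init: "!!x. x : S ==> Q 0 x <= 0"
  and nomax: "!!t x. t > 0 ==> x : S ==> Q t x > 0 ==> (!!s y. 0 <= s ==> s <= t ==> y : S ==> Q s y <= Q t x) ==> False"
  and t: "t >= 0" and x: "x : S"
 shows "Q t x <= 0"
proof (rule ccontr)
 assume "~ Q t x <= 0"
 have "compact ({0..t} \<times> S)" "{0..t} \<times> S ~= {}" using S t x by (auto intro: compact_Times)
 moreover have "continuous_on ({0..t} \<times> S) (%(t, x). Q t x)" by (rule continuous_on_subset[OF cont]) auto
 ultimately obtain z where z: "z : {0..t} \<times> S" "ALL w:{0..t} \<times> S. (case w of (t, x) => Q t x) <= (case z of (t, x) => Q t x)"
  using continuous_attains_sup by blast
 obtain t0 x0 where tx: "z = (t0, x0)" by fastforce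
 have mx: "Q s y <= Q t0 x0" if "0 <= s" "s <= t" "y : S" for s y using z(2) that unfolding tx by auto
 have p: "Q t0 x0 > 0" using mx[of t x] t x \<open>~ Q t x <= 0\<close> by auto
 have t0: "0 <= t0" "t0 <= t" "x0 : S" using z(1) tx by auto
 then have "t0 ~= 0" using init[of x0] p by auto
 then show False using nomax[of t0 x0] t0 p mx by fastforce
qed

context neumann_solution begin

lemma rho_deriv: "(rho has_derivative (%h. g x \<bullet> h)) (at x)" "(g has_derivative (%h. A x *v h)) (at x)"
 and A_cont: "continuous_on UNIV A" using C2_rho unfolding C2_on_def by auto

lemma rho_cont: "continuous_on UNIV rho" and g_cont: "continuous_on UNIV g"
 by (auto intro!: has_derivative_continuous_on rho_deriv intro: has_derivative_at_withinI rho_deriv)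

lemma compact_closure_dom: "compact (closure Om)" using bounded_dom by (simp add: compact_closure)

lemma closure_cases: "x : closure Om \<longleftrightarrow> x : Om | x : frontier Om"
 using open_dom closure_subset[of Om] by (auto simp: frontier_def interior_open)

lemma dom_iff: "x : Om \<longleftrightarrow> rho x < 0" using dom_eq by blast

lemma rho_closure: "x : closure Om ==> rho x <= 0"
 using frontier_rho[of x] dom_iff[of x] closure_cases[of x] by auto

lemma closure_bounded:
 fixes f :: "real^'n => 'b::real_normed_vector"
 assumes "continuous_on (closure Om) f"
 obtains C where "C > 0" "!!x. x : closure Om ==> norm (f x) <= C"
proof -
 have "bounded (f ` closure Om)" using compact_continuous_image[OF assms compact_closure_dom] by (rule compact_imp_bounded)
 then show ?thesis using that unfolding bounded_pos by auto
qed

lemma slice_cont: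
 "continuous_on (I \<times> S) (%(t, x). f t x) ==> t : I ==> continuous_on S (f t)"
 for f :: "real => 'x::topological_space => 'y::topological_space"
 by (rule continuous_on_compose2[of "I \<times> S" "%(t, x). f t x" S "%x. (t, x)", simplified]) (auto intro!: continuous_intros)

lemma inward:
 assumes x0: "x0 : frontier Om"
 obtains e where "e > 0" "!!s. 0 < s ==> s < e ==> x0 - s *R g x0 : Om"
proof -
 have "g x0 \<bullet> (- g x0) < 0" using frontier_rho[OF x0] by simp
 from derivative_sign[OF rho_deriv(1) _ this] frontier_rho[OF x0]
 have "\<forall>\<^sub>F h in at_right 0. rho (x0 + h *R (- g x0)) < 0" by simp
 then show ?thesis using that dom_iff unfolding eventually_at_right_field by auto
qed

text \<open>The derivative at the boundary is only given by continuous extension, so the mean value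
 theorem is used along the inner normal.\<close>
lemma boundary_max:
 fixes Q :: "real^'n => real"
 assumes x0: "x0 : frontier Om" and Q: "continuous_on (closure Om) Q"
  and d: "!!x. x : Om ==> (Q has_derivative (%h. G x \<bullet> h)) (at x)" and G: "continuous_on (closure Om) G"
  and mx: "!!x. x : closure Om ==> Q x <= Q x0"
 shows "G x0 \<bullet> g x0 >= 0"
proof -
 obtain e where e: "e > 0" "!!s. 0 < s ==> s < e ==> x0 - s *R g x0 : Om" using inward[OF x0] by blast
 have x0c: "x0 : closure Om" using x0 closure_cases by blast
 have ex: "EX xi. 0 < xi & xi < s & G (x0 - xi *R g x0) \<bullet> g x0 >= 0" if s: "0 < s" "s < e" for s
 proof -
  let ?phi = "%s. Q (x0 - s *R g x0)"
  have inS: "x0 - sg *R g x0 : closure Om" if "0 <= sg" "sg <= s" for sg using that s e(2)[of sg] x0c closure_subset by (cases "sg = 0") auto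
  have "continuous_on {0..s} ?phi" by (rule continuous_on_compose2[OF Q]) (auto intro!: continuous_intros inS)
  moreover have "(?phi has_derivative (%t. G (x0 - sg *R g x0) \<bullet> (- t *R g x0))) (at sg)" if "0 < sg" "sg < s" for sg
  proof -
   have "((%s. x0 - s *R g x0) has_derivative (%t. - t *R g x0)) (at sg)" by (rule derivative_eq_intros refl | simp)+
   from has_derivative_compose[OF this d[OF e(2)]] that s show ?thesis by (auto intro: has_derivative_eq_rhs)
  qed
  ultimately obtain xi where xi: "0 < xi" "xi < s" "?phi s - ?phi 0 = G (x0 - xi *R g x0) \<bullet> (- (s - 0) *R g x0)"
   using mvt[OF s(1), of ?phi "%sg t. G (x0 - sg *R g x0) \<bullet> (- t *R g x0)"] by blast
  have "?phi s <= ?phi 0" using mx[OF inS[of s]] s by simp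
  then have "s * (G (x0 - xi *R g x0) \<bullet> g x0) >= 0" using xi(3) by simp
  then show ?thesis using xi s by (auto simp: zero_le_mult_iff)
 qed
 show ?thesis
 proof (rule ccontr)
  assume nt: "~ ?thesis"
  define eta where "eta = - (G x0 \<bullet> g x0)"
  have eta: "eta > 0" using nt by (simp add: eta_def)
  have "continuous_on (closure Om) (%x. G x \<bullet> g x0)" by (intro continuous_intros G)
  then obtain d where d: "d > 0" "!!x. x : closure Om ==> dist x x0 < d ==> dist (G x \<bullet> g x0) (G x0 \<bullet> g x0) < eta"
   using x0c eta unfolding continuous_on_iff by metis
  have ng: "norm (g x0) > 0" using frontier_rho[OF x0] by simp
  define s where "s = min e (d / norm (g x0)) / 2"
  have s: "s > 0" "s < e" "s * norm (g x0) < d" using e d ng by (auto simp: s_def field_simps min_def)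
  obtain xi where xi: "0 < xi" "xi < s" "G (x0 - xi *R g x0) \<bullet> g x0 >= 0" using ex[OF s(1,2)] by blast
  have "dist (x0 - xi *R g x0) x0 = xi * norm (g x0)" using xi by (simp add: dist_norm)
  also have "... < s * norm (g x0)" using xi ng by simp
  finally have "dist (x0 - xi *R g x0) x0 < d" using s by simp
  then have "dist (G (x0 - xi *R g x0) \<bullet> g x0) (G x0 \<bullet> g x0) < eta"
   using d(2)[of "x0 - xi *R g x0"] e(2)[of xi] xi s closure_subset[of Om] by auto
  then show False using xi(3) by (simp add: dist_real_def eta_def)
 qed
qed

text \<open>Along a direction tilted slightly inward, the function would grow linearly with the slope of
 the tangential derivative, while the distance to the boundary, and with it the function, is only
 linear with a slope proportional to the tilt.\<close>
lemma tangential_derivative_zero: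
 fixes F :: "real^'n => real"
 assumes x0: "x0 : frontier Om" and F: "continuous_on (closure Om) F" "!!x. x : frontier Om ==> F x = 0"
  and d: "!!x. x : Om ==> (F has_derivative (%h. G x \<bullet> h)) (at x)" and G: "continuous_on (closure Om) G"
  and tau: "tau \<bullet> g x0 = 0"
 shows "G x0 \<bullet> tau = 0"
proof -
 define n where "n = g x0"
 have n: "norm n > 0" "n \<bullet> n > 0" using frontier_rho[OF x0] by (auto simp: n_def)
 have x0c: "x0 : closure Om" using x0 closure_cases by blast
 obtain M where M: "M > 0" "!!x. x : closure Om ==> norm (G x) <= M" using closure_bounded[OF G] by blast
 have line: "((%s. x + s *R v) has_derivative (%t. t *R v)) (at s)" for x v :: "real^'n" and s by (rule derivative_eq_intros refl | simp)+
 have drho: "((%s. rho (x + s *R v)) has_real_derivative g (x + s *R v) \<bullet> v) (at s)" for x v s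
  using has_derivative_compose[OF line rho_deriv(1)] by (rule has_derivative_imp_has_field_derivative) simp
 have seg: "EX xi. 0 < xi & xi < h & F (x + h *R v) - F x = h * (G (x + xi *R v) \<bullet> v)"
  if h: "h > 0" and inO: "!!s. 0 < s ==> s < h ==> x + s *R v : Om" and cl: "x : closure Om" "x + h *R v : closure Om" for x v h
 proof -
  have "x + s *R v : closure Om" if "s : {0..h}" for s using inO[of s] cl that closure_subset[of Om] by (cases "s = 0"; cases "s = h") auto
  then have c: "continuous_on {0..h} (%s. F (x + s *R v))" by (intro continuous_on_compose2[OF F(1)]) (auto intro!: continuous_intros)
  obtain xi where "0 < xi" "xi < h" "F (x + h *R v) - F (x + 0 *R v) = G (x + xi *R v) \<bullet> ((h - 0) *R v)"
   by (rule mvt[OF h c has_derivative_compose[OF line d[OF inO]]]) (assumption)+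
  then show ?thesis by auto
 qed
 have le: "G x0 \<bullet> tau <= 0" if tau: "tau \<bullet> n = 0" for tau
 proof (rule ccontr)
  define c where "c = G x0 \<bullet> tau"
  assume "~ G x0 \<bullet> tau <= 0"
  then have c: "c > 0" by (simp add: c_def)
  define s where "s = c / (16 * M * norm n)"
  define w where "w = tau - s *R n"
  have s: "s > 0" "s * (M * norm n) = c / 16" using c M n by (auto simp: s_def)
  have "G x0 \<bullet> n <= M * norm n" using order_trans[OF norm_cauchy_schwarz mult_right_mono[OF M(2)[OF x0c] norm_ge_zero]] .
  then have "s * (G x0 \<bullet> n) <= c / 16" using mult_left_mono[of "G x0 \<bullet> n" "M * norm n" s] s by simp
  then have Gw: "G x0 \<bullet> w >= 15/16 * c" by (simp add: w_def inner_diff_right c_def)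
  have cont: "continuous_on (closure Om) (%y. G y \<bullet> w)" "continuous_on UNIV (%y. g y \<bullet> n)" by (intro continuous_intros G g_cont)+
  obtain r1 where r1: "r1 > 0" "!!y. y : closure Om ==> dist y x0 < r1 ==> \<bar>G y \<bullet> w - G x0 \<bullet> w\<bar> < c / 4"
   using cont(1)[unfolded continuous_on_iff, rule_format, OF x0c, of "c / 4"] c by (auto simp: dist_real_def)
  obtain r2 where r2: "r2 > 0" "!!y. dist y x0 < r2 ==> \<bar>g y \<bullet> n - n \<bullet> n\<bar> < (n \<bullet> n) / 2"
   using cont(2)[unfolded continuous_on_iff, rule_format, of x0 "(n \<bullet> n) / 2"] n by (auto simp: dist_real_def n_def)
  have "((%h. (rho (x0 + h *R w) - rho x0) / h) ---> - s * (n \<bullet> n)) (at 0)"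
   using drho[of x0 w 0] tau by (simp add: DERIV_def w_def n_def inner_diff_right inner_commute)
  moreover have "- s * (n \<bullet> n) < 0" "- 2 * s * (n \<bullet> n) < - s * (n \<bullet> n)" using s n by (auto simp: mult_pos_neg)
  ultimately have "\<forall>\<^sub>F h in at 0. (rho (x0 + h *R w) - rho x0) / h < 0 & - 2 * s * (n \<bullet> n) < (rho (x0 + h *R w) - rho x0) / h"
   by (intro eventually_conj order_tendstoD)
  then obtain h0 where h0: "h0 > 0" "!!h. 0 < h ==> h < h0 ==> rho (x0 + h *R w) < 0 & - 2 * s * (n \<bullet> n) * h < rho (x0 + h *R w)"
  proof -
   assume *: "!!h0. h0 > 0 ==> (!!h. 0 < h ==> h < h0 ==> rho (x0 + h *R w) < 0 & - 2 * s * (n \<bullet> n) * h < rho (x0 + h *R w)) ==> thesis"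
   assume "\<forall>\<^sub>F h in at 0. (rho (x0 + h *R w) - rho x0) / h < 0 & - 2 * s * (n \<bullet> n) < (rho (x0 + h *R w) - rho x0) / h"
   then obtain h0 where h0: "h0 > 0" "!!h. h ~= 0 ==> dist h 0 < h0 ==> rho (x0 + h *R w) / h < 0 & - 2 * s * (n \<bullet> n) < rho (x0 + h *R w) / h"
    using frontier_rho[OF x0] unfolding eventually_at by auto
   show thesis
   proof (rule *[OF h0(1)])
    fix h :: real assume "0 < h" "h < h0"
    then show "rho (x0 + h *R w) < 0 & - 2 * s * (n \<bullet> n) * h < rho (x0 + h *R w)"
     using h0(2)[of h] by (simp add: divide_less_0_iff pos_less_divide_eq)
   qed
  qed
  define B where "B = norm w + 4 * s * norm n"
  define h where "h = min (h0 / 2) (min r1 r2 / 2 / (B + 1))"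
  have B: "B >= 0" using s by (simp add: B_def)
  have h: "0 < h" "h < h0" "h * B < min r1 r2"
  proof -
   show "0 < h" "h < h0" using h0 r1 r2 B by (auto simp: h_def)
   have "h * (B + 1) <= min r1 r2 / 2 / (B + 1) * (B + 1)" using B by (intro mult_right_mono) (auto simp: h_def)
   also have "... = min r1 r2 / 2" by (subst times_divide_eq_left, rule nonzero_mult_div_cancel_right) (use B in simp)
   also have "... < min r1 r2" using r1 r2 by linarith
   finally show "h * B < min r1 r2" using \<open>0 < h\<close> by (simp add: distrib_left)
  qed
  define z where "z = x0 + h *R w"
  have near: "dist (x0 + a *R w + b *R n) x0 < min r1 r2" if "0 <= a" "a <= h" "0 <= b" "b <= 4 * s * h" for a b
  proof -
   have "dist (x0 + a *R w + b *R n) x0 <= a * norm w + b * norm n"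
    using that norm_triangle_ineq[of "a *R w" "b *R n"] by (simp add: dist_norm add.assoc)
   also have "... <= h * norm w + 4 * s * h * norm n" using that by (intro add_mono mult_right_mono) auto
   finally show ?thesis using h(3) by (simp add: B_def algebra_simps)
  qed
  have inO: "x0 + a *R w : Om" if "0 < a" "a <= h" for a using h0(2)[of a] that h dom_iff by simp
  have zO: "z : Om" using inO h by (simp add: z_def)
  have Fz: "F z > c / 2 * h"
  proof -
   obtain xi where xi: "0 < xi" "xi < h" "F z - F x0 = h * (G (x0 + xi *R w) \<bullet> w)"
    using seg[OF h(1), of x0 w] inO x0c zO closure_subset unfolding z_def by force
   have "\<bar>G (x0 + xi *R w) \<bullet> w - G x0 \<bullet> w\<bar> < c / 4"
    using r1(2)[of "x0 + xi *R w"] near[of xi 0] inO[of xi] xi s h(1) closure_subset[of Om] by auto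
   then have "c / 2 < G (x0 + xi *R w) \<bullet> w" using Gw c unfolding abs_less_iff by linarith
   then show ?thesis using xi(3) F(2)[OF x0] h(1) by (simp add: mult.commute)
  qed
  \<comment> \<open>from \<open>z\<close> the boundary is reached in the direction \<open>n\<close> within the length \<open>4 s h\<close>\<close>
  define T where "T = 4 * s * h"
  have T: "T > 0" using s h by (simp add: T_def)
  have gn: "g (z + t *R n) \<bullet> n > (n \<bullet> n) / 2" if "0 <= t" "t <= T" for t
  proof -
   have "\<bar>g (z + t *R n) \<bullet> n - n \<bullet> n\<bar> < (n \<bullet> n) / 2" using r2(2) near[of h t] that h by (simp add: T_def z_def)
   then show ?thesis unfolding abs_less_iff by linarith
  qed
  obtain zt where zt: "0 < zt" "zt < T" "rho (z + T *R n) - rho (z + 0 *R n) = (T - 0) * (g (z + zt *R n) \<bullet> n)" using MVT2[OF T drho] by blast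
  then have "rho (z + T *R n) = rho z + T * (g (z + zt *R n) \<bullet> n)" by simp
  moreover have "T * ((n \<bullet> n) / 2) <= T * (g (z + zt *R n) \<bullet> n)" using gn[of zt] zt T by (intro mult_left_mono) auto
  moreover have "T * ((n \<bullet> n) / 2) = 2 * s * (n \<bullet> n) * h" by (simp add: T_def)
  moreover have rhoz: "rho z < 0" "- 2 * s * (n \<bullet> n) * h < rho z" using h0(2)[OF h(1,2)] by (auto simp: z_def)
  ultimately have "0 <= rho (z + T *R n)" by linarith
  moreover have "continuous_on {0..T} (%t. rho (z + t *R n))" by (intro continuous_on_compose2[OF rho_cont] continuous_intros) auto
  ultimately obtain b where b: "0 <= b" "b <= T" "rho (z + b *R n) = 0" using IVT'[of "%t. rho (z + t *R n)" 0 0 T] T rhoz(1) by fastforce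
  have b0: "b > 0" using b rhoz(1) by (cases "b = 0") auto
  have bO: "z + t *R n : Om" if t: "0 <= t" "t < b" for t
  proof -
   have "rho (z + t *R n) < rho (z + b *R n)"
   proof (rule DERIV_pos_imp_increasing[OF t(2)])
    fix x assume "t <= x" "x <= b"
    then have "g (z + x *R n) \<bullet> n > 0" using gn[of x] n(2) t b by linarith
    then show "EX y. ((%t. rho (z + t *R n)) has_real_derivative y) (at x) & 0 < y" using drho by blast
   qed
   then show ?thesis using b dom_iff by simp
  qed
  have bc: "z + b *R n : closure Om"
  proof (rule Lim_in_closed_set[OF closed_closure])
   show "((%t. z + t *R n) ---> z + b *R n) (at_left b)" by (intro tendsto_intros)
   show "\<forall>\<^sub>F t in at_left b. z + t *R n : closure Om"
    using eventually_at_left_real[OF b0] by eventually_elim (use bO closure_subset in force)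
  qed simp
  then have "F (z + b *R n) = 0" using F(2) closure_cases dom_iff[of "z + b *R n"] b by auto
  then obtain xi where xi: "0 < xi" "xi < b" "- F z = b * (G (z + xi *R n) \<bullet> n)" using seg[OF b0 _ _ bc] bO zO closure_subset[of Om] by force
  have "- (G (z + xi *R n) \<bullet> n) <= M * norm n"
   using Cauchy_Schwarz_ineq2[of "G (z + xi *R n)" n] mult_right_mono[OF M(2)[of "z + xi *R n"] norm_ge_zero[of n]] bO[of xi] xi closure_subset[of Om]
   by (auto simp: abs_le_iff)
  then have "b * - (G (z + xi *R n) \<bullet> n) <= b * (M * norm n)" using b by (intro mult_left_mono) auto
  also have "... <= T * (M * norm n)" using b M n by (intro mult_right_mono) auto
  also have "... = 4 * h * (s * (M * norm n))" by (simp add: T_def)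
  also have "... = c / 4 * h" unfolding s(2) by simp
  finally have "F z <= c / 4 * h" using xi(3) by simp
  also have "... < c / 2 * h" using c h(1) by (intro mult_strict_right_mono) auto
  finally show False using Fz by simp
 qed
 show ?thesis using le[of tau] le[of "- tau"] tau by (simp add: n_def)
qed

text \<open>The Neumann condition \<open>g \<bullet> p = 0\<close> is differentiated along the boundary in the direction \<open>p\<close>,
 which is tangential by the same condition.\<close>
lemma boundary_hessian:
 assumes t: "t > 0" and x0: "x0 : frontier Om"
 shows "g x0 \<bullet> (D t x0 *v p t x0) = - (p t x0 \<bullet> (A x0 *v p t x0))"
proof -
 define G where "G x = g x v* D t x + p t x v* A x" for x
 have cD: "continuous_on (closure Om) (D t)" "continuous_on (closure Om) (p t)"
  using slice_cont[OF D_cont, of t] slice_cont[OF p_cont, of t] t by auto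
 have cg: "continuous_on (closure Om) g" "continuous_on (closure Om) A" using g_cont A_cont by (auto intro: continuous_on_subset)
 have "G x0 \<bullet> p t x0 = 0"
 proof (rule tangential_derivative_zero[OF x0, where F="%x. p t x \<bullet> g x"])
  show "continuous_on (closure Om) (%x. p t x \<bullet> g x)" by (intro continuous_intros cD cg)
  show "p t x \<bullet> g x = 0" if "x : frontier Om" for x by (rule neumann[OF t that])
  show "((%x. p t x \<bullet> g x) has_derivative (%h. G x \<bullet> h)) (at x)" if "x : Om" for x
   using has_derivative_inner[OF p_D[OF t that] rho_deriv(2)]
   by (rule has_derivative_eq_rhs) (simp add: G_def inner_add_left dot_lmul_matrix inner_commute[of _ "g x"] fun_eq_iff)
  show "continuous_on (closure Om) G" unfolding G_def vector_matrix_mult_def by (intro continuous_intros cD cg)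
  show "p t x0 \<bullet> g x0 = 0" by (rule neumann[OF t x0])
 qed
 moreover have "G x0 \<bullet> p t x0 = g x0 \<bullet> (D t x0 *v p t x0) + p t x0 \<bullet> (A x0 *v p t x0)"
  by (simp add: G_def inner_add_left dot_lmul_matrix)
 ultimately show ?thesis by simp
qed

lemma line_deriv:
 assumes "(f has_derivative (%h. a \<bullet> h)) (at (x + s *R axis j 1))"
 shows "((%s. f (x + s *R axis j 1)) has_real_derivative a $ j) (at s)"
proof -
 have "((%s. x + s *R axis j 1) has_derivative (%h. h *R axis j 1)) (at s)" by (rule derivative_eq_intros refl | simp)+
 from has_derivative_compose[OF this assms] show ?thesis by (rule has_derivative_imp_has_field_derivative) (simp add: cart_eq_inner_axis)
qed

lemma line_deriv_vec:
 fixes f :: "real^'n => real^'n"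
 assumes "(f has_derivative (%h. B *v h)) (at (x + s *R axis j 1))"
 shows "((%s. f (x + s *R axis j 1) $ i) has_real_derivative B $ i $ j) (at s)"
proof -
 have "((%s. x + s *R axis j 1) has_derivative (%h. h *R axis j 1)) (at s)" by (rule derivative_eq_intros refl | simp)+
 from has_derivative_compose[OF this assms]
 have "((%s. f (x + s *R axis j 1) $ i) has_derivative (%h. (B *v (h *R axis j 1)) $ i)) (at s)"
  by (rule bounded_linear.has_derivative[OF bounded_linear_vec_nth])
 then show ?thesis by (rule has_derivative_imp_has_field_derivative) (simp add: matrix_vector_mult_scaleR matrix_vector_mult_basis column_def)
qed

lemma eventually_line:
 assumes "x : Om"
 shows "\<forall>\<^sub>F s in nhds 0. x + s *R v : Om"
proof -
 have "((%s. x + s *R v) ---> x + 0 *R v) (nhds 0)" by (intro tendsto_intros filterlim_ident)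
 then show ?thesis using topological_tendstoD[OF _ open_dom] assms by fastforce
qed

text \<open>At a positive interior maximum of \<open>Q\<close>, the Bochner identity and \<open>G'' = - kp / 4\<close> leave the term
 \<open>kp / 4 \<bar>p\<bar>\<^sup>2\<close> with the good sign, which absorbs all errors of order \<open>a\<close> and \<open>eps\<close>; the sign of
 \<open>W'(s) (gm - s)\<close> makes the product of \<open>W'\<close> and \<open>G'\<close> harmless. At the boundary of a nonconvex domain
 the curvature has the wrong sign. The weight \<open>eta\<close>, which is one on the boundary and increases inwards
 with slope \<open>M\<close> times \<open>\<bar>g\<bar>\<close> while staying within \<open>1 + a\<close>, beats it.\<close>
lemma gradient_bound:
 fixes kp a M CW c0 Crho CA Ct gm :: real
 assumes kp: "0 < kp" "kp <= 1" and a: "0 < a" "a <= 1" and M: "M > 0" and c0: "c0 > 0" and CW: "CW >= 0"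
  and W_bounds: "!!s. \<bar>s\<bar> <= 1 ==> 0 <= W s & W s <= CW & \<bar>W' s\<bar> <= CW & \<bar>W'' s\<bar> <= CW"
  and gm: "-1 < gm" "gm < 1" and W_sign: "!!s. \<bar>s\<bar> <= 1 ==> W' s * (gm - s) >= 0"
  and geo: "!!x. x : closure Om ==> norm (g x) <= Crho & \<bar>trace (A x)\<bar> <= Ct & (ALL v. norm (A x *v v) <= CA * norm v)"
  and geo0: "!!x. x : frontier Om ==> norm (g x) >= c0" and Mc: "M * c0^2 > 2 * CA"
  and small_a: "a * CW <= kp / 4"
  and small: "2 * a * (CW + 1) * CW / kp + 6 * (CW + 1) * (M * Crho) * eps / kp + a * CW +
    eps^2 * ((M * Ct + M^2 / a * Crho^2) / 2 + (M * Crho)^2) < kp / 4"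
  and u_le: "!!t x. t >= 0 ==> x : closure Om ==> \<bar>u t x\<bar> <= 1"
  and init: "!!x. x : closure Om ==> eps^2 * (norm (p 0 x))^2 / 2 <= W (u 0 x) + kp / 8"
  and t: "t >= 0" and x: "x : closure Om"
 shows "eps^2 * (norm (p t x))^2 / 2 <= W (u t x) + kp"
proof -
 define E where "E x = exp (M * rho x / a)" for x
 define eta where "eta x = 1 + a - a * E x" for x
 define deta where "deta x = (- M * E x) *R g x" for x
 define G where "G s = kp * (1 - (s - gm)^2 / 8)" for s
 define G' where "G' s = - kp * (s - gm) / 4" for s
 define Q where "Q t x = eps^2 / 2 * eta x * (p t x \<bullet> p t x) - W (u t x) - G (u t x)" for t x
 have E: "0 < E x" "x : closure Om ==> E x <= 1" "x : frontier Om ==> E x = 1" for x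
  using rho_closure[of x] frontier_rho[of x] M a by (auto simp: E_def mult_nonneg_nonpos divide_nonpos_pos)
 have eta: "1 <= eta x" "eta x <= 1 + a" if "x : closure Om" for x
 proof -
  have "a * E x <= a * 1" using E(2)[OF that] a by (intro mult_left_mono) auto
  then show "1 <= eta x" by (simp add: eta_def)
  show "eta x <= 1 + a" using E(1)[of x] a by (simp add: eta_def)
 qed
 have eta_deriv: "(eta has_derivative (%h. deta x \<bullet> h)) (at x)" for x unfolding eta_def E_def deta_def using a
  by (auto intro!: derivative_eq_intros rho_deriv(1))
 have deta_le: "norm (deta x) <= M * Crho" if "x : closure Om" for x
 proof -
  have "E x * norm (g x) <= 1 * Crho" using E[of x] geo[OF that] that by (intro mult_mono) auto
  then show ?thesis using E(1)[of x] M by (simp add: deta_def abs_mult mult.assoc)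
 qed
 have G_bounds: "kp / 2 <= G s" "G s <= kp" "\<bar>G' s\<bar> <= 1" if "\<bar>s\<bar> <= 1" for s
 proof -
  have s2: "\<bar>s - gm\<bar> <= 2" using that gm by (simp add: abs_le_iff)
  then have "\<bar>s - gm\<bar>^2 <= 2^2" by (intro power_mono) auto
  then have sq: "(s - gm)^2 <= 4" by simp
  have "kp * (1 / 2) <= kp * (1 - (s - gm)^2 / 8)" using sq kp by (intro mult_left_mono) auto
  then show "kp / 2 <= G s" by (simp add: G_def)
  have "kp * (1 - (s - gm)^2 / 8) <= kp * 1" using kp by (intro mult_left_mono) auto
  then show "G s <= kp" by (simp add: G_def)
  have "kp * \<bar>s - gm\<bar> <= 1 * 2" using s2 kp by (intro mult_mono) auto
  then show "\<bar>G' s\<bar> <= 1" using kp by (simp add: G'_def abs_mult)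
 qed
 have G_deriv: "(G has_real_derivative G' s) (at s)" for s unfolding G_def[abs_def] G'_def by (rule derivative_eq_intros refl | simp)+
 have G'_deriv: "(G' has_real_derivative - kp / 4) (at s)" for s unfolding G'_def[abs_def] by (rule derivative_eq_intros refl | simp)+
 have G_cont: "continuous_on S (%x. G (f x))" if "continuous_on S f" for S and f :: "'z::topological_space => real"
  unfolding G_def by (intro continuous_intros that) auto
 have W_cont: "continuous_on S (%x. W (f x))" if "continuous_on S f" for S and f :: "'z::topological_space => real"
 proof -
  have "continuous_on UNIV W" using W_deriv(1) by (meson DERIV_continuous continuous_at_imp_continuous_on)
  then show ?thesis by (rule continuous_on_compose2[OF _ that]) auto
 qed
 have eta_cont: "continuous_on UNIV eta" unfolding eta_def E_def using a by (intro continuous_intros rho_cont) auto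
 have deta_cont: "continuous_on UNIV deta" unfolding deta_def E_def using a by (intro continuous_intros rho_cont g_cont) auto
 have "Q t x <= 0"
 proof (rule parabolic_max_principle[OF _ compact_closure_dom _ _ t x])
  show "continuous_on ({0..} \<times> closure Om) (%(t, x). Q t x)"
   unfolding Q_def split_beta using u_cont[unfolded split_beta] p_cont[unfolded split_beta]
   by (intro continuous_intros W_cont G_cont continuous_on_compose2[OF eta_cont]) auto
  show "Q 0 y <= 0" if y: "y : closure Om" for y
  proof -
   have u0: "\<bar>u 0 y\<bar> <= 1" using u_le[OF _ y] by simp
   have "eps^2 / 2 * eta y * (p 0 y \<bullet> p 0 y) = eta y * (eps^2 * (norm (p 0 y))^2 / 2)" by (simp add: dot_square_norm)
   also have "... <= eta y * (W (u 0 y) + kp / 8)" using init[OF y] eta(1)[OF y] by (intro mult_left_mono) auto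
   also have "... <= (1 + a) * (W (u 0 y) + kp / 8)" using eta(2)[OF y] W_bounds[OF u0] kp by (intro mult_right_mono) auto
   also have "... = W (u 0 y) + a * W (u 0 y) + (1 + a) * (kp / 8)" by (simp add: algebra_simps)
   also have "... <= W (u 0 y) + a * CW + (1 + 1) * (kp / 8)" using W_bounds[OF u0] a kp by (intro add_mono mult_left_mono mult_right_mono) auto
   also have "... <= W (u 0 y) + kp / 2" using small_a by simp
   finally show ?thesis using G_bounds(1)[OF u0] by (simp add: Q_def)
  qed
  fix t y assume t: "t > 0" and y: "y : closure Om" and pos: "Q t y > 0"
   and mx: "!!s z. 0 <= s ==> s <= t ==> z : closure Om ==> Q s z <= Q t y"
  define P where "P = p t y \<bullet> p t y"
  define v where "v = u t y"
  have v: "\<bar>v\<bar> <= 1" unfolding v_def using u_le[OF _ y] t by simp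
  note Wv = W_bounds[OF v] and Gv = G_bounds[OF v]
  have P0: "P >= 0" by (simp add: P_def)
  have "eps^2 / 2 * eta y * P > kp / 2" using pos Wv Gv unfolding Q_def P_def[symmetric] v_def[symmetric] by linarith
  then have XP: "eps^2 * P > kp / 2"
  proof -
   assume *: "eps^2 / 2 * eta y * P > kp / 2"
   have "eta y * (eps^2 / 2 * P) <= 2 * (eps^2 / 2 * P)" using eta(2)[OF y] a P0 by (intro mult_right_mono) auto
   then show ?thesis using * by (simp add: mult_ac)
  qed
  have Ppos: "P > 0" using XP P0 kp by (cases "P = 0") auto
  have cont: "continuous_on (closure Om) (u t)" "continuous_on (closure Om) (p t)" "continuous_on (closure Om) (D t)"
   using slice_cont[OF u_cont, of t] slice_cont[OF p_cont, of t] slice_cont[OF D_cont, of t] t by auto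
  have W'_cont: "continuous_on S (%x. W' (f x))" if "continuous_on S f" for S and f :: "'z::topological_space => real"
  proof -
   have "continuous_on UNIV W'" using W_deriv(2) by (meson DERIV_continuous continuous_at_imp_continuous_on)
   then show ?thesis by (rule continuous_on_compose2[OF _ that]) auto
  qed
  define dQ where "dQ x = (eps^2 * eta x) *R (p t x v* D t x) + (eps^2 / 2 * (p t x \<bullet> p t x)) *R deta x
    - (W' (u t x) + G' (u t x)) *R p t x" for x
  have pp_deriv: "((%x. p t x \<bullet> p t x) has_derivative (%h. (2 *R (p t z v* D t z)) \<bullet> h)) (at z)" if "z : Om" for z
   using has_derivative_inner[OF p_D[OF t that] p_D[OF t that]]
   by (rule has_derivative_eq_rhs) (simp add: fun_eq_iff dot_lmul_matrix inner_commute[of _ "p t z"])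
  have dQ_deriv: "(Q t has_derivative (%h. dQ z \<bullet> h)) (at z)" if z: "z : Om" for z
  proof -
   note du = u_p[OF less_imp_le[OF t] z]
   have 1: "((%x. W (u t x)) has_derivative (%h. W' (u t z) * (p t z \<bullet> h))) (at z)"
    using has_derivative_compose[OF du W_deriv(1)[unfolded has_field_derivative_def]] .
   have 2: "((%x. G (u t x)) has_derivative (%h. G' (u t z) * (p t z \<bullet> h))) (at z)"
    using has_derivative_compose[OF du G_deriv[unfolded has_field_derivative_def]] .
   have 4: "((%x. eps^2 / 2 * eta x) has_derivative (%h. eps^2 / 2 * (deta z \<bullet> h))) (at z)" by (rule has_derivative_mult_right[OF eta_deriv])
   show ?thesis unfolding Q_def
    by (rule has_derivative_eq_rhs[OF has_derivative_diff[OF has_derivative_diff[OF has_derivative_mult[OF 4 pp_deriv[OF z]] 1] 2]])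
      (simp add: fun_eq_iff dQ_def inner_add_left inner_diff_left algebra_simps)
  qed
  show False
  proof (cases "y : Om")
   case False
   then have yf: "y : frontier Om" using y closure_cases by blast
   have "dQ y \<bullet> g y >= 0"
   proof (rule boundary_max[OF yf, where Q="Q t"])
    show "continuous_on (closure Om) (Q t)" unfolding Q_def by (intro continuous_intros cont W_cont G_cont continuous_on_subset[OF eta_cont]) auto
    show "continuous_on (closure Om) dQ" unfolding dQ_def vector_matrix_mult_def G'_def
     by (intro continuous_intros cont W'_cont continuous_on_subset[OF eta_cont] continuous_on_subset[OF deta_cont]) auto
    show "Q t z <= Q t y" if "z : closure Om" for z using mx[OF _ _ that] t by simp
    show "(Q t has_derivative (%h. dQ z \<bullet> h)) (at z)" if "z : Om" for z by (rule dQ_deriv[OF that])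
   qed
   moreover have "dQ y \<bullet> g y < 0"
   proof -
    have pg: "p t y \<bullet> g y = 0" by (rule neumann[OF t yf])
    have E1: "E y = 1" "eta y = 1" using E(3)[OF yf] by (auto simp: eta_def)
    have symb: "transpose (D t y) = D t y"
    proof -
     have c: "continuous_on (closure Om) (%x. transpose (D t x) - D t x)" unfolding transpose_def by (intro continuous_intros cont)
     have "(%x. transpose (D t x) - D t x) y = 0" by (rule continuous_constant_on_closure[OF c _ y]) (use D_sym[OF t] in auto)
     then show ?thesis by simp
    qed
    have "(p t y v* D t y) \<bullet> g y = g y \<bullet> (D t y *v p t y)"
     using symb transpose_matrix_vector[of "D t y" "p t y"] by (simp add: inner_commute)
    also have "... = - (p t y \<bullet> (A y *v p t y))" by (rule boundary_hessian[OF t yf])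
    also have "... <= CA * P"
    proof -
     have "- (p t y \<bullet> (A y *v p t y)) <= norm (p t y) * norm (A y *v p t y)" using Cauchy_Schwarz_ineq2[of "p t y" "A y *v p t y"] by linarith
     also have "... <= norm (p t y) * (CA * norm (p t y))" using geo[OF y] by (intro mult_left_mono) auto
     finally show ?thesis by (simp add: P_def dot_square_norm power2_eq_square mult_ac)
    qed
    finally have b: "eps^2 * ((p t y v* D t y) \<bullet> g y) <= eps^2 * (CA * P)" by (intro mult_left_mono) auto
    have "dQ y \<bullet> g y = eps^2 * ((p t y v* D t y) \<bullet> g y) - eps^2 / 2 * P * (M * (g y \<bullet> g y))"
     by (simp add: dQ_def inner_add_left inner_diff_left pg E1 deta_def P_def)
    also have "... <= eps^2 * (CA * P) - eps^2 / 2 * P * (M * c0^2)"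
    proof -
     have "c0^2 <= (norm (g y))^2" using geo0[OF yf] c0 by (intro power_mono) auto
     then have "eps^2 / 2 * P * (M * c0^2) <= eps^2 / 2 * P * (M * (g y \<bullet> g y))"
      using P0 M by (intro mult_left_mono) (auto simp: power2_norm_eq_inner)
     then show ?thesis using b by linarith
    qed
    also have "... = eps^2 / 2 * P * (2 * CA - M * c0^2)" by (simp add: algebra_simps)
    also have "... < 0" using Ppos eps_pos Mc by (intro mult_pos_neg) auto
    finally show ?thesis .
   qed
   ultimately show False by linarith
  next
   case True
   define Ph' where "Ph' = W' v + G' v"
   define q where "q = p t y v* D t y"
   have qj: "q $ j = (\<Sum>i\<in>UNIV. p t y $ i * D t y $ i $ j)" for j by (simp add: q_def vector_matrix_mult_def mult.commute)
   have ddeta: "((%s. deta (y + s *R axis j 1) $ j) has_real_derivative - M * E y * (A y $ j $ j) - M^2 / a * E y * (g y $ j)^2) (at 0)" for j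
   proof -
    have g0: "(g has_derivative (%h. A y *v h)) (at (y + 0 *R axis j 1))" using rho_deriv(2) by simp
    note 1 = line_deriv_vec[OF g0, of j] and 2 = line_deriv[OF rho_deriv(1), where s=0 and x=y and j=j]
    have "((%s. E (y + s *R axis j 1)) has_real_derivative M / a * E y * g y $ j) (at 0)"
     unfolding E_def using a by (auto intro!: derivative_eq_intros 2)
    from DERIV_mult[OF DERIV_cmult[OF this, of "- M"] 1]
    show ?thesis by (simp add: deta_def power2_eq_square algebra_simps)
   qed
   define eta2 where "eta2 j = - M * E y * (A y $ j $ j) - M^2 / a * E y * (g y $ j)^2" for j
   define Qjj where "Qjj j = eps^2 / 2 * eta2 j * P + 2 * eps^2 * deta y $ j * q $ j
     + eps^2 * eta y * (\<Sum>i\<in>UNIV. (D t y $ i $ j)^2 + p t y $ i * T t y $ i $ j)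
     - (W'' v - kp / 4) * (p t y $ j)^2 - Ph' * D t y $ j $ j" for j
   have dQj: "dQ x $ j = eps^2 / 2 * (deta x $ j) * (p t x \<bullet> p t x) + eps^2 * eta x * (\<Sum>i\<in>UNIV. p t x $ i * D t x $ i $ j)
     - (W' (u t x) + G' (u t x)) * p t x $ j" for j x by (simp add: dQ_def vector_matrix_mult_def mult.commute)
   have der2: "((%s. dQ (y + s *R axis j 1) $ j) has_real_derivative Qjj j) (at 0)" for j
   proof -
    have z: "y + 0 *R axis j 1 : Om" using True by simp
    note 1 = line_deriv[OF u_p[OF less_imp_le[OF t] z]] and 2 = line_deriv[OF eta_deriv, where x=y and s=0 and j=j] and 3 = line_deriv[OF pp_deriv[OF z]]
    note 4 = DERIV_chain2[OF W_deriv(2) 1] and 5 = DERIV_chain2[OF G'_deriv 1] and 6 = line_deriv_vec[OF p_D[OF t z]]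
    have 7: "((%s. \<Sum>i\<in>UNIV. p t (y + s *R axis j 1) $ i * D t (y + s *R axis j 1) $ i $ j) has_real_derivative
      (\<Sum>i\<in>UNIV. D t y $ i $ j * D t y $ i $ j + T t y $ i $ j * p t y $ i)) (at 0)"
     by (intro DERIV_sum DERIV_cong[OF DERIV_mult[OF 6 D_T[OF t True]]]) simp
    from DERIV_diff[OF DERIV_add[OF DERIV_mult[OF DERIV_cmult[OF ddeta, of "eps^2 / 2" j] 3] DERIV_mult[OF DERIV_cmult[OF 2, of "eps^2"] 7]] DERIV_mult[OF DERIV_add[OF 4 5] 6[of j]]]
    show ?thesis unfolding dQj Qjj_def by (rule DERIV_cong)
       (simp add: eta2_def qj q_def[symmetric] P_def v_def Ph'_def power2_eq_square algebra_simps sum_distrib_left sum.distrib)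
   qed
   have ev: "\<forall>\<^sub>F s in nhds 0. y + s *R axis j 1 : Om" for j by (rule eventually_line[OF True])
   have crit: "dQ y $ j = 0" and conc: "Qjj j <= 0" for j
   proof -
    have e1: "\<forall>\<^sub>F s in nhds 0. ((%s. Q t (y + s *R axis j 1)) has_real_derivative dQ (y + s *R axis j 1) $ j) (at s)"
     using ev[of j] by eventually_elim (rule line_deriv[OF dQ_deriv])
    have e2: "\<forall>\<^sub>F s in nhds 0. Q t (y + s *R axis j 1) <= Q t (y + 0 *R axis j 1)"
     using ev[of j] by eventually_elim (use mx[of t] t closure_subset[of Om] in auto)
    show "dQ y $ j = 0" using second_derivative_at_max(1)[OF e1 der2 e2] by simp
    show "Qjj j <= 0" using second_derivative_at_max(2)[OF e1 der2 e2] .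
   qed
   have time: "eps^2 * eta y * (p t y \<bullet> pt t y) - Ph' * ut t y >= 0"
   proof (rule time_derivative_at_max[OF _ t])
    note 1 = u_ut[OF t True]
    have 2: "((%s. p s y \<bullet> p s y) has_real_derivative 2 * (p t y \<bullet> pt t y)) (at t)"
     using has_derivative_inner[OF p_pt[OF t True, unfolded has_vector_derivative_def] p_pt[OF t True, unfolded has_vector_derivative_def]]
     by (rule has_derivative_imp_has_field_derivative) (simp add: inner_commute[of _ "p t y"])
    from DERIV_diff[OF DERIV_diff[OF DERIV_cmult[OF 2, of "eps^2 / 2 * eta y"] DERIV_chain2[OF W_deriv(1) 1]] DERIV_chain2[OF G_deriv 1]]
    show "((%s. Q s y) has_real_derivative eps^2 * eta y * (p t y \<bullet> pt t y) - Ph' * ut t y) (at t)"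
     unfolding Q_def by (rule DERIV_cong) (simp add: Ph'_def v_def algebra_simps)
    show "Q s y <= Q t y" if "0 <= s" "s <= t" for s using mx[OF that y] .
   qed
   have "dQ y = 0" using crit by (simp add: vec_eq_iff)
   then have crit_vec: "(eps^2 * eta y) *R q = Ph' *R p t y - (eps^2 / 2 * P) *R deta y" by (simp add: dQ_def q_def P_def Ph'_def v_def algebra_simps)
   define Dleta where "Dleta = (\<Sum>j\<in>UNIV. eta2 j)"
   define D2 where "D2 = (\<Sum>j\<in>UNIV. \<Sum>i\<in>UNIV. (D t y $ i $ j)^2)"
   have lap: "eps^2 / 2 * Dleta * P + 2 * eps^2 * (deta y \<bullet> q) + eps^2 * eta y * (D2 + p t y \<bullet> pt t y + W'' v / eps^2 * P)
     - (W'' v - kp / 4) * P - Ph' * trace (D t y) <= 0"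
   proof -
    have TT: "(\<Sum>j\<in>UNIV. \<Sum>i\<in>UNIV. p t y $ i * T t y $ i $ j) = p t y \<bullet> pt t y + W'' v / eps^2 * P"
    proof -
     have "(\<Sum>j\<in>UNIV. \<Sum>i\<in>UNIV. p t y $ i * T t y $ i $ j) = (\<Sum>i\<in>UNIV. p t y $ i * (\<Sum>j\<in>UNIV. T t y $ i $ j))"
      by (subst sum.swap) (simp add: sum_distrib_left)
     also have "... = (\<Sum>i\<in>UNIV. p t y $ i * pt t y $ i + W'' v / eps^2 * (p t y $ i * p t y $ i))"
      unfolding equation'[OF t True] v_def by (intro sum.cong refl) (simp add: algebra_simps)
     also have "... = p t y \<bullet> pt t y + W'' v / eps^2 * P" by (simp add: sum.distrib inner_vec_def P_def sum_distrib_left)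
     finally show ?thesis .
    qed
    have PS: "(\<Sum>j\<in>UNIV. (p t y $ j)^2) = P" by (simp add: P_def inner_vec_def power2_eq_square)
    have "(\<Sum>j\<in>UNIV. Qjj j) = (\<Sum>j\<in>UNIV. eps^2 / 2 * eta2 j * P) + (\<Sum>j\<in>UNIV. 2 * eps^2 * deta y $ j * q $ j)
     + (\<Sum>j\<in>UNIV. eps^2 * eta y * (\<Sum>i\<in>UNIV. (D t y $ i $ j)^2 + p t y $ i * T t y $ i $ j))
     - (\<Sum>j\<in>UNIV. (W'' v - kp / 4) * (p t y $ j)^2) - (\<Sum>j\<in>UNIV. Ph' * D t y $ j $ j)"
     unfolding Qjj_def by (simp only: sum.distrib sum_subtractf)
    also have "(\<Sum>j\<in>UNIV. eps^2 / 2 * eta2 j * P) = eps^2 / 2 * Dleta * P" by (simp add: Dleta_def sum_distrib_left sum_distrib_right)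
    also have "(\<Sum>j\<in>UNIV. 2 * eps^2 * deta y $ j * q $ j) = 2 * eps^2 * (deta y \<bullet> q)"
     by (simp add: inner_vec_def sum_distrib_left mult.assoc)
    also have "(\<Sum>j\<in>UNIV. eps^2 * eta y * (\<Sum>i\<in>UNIV. (D t y $ i $ j)^2 + p t y $ i * T t y $ i $ j)) =
      eps^2 * eta y * (D2 + (\<Sum>j\<in>UNIV. \<Sum>i\<in>UNIV. p t y $ i * T t y $ i $ j))"
     by (simp only: D2_def sum.distrib sum_distrib_left[symmetric])
    also have "(\<Sum>j\<in>UNIV. (W'' v - kp / 4) * (p t y $ j)^2) = (W'' v - kp / 4) * P" by (simp only: sum_distrib_left[symmetric] PS)
    also have "(\<Sum>j\<in>UNIV. Ph' * D t y $ j $ j) = Ph' * trace (D t y)" by (simp only: sum_distrib_left[symmetric] trace_def)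
    finally have "(\<Sum>j\<in>UNIV. Qjj j) = eps^2 / 2 * Dleta * P + 2 * eps^2 * (deta y \<bullet> q)
     + eps^2 * eta y * (D2 + (\<Sum>j\<in>UNIV. \<Sum>i\<in>UNIV. p t y $ i * T t y $ i $ j)) - (W'' v - kp / 4) * P - Ph' * trace (D t y)" .
    moreover have "(\<Sum>j\<in>UNIV. Qjj j) <= 0" by (rule sum_nonpos) (rule conc)
    ultimately show ?thesis unfolding TT by (simp only: add.assoc)
   qed
   have e2: "eps^2 > 0" using eps_pos by simp
   have main: "eps^2 * eta y * D2 + kp / 4 * P <= Ph' * W' v / eps^2 - (eta y - 1) * W'' v * P - eps^2 / 2 * Dleta * P - 2 * eps^2 * (deta y \<bullet> q)"
   proof -
    have "Ph' * ut t y = Ph' * trace (D t y) - Ph' * W' v / eps^2" by (simp add: equation[OF t True] v_def algebra_simps)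
    moreover have "eps^2 * eta y * (D2 + p t y \<bullet> pt t y + W'' v / eps^2 * P) =
      eps^2 * eta y * D2 + eps^2 * eta y * (p t y \<bullet> pt t y) + eta y * W'' v * P" using eps_pos by (simp add: algebra_simps)
    moreover have "(eta y - 1) * W'' v * P = eta y * W'' v * P - W'' v * P" "(W'' v - kp / 4) * P = W'' v * P - kp / 4 * P"
     by (simp_all add: algebra_simps)
    ultimately show ?thesis using lap time by linarith
   qed
   define Beta where "Beta = M * Crho"
   define C1 where "C1 = CW + 1"
   define n where "n = norm (p t y)"
   have n: "n > 0" "n^2 = P" "n >= 0" using Ppos by (auto simp: n_def P_def power2_norm_eq_inner)
   have Phle: "\<bar>Ph'\<bar> <= C1" unfolding Ph'_def C1_def using Wv Gv abs_triangle_ineq[of "W' v" "G' v"] by linarith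
   have C1: "C1 > 0" using CW by (simp add: C1_def)
   have nd: "norm (deta y) <= Beta" using deta_le[OF y] by (simp add: Beta_def)
   have B0: "Beta >= 0" using nd norm_ge_zero order_trans by blast
   note etay = eta[OF y]
   have Dq: "(norm q)^2 <= D2 * P"
   proof -
    have "(q $ j)^2 <= P * (\<Sum>i\<in>UNIV. (D t y $ i $ j)^2)" for j using Cauchy_Schwarz_ineq_sum[of "%i. p t y $ i" "%i. D t y $ i $ j" UNIV]
     by (simp add: qj P_def inner_vec_def power2_eq_square)
    then have "(\<Sum>j\<in>UNIV. (q $ j)^2) <= (\<Sum>j\<in>UNIV. P * (\<Sum>i\<in>UNIV. (D t y $ i $ j)^2))" by (intro sum_mono)
    moreover have "(norm q)^2 = (\<Sum>j\<in>UNIV. (q $ j)^2)" unfolding power2_norm_eq_inner inner_vec_def by (simp add: power2_eq_square)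
    moreover have "(\<Sum>j\<in>UNIV. P * (\<Sum>i\<in>UNIV. (D t y $ i $ j)^2)) = D2 * P"
     unfolding D2_def by (simp only: sum_distrib_left[symmetric] mult.commute)
    ultimately show ?thesis by simp
   qed
   have qn: "eps^2 * norm q <= C1 * n + eps^2 / 2 * P * Beta"
   proof -
    have "eps^2 * norm q <= eta y * (eps^2 * norm q)" using mult_right_mono[OF etay(1), of "eps^2 * norm q"] by simp
    also have "... = norm ((eps^2 * eta y) *R q)" using etay by (simp add: abs_mult mult_ac)
    also have "... <= norm (Ph' *R p t y) + norm ((eps^2 / 2 * P) *R deta y)" unfolding crit_vec by (rule norm_triangle_ineq4)
    also have "... = \<bar>Ph'\<bar> * n + eps^2 / 2 * P * norm (deta y)" using P0 by (simp add: n_def abs_mult)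
    also have "... <= C1 * n + eps^2 / 2 * P * Beta" using Phle n nd P0 by (intro add_mono mult_right_mono mult_left_mono) auto
    finally show ?thesis .
   qed
   have D2low: "eps^2 * eta y * D2 >= Ph'^2 / (eps^2 * eta y) - C1 * n * Beta"
   proof -
    have "(norm ((eps^2 * eta y) *R q))^2 =
      (Ph' *R p t y - (eps^2 / 2 * P) *R deta y) \<bullet> (Ph' *R p t y - (eps^2 / 2 * P) *R deta y)"
     unfolding crit_vec by (rule power2_norm_eq_inner)
    also have "... = Ph'^2 * P - Ph' * (eps^2 * P) * (p t y \<bullet> deta y) + (eps^2 / 2 * P)^2 * (deta y \<bullet> deta y)"
     unfolding P_def by (simp add: inner_diff_left inner_diff_right inner_commute[of "deta y" "p t y"] power2_eq_square algebra_simps)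
    also have "... >= Ph'^2 * P - C1 * (eps^2 * P) * (n * Beta)"
    proof -
     have "\<bar>Ph' * (eps^2 * P) * (p t y \<bullet> deta y)\<bar> = \<bar>Ph'\<bar> * (eps^2 * P) * \<bar>p t y \<bullet> deta y\<bar>" using P0 by (simp add: abs_mult)
     also have "... <= C1 * (eps^2 * P) * (n * Beta)"
     proof (rule mult_mono)
      show "\<bar>p t y \<bullet> deta y\<bar> <= n * Beta"
       using Cauchy_Schwarz_ineq2[of "p t y" "deta y"] mult_left_mono[OF nd n(3)] by (simp add: n_def)
     qed (use Phle P0 C1 in "auto intro!: mult_right_mono")
     finally have "Ph' * (eps^2 * P) * (p t y \<bullet> deta y) <= C1 * (eps^2 * P) * (n * Beta)" by linarith
     moreover have "(eps^2 / 2 * P)^2 * (deta y \<bullet> deta y) >= 0" by simp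
     ultimately show ?thesis by linarith
    qed
    finally have "Ph'^2 * P - C1 * (eps^2 * P) * (n * Beta) <= (eps^2 * eta y)^2 * (norm q)^2" by (simp add: power_mult_distrib)
    also have "... <= (eps^2 * eta y)^2 * (D2 * P)" by (rule mult_left_mono[OF Dq]) simp
    finally have "(Ph'^2 - C1 * eps^2 * (n * Beta)) * P <= ((eps^2 * eta y)^2 * D2) * P" by (simp add: algebra_simps)
    then have "Ph'^2 - C1 * eps^2 * (n * Beta) <= (eps^2 * eta y)^2 * D2" using Ppos by simp
    then have "(Ph'^2 - C1 * eps^2 * (n * Beta)) / (eps^2 * eta y) <= (eps^2 * eta y)^2 * D2 / (eps^2 * eta y)"
     using etay by (intro divide_right_mono) auto
    also have "... = eps^2 * eta y * D2" using e2 etay by (simp add: power2_eq_square)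
    finally have "Ph'^2 / (eps^2 * eta y) - C1 * (n * Beta) / eta y <= eps^2 * eta y * D2" using e2 etay by (simp add: diff_divide_distrib)
    moreover have "C1 * (n * Beta) / eta y <= C1 * (n * Beta) / 1" using etay C1 n B0 by (intro divide_left_mono) auto
    ultimately show ?thesis by simp
   qed
   have PhiW: "Ph' * W' v / eps^2 - Ph'^2 / (eps^2 * eta y) <= a * (C1 * CW) / eps^2"
   proof -
    have "Ph' * G' v >= 0"
    proof -
     have "W' v * G' v = kp / 4 * (W' v * (gm - v))" by (simp add: G'_def field_simps)
     then have "W' v * G' v >= 0" using W_sign[OF v] kp by (simp only:) simp
     then show ?thesis by (simp add: Ph'_def algebra_simps)
    qed
    then have "Ph' * W' v * (1 / eta y) <= Ph'^2 * (1 / eta y)"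
     using etay by (intro mult_right_mono) (auto simp: Ph'_def power2_eq_square algebra_simps)
    then have "Ph' * W' v - Ph'^2 / eta y <= Ph' * W' v * (1 - 1 / eta y)" by (simp add: algebra_simps)
    also have "... <= (C1 * CW) * a"
    proof -
     have "\<bar>Ph' * W' v\<bar> <= C1 * CW" unfolding abs_mult using Phle Wv C1 by (intro mult_mono) auto
     moreover have "0 <= 1 - 1 / eta y" using etay by simp
     moreover have "1 - 1 / eta y <= a"
     proof -
      have "1 - 1 / eta y = (eta y - 1) / eta y" using etay by (simp add: field_simps)
      also have "... <= (eta y - 1) / 1" using etay by (intro divide_left_mono) auto
      finally show ?thesis using etay by simp
     qed
     moreover have "Ph' * W' v * (1 - 1 / eta y) <= C1 * CW * (1 - 1 / eta y)" using calculation by (intro mult_right_mono) linarith+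
     moreover have "C1 * CW * (1 - 1 / eta y) <= C1 * CW * a" using calculation C1 CW by (intro mult_left_mono) auto
     ultimately show ?thesis by linarith
    qed
    finally have "(Ph' * W' v - Ph'^2 / eta y) / eps^2 <= (C1 * CW) * a / eps^2" by (intro divide_right_mono) auto
    then show ?thesis by (simp add: diff_divide_distrib mult_ac)
   qed
   have Dlle: "\<bar>Dleta\<bar> <= M * Ct + M^2 / a * Crho^2"
   proof -
    have "Dleta = - (M * E y * trace (A y)) - M^2 / a * E y * (g y \<bullet> g y)"
     by (simp add: Dleta_def eta2_def sum_subtractf trace_def inner_vec_def sum_distrib_left power2_eq_square sum_negf)
    also have "\<bar>...\<bar> <= \<bar>M * E y * trace (A y)\<bar> + \<bar>M^2 / a * E y * (g y \<bullet> g y)\<bar>"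
     by (rule order_trans[OF abs_triangle_ineq4]) simp
    also have "... = E y * (M * \<bar>trace (A y)\<bar> + M^2 / a * (norm (g y))^2)"
     using E(1)[of y] M a by (simp add: abs_mult power2_norm_eq_inner algebra_simps)
    also have "... <= 1 * (M * Ct + M^2 / a * Crho^2)" using E(1,2)[of y] y geo[OF y] M a
     by (intro mult_mono add_mono mult_left_mono power_mono) (auto intro!: add_nonneg_nonneg mult_nonneg_nonneg)
    finally show ?thesis by simp
   qed
   define Ceta where "Ceta = M * Ct + M^2 / a * Crho^2"
   have tot: "kp / 4 * P <= a * (C1 * CW) / eps^2 + 3 * (C1 * n * Beta) + a * CW * P + eps^2 / 2 * Ceta * P + eps^2 * P * Beta^2"
   proof -
    have 1: "- ((eta y - 1) * W'' v * P) <= a * CW * P"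
    proof -
     have "\<bar>(eta y - 1) * W'' v\<bar> <= a * CW" unfolding abs_mult using etay Wv a by (intro mult_mono) auto
     then have "- ((eta y - 1) * W'' v) <= a * CW" by linarith
     from mult_right_mono[OF this P0] show ?thesis by simp
    qed
    have 2: "- (eps^2 / 2 * Dleta * P) <= eps^2 / 2 * Ceta * P"
    proof -
     have "- Dleta <= Ceta" using Dlle by (simp add: Ceta_def)
     then have "eps^2 / 2 * - Dleta * P <= eps^2 / 2 * Ceta * P" using P0 by (intro mult_right_mono mult_left_mono) auto
     then show ?thesis by simp
    qed
    have 3: "- (2 * eps^2 * (deta y \<bullet> q)) <= 2 * (C1 * n * Beta) + eps^2 * P * Beta^2"
    proof -
     have "- (2 * eps^2 * (deta y \<bullet> q)) = 2 * eps^2 * - (deta y \<bullet> q)" by simp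
     also have "... <= 2 * eps^2 * (Beta * norm q)"
     proof (rule mult_left_mono)
      show "- (deta y \<bullet> q) <= Beta * norm q" using Cauchy_Schwarz_ineq2[of "deta y" q] mult_right_mono[OF nd, of "norm q"] by simp
     qed simp
     also have "... = 2 * Beta * (eps^2 * norm q)" by simp
     also have "... <= 2 * Beta * (C1 * n + eps^2 / 2 * P * Beta)" using B0 by (intro mult_left_mono[OF qn]) auto
     also have "... = 2 * (C1 * n * Beta) + eps^2 * P * Beta^2" by (simp add: algebra_simps power2_eq_square)
     finally show ?thesis .
    qed
    show ?thesis using main D2low PhiW 1 2 3 by linarith
   qed
   define X where "X = eps^2 * P"
   have X: "X > kp / 2" using XP by (simp add: X_def)
   have nX: "eps^2 * n <= eps * (2 / kp * X)"
   proof -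
    have en: "(eps * n)^2 = X" using n by (simp add: X_def power_mult_distrib)
    have "kp / 2 <= eps * n"
    proof (rule power2_le_imp_le)
     have "(kp / 2)^2 <= kp / 2 * 1" unfolding power2_eq_square using kp by (intro mult_left_mono) auto
     then show "(kp / 2)^2 <= (eps * n)^2" unfolding en using X by linarith
    qed (use eps_pos n in simp)
    then have "kp / 2 * (eps * n) <= (eps * n) * (eps * n)" using eps_pos n by (intro mult_right_mono) auto
    also have "... = X" using en by (simp add: power2_eq_square)
    finally have "eps * n <= 2 / kp * X" using kp by (simp add: field_simps)
    then have "eps * (eps * n) <= eps * (2 / kp * X)" using eps_pos by (intro mult_left_mono) auto
    then show ?thesis by (simp add: power2_eq_square mult.assoc)
   qed
   have "eps^2 * (kp / 4 * P) <= eps^2 * (a * (C1 * CW) / eps^2 + 3 * (C1 * n * Beta) + a * CW * P + eps^2 / 2 * Ceta * P + eps^2 * P * Beta^2)"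
    by (rule mult_left_mono[OF tot]) simp
   also have "... = a * C1 * CW + 3 * C1 * Beta * (eps^2 * n) + (a * CW + eps^2 * (Ceta / 2 + Beta^2)) * X"
    using eps_pos by (simp add: X_def algebra_simps power2_eq_square)
   also have "... <= a * C1 * CW * (2 / kp * X) + 3 * C1 * Beta * (eps * (2 / kp * X)) + (a * CW + eps^2 * (Ceta / 2 + Beta^2)) * X"
   proof -
    have "1 <= 2 / kp * X" using X kp by (simp add: field_simps)
    then have "a * C1 * CW * 1 <= a * C1 * CW * (2 / kp * X)" using a C1 CW by (intro mult_left_mono) auto
    moreover have "3 * C1 * Beta * (eps^2 * n) <= 3 * C1 * Beta * (eps * (2 / kp * X))" using C1 B0 by (intro mult_left_mono[OF nX]) auto
    ultimately show ?thesis by linarith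
   qed
   also have "... = (2 * a * C1 * CW / kp + 6 * C1 * Beta * eps / kp + a * CW + eps^2 * (Ceta / 2 + Beta^2)) * X" by (simp add: algebra_simps)
   also have "... < kp / 4 * X"
   proof (rule mult_strict_right_mono)
    show "2 * a * C1 * CW / kp + 6 * C1 * Beta * eps / kp + a * CW + eps^2 * (Ceta / 2 + Beta^2) < kp / 4"
     using small unfolding C1_def Beta_def Ceta_def .
   qed (use X kp in simp)
   finally show False by (simp add: X_def mult_ac)
  qed
 qed
 moreover have "eps^2 * (norm (p t x))^2 / 2 <= eps^2 / 2 * eta x * (p t x \<bullet> p t x)"
 proof -
  have "1 * (eps^2 / 2 * (p t x \<bullet> p t x)) <= eta x * (eps^2 / 2 * (p t x \<bullet> p t x))" using eta(1)[OF x] by (intro mult_right_mono) auto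
  then show ?thesis by (simp add: dot_square_norm mult_ac)
 qed
 ultimately show ?thesis using G_bounds(2)[OF u_le[OF t x]] by (simp add: Q_def)
qed

end

section \<open>Divergence theorem, phase bound and energy\<close>

lemma integral_directional_derivative_zero:
 fixes f :: "'a::euclidean_space => real"
 assumes f: "f : compactly_supported" and d: "!!x. (f has_derivative F x) (at x)"
  and F: "continuous_on UNIV (%x. F x v)"
 shows "(LINT x|lborel. F x v) = 0"
proof -
 obtain K where K: "compact K" "!!x. x ~: K ==> f x = 0" using f unfolding compactly_supported_def by auto
 obtain R where R: "!!x. x : K ==> norm x <= R" using compact_imp_bounded[OF K(1)] unfolding bounded_iff by auto
 define B where "B = cball (0::'a) (R + 2 * norm v)"
 have f0: "f x = 0" if "norm x > R" for x using K(2) R that by force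
 obtain M where M: "!!x. x : B ==> norm (F x v) <= M"
  using compact_imp_bounded[OF compact_continuous_image[OF continuous_on_subset[OF F]], of B] unfolding B_def bounded_iff by fastforce
 define s where "s k = 1 / real (Suc k)" for k
 define q where "q k x = (f (s k *R v + x) - f x) / s k" for k x
 have s: "s k > 0" "s k <= 1" for k by (auto simp: s_def)
 have line: "((%t. f (t *R v + x)) has_real_derivative F (t *R v + x) v) (at t)" for t x
 proof -
  have "((%t. t *R v + x) has_derivative (%h. h *R v)) (at t)" by (rule derivative_eq_intros refl | simp)+
  from has_derivative_compose[OF this d] show ?thesis by (rule has_derivative_imp_has_field_derivative)
    (simp add: linear_cmul[OF has_derivative_linear[OF d]])
 qed
 have qb: "norm (q k x) <= indicator (cball (0::'a) (R + 3 * norm v)) x *R max M 0" for k x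
 proof (cases "norm x <= R + norm v")
  case True
  obtain z where z: "0 < z" "z < s k" "f (s k *R v + x) - f (0 *R v + x) = (s k - 0) * F (z *R v + x) v" using MVT2[OF s(1) line] by blast
  have "norm (z *R v) <= norm v" using z s[of k] by (simp add: mult_left_le_one_le)
  then have "z *R v + x : B" unfolding B_def using norm_triangle_ineq[of "z *R v" x] True by simp
  moreover have "q k x = F (z *R v + x) v" using z s[of k] by (simp add: q_def)
  moreover have "x : cball 0 (R + 3 * norm v)" using True by (simp add: add_increasing2 order_trans[OF True])
  ultimately show ?thesis using M[of "z *R v + x"] by simp
 next
  case False
  have "norm (s k *R v) <= norm v" using s[of k] by (simp add: mult_left_le_one_le)
  moreover have "norm x <= norm (s k *R v + x) + norm (s k *R v)" using norm_triangle_ineq4[of "s k *R v + x" "s k *R v"] by simp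
  ultimately have "norm (s k *R v + x) > R" "norm x > R" using False norm_ge_zero[of v] by linarith+
  then have "q k x = 0" by (simp add: q_def f0)
  then show ?thesis by simp
 qed
 have fi: "integrable lborel f"
 proof -
  have "continuous_on K f" using f by (auto simp: compactly_supported_def intro: continuous_on_subset)
  moreover have "(%x. indicator K x *R f x) = f" using K(2) by (force simp: fun_eq_iff indicator_def)
  ultimately show ?thesis using borel_integrable_compact[OF K(1), of f] by simp
 qed
 have trans: "integral\<^sup>L lborel (%x. f (c + x)) = integral\<^sup>L lborel f" "integrable lborel (%x. f (c + x))" for c
 proof -
  have m: "f : borel_measurable borel" using f by (rule compactly_supported_measurable)
  show "integral\<^sup>L lborel (%x. f (c + x)) = integral\<^sup>L lborel f"
   using integral_distr[of "(+) c" lborel borel f] m by (simp add: lborel_distr_plus)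
  show "integrable lborel (%x. f (c + x))" using integrable_distr_eq[of "(+) c" lborel borel f] m fi by (simp add: lborel_distr_plus)
 qed
 have q_int: "integral\<^sup>L lborel (q k) = 0" for k unfolding q_def by (simp add: Bochner_Integration.integral_diff trans fi)
 have "(%k. integral\<^sup>L lborel (q k)) ----> (LINT x|lborel. F x v)"
 proof (rule integral_dominated_convergence)
  show "(%x. F x v) : borel_measurable lborel" using F by (simp add: borel_measurable_continuous_onI)
  show "q k : borel_measurable lborel" for k
   unfolding q_def using borel_measurable_integrable[OF trans(2)] borel_measurable_integrable[OF fi] by measurable
  show "integrable lborel (%x. indicator (cball (0::'a) (R + 3 * norm v)) x *R max M 0)" by (rule borel_integrable_compact) auto
  show "AE x in lborel. (%k. q k x) ----> F x v"
  proof (rule always_eventually, rule allI)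
   fix x
   have "((%h. (f (h *R v + x) - f x) / h) ---> F x v) (at 0)" using line[of x 0] by (simp add: DERIV_def)
   moreover have "filterlim s (at 0) sequentially" unfolding filterlim_at using s(1) LIMSEQ_Suc[OF lim_1_over_n]
    by (auto simp: s_def[abs_def] less_imp_neq[symmetric] simp del: of_nat_Suc)
   ultimately show "(%k. q k x) ----> F x v" unfolding q_def by (rule filterlim_compose)
  qed
 qed (use qb in auto)
 then show ?thesis by (simp add: q_int LIMSEQ_const_iff)
qed

lemma integral_divergence_zero:
 fixes X :: "real^'n => real^'n"
 assumes X: "X : compactly_supported" and d: "!!x. (X has_derivative (%h. B x *v h)) (at x)"
  and B: "continuous_on UNIV B"
 shows "(LINT x|lborel. trace (B x)) = 0"
proof -
 have e: "B x $ i $ j = (B x *v axis j 1) $ i" for x i j by (simp add: matrix_vector_mult_basis column_def)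
 obtain K where K: "compact K" "!!x. x ~: K ==> X x = 0" using X unfolding compactly_supported_def by auto
 have B0: "B x = 0" if "x ~: K" for x
 proof -
  have "\<forall>\<^sub>F y in nhds x. y : - K" using that K(1) by (intro eventually_nhds_in_open) (auto intro: compact_imp_closed)
  then have "(X has_derivative (%h. 0)) (at x)" using has_derivative_transform_eventually[OF has_derivative_const[of 0 "at x"], of X]
   by (simp add: eventually_at_filter) (smt (verit) ComplD K(2) eventually_mono that)
  then have "(%h. B x *v h) = (%h. 0)" using has_derivative_unique[OF d] by blast
  then show ?thesis by (metis e matrix_eq matrix_vector_mult_0)
 qed
 have "(LINT x|lborel. B x $ i $ i) = 0" "integrable lborel (%x. B x $ i $ i)" for i
 proof -
  have "(LINT x|lborel. (B x *v axis i 1) $ i) = 0"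
  proof (rule integral_directional_derivative_zero[of "%x. X x $ i" "%x h. (B x *v h) $ i"])
   show "(%x. X x $ i) : compactly_supported" by (rule compactly_supported_comp[OF X, of "%y. y $ i"]) (auto intro!: continuous_intros)
   show "((%x. X x $ i) has_derivative (%h. (B x *v h) $ i)) (at x)" for x using bounded_linear.has_derivative[OF bounded_linear_vec_nth d] .
   show "continuous_on UNIV (%x. (B x *v axis i 1) $ i)" unfolding e[symmetric] by (intro continuous_intros B)
  qed
  then show "(LINT x|lborel. B x $ i $ i) = 0" by (simp add: e)
  have "integrable lborel (%x. indicator K x *R B x $ i $ i)" by (intro borel_integrable_compact K continuous_intros continuous_on_subset[OF B]) auto
  then show "integrable lborel (%x. B x $ i $ i)"
   by (rule Bochner_Integration.integrable_cong[THEN iffD1, rotated -1]) (auto simp: B0 split: split_indicator)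
 qed
 then show ?thesis unfolding trace_def by (subst Bochner_Integration.integral_sum) auto
qed

lemma AE_le_on_closure:
 fixes f :: "'a::euclidean_space => real"
 assumes op: "open Om" and f: "continuous_on (closure Om) f" and ae: "AE x in lborel. x : Om --> f x <= c" and x: "x : closure Om"
 shows "f x <= c"
proof (rule continuous_le_on_closure[OF f x], rule ccontr)
 fix y assume y: "y : Om" "~ f y <= c"
 define U where "U = Om \<inter> f -` {c<..}"
 have "open U" unfolding U_def by (intro continuous_open_preimage continuous_on_subset[OF f closure_subset] op) auto
 moreover have "U : null_sets lborel"
 proof -
  have "AE x in lborel. x ~: U" using ae by eventually_elim (auto simp: U_def)
  then show ?thesis using \<open>open U\<close> by (simp add: AE_iff_null_sets)
 qed
 then have "negligible U" by (simp add: negligible_iff_null_sets null_sets_completionI)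
 moreover have "y : U" using y by (simp add: U_def)
 ultimately show False using open_not_negligible[of U] by blast
qed

context neumann_solution begin

abbreviation vol where "vol \<equiv> restrict_space lborel Om"

lemma finite_vol: "finite_measure vol" and space_vol: "space vol = Om"
proof -
 show s: "space vol = Om" by (simp add: space_restrict_space)
 have "emeasure vol Om < \<infinity>" using open_dom bounded_dom emeasure_bounded_finite[of Om] by (subst emeasure_restrict_space) auto
 then show "finite_measure vol" by (intro finite_measureI) (simp add: s)
qed

lemma vol_measurable: "continuous_on Om f ==> f : borel_measurable vol"
 for f :: "real^'n => 'b::{second_countable_topology, real_normed_vector}"
 using borel_measurable_continuous_on_restrict[of Om f] by (simp add: measurable_def space_restrict_space sets_restrict_space)

lemma integral_vol: "(LINT x|vol. f x) = (LINT x|lborel. indicator Om x *R f x)"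
 for f :: "real^'n => 'b::{second_countable_topology, banach}" using open_dom by (intro integral_restrict_space) auto

lemma integrable_dom:
 fixes f :: "real^'n => 'b::{second_countable_topology, banach}"
 assumes "continuous_on (closure Om) f"
 shows "integrable vol f"
proof -
 interpret finite_measure vol by (rule finite_vol)
 obtain C where C: "!!x. x : closure Om ==> norm (f x) <= C" using closure_bounded[OF assms] by blast
 show ?thesis by (rule integrable_const_bound[of _ C])
   (use C subsetD[OF closure_subset] assms in "auto simp: space_vol intro!: AE_I2 C vol_measurable intro: continuous_on_subset[OF _ closure_subset]")
qed

lemma near_boundary:
 fixes phi :: "real^'n => real"
 assumes phi: "continuous_on (closure Om) phi" "!!x. x : frontier Om ==> phi x < 0"
 obtains m where "m > 0" "!!x. x : Om ==> - m < rho x ==> phi x < 0"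
proof -
 define C where "C = {x:closure Om. phi x : {0..}}"
 have C: "compact C"
 proof -
  have "closed C" unfolding C_def using continuous_closed_preimage[OF phi(1) closed_closure closed_atLeast, of 0] by (simp add: vimage_def Int_def)
  then show ?thesis using compact_Int_closed[OF compact_closure_dom, of C] by (simp add: C_def Int_def conj_ac)
 qed
 show ?thesis
 proof (cases "C = {}")
  case True
  then show ?thesis using that[of 1] closure_subset[of Om] by (force simp: C_def)
 next
  case False
  obtain y where y: "y : C" "!!x. x : C ==> rho x <= rho y" using continuous_attains_sup[OF C False continuous_on_subset[OF rho_cont]] by auto
  have "rho y < 0" using y(1) phi(2)[of y] closure_cases[of y] dom_iff[of y] by (force simp: C_def)
  moreover have "phi x < 0" if "x : Om" "rho y < rho x" for x using y(2)[of x] that closure_subset[of Om] by (force simp: C_def)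
  ultimately show ?thesis using that[of "- rho y"] by auto
 qed
qed

lemma cutoff_continuous:
 fixes h :: "real^'n => 'b::real_normed_vector"
 assumes m: "continuous_on UNIV m" "!!x. rho x >= - dl ==> m x = (0::real)" and dl: "dl > 0" and h: "continuous_on Om h"
 shows "continuous_on UNIV (%x. m x *R (if x : Om then h x else 0))"
proof -
 define V where "V = {x. - dl < rho x}"
 have V: "open V" unfolding V_def by (intro open_Collect_less continuous_intros rho_cont)
 have "continuous_on Om (%x. m x *R h x)" by (intro continuous_intros h continuous_on_subset[OF m(1)]) auto
 then have 1: "continuous_on Om (%x. m x *R (if x : Om then h x else 0))" by (rule continuous_on_cong[THEN iffD1, rotated -1]) auto
 have 2: "continuous_on V (%x. m x *R (if x : Om then h x else 0))"
  by (rule continuous_on_cong[THEN iffD2, OF refl _ continuous_on_const[of _ 0]]) (auto simp: V_def m(2))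
 have "Om \<union> V = UNIV" using dom_iff dl by (fastforce simp: V_def)
 then show ?thesis using continuous_on_open_Un[OF open_dom V 1 2] by simp
qed

text \<open>The cut-off is a function of \<open>rho\<close>. Its derivative takes the place of the surface measure.\<close>
lemma cutoff_divergence:
 assumes d: "!!x. x : Om ==> (X has_derivative (%h. B x *v h)) (at x)" and B: "continuous_on Om B"
  and dl: "dl > 0"
 shows "(LINT x|vol. smoothstep ((- rho x - dl) / dl) * trace (B x)) = (LINT x|vol. smoothstep' ((- rho x - dl) / dl) / dl * (g x \<bullet> X x))"
proof -
 define z where "z x = smoothstep ((- rho x - dl) / dl)" for x
 define l where "l x = smoothstep' ((- rho x - dl) / dl) / dl" for x
 have zl0: "z x = 0" "l x = 0" if "rho x >= - dl" for x
 proof -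
  have "(- rho x - dl) / dl <= 0" using that dl by (simp add: divide_nonpos_pos)
  then show "z x = 0" "l x = 0" by (simp_all add: z_def l_def smoothstep_eq smoothstep'_eq)
 qed
 have zc: "continuous_on UNIV z" "continuous_on UNIV l" unfolding z_def l_def using dl by (auto intro!: continuous_intros rho_cont)
 have dz: "(z has_derivative (%h. - l x * (g x \<bullet> h))) (at x)" for x
 proof -
  have "((%x. (- rho x - dl) / dl) has_derivative (%h. - (g x \<bullet> h) / dl)) (at x)" using dl by (auto intro!: derivative_eq_intros rho_deriv(1))
  from has_derivative_smoothstep_comp[OF this] show ?thesis unfolding z_def[symmetric] by (rule has_derivative_eq_rhs) (auto simp: l_def)
 qed
 have Xc: "continuous_on Om X" by (rule has_derivative_continuous_on) (use d in "auto intro: has_derivative_at_withinI")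
 have gc: "continuous_on Om g" using g_cont by (rule continuous_on_subset) auto
 let ?e = "%f x. if x : Om then f x else 0"
 define Y where "Y x = z x *R ?e X x" for x
 define BY where "BY x = z x *R ?e B x - l x *R ?e (%x. tensor (X x) (g x)) x" for x
 have "(LINT x|lborel. trace (BY x)) = 0"
 proof (rule integral_divergence_zero)
  have "continuous_on UNIV Y" unfolding Y_def by (rule cutoff_continuous[OF zc(1) zl0(1) dl Xc])
  then show "Y : compactly_supported" using closure_subset by (intro compactly_supportedI[OF _ compact_closure_dom]) (auto simp: Y_def)
  show "(Y has_derivative (%h. BY x *v h)) (at x)" for x
  proof (cases "x : Om")
   case True
   have "((%x. z x *R X x) has_derivative (%h. BY x *v h)) (at x)" using has_derivative_scaleR[OF dz d[OF True]]
    by (rule has_derivative_eq_rhs) (use True in "auto simp: BY_def algebra_simps tensor_mult scaleR_matrix_vector_assoc[symmetric]")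
   then show ?thesis by (rule has_derivative_transform_within_open[OF _ open_dom True]) (simp add: Y_def)
  next
   case False
   then have r: "- dl < rho x" using dom_iff[of x] dl by linarith
   have "(Y has_derivative (%h. 0)) (at x)" by (rule has_derivative_transform_within_open[OF has_derivative_const, of "{x. - dl < rho x}" _ 0])
     (use r in "auto intro!: open_Collect_less continuous_intros rho_cont simp: Y_def zl0")
   then show ?thesis using False by (simp add: BY_def)
  qed
  show "continuous_on UNIV BY" unfolding BY_def
   by (intro continuous_on_diff cutoff_continuous[OF zc(1) zl0(1) dl B] cutoff_continuous[OF zc(2) zl0(2) dl])
    (auto intro!: continuous_intros Xc gc)
 qed
 moreover have "trace (BY x) = indicator Om x *R (z x * trace (B x)) - indicator Om x *R (l x * (g x \<bullet> X x))" for x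
  by (auto simp: BY_def trace_def tensor_def inner_vec_def sum_subtractf sum_distrib_left mult_ac)
 ultimately have 0: "(LINT x|lborel. indicator Om x *R (z x * trace (B x)) - indicator Om x *R (l x * (g x \<bullet> X x))) = 0" by simp
 have int: "integrable lborel (%x. indicator Om x *R (m x * h x))"
  if "continuous_on UNIV m" "!!x. rho x >= - dl ==> m x = 0" "continuous_on Om h" for m h :: "real^'n => real"
 proof -
  have "continuous_on UNIV (%x. m x *R ?e h x)" by (rule cutoff_continuous[OF that(1,2) dl that(3)])
  then have "integrable vol (%x. m x *R ?e h x)" by (intro integrable_dom) (auto intro: continuous_on_subset)
  then show ?thesis using open_dom
   by (subst (asm) integrable_restrict_space) (auto elim!: Bochner_Integration.integrable_cong[THEN iffD1, rotated -1] split: split_indicator)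
 qed
 have "(LINT x|lborel. indicator Om x *R (z x * trace (B x))) = (LINT x|lborel. indicator Om x *R (l x * (g x \<bullet> X x)))"
 proof -
  have "continuous_on Om (%x. trace (B x))" "continuous_on Om (%x. g x \<bullet> X x)" unfolding trace_def by (intro continuous_intros B Xc gc)+
  from Bochner_Integration.integral_diff[OF int[OF zc(1) zl0(1) this(1)] int[OF zc(2) zl0(2) this(2)]] show ?thesis using 0 by simp
 qed
 then show ?thesis unfolding integral_vol z_def l_def .
qed

text \<open>A field pointing strictly inward along the boundary has negative total divergence: the
 boundary layer terms of the cut-off identity are negative, and the cut-off tends to one. The
 general case follows by adding a small multiple of \<open>g\<close>.\<close>
lemma divergence_nonpos:
 assumes X: "continuous_on (closure Om) X" and d: "!!x. x : Om ==> (X has_derivative (%h. B x *v h)) (at x)"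
  and B: "continuous_on (closure Om) B" and bd: "!!x. x : frontier Om ==> g x \<bullet> X x <= 0"
 shows "(LINT x|vol. trace (B x)) <= 0"
proof -
 interpret finite_measure vol by (rule finite_vol)
 have tc: "continuous_on S (%x. trace (F x))" if "continuous_on S F" for S and F :: "real^'n => real^'n^'n"
  unfolding trace_def by (intro continuous_intros that)
 have gA: "continuous_on (closure Om) g" "continuous_on (closure Om) A" using g_cont A_cont by (auto intro: continuous_on_subset)
 have strict: "(LINT x|vol. trace (B x) - eta * trace (A x)) <= 0" if eta: "eta > 0" for eta :: real
 proof -
  define F where "F x = B x - eta *R A x" for x
  have F: "continuous_on (closure Om) F" unfolding F_def by (intro continuous_intros B gA)
  have dF: "((%x. X x - eta *R g x) has_derivative (%h. F x *v h)) (at x)" if "x : Om" for x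
   unfolding F_def by (rule has_derivative_eq_rhs, (rule derivative_intros d that rho_deriv)+)
    (simp add: algebra_simps scaleR_matrix_vector_assoc[symmetric])
  obtain m where m: "m > 0" "!!x. x : Om ==> - m < rho x ==> g x \<bullet> (X x - eta *R g x) < 0"
  proof (rule near_boundary[of "%x. g x \<bullet> (X x - eta *R g x)"])
   show "continuous_on (closure Om) (%x. g x \<bullet> (X x - eta *R g x))" by (intro continuous_intros X gA)
   show "g x \<bullet> (X x - eta *R g x) < 0" if "x : frontier Om" for x
   proof -
    have "eta * (g x \<bullet> g x) > 0" using frontier_rho[OF that] eta by simp
    then show ?thesis using bd[OF that] by (simp add: inner_diff_right)
   qed
  qed blast
  define dl where "dl k = m / 2 / real (Suc k)" for k
  let ?z = "%k x. smoothstep ((- rho x - dl k) / dl k)"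
  let ?l = "%k x. smoothstep' ((- rho x - dl k) / dl k) / dl k"
  have dl: "dl k > 0" "dl k <= m / 2" for k using m(1) by (auto simp: dl_def field_simps)
  have neg: "(LINT x|vol. ?z k x * trace (F x)) <= 0" for k
  proof -
   have "0 <= (LINT x|vol. - (?l k x * (g x \<bullet> (X x - eta *R g x))))"
   proof (rule integral_nonneg_AE, rule AE_I2)
    fix x assume "x : space vol"
    then have x: "x : Om" by (simp add: space_vol)
    show "0 <= - (?l k x * (g x \<bullet> (X x - eta *R g x)))"
    proof (cases "- m < rho x")
     case True
     have "0 <= ?l k x" using smoothstep'_bounds(1) dl(1)[of k] by simp
     from mult_nonneg_nonpos[OF this less_imp_le[OF m(2)[OF x True]]] show ?thesis by linarith
    next
     case False
     then have "(- rho x - dl k) / dl k >= 1" using dl[of k] by (simp add: field_simps)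
     then show ?thesis by (simp add: smoothstep'_eq)
    qed
   qed
   then show ?thesis using cutoff_divergence[OF dF continuous_on_subset[OF F closure_subset] dl(1)] by simp
  qed
  have "(%k. LINT x|vol. ?z k x * trace (F x)) ----> (LINT x|vol. trace (F x))"
  proof (rule integral_dominated_convergence[where w="%x. \<bar>trace (F x)\<bar>"])
   show "(%x. trace (F x)) : borel_measurable vol" by (intro vol_measurable tc continuous_on_subset[OF F closure_subset])
   show "(%x. ?z k x * trace (F x)) : borel_measurable vol" for k
    using dl(1)[of k] by (intro vol_measurable continuous_intros tc continuous_on_subset[OF F closure_subset] continuous_on_subset[OF rho_cont]) auto
   show "integrable vol (%x. \<bar>trace (F x)\<bar>)" by (intro integrable_dom continuous_intros tc F)
   show "AE x in vol. norm (?z k x * trace (F x)) <= \<bar>trace (F x)\<bar>" for k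
    using smoothstep_bounds by (auto simp: abs_mult mult_left_le_one_le)
   show "AE x in vol. (%k. ?z k x * trace (F x)) ----> trace (F x)"
   proof (rule AE_I2)
    fix x assume "x : space vol"
    then have r: "rho x < 0" using dom_iff by (simp add: space_vol)
    have "dl ----> m / 2 * 0" unfolding dl_def using tendsto_mult_left[OF LIMSEQ_Suc[OF lim_1_over_n], of "m / 2"] by simp
    then have "\<forall>\<^sub>F k in sequentially. dl k < - rho x / 2" using r by (intro order_tendstoD(2)) auto
    then have "\<forall>\<^sub>F k in sequentially. ?z k x * trace (F x) = trace (F x)"
    proof eventually_elim
     case (elim k)
     then have "(- rho x - dl k) / dl k >= 1" using dl[of k] by (simp add: field_simps)
     then show ?case by (simp add: smoothstep_eq)
    qed
    then show "(%k. ?z k x * trace (F x)) ----> trace (F x)" by (rule tendsto_eventually)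
   qed
  qed
  then have "(LINT x|vol. trace (F x)) <= 0" by (rule LIMSEQ_le_const2) (use neg in auto)
  then show ?thesis by (simp add: F_def trace_def sum_subtractf sum_distrib_left)
 qed
 have "(LINT x|vol. trace (B x)) <= e" if "e > 0" for e :: real
 proof -
  define c where "c = \<bar>LINT x|vol. trace (A x)\<bar> + 1"
  have c: "c > 0" by (simp add: c_def)
  have "(LINT x|vol. trace (B x)) <= e / c * (LINT x|vol. trace (A x))"
   using strict[of "e / c"] c that integrable_dom[OF tc[OF B]] integrable_dom[OF tc[OF gA(2)]] by simp
  also have "... <= e / c * c" using c that by (intro mult_left_mono) (auto simp: c_def)
  finally show ?thesis using c by simp
 qed
 then show ?thesis by (meson dense_ge)
qed

lemma divergence_zero:
 assumes X: "continuous_on (closure Om) X" and d: "!!x. x : Om ==> (X has_derivative (%h. B x *v h)) (at x)"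
  and B: "continuous_on (closure Om) B" and bd: "!!x. x : frontier Om ==> g x \<bullet> X x = 0"
 shows "(LINT x|vol. trace (B x)) = 0"
proof (rule antisym)
 show "(LINT x|vol. trace (B x)) <= 0" using divergence_nonpos[OF X d B] bd by simp
 have "(LINT x|vol. trace (- B x)) <= 0" by (rule divergence_nonpos[where X="%x. - X x"])
   (auto intro!: continuous_intros X B has_derivative_eq_rhs[OF has_derivative_minus[OF d]] simp: bd fun_eq_iff matrix_vector_mult_def vec_eq_iff sum_negf)
 then show "0 <= (LINT x|vol. trace (B x))" by (simp add: trace_def sum_negf)
qed

lemma integral_slices_continuous:
 fixes I :: "real set"
 assumes F: "continuous_on (I \<times> closure Om) (%(t, x). F t x :: real)"
 shows "continuous_on I (%t. LINT x|vol. F t x)" unfolding continuous_on_sequentially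
proof (intro allI ballI impI, elim conjE)
 interpret finite_measure vol by (rule finite_vol)
 fix s t assume s: "t : I" "ALL n. s n : I" "s ----> t"
 let ?K = "insert t (range s)"
 have "compact (?K \<times> closure Om)" by (intro compact_Times compact_sequence_with_limit s compact_closure_dom)
 moreover have "continuous_on (?K \<times> closure Om) (%(t, x). F t x)" by (rule continuous_on_subset[OF F]) (use s in auto)
 ultimately have "bounded ((%(t, x). F t x) ` (?K \<times> closure Om))" by (intro compact_imp_bounded compact_continuous_image)
 then obtain C where C0: "!!z. z : ?K \<times> closure Om ==> norm (case z of (t, x) => F t x) <= C" unfolding bounded_iff by blast
 have C: "\<bar>F r x\<bar> <= C" if "r : ?K" "x : closure Om" for r x using C0[of "(r, x)"] that by simp
 have m: "F r : borel_measurable vol" if "r : I" for r by (intro vol_measurable continuous_on_subset[OF slice_cont[OF F that]] closure_subset)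
 show "((%t. LINT x|vol. F t x) \<circ> s) ----> (LINT x|vol. F t x)" unfolding comp_def
 proof (rule integral_dominated_convergence[where w="%_. C"])
  show "AE x in vol. (%n. F (s n) x) ----> F t x"
  proof (rule AE_I2)
   fix x assume "x : space vol"
   then have x: "x : closure Om" using closure_subset by (auto simp: space_vol)
   have "continuous_on I (%t. F t x)"
    by (rule continuous_on_compose2[OF F, of _ "%t. (t, x)", simplified]) (use x in "auto intro!: continuous_intros")
   then show "(%n. F (s n) x) ----> F t x" using s unfolding continuous_on_sequentially comp_def by blast
  qed
  show "AE x in vol. norm (F (s n) x) <= C" for n using C[of "s n"] subsetD[OF closure_subset, of _ Om] by (auto intro!: AE_I2 simp: space_vol)
 qed (use s m in auto)
qed

lemma integral_slices_derivative:
 assumes F: "continuous_on ({0<..} \<times> closure Om) (%(t, x). F t x :: real)"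
  and G: "continuous_on ({0<..} \<times> closure Om) (%(t, x). G t x)" and t: "t > 0"
  and d: "!!s x. s > 0 ==> x : Om ==> ((%s. F s x) has_real_derivative G s x) (at s)"
 shows "((%s. LINT x|vol. F s x) has_real_derivative (LINT x|vol. G t x)) (at t)" unfolding DERIV_def tendsto_at_iff_sequentially comp_def
proof (intro allI impI)
 interpret finite_measure vol by (rule finite_vol)
 fix h :: "nat => real" assume h: "ALL i. h i : UNIV - {0}" "h ----> 0"
 have "compact ({t/2..2*t} \<times> closure Om)" by (intro compact_Times compact_closure_dom) auto
 moreover have "continuous_on ({t/2..2*t} \<times> closure Om) (%(t, x). G t x)" by (rule continuous_on_subset[OF G]) (use t in auto)
 ultimately have "bounded ((%(t, x). G t x) ` ({t/2..2*t} \<times> closure Om))" by (intro compact_imp_bounded compact_continuous_image)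
 then obtain C where C: "!!r x. t/2 <= r ==> r <= 2 * t ==> x : Om ==> \<bar>G r x\<bar> <= C"
  using closure_subset[of Om] unfolding bounded_iff by force
 define q where "q i x = (if \<bar>h i\<bar> < t/2 then (F (t + h i) x - F t x) / h i else G t x)" for i x
 have ev: "\<forall>\<^sub>F i in sequentially. \<bar>h i\<bar> < t/2" using tendstoD[OF h(2), of "t/2"] t by simp
 have m: "F r : borel_measurable vol" "G r : borel_measurable vol" "integrable vol (F r)" if "r > 0" for r
  using that by (auto intro!: vol_measurable integrable_dom continuous_on_subset[OF slice_cont[OF F]]
   continuous_on_subset[OF slice_cont[OF G]] slice_cont[OF F] intro: subsetD[OF closure_subset])
 have "(%i. LINT x|vol. q i x) ----> (LINT x|vol. G t x)"
 proof (rule integral_dominated_convergence[where w="%_. C"])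
  show "q i : borel_measurable vol" for i using m(1,2) t unfolding q_def[abs_def] by (cases "\<bar>h i\<bar> < t/2") (auto simp: abs_less_iff)
  show "AE x in vol. (%i. q i x) ----> G t x"
  proof (rule AE_I2)
   fix x assume "x : space vol"
   then have "((%h. (F (t + h) x - F t x) / h) ---> G t x) (at 0)" using d[OF t] by (simp add: DERIV_def space_vol)
   then have "(%i. (F (t + h i) x - F t x) / h i) ----> G t x" using h unfolding tendsto_at_iff_sequentially comp_def by blast
   then show "(%i. q i x) ----> G t x" by (rule Lim_transform_eventually) (use ev in eventually_elim, simp add: q_def)
  qed
  show "AE x in vol. norm (q i x) <= C" for i
  proof (rule AE_I2)
   fix x assume "x : space vol"
   then have x: "x : Om" by (simp add: space_vol)
   show "norm (q i x) <= C"
   proof (cases "\<bar>h i\<bar> < t/2")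
    case True
    define a b where "a = min t (t + h i)" and "b = max t (t + h i)"
    have ab: "a < b" "t/2 < a" "b < 2 * t" "b - a = \<bar>h i\<bar>" using True h(1)[rule_format, of i] by (auto simp: a_def b_def)
    have "((%s. F s x) has_real_derivative G r x) (at r)" if "a <= r" "r <= b" for r using d[of r x] x that ab t by simp
    from MVT2[OF ab(1) this] obtain r where r: "a < r" "r < b" "F b x - F a x = (b - a) * G r x" by blast
    have "\<bar>F (t + h i) x - F t x\<bar> = \<bar>F b x - F a x\<bar>" by (auto simp: a_def b_def min_def max_def)
    also have "... = \<bar>h i\<bar> * \<bar>G r x\<bar>" using r ab by (simp add: abs_mult)
    finally have "\<bar>q i x\<bar> = \<bar>G r x\<bar>" using True h(1) by (simp add: q_def)
    then show ?thesis using C[of r x] r ab x by simp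
   next
    case False
    then show ?thesis using C[of t x] t x by (simp add: q_def)
   qed
  qed
 qed (use m t in auto)
 moreover have "\<forall>\<^sub>F i in sequentially. (LINT x|vol. q i x) = ((LINT x|vol. F (t + h i) x) - (LINT x|vol. F t x)) / h i" using ev
 proof eventually_elim
  case (elim i)
  then have "t + h i > 0" using t by linarith
  then show ?case using elim m(3) t by (simp add: q_def)
 qed
 ultimately show "(%i. ((LINT x|vol. F (t + h i) x) - (LINT x|vol. F t x)) / h i) ----> (LINT x|vol. G t x)" by (rule Lim_transform_eventually)
qed

definition edens where "edens t x = eps * (norm (p t x))^2 / 2 + W (u t x) / eps"
definition energy where "energy t = (LINT x|vol. edens t x)"
definition dissip where "dissip t = (LINT x|vol. eps * (ut t x)^2)"

lemma W_cont: "continuous_on S f ==> continuous_on S (%x. W (f x))" "continuous_on S f ==> continuous_on S (%x. W' (f x))"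
 for f :: "'x::topological_space => real"
proof -
 have "continuous_on UNIV W" "continuous_on UNIV W'" using W_deriv by (auto intro!: continuous_at_imp_continuous_on DERIV_isCont)
 then show "continuous_on S f ==> continuous_on S (%x. W (f x))" "continuous_on S f ==> continuous_on S (%x. W' (f x))"
  by (auto intro: continuous_on_compose2)
qed

lemma edens_cont: "continuous_on ({0..} \<times> closure Om) (%(t, x). edens t x)"
 using p_cont u_cont eps_pos unfolding edens_def split_beta by (intro continuous_intros W_cont) auto

lemma dissip_cont: "continuous_on {0<..} dissip"
 unfolding dissip_def[abs_def] using ut_cont by (intro integral_slices_continuous) (auto simp: split_beta intro!: continuous_intros)

lemma slices:
 assumes "t > 0"
 shows "continuous_on (closure Om) (u t)" "continuous_on (closure Om) (p t)" "continuous_on (closure Om) (D t)"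
  "continuous_on (closure Om) (ut t)" "continuous_on (closure Om) (pt t)" "continuous_on (closure Om) (edens t)"
  "continuous_on (closure Om) g" "continuous_on (closure Om) A"
 using slice_cont[OF u_cont, of t] slice_cont[OF p_cont, of t] slice_cont[OF D_cont, of t] slice_cont[OF ut_cont, of t]
  slice_cont[OF pt_cont, of t] slice_cont[OF edens_cont, of t] assms g_cont A_cont by (auto intro: continuous_on_subset)

lemma has_derivative_W: "t > 0 ==> x : Om ==> ((%x. W (u t x)) has_derivative (%h. W' (u t x) * (p t x \<bullet> h))) (at x)"
 using has_derivative_compose[OF u_p has_field_derivative_imp_has_derivative[OF W_deriv(1)]] by simp

text \<open>The energy is differentiated under the integral; the divergence of \<open>eps ut p\<close>, whose flux through
 the boundary vanishes, turns the result into the dissipation.\<close>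
lemma energy_identity:
 assumes t: "t > 0"
 shows "(energy has_real_derivative - dissip t) (at t)"
proof -
 let ?M = "%x. eps *R (tensor (p t x) (pt t x) + ut t x *R D t x)"
 define G where "G t x = eps * (p t x \<bullet> pt t x) + W' (u t x) * ut t x / eps" for t x
 have c0: "continuous_on ({0<..} \<times> closure Om) (%z. p (fst z) (snd z))" "continuous_on ({0<..} \<times> closure Om) (%z. u (fst z) (snd z))"
  using p_cont u_cont by (auto simp: split_beta elim: continuous_on_subset)
 have 1: "(energy has_real_derivative (LINT x|vol. G t x)) (at t)" unfolding energy_def[abs_def]
 proof (rule integral_slices_derivative[OF _ _ t])
  show "continuous_on ({0<..} \<times> closure Om) (%(t, x). edens t x)" using edens_cont by (rule continuous_on_subset) auto
  show "continuous_on ({0<..} \<times> closure Om) (%(t, x). G t x)" unfolding G_def split_beta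
   using c0 pt_cont ut_cont eps_pos by (intro continuous_intros W_cont) (auto simp: split_beta)
  fix s :: real and x assume s: "s > 0" "x : Om"
  have "((%s. p s x \<bullet> p s x) has_real_derivative 2 * (p s x \<bullet> pt s x)) (at s)"
   using has_derivative_inner[OF p_pt[OF s, unfolded has_vector_derivative_def] p_pt[OF s, unfolded has_vector_derivative_def]]
   by (rule has_derivative_imp_has_field_derivative) (simp add: inner_commute algebra_simps)
  then show "((%s. edens s x) has_real_derivative G s x) (at s)"
   unfolding edens_def G_def power2_norm_eq_inner using DERIV_chain2[OF W_deriv(1) u_ut[OF s]] eps_pos by (auto intro!: derivative_eq_intros)
 qed
 have 2: "(LINT x|vol. trace (?M x)) = 0"
 proof (rule divergence_zero[where X="%x. eps *R ut t x *R p t x"])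
  show "continuous_on (closure Om) (%x. eps *R ut t x *R p t x)" by (intro continuous_intros slices t)
  show "continuous_on (closure Om) (%x. ?M x)" by (intro continuous_intros slices t)
  show "g x \<bullet> (eps *R ut t x *R p t x) = 0" if "x : frontier Om" for x using neumann[OF t that] by (simp add: inner_commute)
  show "((%x. eps *R ut t x *R p t x) has_derivative (%h. (?M x) *v h)) (at x)"
   if "x : Om" for x by (rule has_derivative_eq_rhs, (rule derivative_intros ut_pt p_D t that)+)
    (simp add: tensor_mult algebra_simps scaleR_matrix_vector_assoc[symmetric])
 qed
 have "G t x = trace (?M x) - eps * (ut t x)^2" if "x : Om" for x
 proof -
  have "trace (?M x) = eps * (p t x \<bullet> pt t x) + eps * ut t x * trace (D t x)"
   by (simp add: trace_def tensor_def inner_vec_def sum.distrib sum_distrib_left algebra_simps)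
  moreover have "trace (D t x) = ut t x + W' (u t x) / eps^2" using equation[OF t that] by simp
  ultimately show ?thesis unfolding G_def using eps_pos by (simp only:) (simp add: power2_eq_square field_simps)
 qed
 then have "(LINT x|vol. G t x) = (LINT x|vol. trace (?M x) - eps * (ut t x)^2)" by (intro Bochner_Integration.integral_cong) (auto simp: space_vol)
 also have "... = (LINT x|vol. trace (?M x)) - dissip t"
  unfolding dissip_def trace_def by (intro Bochner_Integration.integral_diff integrable_dom continuous_intros slices t)
 finally show ?thesis using 1 2 by simp
qed

text \<open>Gronwall's lemma for the integral of the cubed positive part of \<open>sg u - 1\<close>; the cube is twice
 differentiable.\<close>
lemma phase_bound:
 assumes init: "!!x. x : closure Om ==> \<bar>u 0 x\<bar> <= 1" and W0: "W' 1 = 0" "W' (-1) = 0"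
  and t: "t >= 0" and x: "x : closure Om"
 shows "\<bar>u t x\<bar> <= 1"
proof -
 have "sg * u t x <= 1" if sg: "sg = 1 | sg = -1" for sg :: real
 proof -
  define m where "m s = max 0 (sg * s - 1)" for s
  let ?Z = "%s x. (2 * m (u s x)) *R tensor (p s x) (p s x) + (sg * m (u s x) ^ 2) *R D s x"
  let ?G = "%s x. 3 * m (u s x) ^ 2 * sg * ut s x"
  have lin: "((%s. sg * s - 1) has_real_derivative sg) (at s)" for s by (auto intro!: derivative_eq_intros)
  have d3: "((%s. m s ^ 3) has_real_derivative 3 * m s ^ 2 * sg) (at s)" for s
   unfolding m_def using DERIV_chain2[OF DERIV_max_power[of 1] lin, of s] by (simp add: numeral_3_eq_3 numeral_2_eq_2)
  have d2: "((%s. m s ^ 2) has_real_derivative 2 * m s * sg) (at s)" for s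
   unfolding m_def using DERIV_chain2[OF DERIV_max_power[of 0] lin, of s] by (simp add: numeral_2_eq_2)
  have mc: "continuous_on S (%x. m (f x))" if "continuous_on S f" for S and f :: "'z::topological_space => real"
   unfolding m_def by (intro continuous_intros that)
  have "compact ({0..t} \<times> closure Om)" "continuous_on ({0..t} \<times> closure Om) (%(t, x). u t x)"
   using u_cont by (auto intro!: compact_Times compact_closure_dom elim: continuous_on_subset)
  then have "bounded ((%(t, x). u t x) ` ({0..t} \<times> closure Om))" by (intro compact_imp_bounded compact_continuous_image)
  then obtain R where "ALL w:(%(t, x). u t x) ` ({0..t} \<times> closure Om). norm w <= R" unfolding bounded_iff by blast
  then have R: "norm (u s x) <= R" if "0 <= s" "s <= t" "x : closure Om" for s x using that by force
  have "bounded (W'' ` {- (R + 1)..R + 1})" by (intro compact_imp_bounded compact_continuous_image continuous_on_subset[OF W''_cont]) auto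
  then obtain B where B: "B > 0" "!!s. \<bar>s\<bar> <= R + 1 ==> \<bar>W'' s\<bar> <= B" unfolding bounded_pos by (auto simp: abs_le_iff)
  have W'_le: "- (sg * m s ^ 2 * W' s) <= B * m s ^ 3" if s: "\<bar>s\<bar> <= R" for s
  proof (cases "sg * s > 1")
   case True
   have Wsg: "W' sg = 0" using sg W0 by auto
   have "\<bar>W' s - W' sg\<bar> <= B * \<bar>s - sg\<bar>"
   proof -
    have seg: "r : closed_segment sg s ==> norm (W'' r) <= B" for r
     using sg True s by (intro order_trans[OF _ B(2)]) (auto simp: closed_segment_eq_real_ivl split: if_splits)
    have "norm (W' s - W' sg) <= B * norm (s - sg)" by (rule field_differentiable_bound[where S="closed_segment sg s" and f'=W''])
      (use seg in "auto intro: DERIV_subset[OF W_deriv(2)]")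
    then show ?thesis by simp
   qed
   moreover have "\<bar>s - sg\<bar> = m s" using sg True by (auto simp: m_def)
   ultimately have "\<bar>W' s\<bar> <= B * m s" using Wsg by simp
   then have "\<bar>sg * m s ^ 2\<bar> * \<bar>W' s\<bar> <= m s ^ 2 * (B * m s)" using sg by (intro mult_mono) (auto simp: abs_mult)
   then show ?thesis by (simp add: abs_mult[symmetric] abs_le_iff power3_eq_cube power2_eq_square mult_ac)
  qed (simp add: m_def)
  define A where "A = 3 * B / eps^2"
  define y where "y s = (LINT x|vol. m (u s x) ^ 3)" for s
  have u': "continuous_on ({0<..} \<times> closure Om) (%z. u (fst z) (snd z))" using u_cont by (auto simp: split_beta elim: continuous_on_subset)
  have dy: "(y has_real_derivative (LINT x|vol. ?G s x)) (at s)"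
   and le: "(LINT x|vol. ?G s x) <= A * y s" if s: "0 < s" "s < t" for s
  proof -
   note sl = slices[OF s(1)]
   show "(y has_real_derivative (LINT x|vol. ?G s x)) (at s)" unfolding y_def[abs_def]
   proof (rule integral_slices_derivative[OF _ _ s(1)])
    show "((%r. m (u r x) ^ 3) has_real_derivative ?G r x) (at r)" if "r > 0" "x : Om" for r x by (rule DERIV_chain2[OF d3 u_ut[OF that]])
   qed (use u' ut_cont in "auto intro!: continuous_intros mc simp: split_beta")
   have 0: "(LINT x|vol. trace (?Z s x)) = 0"
   proof (rule divergence_zero[where X="%x. (sg * m (u s x) ^ 2) *R p s x"])
    show "((%x. (sg * m (u s x) ^ 2) *R p s x) has_derivative (%h. (?Z s x) *v h)) (at x)"
     if x: "x : Om" for x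
    proof -
     have "((%x. sg * m (u s x) ^ 2) has_derivative (%h. sg * (2 * m (u s x) * sg * (p s x \<bullet> h)))) (at x)"
      by (rule has_derivative_mult_right[OF has_derivative_compose[OF u_p[OF _ x] d2[unfolded has_field_derivative_def]]]) (use s in simp)
     moreover have "sg * (2 * m (u s x) * sg * c) = 2 * m (u s x) * c" for c using sg by auto
     ultimately have "((%x. sg * m (u s x) ^ 2) has_derivative (%h. 2 * m (u s x) * (p s x \<bullet> h))) (at x)" by simp
     from has_derivative_scaleR[OF this p_D[OF s(1) x]] show ?thesis
      by (rule has_derivative_eq_rhs) (simp add: fun_eq_iff tensor_mult algebra_simps scaleR_matrix_vector_assoc[symmetric])
    qed
    show "g x \<bullet> ((sg * m (u s x) ^ 2) *R p s x) = 0" if "x : frontier Om" for x using neumann[OF s(1) that] by (simp add: inner_commute)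
   qed (intro continuous_intros mc sl)+
   have "?G s x <= A * m (u s x) ^ 3 + 3 * trace (?Z s x)"
    if x: "x : Om" for x
   proof -
    have "\<bar>u s x\<bar> <= R" using R[of s x] s x closure_subset by auto
    from divide_right_mono[OF mult_left_mono[OF W'_le[OF this], of 3], of "eps^2"]
    have "- (3 * m (u s x) ^ 2 * sg * (W' (u s x) / eps^2)) <= A * m (u s x) ^ 3" by (simp add: A_def mult_ac)
    moreover have "0 <= 6 * m (u s x) * (p s x \<bullet> p s x)" by (simp add: m_def)
    moreover have "3 * trace (?Z s x) =
      6 * m (u s x) * (p s x \<bullet> p s x) + 3 * m (u s x) ^ 2 * sg * trace (D s x)"
     by (simp add: trace_def tensor_def inner_vec_def sum.distrib sum_distrib_left mult_ac)
    ultimately show ?thesis unfolding equation[OF s(1) x] by (simp add: right_diff_distrib)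
   qed
   then have 1: "(LINT x|vol. ?G s x) <= (LINT x|vol. A * m (u s x) ^ 3 + 3 * trace (?Z s x))"
    unfolding trace_def by (intro integral_mono integrable_dom continuous_intros mc sl) (simp add: space_vol)
   have "(LINT x|vol. A * m (u s x) ^ 3 + 3 * trace (?Z s x)) = A * y s + 3 * (LINT x|vol. trace (?Z s x))"
    unfolding y_def integral_mult_right_zero[symmetric] trace_def by (intro Bochner_Integration.integral_add integrable_dom continuous_intros mc sl)
   with 1 0 show "(LINT x|vol. ?G s x) <= A * y s" by simp
  qed
  have yc: "continuous_on {0..} y" unfolding y_def[abs_def]
   using u_cont by (intro integral_slices_continuous) (auto intro!: continuous_intros mc simp: split_beta)
  have "- (exp (- A * 0) * y 0) <= - (exp (- A * t) * y t)"
  proof (rule DERIV_nonneg_imp_increasing_open[OF t])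
   show "continuous_on {0..t} (%s. - (exp (- A * s) * y s))" by (intro continuous_intros continuous_on_subset[OF yc]) auto
   fix s assume s: "0 < s" "s < t"
   have "((%s. - (exp (- A * s) * y s)) has_real_derivative
     exp (- A * s) * (A * y s - (LINT x|vol. ?G s x))) (at s)" by (auto intro!: derivative_eq_intros dy[OF s] simp: algebra_simps)
   moreover have "0 <= exp (- A * s) * (A * y s - (LINT x|vol. ?G s x))" using le[OF s] by simp
   ultimately show "EX d. ((%s. - (exp (- A * s) * y s)) has_real_derivative d) (at s) & 0 <= d" by blast
  qed
  moreover have "y 0 = 0"
  proof -
   have "m (u 0 x) = 0" if "x : Om" for x using init[OF subsetD[OF closure_subset that]] sg by (auto simp: m_def abs_le_iff)
   then have "y 0 = (LINT x|vol. 0)" unfolding y_def by (intro Bochner_Integration.integral_cong) (auto simp: space_vol)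
   then show ?thesis by simp
  qed
  ultimately have "y t <= 0" by (simp add: mult_le_0_iff)
  have ct: "continuous_on (closure Om) (u t)" using slice_cont[OF u_cont, of t] t by auto
  have "AE x in vol. m (u t x) ^ 3 = 0"
  proof -
   have i: "integrable vol (%x. m (u t x) ^ 3)" by (intro integrable_dom continuous_intros mc ct)
   have nn: "AE x in vol. 0 <= m (u t x) ^ 3" by (simp add: m_def)
   from integral_nonneg_eq_0_iff_AE[OF i nn] integral_nonneg_AE[OF nn] \<open>y t <= 0\<close> show ?thesis by (simp add: y_def)
  qed
  then have "AE x in lborel. x : Om --> sg * u t x <= 1"
   using open_dom by (subst (asm) AE_restrict_space_iff) (auto simp: m_def elim!: eventually_mono)
  then show ?thesis by (rule AE_le_on_closure[OF open_dom _ _ x, rotated]) (intro continuous_intros ct)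
 qed
 from this[of 1] this[of "-1"] show ?thesis by simp
qed

lemma dissip_nonneg: "dissip t >= 0"
 unfolding dissip_def using eps_pos by (intro integral_nonneg_AE) auto

lemma energy_le:
 assumes "0 <= s" "s <= t"
 shows "energy t <= energy s"
proof -
 have "continuous_on {0..} energy" unfolding energy_def[abs_def] by (rule integral_slices_continuous[OF edens_cont])
 then have "continuous_on {s..t} energy" by (rule continuous_on_subset) (use assms in auto)
 then have c: "continuous_on {s..t} (%t. - energy t)" by (rule continuous_on_minus)
 have "- energy s <= - energy t"
 proof (rule DERIV_nonneg_imp_increasing_open[OF assms(2) _ c])
  fix r assume "s < r" "r < t"
  then have "((%t. - energy t) has_real_derivative dissip r) (at r)" using DERIV_minus[OF energy_identity[of r]] assms by simp
  then show "EX y. ((%t. - energy t) has_real_derivative y) (at r) & 0 <= y" using dissip_nonneg by blast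
 qed
 then show ?thesis by simp
qed

lemma dissipation_bound:
 assumes W0: "!!s. W s >= 0"
 shows "(\<integral>\<^sup>+t\<in>{0<..tau}. ennreal (dissip t) \<partial>lborel) <= ennreal (energy 0)"
proof -
 have en: "energy t >= 0" for t
  unfolding energy_def edens_def using eps_pos W0 by (intro integral_nonneg_AE) (auto intro!: always_eventually add_nonneg_nonneg)
 have [measurable]: "(%t. indicator {0<..} t * dissip t) : borel_measurable borel"
  using borel_measurable_continuous_on_indicator[OF _ dissip_cont] by simp
 define a where "a k = 1 / real (Suc k)" for k
 have "(\<integral>\<^sup>+t\<in>{a k..tau}. ennreal (dissip t) \<partial>lborel) <= ennreal (energy 0)" for k
 proof (cases "a k <= tau")
  case True
  have a: "a k > 0" by (simp add: a_def)
  have "(\<integral>\<^sup>+t. ennreal (indicator {0<..} t * dissip t) * indicator {a k..tau} t \<partial>lborel) = ennreal (- energy tau - (- energy (a k)))"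
   by (rule nn_integral_FTC_Icc[OF _ _ _ True])
    (use a in "auto simp: dissip_nonneg intro!: derivative_eq_intros DERIV_subset[OF energy_identity]")
  also have "... <= ennreal (energy 0)" using energy_le[of 0 "a k"] a en[of tau] by (intro ennreal_leI) simp
  finally show ?thesis using a by (subst (asm) nn_integral_cong[where v="%t. ennreal (dissip t) * indicator {a k..tau} t"]) (auto split: split_indicator)
 qed simp
 moreover have "(\<integral>\<^sup>+t\<in>{0<..tau}. ennreal (dissip t) \<partial>lborel) = (SUP k. \<integral>\<^sup>+t\<in>{a k..tau}. ennreal (dissip t) \<partial>lborel)"
 proof -
  have "(\<integral>\<^sup>+t\<in>{0<..tau}. ennreal (dissip t) \<partial>lborel) = (\<integral>\<^sup>+t. (SUP k. ennreal (indicator {0<..} t * dissip t) * indicator {a k..tau} t) \<partial>lborel)"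
  proof (intro nn_integral_cong)
   fix t :: real
   show "ennreal (dissip t) * indicator {0<..tau} t = (SUP k. ennreal (indicator {0<..} t * dissip t) * indicator {a k..tau} t)"
   proof (cases "0 < t & t <= tau")
    case True
    then obtain k where "a k < t" using reals_Archimedean[of t] by (auto simp: a_def inverse_eq_divide)
    then show ?thesis using True by (intro antisym SUP_least SUP_upper2[of k]) (auto split: split_indicator)
   next
    case False
    then have "a k <= t ==> t <= tau ==> False" for k
      proof -
       assume "a k <= t" "t <= tau"
       moreover have "a k > 0" by (simp add: a_def)
       ultimately show False using False by simp
      qed
    then show ?thesis using False by (auto simp: indicator_def)
   qed
  qed
  also have "... = (SUP k. \<integral>\<^sup>+t. ennreal (indicator {0<..} t * dissip t) * indicator {a k..tau} t \<partial>lborel)"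
  proof (rule nn_integral_monotone_convergence_SUP)
   have "a j <= a i" if "i <= j" for i j using that unfolding a_def by (intro divide_left_mono) auto
   then show "incseq (%k t. ennreal (indicator {0<..} t * dissip t) * indicator {a k..tau} t)"
    by (intro monoI le_funI mult_left_mono) (auto split: split_indicator intro: order_trans)
  qed measurable
  also have "... = (SUP k. \<integral>\<^sup>+t\<in>{a k..tau}. ennreal (dissip t) \<partial>lborel)"
  proof (intro SUP_cong refl nn_integral_cong)
   fix k t have "a k > 0" by (simp add: a_def)
   then show "ennreal (indicator {0<..} t * dissip t) * indicator {a k..tau} t = ennreal (dissip t) * indicator {a k..tau} t"
    by (auto split: split_indicator)
  qed
  finally show ?thesis .
 qed
 ultimately show ?thesis by (simp add: SUP_least)
qed

end

section \<open>First variation and discrepancy at a fixed time\<close>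

context neumann_solution begin

definition stress where "stress t x = edens t x *R mat 1 - eps *R tensor (p t x) (p t x)"

lemma W_over_eps: "(!!s. W s >= 0) ==> eps * (norm (p t x))^2 <= 2 * edens t x" "(!!s. W s >= 0) ==> edens t x >= 0"
 unfolding edens_def using eps_pos by (auto intro!: add_nonneg_nonneg divide_nonneg_pos)

text \<open>The divergence of the stress is \<open>- eps ut p\<close>, and the flux through the boundary is the
 energy density times the normal part of \<open>h\<close>, by the Neumann condition.\<close>
lemma stress_flux:
 assumes t: "t > 0" and h: "continuous_on (closure Om) h" "continuous_on (closure Om) J"
  and d: "!!x. x : Om ==> (h has_derivative (%v. J x *v v)) (at x)"
  and bd: "!!x. x : frontier Om ==> g x \<bullet> h x <= 0" and W0: "!!s. W s >= 0"
 shows "(LINT x|vol. stress t x \<bullet> J x - eps * ut t x * (p t x \<bullet> h x)) <= 0"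
proof -
 define e' where "e' x = eps *R (D t x *v p t x) + (W' (u t x) / eps) *R p t x" for x
 define X where "X x = edens t x *R h x - (eps * (p t x \<bullet> h x)) *R p t x" for x
 define B where "B x = tensor (h x) (e' x) + edens t x *R J x
  - eps *R (tensor (p t x) (h x v* D t x + p t x v* J x) + (p t x \<bullet> h x) *R D t x)" for x
 note sl = slices[OF t]
 have mv: "continuous_on (closure Om) (%x. F x *v f x)" if "continuous_on (closure Om) F" "continuous_on (closure Om) f"
  for F :: "real^'n => real^'n^'n" and f unfolding matrix_vector_mult_def by (intro continuous_intros that)
 have vm: "continuous_on (closure Om) (%x. f x v* F x)" if "continuous_on (closure Om) F" "continuous_on (closure Om) f"
  for F :: "real^'n => real^'n^'n" and f unfolding vector_matrix_mult_def by (intro continuous_intros that)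
 have "(LINT x|vol. trace (B x)) <= 0"
 proof (rule divergence_nonpos[where X=X])
  show "continuous_on (closure Om) X" unfolding X_def by (intro continuous_intros sl h)
  show "continuous_on (closure Om) B" unfolding B_def e'_def using eps_pos by (intro continuous_intros sl h mv vm W_cont) auto
  show "g x \<bullet> X x <= 0" if "x : frontier Om" for x using neumann[OF t that] bd[OF that] W_over_eps(2)[OF W0, of t x]
   by (simp add: X_def inner_diff_right inner_commute[of "g x" "p t x"] mult_nonneg_nonpos)
  fix x assume x: "x : Om"
  have pp: "((%x. p t x \<bullet> p t x) has_derivative (%v. 2 * (p t x \<bullet> (D t x *v v)))) (at x)"
   by (rule has_derivative_eq_rhs[OF has_derivative_inner[OF p_D[OF t x] p_D[OF t x]]]) (simp add: inner_commute fun_eq_iff)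
  have sym: "(D t x *v v) \<bullet> w = v \<bullet> (D t x *v w)" for v w
   using dot_lmul_matrix[of v "D t x" w] transpose_matrix_vector[of "D t x" v] D_sym[OF t x] by simp
  have de: "(edens t has_derivative (%v. e' x \<bullet> v)) (at x)"
  proof -
   have "((%x. eps / 2 * (p t x \<bullet> p t x) + 1 / eps * W (u t x)) has_derivative
     (%v. eps / 2 * (2 * (p t x \<bullet> (D t x *v v))) + 1 / eps * (W' (u t x) * (p t x \<bullet> v)))) (at x)"
    by (intro has_derivative_add has_derivative_mult_right pp has_derivative_W t x)
   moreover have "edens t = (%x. eps / 2 * (p t x \<bullet> p t x) + 1 / eps * W (u t x))" by (simp add: fun_eq_iff edens_def power2_norm_eq_inner)
   ultimately show ?thesis by (auto simp: e'_def inner_add_left sym elim: has_derivative_eq_rhs)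
  qed
  show "(X has_derivative (%v. B x *v v)) (at x)" unfolding X_def by (rule has_derivative_eq_rhs, (rule derivative_intros de d[OF x] p_D[OF t x])+)
    (auto simp: fun_eq_iff B_def tensor_mult algebra_simps scaleR_matrix_vector_assoc[symmetric] inner_commute[of "D t x *v _" "h x"]
     dot_lmul_matrix inner_add_left)
 qed
 also have "(LINT x|vol. trace (B x)) = (LINT x|vol. stress t x \<bullet> J x - eps * ut t x * (p t x \<bullet> h x))"
 proof (intro Bochner_Integration.integral_cong refl)
  fix x assume "x : space vol"
  then have x: "x : Om" by (simp add: space_vol)
  have tt: "trace (tensor v w) = v \<bullet> w" for v w :: "real^'n" by (simp add: trace_def tensor_def inner_vec_def)
  have ta: "trace (P + Q) = trace P + trace Q" "trace (P - Q) = trace P - trace Q" "trace (c *R P) = c * trace P"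
   for P Q :: "real^'n^'n" and c by (simp_all add: trace_def sum.distrib sum_subtractf sum_distrib_left)
  have ti: "v \<bullet> (w v* M) = w \<bullet> (M *v v)" for v w :: "real^'n" and M :: "real^'n^'n" by (simp add: inner_commute[of v] dot_lmul_matrix)
have "trace (J x) = J x \<bullet> mat 1" by (simp add: trace_def inner_vec_def mat_def if_distrib[of "%c. _ * c"] cong: if_cong)
  then have "stress t x \<bullet> J x = edens t x * trace (J x) - eps * (p t x \<bullet> (J x *v p t x))"
   by (simp add: stress_def inner_commute[of _ "J x"] inner_diff_right inner_tensor)
  moreover have "trace (D t x) = ut t x + W' (u t x) / eps^2" using equation[OF t x] by simp
  ultimately show "trace (B x) = stress t x \<bullet> J x - eps * ut t x * (p t x \<bullet> h x)" unfolding B_def e'_def using eps_pos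
   by (simp only: ta tt ti inner_add_right) (simp add: inner_commute[of "h x" "p t x"] field_simps power2_eq_square)
 qed
 finally show ?thesis .
qed

text \<open>Subtracting \<open>G / c0\<close> times the extended normal field \<open>g\<close> from \<open>h\<close> makes the boundary flux
 nonpositive, and the stress tested with \<open>g\<close> itself is at most a multiple of the energy. The lower
 bound follows with \<open>- h\<close>.\<close>
lemma first_variation_bound:
 assumes t: "t > 0" and W0: "!!s. W s >= 0"
  and geo: "!!x. x : closure Om ==> norm (g x) <= Crho" "!!x. x : closure Om ==> \<bar>trace (A x)\<bar> <= Ct"
   "!!x v. x : closure Om ==> norm (A x *v v) <= CA * norm v"
  and c0: "c0 > 0" "!!x. x : frontier Om ==> c0 <= norm (g x)"
  and h: "continuous_on (closure Om) h" "continuous_on (closure Om) J"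
   "!!x. x : Om ==> (h has_derivative (%v. J x *v v)) (at x)"
  and G: "!!x. x : closure Om ==> norm (h x) <= G" "G >= 0"
 shows "\<bar>LINT x|vol. stress t x \<bullet> J x\<bar> <= G * (1 + (Ct + 2 * CA + Crho) / c0) * (energy t + dissip t)"
proof -
 define K where "K = 1 + (Ct + 2 * CA + Crho) / c0"
 note sl = slices[OF t]
 have one: "(LINT x|vol. stress t x \<bullet> J x) <= G * K * (energy t + dissip t)"
  if h: "continuous_on (closure Om) h" "continuous_on (closure Om) J"
   "!!x. x : Om ==> (h has_derivative (%v. J x *v v)) (at x)" and G: "!!x. x : closure Om ==> norm (h x) <= G" for h J
 proof -
  define c where "c = G / c0"
  have c: "c >= 0" using G(1) assms(12) c0 by (simp add: c_def)
  define H where "H x = h x - c *R g x" for x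
  define L where "L x = J x - c *R A x" for x
  have Hc: "continuous_on (closure Om) H" "continuous_on (closure Om) L" unfolding H_def L_def by (intro continuous_intros h sl)+
  have 1: "(LINT x|vol. stress t x \<bullet> L x - eps * ut t x * (p t x \<bullet> H x)) <= 0"
  proof (rule stress_flux[OF t Hc _ _ W0])
   show "(H has_derivative (%v. L x *v v)) (at x)" if "x : Om" for x
    unfolding H_def L_def by (rule has_derivative_eq_rhs, (rule derivative_intros h(3)[OF that] rho_deriv)+)
     (simp add: algebra_simps scaleR_matrix_vector_assoc[symmetric])
   show "g x \<bullet> H x <= 0" if x: "x : frontier Om" for x
   proof -
    have "g x \<bullet> h x <= norm (g x) * G"
     using norm_cauchy_schwarz[of "g x" "h x"] mult_left_mono[OF G[of x] norm_ge_zero[of "g x"]] x closure_cases[of x] by force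
    also have "... = c0 * (c * norm (g x))" using c0 by (simp add: c_def)
    also have "... <= norm (g x) * (c * norm (g x))" using c c0(2)[OF x] by (intro mult_right_mono) auto
    finally show ?thesis by (simp add: H_def inner_diff_right dot_square_norm power2_eq_square mult_ac)
   qed
  qed
  have pt: "stress t x \<bullet> J x <= (stress t x \<bullet> L x - eps * ut t x * (p t x \<bullet> H x)) + G * K * (edens t x + eps * (ut t x)^2)" if x: "x : Om" for x
  proof -
   have xc: "x : closure Om" using x closure_subset by auto
   define e where "e = edens t x"
   define d where "d = eps * (ut t x)^2"
   have e: "eps * (norm (p t x))^2 <= 2 * e" "e >= 0" "d >= 0" using W_over_eps[OF W0] eps_pos by (auto simp: e_def d_def)
   have cross: "\<bar>eps * ut t x * (p t x \<bullet> v)\<bar> <= r * (e + d)" if "norm v <= r" for v r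
   proof -
    have r: "r >= 0" using norm_ge_zero[of v] that by linarith
    have "\<bar>eps * ut t x * (p t x \<bullet> v)\<bar> <= eps * \<bar>ut t x\<bar> * (norm (p t x) * norm v)"
     using eps_pos Cauchy_Schwarz_ineq2[of "p t x" v] by (simp add: abs_mult mult_left_mono)
    also have "... <= eps * \<bar>ut t x\<bar> * (norm (p t x) * r)" using that eps_pos by (intro mult_left_mono) auto
    also have "... = r * (eps * (\<bar>ut t x\<bar> * norm (p t x)))" by simp
    also have "... <= r * (eps * (((norm (p t x))^2 + (ut t x)^2) / 2))" using sum_squares_bound[of "\<bar>ut t x\<bar>" "norm (p t x)"] eps_pos r
     by (intro mult_left_mono) auto
    also have "... <= r * (e + d)"
    proof (rule mult_left_mono[OF _ r])
     have "eps * (((norm (p t x))^2 + (ut t x)^2) / 2) = (eps * (norm (p t x))^2 + d) / 2" by (simp add: d_def algebra_simps)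
     also have "... <= e + d" using e by argo
     finally show "eps * (((norm (p t x))^2 + (ut t x)^2) / 2) <= e + d" .
    qed
    finally show ?thesis .
   qed
   have "stress t x \<bullet> A x <= (Ct + 2 * CA) * e"
   proof -
    have "\<bar>p t x \<bullet> (A x *v p t x)\<bar> <= norm (p t x) * (CA * norm (p t x))"
     by (rule order_trans[OF Cauchy_Schwarz_ineq2]) (intro mult_left_mono geo(3) xc, simp)
    then have "eps * - (p t x \<bullet> (A x *v p t x)) <= eps * (CA * (norm (p t x))^2)"
     using eps_pos by (intro mult_left_mono) (auto simp: power2_eq_square mult_ac)
    also have "... = CA * (eps * (norm (p t x))^2)" by simp
    also have "... <= CA * (2 * e)"
    proof (rule mult_left_mono[OF e(1)])
     have "0 <= norm (A x *v axis undefined 1)" by simp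
     also have "... <= CA" using geo(3)[OF xc, of "axis undefined 1"] by simp
     finally show "0 <= CA" .
    qed
    finally have 2: "- (eps * (p t x \<bullet> (A x *v p t x))) <= CA * (2 * e)" by simp
    have 3: "e * trace (A x) <= e * Ct" using geo(2)[OF xc] e by (intro mult_left_mono) auto
    have "trace (A x) = A x \<bullet> mat 1" by (simp add: trace_def inner_vec_def mat_def if_distrib[of "%c. _ * c"] cong: if_cong)
    then have "stress t x \<bullet> A x = e * trace (A x) - eps * (p t x \<bullet> (A x *v p t x))"
     by (simp add: stress_def e_def inner_commute[of _ "A x"] inner_diff_right inner_tensor)
    then show ?thesis using 2 3 by (simp add: algebra_simps)
   qed
   then have "c * (stress t x \<bullet> A x) <= c * ((Ct + 2 * CA) * (e + d))"
   proof -
    have "0 <= Ct + 2 * CA"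
    proof -
     have "0 <= norm (A x *v axis undefined 1)" by simp
     also have "... <= CA" using geo(3)[OF xc, of "axis undefined 1"] by simp
     finally show ?thesis using geo(2)[OF xc] by simp
    qed
    then have "(Ct + 2 * CA) * e <= (Ct + 2 * CA) * (e + d)" using e by (intro mult_left_mono) auto
    then show ?thesis using \<open>stress t x \<bullet> A x <= _\<close> c by (intro mult_left_mono) auto
   qed
   moreover have "c * - (eps * ut t x * (p t x \<bullet> g x)) <= c * (Crho * (e + d))" using cross[OF geo(1)[OF xc]] c by (intro mult_left_mono) auto
   moreover have "eps * ut t x * (p t x \<bullet> h x) <= G * (e + d)" using cross[OF G[OF xc]] by simp
   moreover have "G * K * (e + d) = G * (e + d) + c * ((Ct + 2 * CA) * (e + d)) + c * (Crho * (e + d))"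
    using c0 by (simp add: K_def c_def field_simps)
   ultimately show ?thesis by (simp add: e_def[symmetric] d_def[symmetric] L_def H_def inner_diff_right algebra_simps)
  qed
  have sc: "continuous_on (closure Om) (stress t)" unfolding stress_def by (intro continuous_intros sl)
  have "(LINT x|vol. stress t x \<bullet> J x) <= (LINT x|vol. (stress t x \<bullet> L x - eps * ut t x * (p t x \<bullet> H x)) + G * K * (edens t x + eps * (ut t x)^2))"
   by (intro integral_mono integrable_dom continuous_intros sl h sc Hc) (use pt in "simp add: space_vol")
  also have "... = (LINT x|vol. stress t x \<bullet> L x - eps * ut t x * (p t x \<bullet> H x)) + (LINT x|vol. G * K * (edens t x + eps * (ut t x)^2))"
   by (intro Bochner_Integration.integral_add integrable_dom continuous_intros sl sc Hc)
  also have "(LINT x|vol. G * K * (edens t x + eps * (ut t x)^2)) = G * K * (energy t + dissip t)"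
   unfolding energy_def dissip_def integral_mult_right_zero
   by (subst Bochner_Integration.integral_add) (auto intro!: integrable_dom continuous_intros sl)
  finally show ?thesis using 1 by linarith
 qed
 have "(LINT x|vol. stress t x \<bullet> - J x) <= G * K * (energy t + dissip t)" by (rule one[where h="%x. - h x"])
   (auto intro!: continuous_intros h has_derivative_eq_rhs[OF has_derivative_minus[OF h(3)]] simp: G fun_eq_iff matrix_vector_mult_def vec_eq_iff sum_negf)
 then show ?thesis using one[OF h G(1)] by (simp add: K_def abs_le_iff)
qed

end

text \<open>A test function of \<open>u\<close>: a nonnegative multiple of \<open>gm - s\<close>, so that \<open>phi W' \<ge> 0\<close>. It is of size
 \<open>dl\<close> and vanishes at the wells, next to which it is steep; elsewhere it decreases at most at rate
 of order \<open>dl\<close>.\<close>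
lemma transition_profile:
 fixes gm dl s :: real
 defines "phi \<equiv> %s. dl * (gm - s) * ((1 - s^2) / (1 - s^2 + dl))"
  and "phi' \<equiv> 2 * dl^2 * (s * (s - gm)) / (1 - s^2 + dl)^2 - dl * ((1 - s^2) / (1 - s^2 + dl))"
 assumes gm: "-1 < gm" "gm < 1" and dl: "0 < dl" "dl <= (1 - \<bar>gm\<bar>) / 16" and s: "\<bar>s\<bar> <= 1"
 shows "(phi has_real_derivative phi') (at s)" "\<bar>phi s\<bar> <= 2 * dl"
  "- (1 + 2 / (1 - gm^2)^2) * dl <= phi'" "1 - s^2 <= dl ==> (1 - \<bar>gm\<bar>) / 16 <= phi'"
proof -
 define y where "y = 1 - s^2"
 have s2: "s^2 <= 1" using s by (simp add: abs_square_le_1)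
 then have y: "0 <= y" "y <= 1" by (auto simp: y_def)
 have yd: "y + dl > 0" using y dl by simp
 show "(phi has_real_derivative phi') (at s)"
 proof -
  have "((%s. (1 - s^2) / (1 - s^2 + dl)) has_real_derivative
    ((- (2 * s)) * (1 - s^2 + dl) - (1 - s^2) * (- (2 * s))) / ((1 - s^2 + dl) * (1 - s^2 + dl))) (at s)"
   using yd by (intro DERIV_divide) (auto intro!: derivative_eq_intros simp: y_def)
  also have "((- (2 * s)) * (1 - s^2 + dl) - (1 - s^2) * (- (2 * s))) / ((1 - s^2 + dl) * (1 - s^2 + dl)) = - 2 * s * dl / (1 - s^2 + dl)^2"
   by (simp add: algebra_simps power2_eq_square)
  finally have q: "((%s. (1 - s^2) / (1 - s^2 + dl)) has_real_derivative - 2 * s * dl / (1 - s^2 + dl)^2) (at s)" .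
  have "((%s. dl * (gm - s)) has_real_derivative - dl) (at s)" by (auto intro!: derivative_eq_intros)
  moreover have "- dl * ((1 - s^2) / (1 - s^2 + dl)) + - 2 * s * dl / (1 - s^2 + dl)^2 * (dl * (gm - s)) = phi'"
  proof -
   have "- 2 * s * dl * (dl * (gm - s)) = 2 * dl^2 * (s * (s - gm))" by (simp add: algebra_simps power2_eq_square)
   then show ?thesis by (simp only: times_divide_eq_left phi'_def)
  qed
  ultimately show ?thesis using DERIV_mult[of "%s. dl * (gm - s)" "- dl" s UNIV, OF _ q] unfolding phi_def by simp
 qed
 have q: "0 <= y / (y + dl)" "y / (y + dl) <= 1" using y dl by auto
 have "\<bar>phi s\<bar> = dl * \<bar>gm - s\<bar> * (y / (y + dl))"
  unfolding phi_def y_def[symmetric] by (simp only: abs_mult abs_of_nonneg[OF q(1)] abs_of_pos[OF dl(1)])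
 also have "... <= dl * 2 * 1" using gm s dl q by (intro mult_mono) auto
 finally show "\<bar>phi s\<bar> <= 2 * dl" by simp
 have t1: "dl * (y / (y + dl)) <= dl" using mult_left_mono[OF q(2), of dl] dl by simp
 have ph: "phi' = 2 * dl^2 * (s * (s - gm)) / (y + dl)^2 - dl * (y / (y + dl))" by (simp add: phi'_def y_def)
 have g2: "gm^2 < 1" using gm by (simp add: abs_square_less_1 abs_less_iff)
 show "- (1 + 2 / (1 - gm^2)^2) * dl <= phi'"
 proof (cases "s * (s - gm) >= 0")
  case True
  then have "0 <= 2 * dl^2 * (s * (s - gm)) / (y + dl)^2" using mult_nonneg_nonneg[OF _ True, of "2 * dl^2"] by (intro divide_nonneg_nonneg) auto
  moreover have "0 <= 2 / (1 - gm^2)^2 * dl" using dl by auto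
  ultimately show ?thesis using t1 by (simp add: ph algebra_simps)
 next
  case False
  then have "s^2 <= gm^2" by (intro abs_le_square_iff[THEN iffD1]) (auto simp: not_le mult_less_0_iff)
  then have b: "1 - gm^2 <= y + dl" using dl by (simp add: y_def)
  have "- (s * (s - gm)) <= 1"
  proof -
   have "s * gm <= \<bar>s * gm\<bar>" by simp
   also have "... <= 1 * 1" unfolding abs_mult using s gm by (intro mult_mono) auto
   finally show ?thesis by (simp add: algebra_simps power2_eq_square[symmetric]) (smt (verit) zero_le_power2)
  qed
  then have "2 * dl^2 * - (s * (s - gm)) / (y + dl)^2 <= 2 * dl^2 * 1 / (1 - gm^2)^2"
   using False b g2 by (intro frac_le mult_left_mono power_mono) auto
  also have "... <= 2 * dl / (1 - gm^2)^2" using dl gm by (intro divide_right_mono) (auto simp: power2_eq_square)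
  finally have "- (2 * dl^2 * (s * (s - gm)) / (y + dl)^2) <= 2 * dl / (1 - gm^2)^2" by (simp only: mult_minus_right minus_divide_left[symmetric])
  moreover have "(1 + 2 / (1 - gm^2)^2) * dl = dl + 2 * dl / (1 - gm^2)^2" by (simp add: algebra_simps)
  ultimately show ?thesis using t1 unfolding ph by linarith
 qed
 assume "1 - s^2 <= dl"
 then have yl: "y <= dl" by (simp add: y_def)
 define a where "a = (1 + \<bar>gm\<bar>) / 2"
 have a: "1/2 <= a" "a <= 1" using gm by (auto simp: a_def)
 have "a^2 <= a" using a by (simp add: power2_eq_square mult_left_le)
 also have "... <= 1 - dl" using dl(2) gm by (simp add: a_def field_simps)
 also have "... <= s^2" using yl by (simp add: y_def)
 finally have sa: "a <= \<bar>s\<bar>" using a abs_le_square_iff[of a s] by simp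
 have "(1 - \<bar>gm\<bar>) / 4 <= \<bar>s\<bar> * (\<bar>s\<bar> - \<bar>gm\<bar>)"
 proof -
  have "1/2 * ((1 - \<bar>gm\<bar>) / 2) <= \<bar>s\<bar> * (\<bar>s\<bar> - \<bar>gm\<bar>)" using sa a gm by (intro mult_mono) (auto simp: a_def)
  then show ?thesis by simp
 qed
 also have "... <= s * (s - gm)" using abs_ge_self[of "s * gm"] by (simp add: right_diff_distrib abs_mult)
 finally have n: "(1 - \<bar>gm\<bar>) / 4 <= s * (s - gm)" .
 have "(1 - \<bar>gm\<bar>) / 8 = 2 * dl^2 * ((1 - \<bar>gm\<bar>) / 4) / (dl + dl)^2" using dl by (simp add: power2_eq_square)
 also have "... <= 2 * dl^2 * (s * (s - gm)) / (y + dl)^2" using n yl y yd gm by (intro frac_le mult_left_mono power_mono) auto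
 finally show "(1 - \<bar>gm\<bar>) / 16 <= phi'" using t1 dl(2) by (simp add: ph)
qed

context neumann_solution begin

text \<open>Where \<open>1 - s\<^sup>2 \<ge> dl\<close>, the gradient bound is relative to \<open>W \<ge> w\<close>. Close to the wells the gradient
 energy is bounded by testing the equation with \<open>transition_profile\<close> of \<open>u\<close>.\<close>
lemma discrepancy_bound:
 assumes t: "t > 0" and ub: "!!x. x : closure Om ==> \<bar>u t x\<bar> <= 1"
  and grad: "!!x. x : closure Om ==> eps^2 * (norm (p t x))^2 / 2 <= W (u t x) + kp" and kp: "kp >= 0"
  and W0: "!!s. W s >= 0" and gm: "-1 < gm" "gm < 1" and W_sign: "!!s. \<bar>s\<bar> <= 1 ==> W' s * (gm - s) >= 0"
  and dl: "0 < dl" "dl <= (1 - \<bar>gm\<bar>) / 16" and w: "w > 0" "!!s. \<bar>s\<bar> <= 1 ==> 1 - s^2 >= dl ==> W s >= w"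
 shows "(LINT x|vol. max 0 (eps * (norm (p t x))^2 / 2 - W (u t x) / eps)) <=
  dl * (8 / (1 - \<bar>gm\<bar>)) * (eps * measure vol Om + dissip t + 2 * (1 + 2 / (1 - gm^2)^2) * energy t) + kp / w * energy t"
proof -
 interpret finite_measure vol by (rule finite_vol)
 define C0 where "C0 = 1 + 2 / (1 - gm^2)^2"
 define c where "c = 8 / (1 - \<bar>gm\<bar>)"
 have c: "c > 0" "c * ((1 - \<bar>gm\<bar>) / 16) = 1/2" using gm by (auto simp: c_def)
 have C0: "C0 >= 0" by (simp add: C0_def)
 define phi where "phi = (%s. dl * (gm - s) * ((1 - s^2) / (1 - s^2 + dl)))"
 define phi' where "phi' s = 2 * dl^2 * (s * (s - gm)) / (1 - s^2 + dl)^2 - dl * ((1 - s^2) / (1 - s^2 + dl))" for s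
 note prof = transition_profile[OF gm dl, folded phi_def phi'_def C0_def]
 have den: "1 - (u t x)^2 + dl > 0" if "x : closure Om" for x using ub[OF that] dl abs_square_le_1[of "u t x"] by linarith
 note sl = slices[OF t]
 have dc: "continuous_on (closure Om) (%x. phi (u t x))" "continuous_on (closure Om) (%x. phi' (u t x))"
  unfolding phi_def phi'_def using den by (auto intro!: continuous_intros sl simp: less_imp_neq[symmetric])
 define Z where "Z x = phi' (u t x) * (norm (p t x))^2 + phi (u t x) * trace (D t x)" for x
 have Zc: "continuous_on (closure Om) Z" unfolding Z_def trace_def by (intro continuous_intros dc sl)
 have Z: "(LINT x|vol. Z x) = 0"
 proof -
  have "(LINT x|vol. trace (phi' (u t x) *R tensor (p t x) (p t x) + phi (u t x) *R D t x)) = 0"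
  proof (rule divergence_zero[where X="%x. phi (u t x) *R p t x"])
   show "((%x. phi (u t x) *R p t x) has_derivative (%h. (phi' (u t x) *R tensor (p t x) (p t x) + phi (u t x) *R D t x) *v h)) (at x)"
    if x: "x : Om" for x
   proof -
    have "\<bar>u t x\<bar> <= 1" using x closure_subset by (auto intro!: ub)
    from has_derivative_compose[OF u_p[OF _ x] has_field_derivative_imp_has_derivative[OF prof(1)[OF this]]] t
    have "((%x. phi (u t x)) has_derivative (%h. phi' (u t x) * (p t x \<bullet> h))) (at x)" by simp
    from has_derivative_scaleR[OF this p_D[OF t x]] show ?thesis
     by (rule has_derivative_eq_rhs) (simp add: tensor_mult algebra_simps scaleR_matrix_vector_assoc[symmetric] fun_eq_iff)
   qed
   show "g x \<bullet> phi (u t x) *R p t x = 0" if "x : frontier Om" for x using neumann[OF t that] by (simp add: inner_commute)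
  qed (intro continuous_intros dc sl)+
  moreover have "trace (phi' (u t x) *R tensor (p t x) (p t x) + phi (u t x) *R D t x) = Z x" for x
   by (simp add: Z_def trace_def tensor_def power2_norm_eq_inner inner_vec_def sum.distrib sum_distrib_left)
  ultimately show ?thesis by simp
 qed
 define R where "R x = c * (eps * Z x + dl * (eps + eps * (ut t x)^2 + 2 * C0 * edens t x)) + kp / w * edens t x" for x
 have "max 0 (eps * (norm (p t x))^2 / 2 - W (u t x) / eps) <= R x" if x: "x : Om" for x
 proof -
  have xc: "x : closure Om" using x closure_subset by auto
  define s where "s = u t x"
  have s: "\<bar>s\<bar> <= 1" using ub[OF xc] by (simp add: s_def)
  define P where "P = eps * (norm (p t x))^2"
  have P: "0 <= P" "P <= 2 * edens t x" "edens t x >= 0" using eps_pos W_over_eps[OF W0, of t x] by (auto simp: P_def)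
  have "phi s * W' s >= 0"
  proof -
   have "0 <= dl * ((1 - s^2) / (1 - s^2 + dl))" using s dl by (simp add: abs_square_le_1)
   from mult_nonneg_nonneg[OF this W_sign[OF s]] show ?thesis by (simp add: phi_def mult_ac)
  qed
  then have "0 <= phi s * W' s / eps^2" by simp
  moreover have "phi s * trace (D t x) = phi s * ut t x + phi s * W' s / eps^2" unfolding s_def equation[OF t x] by (simp add: algebra_simps)
  ultimately have "phi s * (ut t x) <= phi s * trace (D t x)" by linarith
  moreover have "- (phi s * (ut t x)) <= dl * (1 + (ut t x)^2)"
  proof -
   have "- (phi s * (ut t x)) <= \<bar>phi s\<bar> * \<bar>ut t x\<bar>" using abs_ge_minus_self[of "phi s * ut t x"] by (simp add: abs_mult)
   also have "... <= 2 * dl * \<bar>ut t x\<bar>" using transition_profile(2)[OF gm dl s] unfolding phi_def by (intro mult_right_mono) auto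
   also have "... = dl * (2 * 1 * \<bar>ut t x\<bar>)" by simp
   also have "... <= dl * (1^2 + \<bar>ut t x\<bar>^2)" using dl sum_squares_bound[of 1 "\<bar>ut t x\<bar>"] by (intro mult_left_mono) auto
   finally show ?thesis by simp
  qed
  ultimately have "phi' s * (norm (p t x))^2 <= Z x + dl * (1 + (ut t x)^2)" by (simp add: Z_def s_def)
  then have "eps * (phi' s * (norm (p t x))^2) <= eps * (Z x + dl * (1 + (ut t x)^2))" using eps_pos by (intro mult_left_mono) auto
  moreover have "C0 * dl * P <= C0 * dl * (2 * edens t x)" using P C0 dl by (intro mult_left_mono) auto
  ultimately have "(phi' s + C0 * dl) * P <= eps * Z x + dl * (eps + eps * (ut t x)^2 + 2 * C0 * edens t x)" by (simp add: P_def algebra_simps)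
  then have main: "c * ((phi' s + C0 * dl) * P) + kp / w * edens t x <= R x" unfolding R_def using c by (intro add_right_mono mult_left_mono) auto
  have pos: "0 <= (phi' s + C0 * dl) * P" using prof(3)[OF s] P by (intro mult_nonneg_nonneg) auto
  have k: "0 <= kp / w * edens t x" using kp w P by auto
  have Wp: "W s / eps >= 0" using W0 eps_pos by simp
  show ?thesis
  proof (cases "1 - s^2 <= dl")
   case True
   have "c * ((1 - \<bar>gm\<bar>) / 16 * P) <= c * ((phi' s + C0 * dl) * P)"
    using prof(4)[OF s True] c P C0 dl by (intro mult_left_mono mult_right_mono) (auto intro: add_increasing2)
   moreover have "c * ((1 - \<bar>gm\<bar>) / 16 * P) = 1/2 * P" by (simp only: mult.assoc[symmetric] c(2))
   ultimately have "P / 2 <= c * ((phi' s + C0 * dl) * P)" by linarith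
   then have "max 0 (P / 2 - W s / eps) <= R x" using main k P Wp by auto
   then show ?thesis by (simp add: P_def s_def)
  next
   case False
   have "P / 2 - W s / eps = (eps^2 * (norm (p t x))^2 / 2 - W s) / eps" using eps_pos by (simp add: P_def field_simps power2_eq_square)
   also have "... <= kp / eps" using grad[OF xc] eps_pos by (intro divide_right_mono) (auto simp: s_def)
   also have "... = kp / w * (w / eps)" using w by simp
   also have "... <= kp / w * edens t x"
   proof (rule mult_left_mono)
    have "w / eps <= W s / eps" using w(2)[OF s] False eps_pos by (intro divide_right_mono) auto
    then show "w / eps <= edens t x" using P(1) by (simp add: edens_def s_def P_def)
   qed (use kp w in auto)
   finally have "max 0 (P / 2 - W s / eps) <= R x" using main k pos mult_nonneg_nonneg[OF less_imp_le[OF c(1)] pos] by auto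
   then show ?thesis by (simp add: P_def s_def)
  qed
 qed
 then have "(LINT x|vol. max 0 (eps * (norm (p t x))^2 / 2 - W (u t x) / eps)) <= (LINT x|vol. R x)" unfolding R_def using eps_pos
  by (intro integral_mono integrable_dom continuous_intros sl Zc W_cont) (auto simp: space_vol)
 also have "... = c * (eps * (LINT x|vol. Z x) + dl * (eps * measure vol Om + dissip t + 2 * C0 * energy t)) + kp / w * energy t"
 proof -
  have [simp]: "integrable vol Z" "integrable vol (edens t)" "integrable vol (%x. (ut t x)^2)" by (intro integrable_dom continuous_intros sl Zc)+
  show ?thesis unfolding R_def energy_def dissip_def by (simp add: space_vol)
 qed
 finally show ?thesis by (simp add: Z c_def C0_def mult_ac)
qed

end

section \<open>Limits of stresses and norms of first variations\<close>

definition upper_limit :: "(nat => real) => real" where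
 "upper_limit x = Inf {c. \<forall>\<^sub>F j in sequentially. x j <= c}"

lemma upper_limit_le:
 assumes "Bseq x" "\<forall>\<^sub>F j in sequentially. x j <= c"
 shows "upper_limit x <= c" unfolding upper_limit_def
proof (rule cInf_lower)
 obtain K where K: "!!j. \<bar>x j\<bar> <= K" using assms(1) unfolding Bseq_def by auto
 show "bdd_below {c. \<forall>\<^sub>F j in sequentially. x j <= c}"
 proof (rule bdd_belowI, safe)
  fix c assume "\<forall>\<^sub>F j in sequentially. x j <= c"
  then obtain j where "x j <= c" unfolding eventually_sequentially by auto
  then show "- K <= c" using K[of j] by linarith
 qed
qed (use assms in simp)

lemma upper_limit_less:
 assumes "Bseq x" "upper_limit x < c"
 shows "\<forall>\<^sub>F j in sequentially. x j <= c"
proof -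
 obtain K where K: "!!j. \<bar>x j\<bar> <= K" using assms(1) unfolding Bseq_def by auto
 have "x j <= K" for j using K[of j] by linarith
 then have "K : {c. \<forall>\<^sub>F j in sequentially. x j <= c}" by simp
 then obtain d where "\<forall>\<^sub>F j in sequentially. x j <= d" "d < c"
  using assms(2) cInf_lessD[of "{c. \<forall>\<^sub>F j in sequentially. x j <= c}" c] unfolding upper_limit_def by blast
 then show ?thesis by (auto elim: eventually_mono)
qed

lemma upper_limit_add:
 assumes "Bseq x" "Bseq y"
 shows "upper_limit (%j. x j + y j) <= upper_limit x + upper_limit y"
proof (rule field_le_epsilon)
 fix e :: real assume e: "e > 0"
 have B: "Bseq (%j. x j + y j)"
 proof -
  obtain K L where "!!j. \<bar>x j\<bar> <= K" "!!j. \<bar>y j\<bar> <= L" using assms unfolding Bseq_def by auto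
  then have "\<bar>x j + y j\<bar> <= K + L" for j by (meson abs_triangle_ineq add_mono order_trans)
  then show ?thesis by (intro BseqI'[of _ "K + L"]) simp
 qed
 have "\<forall>\<^sub>F j in sequentially. x j <= upper_limit x + e/2" "\<forall>\<^sub>F j in sequentially. y j <= upper_limit y + e/2"
  using e by (auto intro!: upper_limit_less assms)
 then have "\<forall>\<^sub>F j in sequentially. x j + y j <= upper_limit x + upper_limit y + e" by eventually_elim simp
 then show "upper_limit (%j. x j + y j) <= upper_limit x + upper_limit y + e" by (rule upper_limit_le[OF B])
qed

lemma upper_limit_scale:
 assumes x: "Bseq x" and c: "c > 0"
 shows "upper_limit (%j. c * x j) <= c * upper_limit x"
proof (rule field_le_epsilon)
 fix e :: real assume e: "e > 0"
 have "Bseq (%j. c * x j)" using Bseq_mult[of "%_. c" x] x by (simp add: BseqI'[of _ "\<bar>c\<bar>"])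
 moreover have "\<forall>\<^sub>F j in sequentially. x j <= upper_limit x + e/c" using e c by (intro upper_limit_less x) auto
 then have "\<forall>\<^sub>F j in sequentially. c * x j <= c * upper_limit x + e" by eventually_elim (use c in "simp add: field_simps")
 ultimately show "upper_limit (%j. c * x j) <= c * upper_limit x + e" by (rule upper_limit_le)
qed

lemma jacobian_compactly_supported: "h : C1c_fields U ==> (%x. jacobian h (at x)) : compactly_supported"
 using C1c_fieldsD(2,4)[of h U] by (auto intro: compactly_supportedI)

lemma jacobian_minus: "h : C1c_fields U ==> jacobian (%x. - h x) (at x) = - jacobian h (at x)"
 by (rule jacobian_eq, rule has_derivative_eq_rhs[OF has_derivative_minus[OF C1c_fieldsD(1)]])
  (auto simp: fun_eq_iff matrix_vector_mult_def vec_eq_iff sum_negf)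

text \<open>\<open>e j\<close> is the energy density and \<open>v j\<close> the gradient times the square root of \<open>eps\<close>; the
 discrepancy is \<open>(norm (v j x))\<^sup>2 - e j x\<close>.\<close>
locale stress_sequence =
 fixes V :: "((real^'n) \<times> (real^'n^'n)) measure" and N :: "(real^'n) measure"
  and e :: "nat => real^'n => real" and v :: "nat => real^'n => real^'n" and C :: real
 assumes rect: "rectifiable_varifold V" and fin: "emeasure V (space V) < \<infinity>"
  and N: "finite_measure N" "(%x. x) : borel_measurable N"
  and e: "!!j. integrable N (e j)" "!!j x. 0 <= e j x"
  and v: "!!j. v j : borel_measurable N" "!!j. integrable N (%x. (norm (v j x))^2)"
  and conv: "!!phi. Cc UNIV phi ==> (%j. LINT x|N. phi x * e j x) ----> (LINT x|weight V. phi x)"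
  and disc: "(%j. LINT x|N. max 0 ((norm (v j x))^2 - e j x)) ----> 0"
  and bound: "!!j h G. h : C1c_fields UNIV ==> (!!x. norm (h x) <= G) ==>
    (LINT x|N. (e j x *R mat 1 - tensor (v j x) (v j x)) \<bullet> jacobian h (at x)) <= C * G"
begin

abbreviation a where "a j F \<equiv> (LINT x|N. (e j x *R mat 1 - tensor (v j x) (v j x)) \<bullet> F x)"

lemma subsequence: "strict_mono r ==> stress_sequence V N (%j. e (r j)) (%j. v (r j)) C"
 using rect fin N e v bound LIMSEQ_subseq_LIMSEQ[OF conv, of _ r] LIMSEQ_subseq_LIMSEQ[OF disc, of r] unfolding stress_sequence_def comp_def by auto

lemma tensor_le: "\<bar>F \<bullet> tensor w w\<bar> <= norm F * (norm w)^2"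
 using Cauchy_Schwarz_ineq2[of F "tensor w w"] by (simp add: norm_tensor power2_eq_square)

text \<open>The functional of \<open>rectifiable_identification\<close> is the upper limit of the integrals of
 \<open>F \<bullet> tensor (v j) (v j)\<close>. It is bounded by the norm of \<open>F\<close> because the discrepancy vanishes.\<close>
lemma first_variation_le:
 assumes h: "h : C1c_fields UNIV" and ev: "\<forall>\<^sub>F j in sequentially. a j (%x. jacobian h (at x)) <= c"
 shows "first_variation V h <= c"
proof -
 interpret N: finite_measure N by (rule N)
 define b where "b F j = (LINT x|N. F x \<bullet> tensor (v j x) (v j x))" for F :: "real^'n => real^'n^'n" and j
 define m where "m F j = (LINT x|N. (mat 1 \<bullet> F x) * e j x)" for F :: "real^'n => real^'n^'n" and j
 have FN: "F : borel_measurable N" if "F : compactly_supported" for F :: "real^'n => real^'n^'n"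
  using measurable_compose[OF N(2) compactly_supported_measurable[OF that]] by simp
 have tm: "(%x. F x \<bullet> tensor (v j x) (v j x)) : borel_measurable N" if "F : compactly_supported" for F j
 proof -
  have "continuous_on UNIV (%w :: real^'n. tensor w w)" by (intro continuous_intros)
  from measurable_compose[OF v(1) borel_measurable_continuous_onI[OF this]] show ?thesis using FN[OF that] by measurable
 qed
 have bi: "integrable N (%x. F x \<bullet> tensor (v j x) (v j x))" and ei: "integrable N (%x. norm (F x) * e j x)"
  and mi: "integrable N (%x. (mat 1 \<bullet> F x) * e j x)" if F: "F : compactly_supported" for F :: "real^'n => real^'n^'n" and j
 proof -
  obtain B where B: "B > 0" "!!x. norm (F x) <= B" using compactly_supported_bounded[OF F] by blast
  note Fm = FN[OF F] borel_measurable_integrable[OF e(1)]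
  show "integrable N (%x. F x \<bullet> tensor (v j x) (v j x))"
  proof (rule Bochner_Integration.integrable_bound[OF integrable_mult_right[OF v(2), of B]])
   show "AE x in N. norm (F x \<bullet> tensor (v j x) (v j x)) <= norm (B * (norm (v j x))^2)"
   proof (rule AE_I2)
    fix x show "norm (F x \<bullet> tensor (v j x) (v j x)) <= norm (B * (norm (v j x))^2)"
     using order_trans[OF tensor_le mult_right_mono[OF B(2)[of x]], of "v j x"] B(1) by simp
   qed
  qed (rule tm[OF F])
  show "integrable N (%x. norm (F x) * e j x)" by (rule Bochner_Integration.integrable_bound[OF integrable_mult_right[OF e(1), of B]])
    (use B Fm e(2) in "auto intro!: AE_I2 mult_mono simp: abs_mult")
  show "integrable N (%x. (mat 1 \<bullet> F x) * e j x)"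
  proof (rule Bochner_Integration.integrable_bound[OF integrable_mult_right[OF e(1), of "norm (mat 1 :: real^'n^'n) * B"]])
   show "AE x in N. norm ((mat 1 \<bullet> F x) * e j x) <= norm (norm (mat 1 :: real^'n^'n) * B * e j x)"
   proof (rule AE_I2)
    fix x have "\<bar>mat 1 \<bullet> F x\<bar> <= norm (mat 1 :: real^'n^'n) * B"
     using order_trans[OF Cauchy_Schwarz_ineq2 mult_left_mono[OF B(2)], of "mat 1 :: real^'n^'n" x] by simp
    then show "norm ((mat 1 \<bullet> F x) * e j x) <= norm (norm (mat 1 :: real^'n^'n) * B * e j x)"
     using e(2)[of j x] B(1) by (simp add: abs_mult mult_right_mono)
   qed
  qed (use Fm in measurable)
 qed
 have di: "integrable N (%x. max 0 ((norm (v j x))^2 - e j x))" for j using v(2) e(1) by (intro integrable_max) auto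
 have upper: "b F j <= (LINT x|N. norm (F x) * e j x) + B * (LINT x|N. max 0 ((norm (v j x))^2 - e j x))"
  if F: "F : compactly_supported" and B: "!!x. norm (F x) <= B" for F B j
 proof -
  have "b F j <= (LINT x|N. norm (F x) * e j x + B * max 0 ((norm (v j x))^2 - e j x))" unfolding b_def
  proof (intro integral_mono bi[OF F] Bochner_Integration.integrable_add ei[OF F] integrable_mult_right di)
   fix x
   have "F x \<bullet> tensor (v j x) (v j x) <= norm (F x) * (norm (v j x))^2" using tensor_le[of "F x" "v j x"] by linarith
   also have "... <= norm (F x) * (e j x + max 0 ((norm (v j x))^2 - e j x))" by (intro mult_left_mono) auto
   also have "... <= norm (F x) * e j x + B * max 0 ((norm (v j x))^2 - e j x)"
    using mult_right_mono[OF B[of x], of "max 0 ((norm (v j x))^2 - e j x)"] by (simp add: distrib_left)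
   finally show "F x \<bullet> tensor (v j x) (v j x) <= norm (F x) * e j x + B * max 0 ((norm (v j x))^2 - e j x)" .
  qed
  then show ?thesis using ei[OF F] di by simp
 qed
 have cs: "(%x. f (F x)) : compactly_supported" if "F : compactly_supported" "continuous_on UNIV f" "f 0 = 0"
  for f :: "real^'n^'n => real" and F :: "real^'n => real^'n^'n" using compactly_supported_comp[OF that] .
 have Cc: "Cc UNIV F \<longleftrightarrow> F : compactly_supported" for F :: "real^'n => real" by (simp add: Cc_UNIV compactly_supported_def)
 have nconv: "(%j. LINT x|N. norm (F x) * e j x) ----> (LINT x|weight V. norm (F x))" if "F : compactly_supported" for F :: "real^'n => real^'n^'n"
  by (rule conv) (auto simp: Cc intro!: cs that continuous_intros)
 have mconv: "m F ----> (LINT x|weight V. mat 1 \<bullet> F x)" if "F : compactly_supported" for F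
  unfolding m_def by (rule conv) (auto simp: Cc intro!: cs that continuous_intros)
 have neg: "(%x. - F x) : compactly_supported" if "F : compactly_supported" for F :: "real^'n => real^'n^'n"
  by (rule compactly_supported_comp[OF that]) (auto intro!: continuous_intros)
 have bB: "Bseq (b F)" if F: "F : compactly_supported" for F
 proof -
  obtain B where B: "B > 0" "!!x. norm (F x) <= B" using compactly_supported_bounded[OF F] by blast
  have "Bseq (%j. (LINT x|N. norm (F x) * e j x) + B * (LINT x|N. max 0 ((norm (v j x))^2 - e j x)))"
   using tendsto_add[OF nconv[OF F] tendsto_mult_left[OF disc, of B]] by (intro convergent_imp_Bseq) (auto simp: convergent_def)
  moreover have "\<bar>b F j\<bar> <= \<bar>(LINT x|N. norm (F x) * e j x) + B * (LINT x|N. max 0 ((norm (v j x))^2 - e j x))\<bar>" for j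
  proof -
   have "b (%x. - F x) j = - b F j" by (simp add: b_def)
   then show ?thesis using upper[OF F B(2), of j] upper[OF neg[OF F], of B j] B(2) by simp
  qed
  ultimately show ?thesis by (elim Bseq_eventually_mono[rotated]) auto
 qed
 have ab: "a j F = m F j - b F j" if "F : compactly_supported" for F j unfolding m_def b_def using bi[OF that] mi[OF that]
  by (subst Bochner_Integration.integral_diff[symmetric]) (auto simp: inner_diff_left inner_commute[of "tensor _ _"] mult.commute)
 define p where "p F = upper_limit (b F)" for F
 have key: "(LINT x|weight V. mat 1 \<bullet> F x) + p (%x. - F x) <= c"
  if F: "F : compactly_supported" and ev: "\<forall>\<^sub>F j in sequentially. a j F <= c" for F c
 proof (rule field_le_epsilon)
  fix eta :: real assume "eta > 0"
  then have "\<forall>\<^sub>F j in sequentially. m F j > (LINT x|weight V. mat 1 \<bullet> F x) - eta"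
   by (intro order_tendstoD(1)[OF mconv[OF F]]) simp
  then have "\<forall>\<^sub>F j in sequentially. b (%x. - F x) j <= c - (LINT x|weight V. mat 1 \<bullet> F x) + eta"
   using ev by eventually_elim (simp add: ab[OF F], simp add: b_def)
  from upper_limit_le[OF bB[OF neg[OF F]] this]
  show "(LINT x|weight V. mat 1 \<bullet> F x) + p (%x. - F x) <= c + eta" by (simp add: p_def)
 qed
 have "first_variation V h <= (LINT x|weight V. mat 1 \<bullet> jacobian h (at x)) + p (%x. - jacobian h (at x))"
 proof (rule rectifiable_identification[OF rect fin _ _ _ _ h])
  show "p (%x. F x + G x) <= p F + p G" if "F : compactly_supported" "G : compactly_supported" for F G
  proof -
   have "b (%x. F x + G x) = (%j. b F j + b G j)" using bi that by (auto simp: fun_eq_iff b_def inner_add_left)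
   then show ?thesis using upper_limit_add bB that by (simp add: p_def)
  qed
  show "p (%x. c *R F x) <= c * p F" if "F : compactly_supported" "c > 0" for F c
  proof -
   have "b (%x. c *R F x) = (%j. c * b F j)" by (auto simp: fun_eq_iff b_def)
   then show ?thesis using upper_limit_scale bB that by (simp add: p_def)
  qed
  show "p F <= (LINT x|weight V. norm (F x))" if F: "F : compactly_supported" for F
  proof (rule field_le_epsilon)
   obtain B where B: "B > 0" "!!x. norm (F x) <= B" using compactly_supported_bounded[OF F] by blast
   fix eta :: real assume "eta > 0"
   then have "\<forall>\<^sub>F j in sequentially. (LINT x|N. norm (F x) * e j x) + B * (LINT x|N. max 0 ((norm (v j x))^2 - e j x)) < (LINT x|weight V. norm (F x)) + eta"
    by (intro order_tendstoD(2)[OF tendsto_add[OF nconv[OF F] tendsto_mult_left[OF disc, of B]]]) simp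
   then have "\<forall>\<^sub>F j in sequentially. b F j <= (LINT x|weight V. norm (F x)) + eta"
   proof eventually_elim
    case (elim j)
    then show ?case using upper[OF F B(2), of j] by linarith
   qed
   then show "p F <= (LINT x|weight V. norm (F x)) + eta" unfolding p_def by (intro upper_limit_le bB[OF F])
  qed
  show "(LINT x|weight V. mat 1 \<bullet> jacobian f (at x)) + p (%x. - jacobian f (at x)) <= C * G"
   if "f : C1c_fields UNIV" "!!x. norm (f x) <= G" for f G
  proof -
   have "\<forall>\<^sub>F j in sequentially. a j (%x. jacobian f (at x)) <= C * G" using bound[OF that] by simp
   from key[OF jacobian_compactly_supported[OF that(1)] this] show ?thesis .
  qed
 qed
 also have "... <= c" by (rule key[OF jacobian_compactly_supported[OF h] ev])
 finally show ?thesis .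
qed

end

text \<open>A subsequence with a different limit contradicts \<open>first_variation_le\<close> for \<open>h\<close> or for \<open>- h\<close>.\<close>
lemma (in stress_sequence) stress_converges:
 assumes h: "h : C1c_fields UNIV"
 shows "(%j. a j (%x. jacobian h (at x))) ----> first_variation V h"
proof (rule ccontr)
 let ?a = "%j. a j (%x. jacobian h (at x))" and ?L = "first_variation V h"
 assume "~ ?thesis"
 then obtain eta where eta: "eta > 0" "~ (\<forall>\<^sub>F j in sequentially. dist (?a j) ?L < eta)" unfolding tendsto_iff by blast
 have "\<exists>\<^sub>F j in sequentially. ?a j <= ?L - eta | ?a j >= ?L + eta"
  using eta(2) unfolding not_eventually by (rule frequently_elim1) (simp add: dist_real_def, linarith)
 then consider "\<exists>\<^sub>F j in sequentially. ?a j <= ?L - eta" | "\<exists>\<^sub>F j in sequentially. ?a j >= ?L + eta"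
  unfolding frequently_disj_iff by blast
 then show False
 proof cases
  case 1
  then have "infinite {j. ?a j <= ?L - eta}" by (simp add: frequently_cofinite[symmetric] cofinite_eq_sequentially)
  then obtain r :: "nat => nat" where r: "strict_mono r" "!!j. ?a (r j) <= ?L - eta" using infinite_enumerate by blast
  from stress_sequence.first_variation_le[OF subsequence[OF r(1)] h, of "?L - eta"] r eta show False by auto
 next
  case 2
  then have "infinite {j. ?a j >= ?L + eta}" by (simp add: frequently_cofinite[symmetric] cofinite_eq_sequentially)
  then obtain r :: "nat => nat" where r: "strict_mono r" "!!j. ?a (r j) >= ?L + eta" using infinite_enumerate by blast
  have h': "(%x. - h x) : C1c_fields UNIV" using C1c_fields_scale[OF h, of "-1"] by simp
  have "first_variation V (%x. - h x) = - ?L"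
   unfolding first_variation_def jacobian_minus[OF h] split_beta inner_minus_left by (rule Bochner_Integration.integral_minus)
  moreover have "a (r j) (%x. jacobian (%x. - h x) (at x)) <= - (?L + eta)" for j using r(2)[of j] by (simp add: jacobian_minus[OF h])
  ultimately show False using stress_sequence.first_variation_le[OF subsequence[OF r(1)] h', of "- (?L + eta)"] eta by auto
 qed
qed

text \<open>A function is determined up to a small error by its radius of support, a modulus of
 continuity and a finite table of values in countable dense sets. One member of \<open>Z\<close> is chosen for
 each table that occurs.\<close>
lemma countable_uniformly_dense:
 fixes Z :: "('a::euclidean_space => 'b::euclidean_space) set"
 assumes Z: "Z <= compactly_supported"
 obtains Y where "countable Y" "Y <= Z" "!!F e. F : Z ==> e > 0 ==> EX G:Y. ALL x. norm (F x - G x) < e"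
proof -
 obtain P :: "'a set" where P: "countable P" "!!U. open U ==> U ~= {} ==> EX x:P. x : U" using countable_dense_exists by blast
 obtain Q :: "'b set" where Q: "countable Q" "!!U. open U ==> U ~= {} ==> EX x:Q. x : U" using countable_dense_exists by blast
 define good where "good F c \<longleftrightarrow> (case c of (m, k, L) => (ALL x. real k < norm x --> F x = 0) &
   (ALL x y. dist x y < 1 / real (Suc k) --> dist (F x) (F y) < 1 / real (Suc m)) &
   (ALL x. norm x <= real k --> (EX (a, b):set L. dist x a < 1 / real (Suc k))) &
   (ALL (a, b):set L. dist (F a) b < 1 / real (Suc m)))" for F :: "'a => 'b" and c :: "nat \<times> nat \<times> ('a \<times> 'b) list"
 define \<C> where "\<C> = (UNIV :: nat set) \<times> (UNIV :: nat set) \<times> lists (P \<times> Q)"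
 have \<C>: "countable \<C>" unfolding \<C>_def using P(1) Q(1) by (intro countable_SIGMA countable_lists) auto
 define pick where "pick c = (SOME F. F : Z & good F c)" for c
 define Y where "Y = pick ` {c:\<C>. EX F:Z. good F c}"
 have pick: "pick c : Z & good (pick c) c" if "F : Z" "good F c" for F c unfolding pick_def by (rule someI[of _ F]) (use that in blast)
 have "EX G:Y. ALL x. norm (F x - G x) < e" if F: "F : Z" and e: "e > 0" for F e
 proof -
  obtain K where K: "compact K" "!!x. x ~: K ==> F x = 0" "continuous_on UNIV F" using F Z unfolding compactly_supported_def by blast
  obtain R where R: "!!x. x : K ==> norm x <= R" using compact_imp_bounded[OF K(1)] unfolding bounded_iff by auto
  obtain m where m: "4 / real (Suc m) < e" using reals_Archimedean[of "e/4"] e by (auto simp: inverse_eq_divide field_simps)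
  obtain d where d: "d > 0" "!!x y. dist x y < d ==> dist (F x) (F y) < 1 / real (Suc m)"
  proof -
   have "compact (cball (0::'a) (R + 1))" by simp
   then have "uniformly_continuous_on (cball (0::'a) (R + 1)) F" using compact_uniformly_continuous[OF continuous_on_subset[OF K(3)]] by blast
   then obtain d where d: "d > 0" "!!x y. norm x <= R + 1 ==> norm y <= R + 1 ==> dist y x < d ==> dist (F y) (F x) < 1 / real (Suc m)"
    unfolding uniformly_continuous_on_def by (auto simp: Ball_def dest!: spec[of _ "1 / real (Suc m)"])
   have "dist (F x) (F y) < 1 / real (Suc m)" if xy: "dist x y < min d 1" for x y
   proof (cases "norm x <= R + 1 & norm y <= R + 1")
    case True
    then show ?thesis using d(2)[of y x] xy by simp
   next
    case False
    then have "R < norm x" "R < norm y" using xy norm_triangle_ineq2[of x y] norm_triangle_ineq2[of y x] by (auto simp: dist_norm norm_minus_commute)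
    then have "F x = 0" "F y = 0" using K(2) R by (metis not_less)+
    then show ?thesis by simp
   qed
   then show ?thesis using that[of "min d 1"] d(1) by simp
  qed
  obtain k where k: "R <= real k" "1 / real (Suc k) < d"
  proof -
   obtain k1 where "1 / real (Suc k1) < d" using reals_Archimedean[OF d(1)] by (auto simp: inverse_eq_divide)
   moreover obtain k2 where "R <= real k2" using real_arch_simple by blast
   moreover have "1 / real (Suc (max k1 k2)) <= 1 / real (Suc k1)" by (intro divide_left_mono) auto
   ultimately show ?thesis using that[of "max k1 k2"] by linarith
  qed
  have "EX L:lists (P \<times> Q). (ALL x. norm x <= real k --> (EX (a, b):set L. dist x a < 1 / real (Suc k))) & (ALL (a, b):set L. dist (F a) b < 1 / real (Suc m))"
  proof -
   have "cball 0 (real k) <= (\<Union>a\<in>P. ball a (1 / real (Suc k)))"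
   proof
    fix x :: 'a
    obtain a where "a : P" "a : ball x (1 / real (Suc k))" using P(2)[of "ball x (1 / real (Suc k))"] by auto
    then show "x : (\<Union>a\<in>P. ball a (1 / real (Suc k)))" by (auto simp: dist_commute)
   qed
   from compactE_image[OF compact_cball _ this] obtain P' where P': "P' <= P" "finite P'" "cball 0 (real k) <= (\<Union>a\<in>P'. ball a (1 / real (Suc k)))" by auto
   obtain L0 where L0: "set L0 = P'" using finite_list[OF P'(2)] by blast
   have "EX b:Q. b : ball (F a) (1 / real (Suc m))" for a using Q(2)[of "ball (F a) (1 / real (Suc m))"] by auto
   then obtain q where q: "!!a. q a : Q" "!!a. dist (F a) (q a) < 1 / real (Suc m)" unfolding mem_ball by metis
   show ?thesis by (rule bexI[of _ "map (%a. (a, q a)) L0"])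
     (use P' L0 q in "auto simp: dist_commute subset_eq")
  qed
  then obtain L where L: "L : lists (P \<times> Q)" "ALL x. norm x <= real k --> (EX (a, b):set L. dist x a < 1 / real (Suc k))"
   "ALL (a, b):set L. dist (F a) b < 1 / real (Suc m)" by blast
  have "F x = 0" if "real k < norm x" for x using K(2)[of x] R[of x] k(1) that by force
  then have gF: "good F (m, k, L)" unfolding good_def prod.case using L(2,3) k(2) d(2) by (intro conjI) force+
  define G where "G = pick (m, k, L)"
  have G: "G : Z" "good G (m, k, L)" using pick[OF F gF] by (auto simp: G_def)
  have "norm (F x - G x) < e" for x
  proof (cases "norm x <= real k")
   case True
   then obtain a b where ab: "(a, b) : set L" "dist x a < 1 / real (Suc k)" using L(2) by blast
   have "dist (F x) (F a) < 1 / real (Suc m)" "dist (G x) (G a) < 1 / real (Suc m)"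
    "dist (F a) b < 1 / real (Suc m)" "dist (G a) b < 1 / real (Suc m)" using gF G(2) ab unfolding good_def by auto
   then have "dist (F x) (G x) < 4 / real (Suc m)"
    using dist_triangle[of "F x" "G x" "F a"] dist_triangle[of "F a" "G x" b] dist_triangle[of b "G x" "G a"] by (simp add: dist_commute)
   then show ?thesis using m by (simp add: dist_norm)
  next
   case False
   then show ?thesis using gF G(2) e by (auto simp: good_def)
  qed
  moreover have "G : Y" unfolding Y_def G_def using gF F L(1) by (intro imageI) (auto simp: \<C>_def)
  ultimately show ?thesis by blast
 qed
 moreover have "countable Y" "Y <= Z" using \<C> pick by (auto simp: Y_def intro: countable_subset)
 ultimately show ?thesis using that by blast
qed

lemma countable_dense_test_fields:
 obtains Y :: "(real^'n => real^'n) set" where "countable Y" "Y <= {g:C1c_fields UNIV. ALL x. norm (g x) <= 1}"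
  "!!g e. g : C1c_fields UNIV ==> (!!x. norm (g x) <= 1) ==> e > 0 ==> EX h:Y. ALL x. norm (jacobian g (at x) - jacobian h (at x)) < e"
proof -
 define B where "B = {g:C1c_fields UNIV :: (real^'n => real^'n) set. ALL x. norm (g x) <= 1}"
 define J where "J g = (%x. jacobian g (at x))" for g :: "real^'n => real^'n"
 have "J ` B <= compactly_supported" unfolding J_def B_def by (auto intro: jacobian_compactly_supported)
 then obtain Y where Y: "countable Y" "Y <= J ` B" "!!F e. F : J ` B ==> e > 0 ==> EX G:Y. ALL x. norm (F x - G x) < e"
  using countable_uniformly_dense by metis
 show ?thesis
 proof (rule that[of "inv_into B J ` Y"])
  show "inv_into B J ` Y <= {g:C1c_fields UNIV. ALL x. norm (g x) <= 1}" using Y(2) inv_into_into[of _ J B] unfolding B_def by blast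
  fix g :: "real^'n => real^'n" and e :: real assume g: "g : C1c_fields UNIV" "!!x. norm (g x) <= 1" "e > 0"
  then obtain G where "G : Y" "ALL x. norm (J g x - G x) < e" using Y(3)[of "J g" e] unfolding B_def by blast
  moreover from this(1) have "J (inv_into B J G) = G" using subsetD[OF Y(2)] by (intro f_inv_into_f[of G J B]) auto
  then have "jacobian (inv_into B J G) (at x) = G x" for x unfolding J_def by (rule fun_cong)
  ultimately show "EX h:inv_into B J ` Y. ALL x. norm (jacobian g (at x) - jacobian h (at x)) < e"
   by (intro bexI[of _ "inv_into B J G"]) (auto simp: J_def)
 qed (use Y(1) in simp)
qed

lemma orth_projection_bounded:
 obtains B where "B > 0" "!!S :: real^'n^'n. S : grassmannian_hyper ==> norm S <= B"
 using compact_imp_bounded[OF compact_grassmannian_hyper[where 'n='n]] unfolding bounded_pos by blast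

lemma first_variation_integrable:
 fixes V :: "((real^'n) \<times> (real^'n^'n)) measure"
 assumes V: "varifold V" and fin: "emeasure V (space V) < \<infinity>" and F: "F : compactly_supported"
 shows "integrable V (%(x, S). F x \<bullet> S)"
proof -
 interpret finite_measure V using fin by (intro finite_measureI) simp
 obtain B :: real where B: "B > 0" "!!S :: real^'n^'n. S : grassmannian_hyper ==> norm S <= B" using orth_projection_bounded[where 'n='n] by blast
 obtain C where C: "C > 0" "!!x. norm (F x) <= C" using compactly_supported_bounded[OF F] by blast
 have "continuous_on UNIV (%z. F (fst z) \<bullet> snd z)"
 proof -
  have "continuous_on UNIV F" using F by (simp add: compactly_supported_def)
  then have "continuous_on UNIV (%z :: (real^'n) \<times> (real^'n^'n). F (fst z))"
   by (rule continuous_on_compose2[OF _ continuous_on_fst[OF continuous_on_id]]) simp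
  then show ?thesis by (intro continuous_intros)
 qed
 then have m: "(%z. F (fst z) \<bullet> snd z) : borel_measurable V" by (intro varifold_measurable[OF V] borel_measurable_continuous_onI)
 have ae: "AE z in V. norm (F (fst z) \<bullet> snd z) <= C * B"
 proof (rule AE_I2)
  fix z assume "z : space V"
  then have "norm (snd z) <= B" unfolding varifold_space[OF V] by (intro B(2)) (simp add: mem_Times_iff)
  then have "norm (F (fst z)) * norm (snd z) <= C * B" using C by (intro mult_mono) auto
  then show "norm (F (fst z) \<bullet> snd z) <= C * B" unfolding real_norm_def using Cauchy_Schwarz_ineq2[of "F (fst z)" "snd z"] by linarith
 qed
 show ?thesis unfolding split_beta by (rule integrable_const_bound[OF ae m])
qed

lemma first_variation_norm_UNIV:
 fixes V :: "((real^'n) \<times> (real^'n^'n)) measure"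
 shows "first_variation_norm V UNIV = (SUP g \<in> {g:C1c_fields UNIV. ALL x. norm (g x) <= 1}. ennreal (first_variation V g))"
 proof -
 have "{U :: (real^'n) set. open U & UNIV <= U} = {UNIV}" by auto
 then show ?thesis by (simp add: first_variation_norm_def)
qed

lemma first_variation_norm_countable:
 fixes V :: "((real^'n) \<times> (real^'n^'n)) measure" and Y :: "(real^'n => real^'n) set"
 assumes V: "varifold V" and fin: "emeasure V (space V) < \<infinity>"
  and Y: "Y <= {g:C1c_fields UNIV. ALL x. norm (g x) <= 1}"
  "!!g e. g : C1c_fields UNIV ==> (!!x. norm (g x) <= 1) ==> e > 0 ==> EX h:Y. ALL x. norm (jacobian g (at x) - jacobian h (at x)) < e"
 shows "first_variation_norm V UNIV = (SUP g \<in> Y. ennreal (first_variation V g))"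
proof (rule antisym)
 show "(SUP g \<in> Y. ennreal (first_variation V g)) <= first_variation_norm V UNIV"
  unfolding first_variation_norm_UNIV by (rule SUP_subset_mono[OF Y(1)]) simp
 interpret finite_measure V using fin by (intro finite_measureI) simp
 obtain B :: real where B: "B > 0" "!!S :: real^'n^'n. S : grassmannian_hyper ==> norm S <= B" using orth_projection_bounded[where 'n='n] by blast
 show "first_variation_norm V UNIV <= (SUP g \<in> Y. ennreal (first_variation V g))" unfolding first_variation_norm_UNIV
 proof (rule SUP_least, rule ennreal_le_epsilon)
  fix g :: "real^'n => real^'n" and e assume g: "g : {g:C1c_fields UNIV. ALL x. norm (g x) <= 1}" and e: "0 < (e::real)"
  define c where "c = B * measure V (space V) + 1"
  have c: "c > 0" using B by (simp add: c_def add_nonneg_pos)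
  obtain h where h: "h : Y" "!!x. norm (jacobian g (at x) - jacobian h (at x)) < e / c" using Y(2)[of g "e / c"] g e c by auto
  have i: "integrable V (%(x, S). jacobian f (at x) \<bullet> S)" if "f : C1c_fields UNIV" for f
   by (rule first_variation_integrable[OF V fin jacobian_compactly_supported[OF that]])
  have hC: "h : C1c_fields UNIV" "g : C1c_fields UNIV" using h(1) Y(1) g by auto
  have "first_variation V g <= (LINT z|V. (case z of (x, S) => jacobian h (at x) \<bullet> S) + e / c * B)" unfolding first_variation_def
  proof (intro integral_mono i hC Bochner_Integration.integrable_add)
   fix z assume z: "z : space V"
   obtain x S where zz: "z = (x, S)" by fastforce
   have S: "norm S <= B" using z B(2) varifold_space[OF V] zz by auto
   have "(jacobian g (at x) - jacobian h (at x)) \<bullet> S <= norm (jacobian g (at x) - jacobian h (at x)) * norm S" by (rule norm_cauchy_schwarz)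
   also have "... <= e / c * B" using h(2)[of x] S e c by (intro mult_mono) auto
   finally show "(case z of (x, S) => jacobian g (at x) \<bullet> S) <= (case z of (x, S) => jacobian h (at x) \<bullet> S) + e / c * B"
    by (simp add: zz inner_diff_left)
  qed simp
  also have "... = first_variation V h + e * (B * measure V (space V) / c)" using i[OF hC(1)] by (simp add: first_variation_def)
  also have "... <= first_variation V h + e * 1" using e c by (intro add_left_mono mult_left_mono) (auto simp: c_def)
  finally have "ennreal (first_variation V g) <= ennreal (first_variation V h + e)" by (intro ennreal_leI) simp
  also have "... <= ennreal (first_variation V h) + ennreal e"
   using e by (cases "first_variation V h >= 0") (auto simp: ennreal_plus[symmetric] ennreal_neg intro!: ennreal_leI simp del: ennreal_plus)
  also have "... <= (SUP g \<in> Y. ennreal (first_variation V g)) + ennreal e" by (intro add_right_mono SUP_upper h)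
  finally show "ennreal (first_variation V g) <= (SUP g \<in> Y. ennreal (first_variation V g)) + ennreal e" .
 qed
qed

lemma cutoff_near_compact:
 fixes S U :: "(real^'n) set"
 assumes S: "compact S" and U: "open U" "S <= U"
 obtains psi psi' O' K where "!!x. (psi has_derivative (%h. psi' x \<bullet> h)) (at x)" "continuous_on UNIV psi'" "open O'" "S <= O'"
  "!!x. x : O' ==> psi x = 1" "compact K" "K <= U" "!!x. x ~: K ==> psi x = (0::real)" "!!x. 0 <= psi x & psi x <= 1"
proof -
 have "EX r>0. cball x (3/2 * r) <= U" if x: "x : S" for x
 proof -
  obtain r where "r > 0" "cball x r <= U" using U x open_contains_cball by blast
  then show ?thesis by (intro exI[of _ "2/3 * r"]) auto
 qed
 then obtain r where r: "!!x. x : S ==> r x > 0 & cball x (3/2 * r x) <= U" by metis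
 have "S <= (\<Union>x\<in>S. ball x (r x))" using r by force
 from compactE_image[OF S _ this] obtain T where T: "T <= S" "finite T" "S <= (\<Union>x\<in>T. ball x (r x))" by auto
 define sg where "sg y = (\<Sum>x\<in>T. cutoff ((y - x) /R r x))" for y
 define sg' where "sg' y = (\<Sum>x\<in>T. inverse (r x) *R cutoff_grad ((y - x) /R r x))" for y
 have d: "(sg has_derivative (%h. sg' y \<bullet> h)) (at y)" for y
 proof -
  have "((%y. cutoff ((y - x) /R r x)) has_derivative (%h. cutoff_grad ((y - x) /R r x) \<bullet> (h /R r x))) (at y)" for x
   by (rule has_derivative_compose[OF _ has_derivative_cutoff]) (auto intro!: derivative_eq_intros)
  then show ?thesis unfolding sg_def sg'_def by (intro has_derivative_eq_rhs[OF has_derivative_sum]) (auto simp: inner_sum_left)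
 qed
 have nr: "norm ((y - x) /R r x) = dist x y / r x" if "x : T" for x y using r[of x] that T(1) by (intro norm_rescale) auto
 show ?thesis
 proof (rule that[of "%y. smoothstep (sg y)" "%y. smoothstep' (sg y) *R sg' y" "\<Union>x\<in>T. ball x (r x)" "\<Union>x\<in>T. cball x (3/2 * r x)"])
  show "((%y. smoothstep (sg y)) has_derivative (%h. (smoothstep' (sg y) *R sg' y) \<bullet> h)) (at y)" for y
   by (rule has_derivative_eq_rhs[OF has_derivative_smoothstep_comp[OF d]]) (simp add: fun_eq_iff)
  show "continuous_on UNIV (%y. smoothstep' (sg y) *R sg' y)"
  proof (intro continuous_on_scaleR continuous_smoothstep')
   show "continuous_on UNIV sg" by (auto intro!: has_derivative_continuous_on intro: has_derivative_at_withinI d)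
   have "continuous_on UNIV (%y. (y - x) /R r x)" for x by (intro continuous_intros)
   from continuous_on_cutoff(2)[OF this] show "continuous_on UNIV sg'" unfolding sg'_def
    by (intro continuous_on_sum continuous_on_scaleR continuous_on_const)
  qed
  show "smoothstep (sg y) = 1" if y: "y : (\<Union>x\<in>T. ball x (r x))" for y
  proof (rule smoothstep_eq(2))
   obtain x where x: "x : T" "dist x y < r x" using y by auto
   have "norm ((y - x) /R r x) <= 1" using x nr[OF x(1)] r[of x] T(1) by auto
   then have "1 = cutoff ((y - x) /R r x)" by (simp add: cutoff_props)
   also have "... <= sg y" unfolding sg_def by (rule member_le_sum[OF x(1) _ T(2)]) (auto simp: cutoff_props)
   finally show "1 <= sg y" .
  qed
  show "smoothstep (sg y) = 0" if "y ~: (\<Union>x\<in>T. cball x (3/2 * r x))" for y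
  proof (rule smoothstep_eq(1))
   have "cutoff ((y - x) /R r x) = 0" if x: "x : T" for x
   proof (rule cutoff_props(4))
    have "0 < r x" "3/2 * r x <= dist x y" using x \<open>y ~: _\<close> r[of x] T(1) by (auto simp: not_le)
    then show "3/2 <= norm ((y - x) /R r x)" unfolding nr[OF x] by (simp add: field_simps)
   qed
   then show "sg y <= 0" by (simp add: sg_def)
  qed
  show "S <= (\<Union>x\<in>T. ball x (r x))" by (rule T(3))
  show "compact (\<Union>x\<in>T. cball x (3/2 * r x))" using T(2) by (intro compact_UN) auto
  show "(\<Union>x\<in>T. cball x (3/2 * r x)) <= U" using r T(1) by blast
 qed (auto simp: smoothstep_bounds)
qed

text \<open>Near \<open>S\<close> a test field agrees with its product with a cut-off, which is supported in any
 prescribed neighbourhood of \<open>S\<close>.\<close>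
lemma first_variation_norm_support:
 fixes V :: "((real^'n) \<times> (real^'n^'n)) measure"
 assumes V: "varifold V" and S: "compact S" and null: "emeasure (weight V) (- S) = 0"
 shows "first_variation_norm V UNIV = first_variation_norm V S"
proof (rule antisym)
 have AE: "AE z in V. fst z : S"
 proof (rule AE_I[where N="fst -` (- S) \<inter> space V"])
  show "emeasure V (fst -` (- S) \<inter> space V) = 0"
   using null emeasure_weight[OF V, of "- S"] compact_imp_closed[OF S] by (simp add: borel_closed)
  have "fst : measurable V borel" by (intro varifold_measurable[OF V] borel_measurable_continuous_onI continuous_on_fst continuous_on_id)
  then show "fst -` (- S) \<inter> space V : sets V" using compact_imp_closed[OF S] by (intro measurable_sets) (auto intro: borel_closed)
 qed auto
 show "first_variation_norm V S <= first_variation_norm V UNIV" unfolding first_variation_norm_def by (intro INF_superset_mono) auto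
 show "first_variation_norm V UNIV <= first_variation_norm V S" unfolding first_variation_norm_def[of V S]
 proof (rule INF_greatest)
  fix U assume "U : {U. open U & S <= U}"
  then obtain psi psi' O' K where psi: "!!x. (psi has_derivative (%h. psi' x \<bullet> h)) (at x)" "continuous_on UNIV psi'" "open O'" "S <= O'"
   "!!x. x : O' ==> psi x = 1" "compact K" "K <= U" "!!x. x ~: K ==> psi x = (0::real)" "!!x. 0 <= psi x & psi x <= 1"
   using cutoff_near_compact[OF S, of U] by blast
  show "first_variation_norm V UNIV <= (SUP g\<in>{g:C1c_fields U. ALL x. norm (g x) <= 1}. ennreal (first_variation V g))"
   unfolding first_variation_norm_UNIV
  proof (rule SUP_least)
   fix g :: "real^'n => real^'n" assume g: "g : {g:C1c_fields UNIV. ALL x. norm (g x) <= 1}"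
   then have gC: "g : C1c_fields UNIV" by simp
   define h where "h x = psi x *R g x" for x
   have psic: "continuous_on UNIV psi" by (auto intro!: has_derivative_continuous_on intro: has_derivative_at_withinI psi(1))
   have dh: "(h has_derivative (%v. (tensor (g x) (psi' x) + psi x *R jacobian g (at x)) *v v)) (at x)" for x
    unfolding h_def by (rule has_derivative_eq_rhs[OF has_derivative_scaleR[OF psi(1) C1c_fieldsD(1)[OF gC]]])
     (simp add: fun_eq_iff tensor_mult algebra_simps scaleR_matrix_vector_assoc[symmetric])
   have "h : C1c_fields U"
   proof (rule C1c_fieldsI[OF dh _ psi(6,7)])
    show "continuous_on UNIV (%x. tensor (g x) (psi' x) + psi x *R jacobian g (at x))"
     by (intro continuous_intros C1c_fieldsD(2,3)[OF gC] psi(2) psic)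
   qed (simp add: h_def psi(8))
   moreover have "norm (h x) <= 1" for x using psi(9)[of x] g by (auto simp: h_def intro: mult_le_one)
   moreover have "first_variation V h = first_variation V g"
   proof -
    have "jacobian h (at x) = jacobian g (at x)" if "x : S" for x
    proof (rule jacobian_eq)
     show "(h has_derivative (%v. jacobian g (at x) *v v)) (at x)"
      by (rule has_derivative_transform_within_open[OF C1c_fieldsD(1)[OF gC] psi(3)]) (use that psi(4,5) in "auto simp: h_def")
    qed
    then have "AE z in V. (case z of (x, S) => jacobian h (at x) \<bullet> S) = (case z of (x, S) => jacobian g (at x) \<bullet> S)"
     using AE by (auto simp: split_beta)
    moreover have "(%(x, S). jacobian f (at x) \<bullet> S) : borel_measurable V" if "f : C1c_fields UNIV" for f :: "real^'n => real^'n"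
    proof -
     have "continuous_on UNIV (%z. jacobian f (at (fst z)) \<bullet> snd z :: real)"
      by (intro continuous_intros continuous_on_compose2[OF C1c_fieldsD(2)[OF that]]) auto
     then show ?thesis unfolding split_beta by (intro varifold_measurable[OF V] borel_measurable_continuous_onI)
    qed
    ultimately show ?thesis unfolding first_variation_def
     using gC \<open>h : C1c_fields U\<close> C1c_fields_mono[of U UNIV] by (intro integral_cong_AE) auto
   qed
   ultimately show "ennreal (first_variation V g) <= (SUP g\<in>{g:C1c_fields U. ALL x. norm (g x) <= 1}. ennreal (first_variation V g))"
    by (intro SUP_upper2[of h]) auto
  qed
 qed
qed

section \<open>Limits measurable in time\<close>

lemma frequently_subsequence:
 assumes "\<exists>\<^sub>F j in sequentially. P j"
 obtains r :: "nat => nat" where "strict_mono r" "!!j. P (r j)"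
proof -
 have "infinite {j. P j}" using assms by (simp add: frequently_cofinite[symmetric] cofinite_eq_sequentially)
 then show ?thesis using infinite_enumerate[of "{j. P j}"] that by auto
qed

text \<open>Discarding the indices with large \<open>d\<close> leaves, for large \<open>M\<close>, an upper limit along which \<open>a\<close>
 converges; for small \<open>M\<close> no index may be left, which gives zero.\<close>
lemma limsup_truncated:
 fixes a d :: "nat => real"
 assumes conv: "!!M r. strict_mono r ==> (!!j. d (r j) <= M) ==> (%j. a (r j)) ----> L"
  and fr: "\<exists>\<^sub>F j in sequentially. d j <= M0"
 shows "(SUP M::nat. limsup (%i. if d i <= real M then ennreal (a i) else 0)) = ennreal L"
proof (rule antisym)
 show "(SUP M::nat. limsup (%i. if d i <= real M then ennreal (a i) else 0)) <= ennreal L"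
 proof (rule SUP_least, unfold Limsup_le_iff, intro allI impI)
  fix M and y :: ennreal assume y: "ennreal L < y"
  show "\<forall>\<^sub>F i in sequentially. (if d i <= real M then ennreal (a i) else 0) < y"
  proof (rule ccontr)
   assume "~ ?thesis"
   then have "\<exists>\<^sub>F i in sequentially. d i <= real M & y <= ennreal (a i)"
    unfolding not_eventually by (rule frequently_elim1) (use y in "auto simp: not_less split: if_splits")
   from frequently_subsequence[OF this]
   obtain r :: "nat => nat" where r: "strict_mono r" "!!j. d (r j) <= real M & y <= ennreal (a (r j))" by blast
   have "(%j. ennreal (a (r j))) ----> ennreal L" using conv[OF r(1)] r(2) by (intro tendsto_ennrealI) auto
   then have "y <= ennreal L" using r(2) by (intro LIMSEQ_le_const) auto
   then show False using y by simp
  qed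
 qed
 obtain r :: "nat => nat" where r: "strict_mono r" "!!j. d (r j) <= M0" using frequently_subsequence[OF fr] by blast
 obtain M :: nat where M: "M0 <= real M" using real_arch_simple by blast
 let ?X = "%i. if d i <= real M then ennreal (a i) else 0"
 have "(%j. ennreal (a (r j))) ----> ennreal L" using conv[OF r(1)] r(2) by (intro tendsto_ennrealI) auto
 moreover have "?X \<circ> r = (%j. ennreal (a (r j)))" using order_trans[OF r(2) M] by (simp add: fun_eq_iff)
 ultimately have "ennreal L = limsup (?X \<circ> r)" using lim_imp_Limsup by (metis trivial_limit_sequentially)
 also have "... <= limsup ?X" by (rule limsup_subseq_mono[OF r(1)])
 also have "... <= (SUP M::nat. limsup (%i. if d i <= real M then ennreal (a i) else 0))" by (rule SUP_upper) simp
 finally show "ennreal L <= (SUP M::nat. limsup (%i. if d i <= real M then ennreal (a i) else 0))" .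
qed

text \<open>The limits \<open>L t h\<close> are only reached along subsequences that depend on the time \<open>t\<close> and
 along which the dissipation stays bounded; the truncated upper limits of the previous lemma
 recover them measurably in \<open>t\<close>.\<close>
lemma limits_along_bounded_dissipation:
 fixes d :: "nat => real => real" and a :: "nat => real => 'h => real" and L :: "real => 'h => real"
 assumes d: "!!j. continuous_on {0<..} (d j)" "!!j t. 0 <= d j t"
  and a: "!!j h. h : Y ==> continuous_on {0<..} (%t. a j t h)" and Y: "countable Y"
  and dint: "!!j T. (\<integral>\<^sup>+t\<in>{0<..T}. ennreal (d j t) \<partial>lborel) <= ennreal E" and E: "E >= 0" and K: "K >= 0"
  and R: "AE t in lborel. t > 0 --> R t"
  and conv: "!!t h M r. t > 0 ==> R t ==> h : Y ==> strict_mono r ==> (!!j. d (r j) t <= M) ==> (%j. a (r j) t h) ----> L t h"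
  and bd: "!!t h M (r :: nat => nat). t > 0 ==> R t ==> h : Y ==> strict_mono r ==> (!!j. d (r j) t <= M) ==> L t h <= K * (E + M)"
 obtains F where "F : borel_measurable borel" "AE t in lborel. t > 0 --> F t = (SUP h\<in>Y. ennreal (L t h))"
  "AE t in lborel. t > 0 --> F t < \<infinity>" "!!T. (\<integral>\<^sup>+t\<in>{0<..T}. F t \<partial>lborel) < \<infinity>"
proof -
 define d0 where "d0 j t = indicator {0<..} t *R d j t" for j t
 define a0 where "a0 j t h = indicator {0<..} t *R a j t h" for j t h
 have [measurable]: "d0 j : borel_measurable borel" for j unfolding d0_def by (rule borel_measurable_continuous_on_indicator[OF _ d(1)]) auto
 have [measurable]: "(%t. a0 j t h) : borel_measurable borel" if "h : Y" for j h
  unfolding a0_def by (rule borel_measurable_continuous_on_indicator[OF _ a[OF that]]) auto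
 define F where "F t = (SUP h\<in>Y. SUP M::nat. limsup (%i. if d0 i t <= real M then ennreal (a0 i t h) else 0))" for t
 have F: "F : borel_measurable borel" unfolding F_def by (intro borel_measurable_SUP Y borel_measurable_limsup) auto
 define l where "l t = liminf (%j. ennreal (d0 j t))" for t
 have [measurable]: "l : borel_measurable borel" unfolding l_def by measurable
 have lint: "(\<integral>\<^sup>+t\<in>{0<..T}. l t \<partial>lborel) <= ennreal E" for T
 proof -
  have "(\<integral>\<^sup>+t\<in>{0<..T}. l t \<partial>lborel) = (\<integral>\<^sup>+t. liminf (%j. ennreal (d0 j t) * indicator {0<..T} t) \<partial>lborel)"
   by (intro nn_integral_cong) (auto simp: l_def indicator_def Liminf_const)
  also have "... <= liminf (%j. \<integral>\<^sup>+t\<in>{0<..T}. ennreal (d0 j t) \<partial>lborel)" by (rule nn_integral_liminf) measurable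
  also have "... <= liminf (%j. ennreal E)"
  proof (rule Liminf_mono, rule always_eventually, rule allI)
   fix j
   have "(\<integral>\<^sup>+t\<in>{0<..T}. ennreal (d0 j t) \<partial>lborel) = (\<integral>\<^sup>+t\<in>{0<..T}. ennreal (d j t) \<partial>lborel)"
    by (intro nn_integral_cong) (auto simp: d0_def indicator_def)
   then show "(\<integral>\<^sup>+t\<in>{0<..T}. ennreal (d0 j t) \<partial>lborel) <= ennreal E" using dint by simp
  qed
  finally show ?thesis by (simp add: Liminf_const)
 qed
 have lfin: "AE t in lborel. t > 0 --> l t ~= \<infinity>"
 proof -
  have "AE t in lborel. l t * indicator {0<..real n} t ~= \<infinity>" for n using lint[of n] by (intro nn_integral_PInf_AE) (auto simp: top_unique)
  then have "AE t in lborel. ALL n::nat. l t * indicator {0<..real n} t ~= \<infinity>" by (simp add: AE_all_countable)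
  then show ?thesis
  proof eventually_elim
   case (elim t)
   obtain n :: nat where "t <= real n" using real_arch_simple by blast
   then show ?case using elim[rule_format, of n] by (auto simp: indicator_def)
  qed
 qed
 have good: "F t = (SUP h\<in>Y. ennreal (L t h)) & F t <= ennreal K * (ennreal E + l t)"
  if t: "t > 0" "R t" "l t ~= \<infinity>" for t
 proof -
  have dt: "d0 j t = d j t" "a0 j t h = a j t h" for j h using t by (auto simp: d0_def a0_def)
  have fr: "\<exists>\<^sub>F j in sequentially. d j t <= M" if M: "l t < ennreal M" for M
  proof (rule ccontr)
   assume "~ ?thesis"
   then have "\<forall>\<^sub>F j in sequentially. ennreal M <= ennreal (d0 j t)"
    unfolding not_frequently by eventually_elim (auto simp: dt intro: ennreal_leI)
   then have "ennreal M <= l t" unfolding l_def by (rule Liminf_bounded)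
   then show False using M by simp
  qed
  obtain m where m: "l t = ennreal m" "m >= 0" using t(3) by (cases "l t") auto
  have fr1: "\<exists>\<^sub>F j in sequentially. d j t <= m + 1" by (rule fr) (simp add: m(1) ennreal_less_iff m(2))
  have Ft: "F t = (SUP h\<in>Y. ennreal (L t h))" unfolding F_def dt by (intro SUP_cong refl limsup_truncated[OF conv[OF t(1,2)] fr1])
  have "ennreal (L t h) <= ennreal K * (ennreal E + l t)" if h: "h : Y" for h
  proof -
   have "L t h <= K * (E + m)"
   proof (rule field_le_epsilon)
    fix eta :: real assume eta: "eta > 0"
    define M where "M = m + eta / (K + 1)"
    have "l t < ennreal M" using eta K m by (simp add: M_def ennreal_less_iff)
    from frequently_subsequence[OF fr[OF this]] obtain r :: "nat => nat" where r: "strict_mono r" "!!j. d (r j) t <= M" by blast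
    have "L t h <= K * (E + M)" by (rule bd[OF t(1,2) h r])
    also have "... = K * (E + m) + eta * (K / (K + 1))" by (simp add: M_def algebra_simps)
    also have "... <= K * (E + m) + eta * 1" using K eta by (intro add_left_mono mult_left_mono) auto
    finally show "L t h <= K * (E + m) + eta" by simp
   qed
   then show ?thesis using m E K by (simp add: ennreal_plus[symmetric] ennreal_mult[symmetric] ennreal_leI del: ennreal_plus)
  qed
  then show ?thesis unfolding Ft by (auto intro: SUP_least)
 qed
 have AEg: "AE t in lborel. t > 0 --> F t = (SUP h\<in>Y. ennreal (L t h)) & F t <= ennreal K * (ennreal E + l t) & l t ~= \<infinity>"
  using R lfin by eventually_elim (use good in blast)
 show ?thesis
 proof (rule that[OF F])
  show "AE t in lborel. t > 0 --> F t = (SUP h\<in>Y. ennreal (L t h))" using AEg by eventually_elim blast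
  show "AE t in lborel. t > 0 --> F t < \<infinity>" using AEg
  proof eventually_elim
   case (elim t)
   have "l t ~= \<infinity> ==> ennreal K * (ennreal E + l t) < \<infinity>" by (simp add: ennreal_mult_less_top less_top)
   then show ?case using elim by (auto intro: order.strict_trans1)
  qed
  fix T :: real
  have "emeasure lborel {0<..T} < \<infinity>" by (cases "0 <= T") auto
  have "(\<integral>\<^sup>+t\<in>{0<..T}. F t \<partial>lborel) <= (\<integral>\<^sup>+t. ennreal K * (ennreal E * indicator {0<..T} t + l t * indicator {0<..T} t) \<partial>lborel)"
   by (intro nn_integral_mono_AE) (use AEg in eventually_elim, auto simp: indicator_def)
  also have "... = ennreal K * ((\<integral>\<^sup>+t. ennreal E * indicator {0<..T} t \<partial>lborel) + (\<integral>\<^sup>+t. l t * indicator {0<..T} t \<partial>lborel))"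
   by (subst nn_integral_cmult, measurable, subst nn_integral_add, measurable)
  also have "... < \<infinity>" using order.strict_trans1[OF lint[of T] ennreal_less_top] \<open>emeasure lborel {0<..T} < \<infinity>\<close>
   by (simp add: ennreal_mult_less_top nn_integral_cmult_indicator)
  finally show "(\<integral>\<^sup>+t\<in>{0<..T}. F t \<partial>lborel) < \<infinity>" .
 qed
qed

lemma measurable_lebesgue_on_AE:
 fixes f g :: "real => ennreal"
 assumes f: "f : borel_measurable borel" and T: "T : sets lebesgue" and ae: "AE x in lebesgue. x : T --> f x = g x"
 shows "g : borel_measurable (lebesgue_on T)" "(\<integral>\<^sup>+x. g x \<partial>lebesgue_on T) = (\<integral>\<^sup>+x\<in>T. f x \<partial>lebesgue)"
proof -
 show "g : borel_measurable (lebesgue_on T)"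
 proof (rule measurableI)
  fix A :: "ennreal set" assume A: "A : sets borel"
  have "f -` A \<inter> space lebesgue : sets lebesgue" using f A by (intro measurable_sets[OF measurable_completion]) auto
  then have "f -` A \<inter> T : sets lebesgue" using T by simp
  then have "g -` A \<inter> T : sets lebesgue" by (rule completion.in_sets_AE[rotated]) (use ae in auto)
  then show "g -` A \<inter> space (lebesgue_on T) : sets (lebesgue_on T)" using T by (auto simp: sets_restrict_space_iff)
 qed auto
 show "(\<integral>\<^sup>+x. g x \<partial>lebesgue_on T) = (\<integral>\<^sup>+x\<in>T. f x \<partial>lebesgue)"
  using T ae by (subst nn_integral_restrict_space) (auto intro!: nn_integral_cong_AE simp: indicator_def)
qed

lemma double_well_facts:
 assumes W_C3: "Ck_upto 3 UNIV UNIV W" and W1: "W 1 = 0" "W (- 1) = 0" "!!s. s ~= 1 ==> s ~= - 1 ==> W s > 0"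
  and W2: "- 1 < gm" "gm < 1" "!!s. gm < s ==> s < 1 ==> deriv W s < 0" "!!s. - 1 < s ==> s < gm ==> deriv W s > 0"
 shows "(W has_real_derivative deriv W s) (at s)" "(deriv W has_real_derivative deriv (deriv W) s) (at s)"
  "continuous_on UNIV (deriv (deriv W))" "0 <= W s" "deriv W 1 = 0" "deriv W (- 1) = 0"
  "\<bar>s\<bar> <= 1 ==> 0 <= deriv W s * (gm - s)"
proof -
 have fd: "frechet_derivative f (at x) 1 = deriv f x" if "f differentiable (at x)" for f :: "real => real" and x
  using that by (metis DERIV_deriv_iff_real_differentiable frechet_derivative_at has_field_derivative_def mult.right_neutral)
 have C: "derivs_extend 3 UNIV UNIV W" using W_C3 by (simp add: Ck_upto_def)
 then have d1: "W differentiable (at x)" and C2: "derivs_extend 2 UNIV UNIV (%x. frechet_derivative W (at x) 1)" for x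
  by (auto simp: numeral_3_eq_3 numeral_2_eq_2)
 have e1: "(%x. frechet_derivative W (at x) 1) = deriv W" using fd[OF d1] by auto
 have d2: "deriv W differentiable (at x)" and C1: "derivs_extend 1 UNIV UNIV (%x. frechet_derivative (deriv W) (at x) 1)" for x
  using C2 unfolding e1 by (auto simp: numeral_2_eq_2)
 have e2: "(%x. frechet_derivative (deriv W) (at x) 1) = deriv (deriv W)" using fd[OF d2] by auto
 show "continuous_on UNIV (deriv (deriv W))"
 proof -
  obtain g where "continuous_on UNIV g" "ALL x. g x = deriv (deriv W) x" using C1 unfolding e2 by auto
  moreover from this(2) have "g = deriv (deriv W)" by auto
  ultimately show ?thesis by simp
 qed
 show D: "(W has_real_derivative deriv W s) (at s)" for s using d1 by (simp add: DERIV_deriv_iff_real_differentiable)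
 show "(deriv W has_real_derivative deriv (deriv W) s) (at s)" using d2 by (simp add: DERIV_deriv_iff_real_differentiable)
 show W0: "0 <= W s" for s using W1(1,2) W1(3)[of s] by (cases "s = 1 | s = - 1") auto
 show z: "deriv W 1 = 0" "deriv W (- 1) = 0" by (rule DERIV_local_min[OF D, of 1], use W0 W1 in auto)+
 show "0 <= deriv W s * (gm - s)" if s: "\<bar>s\<bar> <= 1"
 proof -
  consider "s = 1" | "s = - 1" | "s = gm" | "gm < s" "s < 1" | "- 1 < s" "s < gm" using s by linarith
  then show ?thesis by cases (use z W2(3,4)[of s] in "auto simp: mult_nonpos_nonpos less_imp_le")
 qed
qed

section \<open>The first variation of the limit varifolds\<close>

lemma grad_closure_cong:
 assumes "open Om" "!!x. x : Om ==> f x = h x"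
 shows "grad_closure Om f = grad_closure Om h" "x : Om ==> grad f x = grad h x"
proof -
 show gr: "grad f x = grad h x" if x: "x : Om" for x
 proof -
  have "(f has_derivative D) (at x) \<longleftrightarrow> (h has_derivative D) (at x)" for D
   using has_derivative_transform_within_open[OF _ assms(1) x, of f D UNIV h] has_derivative_transform_within_open[OF _ assms(1) x, of h D UNIV f] assms(2) by auto
  then show ?thesis unfolding grad_def frechet_derivative_def by simp
 qed
 show "grad_closure Om f = grad_closure Om h" unfolding grad_closure_def by (intro ext Lim_cong) (auto simp: eventually_at_filter gr)
qed

lemma (in neumann_solution) integral_ac_measure:
 assumes t: "t >= 0" and g: "!!x. x : Om ==> p t x = grad (u t) x" and W0: "!!s. W s >= 0"
  and phi: "continuous_on UNIV phi"
 shows "integral\<^sup>L (ac_measure W Om eps (u t)) phi = (LINT x|vol. phi x * edens t x)"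
proof -
 have c: "continuous_on (closure Om) (edens t)" using slice_cont[OF edens_cont, of t] t by auto
 have eq: "indicator Om x * ac_energy_density W eps (u t) x = indicator Om x *R edens t x" for x
  using g by (auto simp: ac_energy_density_def edens_def indicator_def)
 have m: "(%x. indicator Om x *R edens t x) : borel_measurable lborel"
  using borel_measurable_continuous_on_indicator[OF _ continuous_on_subset[OF c closure_subset]] open_dom by simp
 have "integral\<^sup>L (ac_measure W Om eps (u t)) phi = (LINT x|lborel. (indicator Om x *R edens t x) *R phi x)"
  unfolding ac_measure_def eq using phi m W_over_eps(2)[OF W0] by (intro integral_density) (auto intro: borel_measurable_continuous_onI)
 then show ?thesis unfolding integral_vol by (simp add: mult_ac)
qed

lemma (in neumann_solution) initial_energy_bound:
 assumes f: "!!x. x : Om ==> u 0 x = f x" "!!x. x : Om ==> p 0 x = grad f x" and B: "Om <= B"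
 shows "energy 0 = (LINT y:(B \<inter> Om)|lebesgue. ac_energy_density W eps f y)"
proof -
 have c: "continuous_on (closure Om) (edens 0)" using slice_cont[OF edens_cont, of 0] by auto
 have m: "(%x. indicator Om x *R edens 0 x) : borel_measurable lborel"
  using borel_measurable_continuous_on_indicator[OF _ continuous_on_subset[OF c closure_subset]] open_dom by simp
 have "B \<inter> Om = Om" using B by auto
 moreover have "(%x. indicator Om x *R ac_energy_density W eps f x) = (%x. indicator Om x *R edens 0 x)"
  using f by (auto simp: ac_energy_density_def edens_def indicator_def fun_eq_iff)
 ultimately show ?thesis unfolding energy_def integral_vol set_lebesgue_integral_def using integral_completion[OF m] by simp
qed

lemma gradient_bound_eventually:
 fixes Om :: "(real^'n) set"
 assumes S: "!!i. neumann_solution Om rho g A W W' W'' (eps i) (u i) (p i) (D i) (ut i) (pt i) (T i)"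
  and eps: "eps ----> 0" and W0: "!!s. W s >= 0" "W' 1 = 0" "W' (- 1) = 0"
  and gm: "-1 < gm" "gm < 1" and W_sign: "!!s. \<bar>s\<bar> <= 1 ==> W' s * (gm - s) >= 0"
  and u1: "!!i x. x : closure Om ==> \<bar>u i 0 x\<bar> <= 1"
  and init: "!!kp. kp > 0 ==> \<forall>\<^sub>F i in sequentially. ALL x:closure Om. (eps i)^2 * (norm (p i 0 x))^2 / 2 <= W (u i 0 x) + kp"
  and geo: "!!x. x : closure Om ==> norm (g x) <= Crho & \<bar>trace (A x)\<bar> <= Ct & (ALL v. norm (A x *v v) <= CA * norm v)" "CA >= 0"
  and c0: "c0 > 0" "!!x. x : frontier Om ==> c0 <= norm (g x)" and kp: "0 < kp" "kp <= 1"
 shows "\<forall>\<^sub>F i in sequentially. ALL t>=0. ALL x:closure Om. (eps i)^2 * (norm (p i t x))^2 / 2 <= W (u i t x) + kp"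
proof -
 interpret n0: neumann_solution Om rho g A W W' W'' "eps 0" "u 0" "p 0" "D 0" "ut 0" "pt 0" "T 0" by (rule S)
 have "continuous_on {-1..1} (%s. (W s, W' s, W'' s))" by (intro continuous_intros n0.W_cont continuous_on_subset[OF n0.W''_cont]) auto
 from compact_imp_bounded[OF compact_continuous_image[OF this]] obtain CW where CW: "CW > 0" "!!s. s : {-1..1} ==> norm (W s, W' s, W'' s) <= CW"
  unfolding bounded_pos by auto
 have W_bounds: "0 <= W s & W s <= CW & \<bar>W' s\<bar> <= CW & \<bar>W'' s\<bar> <= CW" if "\<bar>s\<bar> <= 1" for s
  using CW(2)[of s] that W0(1)[of s] norm_fst_le[of "W s" "(W' s, W'' s)"] norm_snd_le[of "(W' s, W'' s)" "W s"]
   norm_fst_le[of "W' s" "W'' s"] norm_snd_le[of "W'' s" "W' s"] by (auto simp: abs_le_iff)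
 define M where "M = (2 * CA + 1) / c0^2"
 have M: "M > 0" "M * c0^2 > 2 * CA" using geo(2) c0(1) by (auto simp: M_def)
 define q where "q = 2 * (CW + 1) * CW / kp + CW"
 have q: "q > 0" "q >= CW" using CW kp by (auto simp: q_def intro!: add_pos_pos divide_pos_pos)
 define a where "a = min 1 (kp / (8 * q))"
 have a: "0 < a" "a <= 1" "a * q <= kp / 8"
 proof -
  show "0 < a" "a <= 1" using kp q by (auto simp: a_def)
  have "a * q <= kp / (8 * q) * q" using q by (intro mult_right_mono) (auto simp: a_def)
  then show "a * q <= kp / 8" using q by simp
 qed
 have aW: "a * CW <= kp / 4"
 proof -
  have "a * CW <= a * q" using a q by (intro mult_left_mono) auto
  then show ?thesis using a(3) kp(1) by linarith
 qed
 define R where "R e = 2 * a * (CW + 1) * CW / kp + 6 * (CW + 1) * (M * Crho) * e / kp + a * CW +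
    e^2 * ((M * Ct + M^2 / a * Crho^2) / 2 + (M * Crho)^2)" for e
 have "(%i. R (eps i)) ----> R 0" unfolding R_def by (intro tendsto_intros eps) (use kp in auto)
 moreover have "R 0 < kp / 4"
 proof -
  have "R 0 = a * q" by (simp add: R_def q_def algebra_simps)
  then show ?thesis using a kp by simp
 qed
 ultimately have "\<forall>\<^sub>F i in sequentially. R (eps i) < kp / 4" by (rule order_tendstoD(2))
 moreover have "\<forall>\<^sub>F i in sequentially. ALL x:closure Om. (eps i)^2 * (norm (p i 0 x))^2 / 2 <= W (u i 0 x) + kp / 8"
  by (rule init) (use kp in simp)
 ultimately show ?thesis
 proof eventually_elim
  case (elim i)
  interpret n: neumann_solution Om rho g A W W' W'' "eps i" "u i" "p i" "D i" "ut i" "pt i" "T i" by (rule S)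
  show ?case
  proof (intro allI impI ballI)
   fix t :: real and x assume tx: "t >= 0" "x : closure Om"
   show "(eps i)^2 * (norm (p i t x))^2 / 2 <= W (u i t x) + kp"
    by (rule n.gradient_bound[OF kp a(1,2) M(1) c0(1) less_imp_le[OF CW(1)] W_bounds gm W_sign geo(1) c0(2) M(2) aW _ _ _ tx])
     (use elim R_def n.phase_bound[OF u1 W0(2,3)] in auto)
  qed
 qed
qed

lemma discrepancy_eventually:
 fixes Om :: "(real^'n) set"
 assumes S: "!!i. neumann_solution Om rho g A W W' W'' (eps i) (u i) (p i) (D i) (ut i) (pt i) (T i)"
  and eps: "eps ----> 0" and W0: "!!s. W s >= 0" "!!s. s ~= 1 ==> s ~= - 1 ==> W s > 0"
  and gm: "-1 < gm" "gm < 1" and W_sign: "!!s. \<bar>s\<bar> <= 1 ==> W' s * (gm - s) >= 0"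
  and u1: "!!i t x. t >= 0 ==> x : closure Om ==> \<bar>u i t x\<bar> <= 1"
  and grad: "!!kp. 0 < kp ==> kp <= 1 ==> \<forall>\<^sub>F i in sequentially. ALL t>=0. ALL x:closure Om. (eps i)^2 * (norm (p i t x))^2 / 2 <= W (u i t x) + kp"
  and E: "!!i t. t >= 0 ==> neumann_solution.energy Om W (eps i) (u i) (p i) t <= E" "E >= 0" and M: "M >= 0" and eta: "eta > 0"
 shows "\<forall>\<^sub>F i in sequentially. ALL t>0. neumann_solution.dissip Om (eps i) (ut i) t <= M -->
  (LINT x|restrict_space lborel Om. max 0 (eps i * (norm (p i t x))^2 / 2 - W (u i t x) / eps i)) <= eta"
proof -
 interpret n0: neumann_solution Om rho g A W W' W'' "eps 0" "u 0" "p 0" "D 0" "ut 0" "pt 0" "T 0" by (rule S)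
 have dm: "x / b * b = x" if "b > 0" for x b :: real using that by simp
 define C0 where "C0 = 1 + 2 / (1 - gm^2)^2"
 have C0: "C0 >= 0" by (simp add: C0_def)
 define c where "c = 8 / (1 - \<bar>gm\<bar>) * (1 * measure n0.vol Om + M + 2 * C0 * E)"
 have c: "c >= 0" unfolding c_def using gm M E C0 by (intro mult_nonneg_nonneg add_nonneg_nonneg) auto
 define dl where "dl = min ((1 - \<bar>gm\<bar>) / 16) (eta / 2 / (c + 1))"
 have dl: "0 < dl" "dl <= (1 - \<bar>gm\<bar>) / 16" "dl * c <= eta / 2"
 proof -
  show "0 < dl" using gm eta c by (auto simp: dl_def)
  show "dl <= (1 - \<bar>gm\<bar>) / 16" unfolding dl_def by (rule min.cobounded1)
  have "dl * c <= eta / 2 / (c + 1) * (c + 1)" using c eta by (intro mult_mono) (auto simp: dl_def)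
  also have "... = eta / 2" by (rule dm) (use c in simp)
  finally show "dl * c <= eta / 2" .
 qed
 obtain w where w: "w > 0" "!!s. \<bar>s\<bar> <= 1 ==> 1 - s^2 >= dl ==> W s >= w"
 proof -
  define S where "S = {-1..1} \<inter> {s::real. dl <= 1 - s^2}"
  have S: "compact S" unfolding S_def by (intro compact_Int_closed closed_Collect_le continuous_intros) auto
  have inS: "s : S \<longleftrightarrow> \<bar>s\<bar> <= 1 & 1 - s^2 >= dl" for s by (auto simp: S_def)
  show ?thesis
  proof (cases "S = {}")
   case True
   then show ?thesis using inS by (intro that[of 1]) auto
  next
   case False
   obtain s0 where s0: "s0 : S" "!!s. s : S ==> W s0 <= W s" using continuous_attains_inf[OF S False n0.W_cont(1)[OF continuous_on_id]] by auto
   have "W s0 > 0" using s0(1) dl(1) by (intro W0(2)) (auto simp: S_def)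
   then show ?thesis using s0(2) inS by (intro that[of "W s0"]) auto
  qed
 qed
 define kp where "kp = min 1 (eta / 2 / (E + 1) * w)"
 have kp: "0 < kp" "kp <= 1" "kp / w * E <= eta / 2"
 proof -
  show "0 < kp" "kp <= 1" using eta w E by (auto simp: kp_def)
  have "kp / w * E <= (eta / 2 / (E + 1) * w) / w * (E + 1)" using w E(2) eta by (intro mult_mono divide_right_mono) (auto simp: kp_def)
  also have "... = eta / 2 / (E + 1) * (E + 1)" using w by simp
  also have "... = eta / 2" by (rule dm) (use E in simp)
  finally show "kp / w * E <= eta / 2" .
 qed
 have "\<forall>\<^sub>F i in sequentially. eps i < 1" using eps by (rule order_tendstoD(2)) simp
 then show ?thesis using grad[OF kp(1,2)]
 proof eventually_elim
  case (elim i)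
  interpret n: neumann_solution Om rho g A W W' W'' "eps i" "u i" "p i" "D i" "ut i" "pt i" "T i" by (rule S)
  show ?case
  proof (intro allI impI)
   fix t :: real assume t: "t > 0" "n.dissip t <= M"
   have en: "n.energy t <= E" using E(1)[of t i] t by simp
   have "(LINT x|n.vol. max 0 (eps i * (norm (p i t x))^2 / 2 - W (u i t x) / eps i)) <=
     dl * (8 / (1 - \<bar>gm\<bar>)) * (eps i * measure n.vol Om + n.dissip t + 2 * C0 * n.energy t) + kp / w * n.energy t" unfolding C0_def
    by (rule n.discrepancy_bound[OF t(1) _ _ _ W0(1) gm W_sign dl(1,2) w]) (use elim t u1[of t] kp in auto)
   also have "... <= dl * (8 / (1 - \<bar>gm\<bar>)) * (1 * measure n.vol Om + M + 2 * C0 * E) + kp / w * E"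
    using t(2) en elim(1) dl gm C0 kp w by (intro add_mono mult_left_mono mult_right_mono) auto
   also have "dl * (8 / (1 - \<bar>gm\<bar>)) * (1 * measure n.vol Om + M + 2 * C0 * E) = dl * c" by (simp only: c_def mult.assoc)
   also have "dl * c + kp / w * E <= eta" using dl(3) kp(3) by linarith
   finally show "(LINT x|n.vol. max 0 (eps i * (norm (p i t x))^2 / 2 - W (u i t x) / eps i)) <= eta" .
  qed
 qed
qed

theorem theorem3p5:
  fixes \<Omega> :: "(real^'n) set"
    and \<nu> :: "real^'n \<Rightarrow> real^'n"
    and W :: "real \<Rightarrow> real"
    and \<alpha> \<beta> \<gamma> D\<^sub>0 c\<^sub>1 c\<^sub>2 l :: real
    and \<epsilon> :: "nat \<Rightarrow> real"
    and u\<^sub>0 :: "nat \<Rightarrow> real^'n \<Rightarrow> real"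
    and u :: "nat \<Rightarrow> real \<Rightarrow> real^'n \<Rightarrow> real"
    and k :: "nat \<Rightarrow> nat"
    and \<mu> :: "real \<Rightarrow> (real^'n) measure"
    and V :: "real \<Rightarrow> ((real^'n) \<times> (real^'n^'n)) measure"
  assumes domain: "bounded_smooth_domain \<Omega>"
    and normal: "\<And>p. p \<in> frontier \<Omega> \<Longrightarrow> outer_unit_normal \<Omega> p (\<nu> p)"
    and W_C3: "Ck_upto 3 UNIV UNIV W"
    and W1: "W 1 = 0" "W (- 1) = 0" "\<And>s. s \<noteq> 1 \<Longrightarrow> s \<noteq> - 1 \<Longrightarrow> W s > 0"
    and W2: "- 1 < \<gamma>" "\<gamma> < 1"
      "\<And>s. \<gamma> < s \<Longrightarrow> s < 1 \<Longrightarrow> deriv W s < 0"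
      "\<And>s. - 1 < s \<Longrightarrow> s < \<gamma> \<Longrightarrow> deriv W s > 0"
    and W3: "0 < \<alpha>" "\<alpha> < 1" "0 < \<beta>"
      "\<And>s. \<alpha> \<le> \<bar>s\<bar> \<Longrightarrow> \<bar>s\<bar> \<le> 1 \<Longrightarrow> deriv (deriv W) s \<ge> \<beta>"
    and eps: "\<And>i. \<epsilon> i > 0" "\<epsilon> \<longlonglongrightarrow> 0"
    and l: "3 / 5 \<le> l" "l < 1"
    and init_C1: "\<And>i. Ck_upto 1 \<Omega> (closure \<Omega>) (u\<^sub>0 i)"
    and init_i: "\<And>i. AE x in lebesgue_on \<Omega>. \<bar>u\<^sub>0 i x\<bar> \<le> 1"
    and init_ii: "\<And>i x r. x \<in> \<Omega> \<Longrightarrow> r > 0 \<Longrightarrow>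
        (LINT y:(ball x r \<inter> \<Omega>)|lebesgue. ac_energy_density W (\<epsilon> i) (u\<^sub>0 i) y)
          / (unit_ball_vol (real (CARD('n) - 1)) * r ^ (CARD('n) - 1)) \<le> D\<^sub>0"
    and init_iii: "\<And>i x. x \<in> closure \<Omega> \<Longrightarrow> \<epsilon> i * norm (grad_closure \<Omega> (u\<^sub>0 i) x) \<le> c\<^sub>1"
    and init_iv: "\<And>i x. x \<in> closure \<Omega> \<Longrightarrow>
        \<epsilon> i * (norm (grad_closure \<Omega> (u\<^sub>0 i) x))\<^sup>2 / 2 - W (u\<^sub>0 i x) / \<epsilon> i
          \<le> c\<^sub>2 * \<epsilon> i powr (- l)"
    and init_v: "\<And>i x. x \<in> frontier \<Omega> \<Longrightarrow> grad_closure \<Omega> (u\<^sub>0 i) x \<bullet> \<nu> x = 0"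
    and sol: "\<And>i. ac_solution W \<Omega> \<nu> (\<epsilon> i) (u\<^sub>0 i) (u i)"
    and subseq: "strict_mono k"
    and mu_radon: "\<And>t. t \<ge> 0 \<Longrightarrow> radon_measure_on UNIV (\<mu> t)"
    and mu_conv: "\<And>t. t \<ge> 0 \<Longrightarrow>
        radon_converges (\<lambda>i. ac_measure W \<Omega> (\<epsilon> (k i)) (u (k i) t)) (\<mu> t)"
    and mu_support: "\<And>t. t \<ge> 0 \<Longrightarrow> measure_support (\<mu> t) \<subseteq> closure \<Omega>"
    and mu_rectifiable: "AE t in lebesgue_on {0..}. rectifiable_measure (\<mu> t)"
    and V_varifold: "\<And>t. t \<ge> 0 \<Longrightarrow> varifold (V t)"
    and V_weight: "\<And>t. t \<ge> 0 \<Longrightarrow> weight (V t) = \<mu> t"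
    and V_rectifiable: "\<And>t. t \<ge> 0 \<Longrightarrow> rectifiable_measure (\<mu> t) \<Longrightarrow> rectifiable_varifold (V t)"
  shows "(AE t in lebesgue_on {0..}.
            first_variation_norm (V t) UNIV = first_variation_norm (V t) (closure \<Omega>) \<and>
            first_variation_norm (V t) (closure \<Omega>) < \<infinity>) \<and>
         (\<forall>T>0. (\<lambda>t. first_variation_norm (V t) (closure \<Omega>))
                   \<in> borel_measurable (lebesgue_on {0..T}) \<and>
                (\<integral>\<^sup>+ t. first_variation_norm (V t) (closure \<Omega>) \<partial>lebesgue_on {0..T}) < \<infinity>)"
proof -
 have op: "open \<Omega>" and bdd: "bounded \<Omega>" and ne: "\<Omega> ~= {}" using domain by (auto simp: bounded_smooth_domain_def)
 have W: "!!s. (W has_real_derivative deriv W s) (at s)" "!!s. (deriv W has_real_derivative deriv (deriv W) s) (at s)"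
  "continuous_on UNIV (deriv (deriv W))" "!!s. 0 <= W s" "deriv W 1 = 0" "deriv W (- 1) = 0"
  "!!s. \<bar>s\<bar> <= 1 ==> 0 <= deriv W s * (\<gamma> - s)" by (rule double_well_facts[OF W_C3 W1 W2]; assumption)+
 obtain rho g A K0 where rho: "C2_on UNIV rho g A" "compact K0" "!!x. x ~: K0 ==> rho x = 0" "\<Omega> = {x. rho x < 0}"
  "!!x. x : frontier \<Omega> ==> rho x = 0 & g x ~= 0" "!!x v. x : frontier \<Omega> ==> outer_unit_normal \<Omega> x v ==> EX c>0. g x = c *R v"
  by (rule global_defining_function[OF domain]) blast
 define p where "p i t = grad_closure \<Omega> (u (k i) t)" for i t
 define e where "e i = \<epsilon> (k i)" for i
 define v where "v i = u (k i)" for i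
 have rs: "EX K. compact K & (ALL x. x ~: K --> rho x = 0)" using rho(2,3) by blast
 have nu: "EX c>0. g x = c *R \<nu> x" if "x : frontier \<Omega>" for x by (rule rho(6)[OF that normal[OF that]])
 have "EX D ut pt T. neumann_solution \<Omega> rho g A W (deriv W) (deriv (deriv W)) (e i) (v i) (p i) D ut pt T" for i unfolding e_def v_def p_def
  by (rule ac_solution_neumann_solution[OF op bdd rho(1) rs rho(4,5) nu W(1,2,3) eps(1) sol]) (assumption | intro exI, assumption)+
 then obtain D ut pt T where S: "!!i. neumann_solution \<Omega> rho g A W (deriv W) (deriv (deriv W)) (e i) (v i) (p i) (D i) (ut i) (pt i) (T i)"
  by metis
 interpret n: neumann_solution \<Omega> rho g A W "deriv W" "deriv (deriv W)" "e i" "v i" "p i" "D i" "ut i" "pt i" "T i" for i by (rule S)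
 have e: "e i > 0" for i using eps(1) by (simp add: e_def)
 have e0: "e ----> 0" unfolding e_def using LIMSEQ_subseq_LIMSEQ[OF eps(2) subseq] by (simp add: comp_def)
 have u00: "v i 0 x = u\<^sub>0 (k i) x" if "x : \<Omega>" for i x using sol[of "k i"] that by (simp add: ac_solution_def v_def)
 have p0: "p i 0 = grad_closure \<Omega> (u\<^sub>0 (k i))" for i unfolding p_def using grad_closure_cong(1)[OF op u00] by (simp add: v_def)
 have C1: "Ck_upto 1 \<Omega> (closure \<Omega>) (v i t)" if "t >= 0" for i t
  using sol[of "k i"] that by (auto simp: ac_solution_def continuous_into_C1_closure_def v_def)
 have pg: "p i t x = grad (v i t) x" if "t >= 0" "x : \<Omega>" for i t x
  using grad_closure_C1(3)[OF op C1[OF that(1)] that(2)] by (simp add: p_def v_def)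
 have cont0: "continuous_on (closure \<Omega>) (v i 0)" "continuous_on (closure \<Omega>) (p i 0)" for i
  using n.slice_cont[OF n.u_cont, of 0 i] n.slice_cont[OF n.p_cont, of 0 i] by auto
 have v1: "\<bar>v i 0 x\<bar> <= 1" if "x : closure \<Omega>" for i x
 proof -
  have "AE y in lborel. y : \<Omega> --> \<bar>v i 0 y\<bar> <= 1"
   using init_i[of "k i"] op by (subst (asm) AE_restrict_space_iff) (auto simp: u00 AE_completion_iff elim!: eventually_mono)
  then show ?thesis by (rule AE_le_on_closure[OF op _ _ that, rotated]) (intro continuous_intros cont0)
 qed
 have vb: "\<bar>v i t x\<bar> <= 1" if "t >= 0" "x : closure \<Omega>" for i t x using n.phase_bound[OF v1 W(5,6) that] .
 have init: "\<forall>\<^sub>F i in sequentially. ALL x:closure \<Omega>. (e i)^2 * (norm (p i 0 x))^2 / 2 <= W (v i 0 x) + kp" if kp: "kp > 0" for kp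
 proof -
  \<comment> \<open>the initial discrepancy is bounded by \<open>e\<^sup>-\<^sup>l\<close>, and the gradient bound has one more factor \<open>e\<close>\<close>
  have "(%i. c\<^sub>2 * e i powr (1 - l)) ----> c\<^sub>2 * 0 powr (1 - l)"
   using e e0 l by (intro tendsto_mult_left tendsto_powr2) (auto intro: always_eventually less_imp_le)
  then have "\<forall>\<^sub>F i in sequentially. c\<^sub>2 * e i powr (1 - l) < kp" using kp by (intro order_tendstoD(2)) auto
  then show ?thesis
  proof eventually_elim
   case (elim i)
   have O: "(e i)^2 * (norm (p i 0 x))^2 / 2 - W (v i 0 x) <= kp" if x: "x : \<Omega>" for x
   proof -
    have "e i * (e i * (norm (p i 0 x))^2 / 2 - W (v i 0 x) / e i) <= e i * (c\<^sub>2 * e i powr (- l))"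
     using init_iv[of x "k i"] x closure_subset[of \<Omega>] e[of i] by (intro mult_left_mono) (auto simp: p0 u00 e_def)
    also have "... = c\<^sub>2 * e i powr (1 - l)" using e[of i] powr_add[of "e i" 1 "- l"] by simp
    finally show ?thesis using elim e[of i] by (simp add: right_diff_distrib power2_eq_square mult.assoc)
   qed
   have "(e i)^2 * (norm (p i 0 x))^2 / 2 - W (v i 0 x) <= kp" if "x : closure \<Omega>" for x
    by (rule continuous_le_on_closure[OF _ that O]) (intro continuous_intros cont0 n.W_cont, auto)
   then show ?case by (auto simp: algebra_simps)
  qed
 qed
 \<comment> \<open>a ball of radius \<open>diameter \<Omega> + 1\<close> contains \<open>\<Omega>\<close>\<close>
 define E where "E = max 0 (D\<^sub>0 * (unit_ball_vol (real (CARD('n) - 1)) * (diameter \<Omega> + 1) ^ (CARD('n) - 1)))"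
 have en0: "n.energy i 0 <= E" for i
 proof -
  obtain x0 where x0: "x0 : \<Omega>" using ne by auto
  define r where "r = diameter \<Omega> + 1"
  have r: "r > 0" using diameter_ge_0[OF bdd] by (simp add: r_def)
  have sub: "\<Omega> <= ball x0 r" using diameter_bounded_bound[OF bdd x0] by (fastforce simp: r_def)
  have "n.energy i 0 = (LINT y:(ball x0 r \<inter> \<Omega>)|lebesgue. ac_energy_density W (e i) (u\<^sub>0 (k i)) y)"
  proof (rule n.initial_energy_bound[OF u00 _ sub])
   show "p i 0 x = grad (u\<^sub>0 (k i)) x" if "x : \<Omega>" for x using grad_closure_C1(3)[OF op init_C1 that] by (simp add: p0)
  qed
  moreover have "unit_ball_vol (real (CARD('n) - 1)) * r ^ (CARD('n) - 1) > 0" using r by simp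
  ultimately show ?thesis using init_ii[OF x0 r, of "k i"] by (simp add: E_def e_def pos_divide_le_eq r_def[symmetric])
 qed
 have E0: "E >= 0" by (simp add: E_def)
 have en: "n.energy i t <= E" if "t >= 0" for i t using n.energy_le[of 0 t i] en0[of i] that by simp
 obtain Crho where Crho: "!!x. x : closure \<Omega> ==> norm (g x) <= Crho" using n.closure_bounded[OF continuous_on_subset[OF n.g_cont]] by blast
 obtain C\<^sub>A where CA: "C\<^sub>A > 0" "!!x. x : closure \<Omega> ==> norm (A x) <= C\<^sub>A"
  using n.closure_bounded[OF continuous_on_subset[OF n.A_cont]] by blast
 have "continuous_on UNIV (%x. trace (A x))" unfolding trace_def by (intro continuous_intros n.A_cont)
 then obtain Ct where Ct: "!!x. x : closure \<Omega> ==> norm (trace (A x)) <= Ct" using n.closure_bounded[OF continuous_on_subset] by blast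
 have CA': "norm (A x *v w) <= C\<^sub>A * norm w" if "x : closure \<Omega>" for x w
 proof -
  have "norm (A x *v w) <= norm (A x) * norm w"
  proof (cases "A x *v w = 0")
   case False
   have "(norm (A x *v w))^2 = A x \<bullet> tensor (A x *v w) w" by (simp add: inner_tensor power2_norm_eq_inner)
   also have "... <= norm (A x) * (norm (A x *v w) * norm w)" using norm_cauchy_schwarz[of "A x"] by (simp add: norm_tensor[symmetric])
   finally show ?thesis using False by (simp add: power2_eq_square)
  qed simp
  also have "... <= C\<^sub>A * norm w" using CA(2)[OF that] by (intro mult_right_mono) auto
  finally show ?thesis .
 qed
 obtain c0 where c0: "c0 > 0" "!!x. x : frontier \<Omega> ==> c0 <= norm (g x)"
 proof (cases "frontier \<Omega> = {}")
  case False
  have "compact (frontier \<Omega>)" using bdd by (rule compact_frontier_bounded)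
  from continuous_attains_inf[OF this False continuous_on_norm[OF continuous_on_subset[OF n.g_cont]]]
  obtain y where "y : frontier \<Omega>" "ALL x:frontier \<Omega>. norm (g y) <= norm (g x)" by auto
  then show ?thesis using that[of "norm (g y)"] rho(5) by auto
 qed (use that[of 1] in auto)
 define K where "K = max 0 (1 + (Ct + 2 * C\<^sub>A + Crho) / c0)"
 have gb: "\<forall>\<^sub>F i in sequentially. ALL t>=0. ALL x:closure \<Omega>. (e i)^2 * (norm (p i t x))^2 / 2 <= W (v i t x) + kp"
  if "0 < kp" "kp <= 1" for kp
  by (rule gradient_bound_eventually[OF S e0 W(4,5,6) W2(1,2) W(7) v1 init _ _ c0 that, where Crho=Crho and Ct=Ct and CA=C\<^sub>A])
   (use Crho Ct CA CA' in auto)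
 define a where "a i t h = (LINT x|n.vol. n.stress i t x \<bullet> jacobian h (at x))" for i t and h :: "real^'n => real^'n"
 have a_bd: "a i t h <= G * K * (E + M)"
  if t: "t > 0" and h: "h : C1c_fields UNIV" "!!x. norm (h x) <= G" and M: "n.dissip i t <= M" for i t h G M
 proof -
  have G: "G >= 0" using h(2) norm_ge_zero order_trans by blast
  have "\<bar>a i t h\<bar> <= G * (1 + (Ct + 2 * C\<^sub>A + Crho) / c0) * (n.energy i t + n.dissip i t)" unfolding a_def
   by (rule n.first_variation_bound[OF t W(4) Crho _ CA' c0, where h=h and J="%x. jacobian h (at x)"])
    (use Ct h G C1c_fieldsD(1-3)[OF h(1)] in "auto intro: continuous_on_subset")
  also have "... <= G * K * (E + M)"
  proof (rule mult_mono)
   show "n.energy i t + n.dissip i t <= E + M" using en[of t i] t M by simp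
   have "n.energy i t >= 0" unfolding n.energy_def using n.W_over_eps(2)[OF W(4)] by (intro integral_nonneg_AE) auto
   then show "0 <= n.energy i t + n.dissip i t" using n.dissip_nonneg by simp
  qed (use G in "auto simp: K_def intro: mult_left_mono")
  finally show ?thesis by simp
 qed
 have \<mu>: "sets (\<mu> t) = sets borel" "emeasure (\<mu> t) (- closure \<Omega>) = 0" "emeasure (V t) (space (V t)) < \<infinity>" if t: "t >= 0" for t
 proof -
  show s: "sets (\<mu> t) = sets borel" using mu_radon[OF t] by (simp add: radon_measure_on_def)
  have "EX r>0. emeasure (\<mu> t) (ball x r) = 0" if "x : - closure \<Omega>" for x
   using mu_support[OF t] that by (auto simp: measure_support_def zero_less_iff_neq_zero)
  then obtain r where r: "!!x. x : - closure \<Omega> ==> r x > 0 & emeasure (\<mu> t) (ball x (r x)) = 0" by metis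
  obtain F where F: "F <= (%x. ball x (r x)) ` (- closure \<Omega>)" "countable F" "\<Union>F = (\<Union>x\<in>- closure \<Omega>. ball x (r x))"
   using Lindelof[of "(%x. ball x (r x)) ` (- closure \<Omega>)"] by auto
  have "\<Union>F \<in> null_sets (\<mu> t)"
  proof -
   have "(\<Union>B\<in>F. B) : null_sets (\<mu> t)" using F(1,2) r s by (intro null_sets_UN') (auto intro!: null_setsI)
   then show ?thesis by simp
  qed
  moreover have "- closure \<Omega> <= \<Union>F" unfolding F(3) using r by force
  ultimately show z: "emeasure (\<mu> t) (- closure \<Omega>) = 0"
   using emeasure_mono[of "- closure \<Omega>" "\<Union>F" "\<mu> t"] by (simp add: null_sets_def)
  have "emeasure (V t) (space (V t)) = emeasure (\<mu> t) UNIV" using emeasure_weight[OF V_varifold[OF t], of UNIV] V_weight[OF t] by simp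
  also have "... <= emeasure (\<mu> t) (closure \<Omega>) + emeasure (\<mu> t) (- closure \<Omega>)"
   using s emeasure_subadditive[of "closure \<Omega>" "\<mu> t" "- closure \<Omega>"] by (simp add: borel_open)
  also have "... < \<infinity>" using mu_radon[OF t] n.compact_closure_dom z by (simp add: radon_measure_on_def)
  finally show "emeasure (V t) (space (V t)) < \<infinity>" .
 qed
 let ?S = "%i t h. (LINT x|n.vol. (n.edens i t x *R mat 1 - tensor (sqrt (e i) *R p i t x) (sqrt (e i) *R p i t x)) \<bullet> jacobian h (at x))"
 let ?v = "%i t x. sqrt (e i) *R p i t x"
 have seq: "stress_sequence (V t) n.vol (%j. n.edens (r j) t) (%j. ?v (r j) t) (K * (E + M))"
  if t: "t > 0" and R: "rectifiable_measure (\<mu> t)" and r: "strict_mono r" "!!j. n.dissip (r j) t <= M" for t r M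
 proof (rule stress_sequence.intro)
  have t0: "t >= 0" using t by simp
  have M: "M >= 0" using r(2)[of 0] n.dissip_nonneg order_trans by blast
  note sl = n.slices[OF t]
  have sq: "(norm (sqrt (e j) *R w))^2 = e j * (norm w)^2" for j and w :: "real^'n" using e[of j] by (simp add: power_mult_distrib)
  show "rectifiable_varifold (V t)" by (rule V_rectifiable[OF t0 R])
  show "emeasure (V t) (space (V t)) < \<infinity>" by (rule \<mu>(3)[OF t0])
  show "finite_measure n.vol" by (rule n.finite_vol)
  show "(%x. x) : borel_measurable n.vol" by (intro n.vol_measurable continuous_on_id)
  show "integrable n.vol (n.edens (r j) t)" for j by (intro n.integrable_dom sl)
  show "0 <= n.edens (r j) t x" for j x by (rule n.W_over_eps(2)[OF W(4)])
  show "(?v (r j) t) : borel_measurable n.vol" for j by (intro n.vol_measurable continuous_intros continuous_on_subset[OF sl(2) closure_subset])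
  show "integrable n.vol (%x. (norm (?v (r j) t x))^2)" for j by (intro n.integrable_dom continuous_intros sl)
  show "(%j. LINT x|n.vol. phi x * n.edens (r j) t x) ----> (LINT x|weight (V t). phi x)" if phi: "Cc UNIV phi" for phi
  proof -
   have "(%j. integral\<^sup>L (ac_measure W \<Omega> (e (r j)) (v (r j) t)) phi) ----> (LINT x|weight (V t). phi x)"
    using LIMSEQ_subseq_LIMSEQ[OF mu_conv[OF t0, unfolded radon_converges_def, rule_format, OF phi] r(1)] V_weight[OF t0]
    by (simp add: comp_def e_def v_def)
   moreover have "continuous_on UNIV phi" using phi by (simp add: Cc_def)
   ultimately show ?thesis using n.integral_ac_measure[OF t0 pg[OF t0] W(4)] by simp
  qed
  show "(%j. LINT x|n.vol. max 0 ((norm (?v (r j) t x))^2 - n.edens (r j) t x)) ----> 0"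
  proof (rule tendstoI)
   fix eta :: real assume eta: "eta > 0"
   define xi where "xi j = (LINT x|n.vol. max 0 (e j * (norm (p j t x))^2 / 2 - W (v j t x) / e j))" for j
   have "\<forall>\<^sub>F i in sequentially. ALL t>0. n.dissip i t <= M -->
     (LINT x|n.vol. max 0 (e i * (norm (p i t x))^2 / 2 - W (v i t x) / e i)) <= eta / 2"
    by (rule discrepancy_eventually[OF S e0 W(4) W1(3) W2(1,2) W(7) vb gb en E0 M]) (assumption | (use eta in simp))+
   then have "\<forall>\<^sub>F i in sequentially. n.dissip i t <= M --> xi i <= eta / 2" by eventually_elim (use t in "auto simp: xi_def")
   then have "\<forall>\<^sub>F j in sequentially. xi (r j) <= eta / 2" using eventually_subseq[OF r(1)] r(2) by (force elim: eventually_mono)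
   moreover have "xi j >= 0" for j unfolding xi_def by (intro integral_nonneg_AE) auto
   moreover have "max 0 ((norm (sqrt (e j) *R p j t x))^2 - n.edens j t x) = max 0 (e j * (norm (p j t x))^2 / 2 - W (v j t x) / e j)" for j x
    unfolding sq by (simp add: n.edens_def)
   ultimately show "\<forall>\<^sub>F j in sequentially. dist (LINT x|n.vol. max 0 ((norm (?v (r j) t x))^2 - n.edens (r j) t x)) 0 < eta"
    using eta by (auto simp: xi_def[symmetric] elim!: eventually_mono)
  qed
  fix j and h :: "real^'n => real^'n" and G :: real assume h: "h : C1c_fields UNIV" "!!x. norm (h x) <= G"
  have st: "n.edens j t x *R mat 1 - tensor (sqrt (e j) *R p j t x) (sqrt (e j) *R p j t x) = n.stress j t x" for j x
   using e[of j] by (simp add: n.stress_def tensor_scale)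
  show "?S (r j) t h <= K * (E + M) * G" unfolding st using a_bd[OF t h r(2)[of j]] by (simp add: a_def mult_ac)
 qed
 obtain Y :: "(real^'n => real^'n) set" where Y: "countable Y" "Y <= {g:C1c_fields UNIV. ALL x. norm (g x) <= 1}"
  "!!g e. g : C1c_fields UNIV ==> (!!x. norm (g x) <= 1) ==> e > 0 ==> EX h:Y. ALL x. norm (jacobian g (at x) - jacobian h (at x)) < e"
  using countable_dense_test_fields by blast
 have N: "first_variation_norm (V t) UNIV = first_variation_norm (V t) (closure \<Omega>)"
  "first_variation_norm (V t) UNIV = (SUP h\<in>Y. ennreal (first_variation (V t) h))" if t: "t >= 0" for t
  using first_variation_norm_support[OF V_varifold[OF t] n.compact_closure_dom] \<mu>(2)[OF t] V_weight[OF t]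
   first_variation_norm_countable[OF V_varifold[OF t] \<mu>(3)[OF t] Y(2,3)] by auto
 have rect: "AE t in lborel. t > 0 --> rectifiable_measure (\<mu> t)"
  using mu_rectifiable by (subst (asm) AE_restrict_space_iff) (auto simp: AE_completion_iff elim!: eventually_mono)
 have st: "a (r j) t h = ?S (r j) t h" for r j t h using e[of "r j"] by (simp add: a_def n.stress_def tensor_scale)
 obtain F where F: "F : borel_measurable borel" "AE t in lborel. t > 0 --> F t = (SUP h\<in>Y. ennreal (first_variation (V t) h))"
  "AE t in lborel. t > 0 --> F t < \<infinity>" "!!T. (\<integral>\<^sup>+t\<in>{0<..T}. F t \<partial>lborel) < \<infinity>"
 proof (rule limits_along_bounded_dissipation[where d="%i. n.dissip i" and a=a and Y=Y and E=E and K=K and R="%t. rectifiable_measure (\<mu> t)" and L="%t h. first_variation (V t) h"])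
  show "continuous_on {0<..} (n.dissip i)" for i by (rule n.dissip_cont)
  show "0 <= n.dissip i t" for i t by (rule n.dissip_nonneg)
  show "continuous_on {0<..} (%t. a i t h)" if "h : Y" for i h unfolding a_def
  proof (rule n.integral_slices_continuous)
   have J: "continuous_on UNIV (%x. jacobian h (at x))" using that Y(2) C1c_fieldsD(2) by blast
   have "continuous_on ({0<..} \<times> closure \<Omega>) (%z. n.edens i (fst z) (snd z))" "continuous_on ({0<..} \<times> closure \<Omega>) (%z. p i (fst z) (snd z))"
    using n.edens_cont[of i] n.p_cont[of i] by (auto simp: split_beta elim: continuous_on_subset)
   then show "continuous_on ({0<..} \<times> closure \<Omega>) (%(t, x). n.stress i t x \<bullet> jacobian h (at x))"
    unfolding split_beta n.stress_def by (intro continuous_intros continuous_on_compose2[OF J continuous_on_snd[OF continuous_on_id]]) auto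
  qed
  show "(\<integral>\<^sup>+t\<in>{0<..T}. ennreal (n.dissip i t) \<partial>lborel) <= ennreal E" for i T
   using n.dissipation_bound[OF W(4), of i T] en0[of i] by (auto intro: order_trans ennreal_leI)
  show "(%j. a (r j) t h) ----> first_variation (V t) h"
   if "t > 0" "rectifiable_measure (\<mu> t)" "h : Y" "strict_mono r" "!!j. n.dissip (r j) t <= M" for t h M r
   unfolding st using that(3) Y(2) by (intro stress_sequence.stress_converges[OF seq[OF that(1,2,4,5)]]) auto
  show "first_variation (V t) h <= K * (E + M)"
   if "t > 0" "rectifiable_measure (\<mu> t)" "h : Y" "strict_mono r" "!!j. n.dissip (r j) t <= M" for t h M and r :: "nat => nat"
  proof (rule stress_sequence.first_variation_le[OF seq[OF that(1,2,4,5)]])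
   show "h : C1c_fields UNIV" using that(3) Y(2) by blast
   then show "\<forall>\<^sub>F j in sequentially. ?S (r j) t h <= K * (E + M)"
    using a_bd[OF that(1) _ _ that(5), of h 1] that(3) Y(2) by (auto simp: st[symmetric])
  qed
 qed (use Y(1) E0 rect in "auto simp: K_def")
 have AE0: "AE t in lebesgue. t >= 0 --> F t = first_variation_norm (V t) (closure \<Omega>) & F t < \<infinity>"
 proof -
  have "AE t in lborel. t ~= (0::real)" by (rule AE_lborel_singleton)
  then have "AE t in lborel. t >= 0 --> F t = first_variation_norm (V t) (closure \<Omega>) & F t < \<infinity>"
   using F(2,3) by eventually_elim (use N in auto)
  then show ?thesis by (rule AE_completion)
 qed
 have "AE t in lebesgue_on {0..}. first_variation_norm (V t) UNIV = first_variation_norm (V t) (closure \<Omega>) &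
      first_variation_norm (V t) (closure \<Omega>) < \<infinity>"
  by (subst AE_restrict_space_iff, simp) (use AE0 N(1) in "auto elim!: eventually_mono")
 moreover have "(%t. first_variation_norm (V t) (closure \<Omega>)) : borel_measurable (lebesgue_on {0..T}) &
    (\<integral>\<^sup>+ t. first_variation_norm (V t) (closure \<Omega>) \<partial>lebesgue_on {0..T}) < \<infinity>" for T
 proof -
  have ae: "AE t in lebesgue. t : {0..T} --> F t = first_variation_norm (V t) (closure \<Omega>)" using AE0 by eventually_elim auto
  have "(\<integral>\<^sup>+t\<in>{0..T}. F t \<partial>lebesgue) = (\<integral>\<^sup>+t\<in>{0..T}. F t \<partial>lborel)" by (rule nn_integral_completion)
  also have "... = (\<integral>\<^sup>+t\<in>{0<..T}. F t \<partial>lborel)"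
  proof (rule nn_integral_cong_AE)
   have "AE t in lborel. t ~= (0::real)" by (rule AE_lborel_singleton)
   then show "AE t in lborel. F t * indicator {0..T} t = F t * indicator {0<..T} t" by eventually_elim (auto simp: indicator_def)
  qed
  finally show ?thesis using measurable_lebesgue_on_AE[OF F(1) _ ae] F(4)[of T] by simp
 qed
 ultimately show ?thesis by blast
qed

end
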